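(* Let $\mathcal A$ be a $W^*$-algebra, $\mathbb V$ an $\mathcal A$-module, $G$ a group, $X$ a nonempty $G$-space, $U:G\to\mathrm{GL}_{\mathcal A}(\mathbb V)$ a representation, and let $\alpha:G\times X\to\mathrm{Inv}_{\mathcal A}\cap\mathcal Z_{\mathcal A}$ and the 2-cocycle $\sigma:G\times G\to\mathcal U_{\mathcal A}\cap\mathcal Z_{\mathcal A}$ be such that $\alpha(e,x)=1_{\mathcal A}$ and $\alpha(gh,x)=\sigma(g,h)\alpha(h,x)\alpha(g,hx)$ for all $g,h\in G$, $x\in X$. Let $K$ be a positive $(X,\alpha,U)$-covariant kernel. Then there is a self-dual Hilbert $\mathcal A$-module $(\mathbb L,\langle\cdot|\cdot\rangle)$, equipped with the topology $\tau_1$ (resp. $\tau_2$), a map $R:X\to\mathrm{Lin}_{\mathcal A}(\mathbb V;\mathbb L)$ and a map $\tilde U:G\to\mathcal U_{\mathcal A}(\mathbb L)$ with $\tilde U(e)=I_{\mathbb L}$ and $\tilde U(g)\tilde U(h)=\sigma(g,h).\tilde U(gh)$ for all $g,h\in G$, such that (i) $K_{x,y}(v,w)=\langle R(x)v|R(y)w\rangle$ for all $x,y\in X$ and $v,w\in\mathbb V$; (ii) $\mathrm{lin}_{\mathbb C}\{R(x)v\mid x\in X,\ v\in\mathbb V\}$ is $\tau_1$-dense (resp. $\tau_2$-dense) in $\mathbb L$; (iii) $R(x)U(g)=\alpha(g,g^{-1}x).\tilde U(g)R(g^{-1}x)$ for all $x\in X$ and $g\in G$. If $(\mathbb L',R',\tilde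 U')$ is another such triple satisfying (i)--(iii), then there is a unitary $W\in\mathrm{Lin}_{\mathcal A}(\mathbb L;\mathbb L')$ such that $WR(x)=R'(x)$ for all $x\in X$ and $W\tilde U(g)=\tilde U'(g)W$ for all $g\in G$.
   Context: $\mathcal U_{\mathcal A}$, $\mathrm{Inv}_{\mathcal A}$, $\mathcal Z_{\mathcal A}$ denote the unitary group, the group of invertible elements and the center of $\mathcal A$. An $\mathcal A$-module is a complex vector space with a (compatible) right $\mathcal A$-module structure; no inner product is assumed. $S_{\mathcal A}(\mathbb V)$ is the set of $\mathcal A$-sesquilinear forms $s:\mathbb V\times\mathbb V\to\mathcal A$: linear in the second and conjugate linear in the first argument, $s(u,va)=s(u,v)a$, $s(ua,v)=a^*s(u,v)$. $\mathrm{Lin}_{\mathcal A}(\mathbb V;\mathbb W)$ is the set of $\mathcal A$-linear maps, $\mathrm{GL}_{\mathcal A}(\mathbb V)$ the group of $\mathcal A$-linear bijections of $\mathbb V$. For central $a$, $a.v=va$. A Hilbert $\mathcal A$-module $\mathbb L$ is an $\mathcal A$-module with an $\mathcal A$-valued inner product, complete in the norm $\|v\|=\|\langle v|v\rangle\|^{1/2}$; it is self-dual if every continuous $\mathcal A$-linear $f:\mathbb L\to\mathcal A$ is of the form $f=\langle\ell|\cdot\rangle$ for some $\ell\in\mathbb L$. $\mathcal U_{\mathcal A}(\mathbb L)$ is the group of unitary adjointable $\mathcal A$-linear maps on $\mathbb L$; a unitary between two Hilbert modules is a surjective inner-product-preserving $\mathcal A$-linear map. Let $\mathcal A_*^+$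 be the positive cone of the predual of $\mathcal A$. On a self-dual Hilbert $\mathcal A$-module $\mathbb L$, $\tau_1$ is the topology induced by the seminorms $\ell\mapsto\sqrt{\varphi(\langle\ell|\ell\rangle)}$, $\varphi\in\mathcal A_*^+$, and $\tau_2$ the topology induced by the seminorms $\ell\mapsto|\varphi(\langle\ell'|\ell\rangle)|$, $\varphi\in\mathcal A_*^+$, $\ell'\in\mathbb L$. A representation $U:G\to\mathrm{GL}_{\mathcal A}(\mathbb V)$ is a group homomorphism. A 2-cocycle $\sigma$ satisfies $\sigma(e,g)=1_{\mathcal A}=\sigma(g,e)$ and $\sigma(g,hk)\sigma(h,k)=\sigma(gh,k)\sigma(g,h)$. A positive $(X,\alpha,U)$-covariant kernel is a non-zero map $K:X\times X\to S_{\mathcal A}(\mathbb V)$ with $\sum_{j,k=1}^nK_{x_j,x_k}(v_j,v_k)\ge0$ for all $n\in\mathbb N$, $x_j\in X$, $v_j\in\mathbb V$, and $K_{gx,gy}(v,w)=\alpha(g,x)^*K_{x,y}\big(U(g^{-1})v,U(g^{-1})w\big)\alpha(g,y)$ for all $g\in G$, $x,y\in X$, $v,w\in\mathbb V$. *)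

theory Defs
  imports
    "HOL-Analysis.Analysis"
    "HOL-Algebra.Group_Action"
    "HOL-Library.Function_Algebras"
begin

section \<open>C*-algebras and W*-algebras\<close>

text \<open>
  Unital C*-algebras. The superclass gives \<open>norm 1 = 1\<close>, which excludes only the zero algebra
  (over which there are no non-zero kernels).
\<close>

class cstar_algebra = real_normed_algebra_1 + banach +
  fixes scaleC :: "complex \<Rightarrow> 'a \<Rightarrow> 'a" (infixr \<open>*\<^sub>C\<close> 75)
    and star :: "'a \<Rightarrow> 'a"
  assumes scaleC_add_right: "c *\<^sub>C (a + b) = c *\<^sub>C a + c *\<^sub>C b"
    and scaleC_add_left: "(c + d) *\<^sub>C a = c *\<^sub>C a + d *\<^sub>C a"
    and scaleC_scaleC: "c *\<^sub>C d *\<^sub>C a = (c * d) *\<^sub>C a"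
    and scaleC_of_real: "complex_of_real r *\<^sub>C a = r *\<^sub>R a"
    and mult_scaleC_left: "(c *\<^sub>C a) * b = c *\<^sub>C (a * b)"
    and mult_scaleC_right: "a * (c *\<^sub>C b) = c *\<^sub>C (a * b)"
    and norm_scaleC: "norm (c *\<^sub>C a) = cmod c * norm a"
    and star_star: "star (star a) = a"
    and star_add: "star (a + b) = star a + star b"
    and star_scaleC: "star (c *\<^sub>C a) = cnj c *\<^sub>C star a"
    and star_mult: "star (a * b) = star b * star a"
    and cstar_identity: "norm (star a * a) = (norm a)\<^sup>2"

definition positive :: "'a::cstar_algebra \<Rightarrow> bool" where
  "positive a \<longleftrightarrow> (\<exists>b. a = star b * b)"

definition unitaries :: "'a::cstar_algebra set" where
  "unitaries = {u. star u * u = 1 \<and> u * star u = 1}"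

definition invertibles :: "'a::cstar_algebra set" where
  "invertibles = {a. \<exists>b. a * b = 1 \<and> b * a = 1}"

definition center :: "'a::cstar_algebra set" where
  "center = {a. \<forall>b. a * b = b * a}"

definition dual_space :: "('a::cstar_algebra \<Rightarrow> complex) set" where
  "dual_space = {\<phi>. bounded_linear \<phi> \<and> (\<forall>c a. \<phi> (c *\<^sub>C a) = c * \<phi> a)}"

text \<open>
  A W*-algebra is a C*-algebra that is, as a Banach space, the dual of a Banach space. Any such
  predual embeds isometrically into the dual space of the algebra, so it is taken to be a
  norm-closed subspace \<open>P\<close> of that dual space for which evaluation \<open>a \<mapsto> (\<phi> \<mapsto> \<phi> a)\<close> is an
  isometry from the algebra onto the dual of \<open>P\<close> (last two conjuncts).
\<close>

definition is_predual :: "('a::cstar_algebra \<Rightarrow> complex) set \<Rightarrow> bool" where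
  "is_predual P \<longleftrightarrow>
     P \<subseteq> dual_space \<and>
     (\<lambda>a. 0) \<in> P \<and>
     (\<forall>\<phi>\<in>P. \<forall>\<psi>\<in>P. (\<lambda>a. \<phi> a + \<psi> a) \<in> P) \<and>
     (\<forall>\<phi>\<in>P. \<forall>c. (\<lambda>a. c * \<phi> a) \<in> P) \<and>
     (\<forall>f \<psi>. (\<forall>n::nat. f n \<in> P) \<and> \<psi> \<in> dual_space \<and>
        (\<lambda>n. onorm (\<lambda>a. f n a - \<psi> a)) \<longlonglongrightarrow> 0 \<longrightarrow> \<psi> \<in> P) \<and>
     (\<forall>a. norm a = (SUP \<phi>\<in>{\<phi> \<in> P. onorm \<phi> \<le> 1}. cmod (\<phi> a))) \<and>
     (\<forall>F :: ('a \<Rightarrow> complex) \<Rightarrow> complex.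
        (\<forall>\<phi>\<in>P. \<forall>\<psi>\<in>P. F (\<lambda>a. \<phi> a + \<psi> a) = F \<phi> + F \<psi>) \<and>
        (\<forall>\<phi>\<in>P. \<forall>c. F (\<lambda>a. c * \<phi> a) = c * F \<phi>) \<and>
        (\<exists>B. \<forall>\<phi>\<in>P. cmod (F \<phi>) \<le> B * onorm \<phi>)
        \<longrightarrow> (\<exists>a. \<forall>\<phi>\<in>P. F \<phi> = \<phi> a))"

definition positive_cone :: "('a::cstar_algebra \<Rightarrow> complex) set \<Rightarrow> ('a \<Rightarrow> complex) set" where
  "positive_cone P = {\<phi> \<in> P. \<forall>a. positive a \<longrightarrow> \<phi> a \<in> \<real>\<^sub>\<ge>\<^sub>0}"


section \<open>Modules over a C*-algebra\<close>

text \<open>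
  A module is a carrier set in a type that supplies the addition; this makes it possible to assert
  the existence of a module inside a type fixed in advance.
\<close>

record ('a, 'm) amodule = "'m partial_object" +
  mscale :: "complex \<Rightarrow> 'm \<Rightarrow> 'm"
  mact :: "'m \<Rightarrow> 'a \<Rightarrow> 'm"

locale A_module =
  fixes M :: "('a::cstar_algebra, 'm::ab_group_add, 'z) amodule_scheme"
  assumes vector_space: "vector_space (mscale M)"
    and subspace: "module.subspace (mscale M) (carrier M)"
    and act_closed: "v \<in> carrier M \<Longrightarrow> mact M v a \<in> carrier M"
    and act_add_left: "\<lbrakk>v \<in> carrier M; w \<in> carrier M\<rbrakk> \<Longrightarrow> mact M (v + w) a = mact M v a + mact M w a"
    and act_add_right: "v \<in> carrier M \<Longrightarrow> mact M v (a + b) = mact M v a + mact M v b"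
    and act_act: "v \<in> carrier M \<Longrightarrow> mact M (mact M v a) b = mact M v (a * b)"
    and act_one: "v \<in> carrier M \<Longrightarrow> mact M v 1 = v"
    and act_scale_left: "v \<in> carrier M \<Longrightarrow> mact M (mscale M c v) a = mscale M c (mact M v a)"
    and act_scale_right: "v \<in> carrier M \<Longrightarrow> mact M v (c *\<^sub>C a) = mscale M c (mact M v a)"

definition self_module :: "('a::cstar_algebra, 'a) amodule" where
  "self_module = \<lparr>carrier = UNIV, mscale = scaleC, mact = (*)\<rparr>"

text \<open>
  Linear maps, forms and operators are HOL functions of which only the values on the carriers
  matter; equations between them are stated pointwise on the carriers.
\<close>

definition Lin :: "('a, 'm::ab_group_add, 'z) amodule_scheme \<Rightarrow> ('a, 'n::ab_group_add, 'y) amodule_scheme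
    \<Rightarrow> ('m \<Rightarrow> 'n) set" where
  "Lin M N = {f \<in> carrier M \<rightarrow> carrier N.
     (\<forall>v\<in>carrier M. \<forall>w\<in>carrier M. f (v + w) = f v + f w) \<and>
     (\<forall>v\<in>carrier M. \<forall>c. f (mscale M c v) = mscale N c (f v)) \<and>
     (\<forall>v\<in>carrier M. \<forall>a. f (mact M v a) = mact N (f v) a)}"

definition GL :: "('a, 'm::ab_group_add, 'z) amodule_scheme \<Rightarrow> ('m \<Rightarrow> 'm) monoid" where
  "GL M = BijGroup (carrier M) \<lparr>carrier := Bij (carrier M) \<inter> Lin M M\<rparr>"

definition sesquilinear_forms ::
    "('a::cstar_algebra, 'm::ab_group_add, 'z) amodule_scheme \<Rightarrow> ('m \<Rightarrow> 'm \<Rightarrow> 'a) set" where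
  "sesquilinear_forms M = {s. \<forall>u\<in>carrier M. \<forall>v\<in>carrier M.
     (\<forall>w\<in>carrier M. s u (v + w) = s u v + s u w) \<and>
     (\<forall>w\<in>carrier M. s (u + w) v = s u v + s w v) \<and>
     (\<forall>c. s u (mscale M c v) = c *\<^sub>C s u v) \<and>
     (\<forall>c. s (mscale M c u) v = cnj c *\<^sub>C s u v) \<and>
     (\<forall>a. s u (mact M v a) = s u v * a) \<and>
     (\<forall>a. s (mact M u a) v = star a * s u v)}"


section \<open>Hilbert modules\<close>

record ('a, 'm) hmodule = "('a, 'm) amodule" +
  ip :: "'m \<Rightarrow> 'm \<Rightarrow> 'a"

definition hnorm :: "('a::cstar_algebra, 'm, 'z) hmodule_scheme \<Rightarrow> 'm \<Rightarrow> real" where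
  "hnorm L v = sqrt (norm (ip L v v))"

locale hilbert_module = A_module L
  for L :: "('a::cstar_algebra, 'm::ab_group_add, 'z) hmodule_scheme" +
  assumes ip_sesquilinear: "ip L \<in> sesquilinear_forms L"
    and ip_star: "\<lbrakk>v \<in> carrier L; w \<in> carrier L\<rbrakk> \<Longrightarrow> star (ip L v w) = ip L w v"
    and ip_positive: "v \<in> carrier L \<Longrightarrow> positive (ip L v v)"
    and ip_definite: "\<lbrakk>v \<in> carrier L; ip L v v = 0\<rbrakk> \<Longrightarrow> v = 0"
    and hnorm_complete: "\<lbrakk>\<And>n::nat. u n \<in> carrier L;
        \<And>e. e > 0 \<Longrightarrow> \<exists>N. \<forall>m\<ge>N. \<forall>n\<ge>N. hnorm L (u m - u n) < e\<rbrakk>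
      \<Longrightarrow> \<exists>l\<in>carrier L. (\<lambda>n. hnorm L (u n - l)) \<longlonglongrightarrow> 0"

locale self_dual_hilbert_module = hilbert_module +
  assumes self_dual: "\<lbrakk>f \<in> Lin L self_module;
      \<And>u e. \<lbrakk>u \<in> carrier L; e > 0\<rbrakk> \<Longrightarrow>
        \<exists>d>0. \<forall>v\<in>carrier L. hnorm L (v - u) < d \<longrightarrow> norm (f v - f u) < e\<rbrakk>
    \<Longrightarrow> \<exists>l\<in>carrier L. \<forall>v\<in>carrier L. f v = ip L l v"

definition unitary_operators ::
    "('a::cstar_algebra, 'm::ab_group_add, 'z) hmodule_scheme \<Rightarrow> ('m \<Rightarrow> 'm) set" where
  "unitary_operators L = {T \<in> Lin L L. \<exists>S\<in>Lin L L.
     (\<forall>v\<in>carrier L. \<forall>w\<in>carrier L. ip L (T v) w = ip L v (S w)) \<and>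
     (\<forall>v\<in>carrier L. S (T v) = v \<and> T (S v) = v)}"

definition unitary_maps :: "('a::cstar_algebra, 'm::ab_group_add, 'z) hmodule_scheme
    \<Rightarrow> ('a, 'n::ab_group_add, 'y) hmodule_scheme \<Rightarrow> ('m \<Rightarrow> 'n) set" where
  "unitary_maps L L' = {W \<in> Lin L L'. W ` carrier L = carrier L' \<and>
     (\<forall>v\<in>carrier L. \<forall>w\<in>carrier L. ip L' (W v) (W w) = ip L v w)}"

text \<open>
  The open semiballs of a family \<open>S\<close> of seminorms on \<open>C\<close> form a subbase of the topology that
  \<open>S\<close> induces on \<open>C\<close>.
\<close>

definition seminorm_topology :: "'m::ab_group_add set \<Rightarrow> ('m \<Rightarrow> real) set \<Rightarrow> 'm topology" where
  "seminorm_topology C S =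
     topology_generated_by {{w \<in> C. p (w - v) < e} | p v e. p \<in> S \<and> v \<in> C \<and> e > 0}"

datatype tau = Tau1 | Tau2

fun module_topology :: "('a::cstar_algebra \<Rightarrow> complex) set \<Rightarrow> tau
    \<Rightarrow> ('a, 'm::ab_group_add, 'z) hmodule_scheme \<Rightarrow> 'm topology" where
  "module_topology P Tau1 L = seminorm_topology (carrier L)
     {(\<lambda>l. sqrt (Re (\<phi> (ip L l l)))) | \<phi>. \<phi> \<in> positive_cone P}"
| "module_topology P Tau2 L = seminorm_topology (carrier L)
     {(\<lambda>l. cmod (\<phi> (ip L l' l))) | \<phi> l'. \<phi> \<in> positive_cone P \<and> l' \<in> carrier L}"


section \<open>Covariant kernels and their dilations\<close>

definition two_cocycle :: "('g, 'z) monoid_scheme \<Rightarrow> ('g \<Rightarrow> 'g \<Rightarrow> 'a::cstar_algebra) \<Rightarrow> bool" where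
  "two_cocycle G \<sigma> \<longleftrightarrow>
     (\<forall>g\<in>carrier G. \<forall>h\<in>carrier G. \<sigma> g h \<in> unitaries \<inter> center) \<and>
     (\<forall>g\<in>carrier G. \<sigma> \<one>\<^bsub>G\<^esub> g = 1 \<and> \<sigma> g \<one>\<^bsub>G\<^esub> = 1) \<and>
     (\<forall>g\<in>carrier G. \<forall>h\<in>carrier G. \<forall>k\<in>carrier G.
        \<sigma> g (h \<otimes>\<^bsub>G\<^esub> k) * \<sigma> h k = \<sigma> (g \<otimes>\<^bsub>G\<^esub> h) k * \<sigma> g h)"

definition positive_covariant_kernel ::
    "('g, 'z) monoid_scheme \<Rightarrow> 'x set \<Rightarrow> ('g \<Rightarrow> 'x \<Rightarrow> 'x)
     \<Rightarrow> ('a::cstar_algebra, 'v::ab_group_add, 'y) amodule_scheme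
     \<Rightarrow> ('g \<Rightarrow> 'x \<Rightarrow> 'a) \<Rightarrow> ('g \<Rightarrow> 'v \<Rightarrow> 'v) \<Rightarrow> ('x \<Rightarrow> 'x \<Rightarrow> 'v \<Rightarrow> 'v \<Rightarrow> 'a) \<Rightarrow> bool" where
  "positive_covariant_kernel G X act V \<alpha> U K \<longleftrightarrow>
     (\<forall>x\<in>X. \<forall>y\<in>X. K x y \<in> sesquilinear_forms V) \<and>
     (\<exists>x\<in>X. \<exists>y\<in>X. \<exists>v\<in>carrier V. \<exists>w\<in>carrier V. K x y v w \<noteq> 0) \<and>
     (\<forall>(n::nat) x v. (\<forall>j<n. x j \<in> X \<and> v j \<in> carrier V) \<longrightarrow>
        positive (\<Sum>j<n. \<Sum>k<n. K (x j) (x k) (v j) (v k))) \<and>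
     (\<forall>g\<in>carrier G. \<forall>x\<in>X. \<forall>y\<in>X. \<forall>v\<in>carrier V. \<forall>w\<in>carrier V.
        K (act g x) (act g y) v w =
          star (\<alpha> g x) * K x y (U (inv\<^bsub>G\<^esub> g) v) (U (inv\<^bsub>G\<^esub> g) w) * \<alpha> g y)"

definition is_dilation ::
    "('a::cstar_algebra \<Rightarrow> complex) set \<Rightarrow> tau
     \<Rightarrow> ('g, 'z) monoid_scheme \<Rightarrow> 'x set \<Rightarrow> ('g \<Rightarrow> 'x \<Rightarrow> 'x)
     \<Rightarrow> ('a, 'v::ab_group_add, 'y) amodule_scheme
     \<Rightarrow> ('g \<Rightarrow> 'v \<Rightarrow> 'v) \<Rightarrow> ('g \<Rightarrow> 'x \<Rightarrow> 'a) \<Rightarrow> ('g \<Rightarrow> 'g \<Rightarrow> 'a) \<Rightarrow> ('x \<Rightarrow> 'x \<Rightarrow> 'v \<Rightarrow> 'v \<Rightarrow> 'a)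
     \<Rightarrow> ('a, 'l::ab_group_add) hmodule \<Rightarrow> ('x \<Rightarrow> 'v \<Rightarrow> 'l) \<Rightarrow> ('g \<Rightarrow> 'l \<Rightarrow> 'l) \<Rightarrow> bool" where
  "is_dilation P t G X act V U \<alpha> \<sigma> K L R Ut \<longleftrightarrow>
     self_dual_hilbert_module L \<and>
     R \<in> X \<rightarrow> Lin V L \<and>
     Ut \<in> carrier G \<rightarrow> unitary_operators L \<and>
     (\<forall>l\<in>carrier L. Ut \<one>\<^bsub>G\<^esub> l = l) \<and>
     (\<forall>g\<in>carrier G. \<forall>h\<in>carrier G. \<forall>l\<in>carrier L.
        Ut g (Ut h l) = mact L (Ut (g \<otimes>\<^bsub>G\<^esub> h) l) (\<sigma> g h)) \<and>
     (\<forall>x\<in>X. \<forall>y\<in>X. \<forall>v\<in>carrier V. \<forall>w\<in>carrier V. K x y v w = ip L (R x v) (R y w)) \<and>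
     module_topology P t L closure_of
       module.span (mscale L) {R x v | x v. x \<in> X \<and> v \<in> carrier V} = carrier L \<and>
     (\<forall>x\<in>X. \<forall>g\<in>carrier G. \<forall>v\<in>carrier V.
        R x (U g v) =
          mact L (Ut g (R (act (inv\<^bsub>G\<^esub> g) x) v)) (\<alpha> g (act (inv\<^bsub>G\<^esub> g) x)))"

end

theory Submission
  imports Defs
begin

text \<open>
  The module \<open>L\<close> is the dual of the formal sums of pairs \<open>(x, v)\<close>: the kernel is a semi-inner product
  with values in the W*-algebra \<open>A\<close> on these sums, and \<open>L\<close> consists of the bounded functionals that behave
  like \<open>\<langle>\<cdot>|l\<rangle>\<close>. So \<open>R(x) v\<close> is the functional represented by \<open>(x, v)\<close>, every \<open>F\<close> in \<open>L\<close> is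
  recorded by the values \<open>F x v = \<langle>R(x) v|F\<rangle>\<close>, and covariance dictates how \<open>G\<close> acts on these values
  (\<open>model_U\<close>). The group operators and their inverses (up to the cocycle) are contractions, hence
  unitary (\<open>unitary_from_contractions\<close>).

  The substance is that this dual carries an inner product with values in \<open>A\<close> for which it is self-dual
  and the formal sums are dense (\<open>dual_ip\<close>, \<open>dual_self_dual\<close>, \<open>dual_ip_dense\<close>). For a positive
  functional \<open>\<phi>\<close> of the predual, a functional \<open>F\<close> has a Riesz vector in the Hilbert space completion of
  the sums in the \<open>\<phi>\<close>-seminorm, and vectors that approximate it for \<open>\<psi> \<ge> \<phi>\<close> do so for \<open>\<phi>\<close>
  (\<open>approximates_mono\<close>). Along an ultrafilter of growing functionals these vectors approximate \<open>F\<close> for all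
  \<open>\<phi>\<close> at once, and \<open>\<langle>F|G\<rangle>\<close> is the weak* limit of \<open>G\<close> along them. The limit exists because the positive
  functionals span the predual with control of the norms (\<open>positive_decomposition\<close>), and it determines an
  element with the expected positivity because they detect it (\<open>Pp_detects_positive\<close>). A bounded
  module map on the dual is determined by its values on the dense image of the sums, and these values form
  an element of the dual; this is self-duality.

  The decomposition of functionals requires the predual to be closed under the multiplications by
  elements of \<open>A\<close> and under the involution. An element of the predual is recognized by its continuity along
  weak* ultralimits (\<open>P_memI\<close>), and ultralimits are linear contractions of bounded families
  that fix the constants. Such norm one projections are module maps (\<open>E_mult_left\<close>): they respect
  orthogonality (\<open>E_orthogonal\<close>), and a partition of unity in functions of a positive contraction \<open>h\<close>
  reduces commutation with \<open>h\<close> to orthogonality. The necessary C*-algebra theory, the order and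
  the continuous functions of a positive contraction, rests on the binomial series for the square root and on
  Bernstein operators.

  For uniqueness, a dilation \<open>L'\<close> is mapped to the model by \<open>l \<mapsto> (\<lambda>x v. \<langle>R'(x) v|l\<rangle>)\<close>. This map is
  injective by density; the self-duality of \<open>L'\<close> gives it an adjoint, which is a right inverse
  (\<open>J_adjoint\<close>), so the map is unitary; and it intertwines all the structure. Two dilations
  are therefore both isomorphic to the model.
\<close>


section \<open>Order and square roots in a C*-algebra\<close>

lemma star_0 [simp]: "star (0::'a::cstar_algebra) = 0"
  using star_add[of "0::'a" 0] by simp

lemma star_minus [simp]: "star (- a) = - star (a::'a::cstar_algebra)"
  using star_add[of a "- a"] by (simp add: eq_neg_iff_add_eq_0 add.commute)

lemma star_diff: "star (a - b) = star a - star (b::'a::cstar_algebra)"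
  using star_add[of a "- b"] by simp

lemma star_1 [simp]: "star (1::'a::cstar_algebra) = 1"
  using star_mult[of "star (1::'a)" 1] by (simp add: star_star)

lemma star_scaleR [simp]: "star (r *\<^sub>R a) = r *\<^sub>R star (a::'a::cstar_algebra)"
  using star_scaleC[of "complex_of_real r" a] by (simp add: scaleC_of_real)

lemma scaleC_1 [simp]: "1 *\<^sub>C a = (a::'a::cstar_algebra)"
  using scaleC_of_real[of 1 a] by simp

lemma scaleC_0 [simp]: "0 *\<^sub>C a = (0::'a::cstar_algebra)"
  using scaleC_of_real[of 0 a] by simp

lemma scaleC_zero [simp]: "c *\<^sub>C 0 = (0::'a::cstar_algebra)"
  using scaleC_add_right[of c "0::'a" 0] by simp

lemma scaleC_minus1: "(- 1) *\<^sub>C a = - (a::'a::cstar_algebra)"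
  using scaleC_of_real[of "- 1" a] by simp

lemma scaleC_minus_left: "(- c) *\<^sub>C a = - (c *\<^sub>C (a::'a::cstar_algebra))"
  using scaleC_scaleC[of "- 1" c a] by (simp add: scaleC_minus1)

lemma scaleC_minus_right: "c *\<^sub>C (- a) = - (c *\<^sub>C (a::'a::cstar_algebra))"
  using scaleC_scaleC[of c "- 1" a] scaleC_scaleC[of "- 1" c a] by (simp add: scaleC_minus1)

lemma scaleC_diff_right: "c *\<^sub>C (a - b) = c *\<^sub>C a - c *\<^sub>C (b::'a::cstar_algebra)"
  using scaleC_add_right[of c a "- b"] by (simp add: scaleC_minus_right)

lemma scaleC_scaleR: "c *\<^sub>C r *\<^sub>R a = r *\<^sub>R c *\<^sub>C (a::'a::cstar_algebra)"
  by (metis mult.commute scaleC_of_real scaleC_scaleC)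

lemmas scaleC_simps = scaleC_scaleC scaleC_minus1 scaleC_minus_left scaleC_minus_right
  scaleC_add_right scaleC_diff_right mult_scaleC_left mult_scaleC_right

lemma star_sum: "star (sum f I) = (\<Sum>i\<in>I. star (f i :: 'a::cstar_algebra))"
  by (induction I rule: infinite_finite_induct) (auto simp: star_add)

lemma star_power: "star (a ^ n) = star (a::'a::cstar_algebra) ^ n"
  by (induction n) (auto simp: star_mult power_commutes)

lemma norm_star [simp]: "norm (star a) = norm (a::'a::cstar_algebra)"
proof -
  have le: "norm b \<le> norm (star b)" for b :: 'a
  proof (cases "b = 0")
    case False
    have "(norm b)\<^sup>2 \<le> norm (star b) * norm b"
      by (metis cstar_identity norm_mult_ineq)
    then show ?thesis using False by (simp add: power2_eq_square)
  qed simp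
  show ?thesis using le[of a] le[of "star a"] by (simp add: star_star)
qed

lemma bounded_linear_star: "bounded_linear (star :: 'a::cstar_algebra \<Rightarrow> 'a)"
  by (rule bounded_linear_intro[where K = 1]) (auto simp: star_add)

lemma tendsto_star [tendsto_intros]:
  "(f \<longlongrightarrow> a) F \<Longrightarrow> ((\<lambda>x. star (f x)) \<longlongrightarrow> star (a::'a::cstar_algebra)) F"
  by (rule bounded_linear.tendsto[OF bounded_linear_star])

lemma star_mult_self_eq_0: "star a * a = 0 \<longleftrightarrow> (a::'a::cstar_algebra) = 0"
  by (metis cstar_identity mult_zero_right norm_eq_zero power_eq_0_iff pos2)

lemma norm_selfadj_square: "star a = a \<Longrightarrow> norm (a * a) = (norm (a::'a::cstar_algebra))\<^sup>2"
  using cstar_identity[of a] by simp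

lemma norm_unitary: "star u * u = (1::'a::cstar_algebra) \<Longrightarrow> norm u = 1"
  using cstar_identity[of u] by (simp add: power2_eq_1_iff) (smt (verit) norm_ge_zero)

lemma norm_real_part_le: 
  assumes "star a = a" "star b = b"
  shows "norm (a::'a::cstar_algebra) \<le> norm (a + \<i> *\<^sub>C b)"
proof -
  define y where "y = a + \<i> *\<^sub>C b"
  have "2 *\<^sub>R a = y + star y"
    using assms by (simp add: y_def star_add star_scaleC scaleC_minus_left scaleR_2)
  then have "2 * norm a = norm (y + star y)"
    by (metis abs_numeral norm_scaleR)
  also have "\<dots> \<le> norm y + norm (star y)" by (rule norm_triangle_ineq)
  finally show ?thesis by (simp add: y_def)
qed

text \<open>
  The candidate for \<open>sqrt (1 + z)\<close> is the binomial series. It converges absolutely up to the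
  boundary \<open>norm z = 1\<close>, because \<open>\<bar>c n\<bar>\<close> is twice the decrease of \<open>n * \<bar>c n\<bar>\<close>, and this
  boundary case is what makes it applicable to all positive elements.
\<close>

definition sqrt_coeff :: "nat \<Rightarrow> real" where
  "sqrt_coeff n = ((1/2) gchoose n)"

lemma sqrt_coeff_telescope:
  assumes "n \<ge> 1"
  shows "\<bar>sqrt_coeff n\<bar> = 2 * (real n * \<bar>sqrt_coeff n\<bar> - real (Suc n) * \<bar>sqrt_coeff (Suc n)\<bar>)"
proof -
  have "real (Suc n) * sqrt_coeff (Suc n) = (1/2 - real n) * sqrt_coeff n"
    using gbinomial_mult_1[of "1/2::real" n] by (simp add: sqrt_coeff_def algebra_simps)
  then have "\<bar>real (Suc n) * sqrt_coeff (Suc n)\<bar> = \<bar>(1/2 - real n) * sqrt_coeff n\<bar>" by simp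
  then have "real (Suc n) * \<bar>sqrt_coeff (Suc n)\<bar> = (real n - 1/2) * \<bar>sqrt_coeff n\<bar>"
    using assms by (simp only: abs_mult)  simp
  then show ?thesis by (simp add: algebra_simps)
qed

lemma sqrt_coeff_partial_sum:
  "(\<Sum>k<n. \<bar>sqrt_coeff (Suc k)\<bar>) = 1 - 2 * real (Suc n) * \<bar>sqrt_coeff (Suc n)\<bar>"
proof (induction n)
  case 0
  then show ?case by (simp add: sqrt_coeff_def)
next
  case (Suc n)
  then show ?case using sqrt_coeff_telescope[of "Suc n"] by (simp add: algebra_simps)
qed

lemma summable_sqrt_coeff: "summable (\<lambda>n. \<bar>sqrt_coeff (Suc n)\<bar>)"
  by (rule bounded_imp_summable[where B = 1]) (auto simp: sqrt_coeff_partial_sum lessThan_Suc_atMost[symmetric] simp del: sum.lessThan_Suc)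

lemma suminf_sqrt_coeff_le: "(\<Sum>n. \<bar>sqrt_coeff (Suc n)\<bar>) \<le> 1"
  by (rule suminf_le_const[OF summable_sqrt_coeff]) (simp add: sqrt_coeff_partial_sum)

lemma sqrt_series:
  fixes z :: "'a::cstar_algebra"
  assumes z: "norm z \<le> 1" "star z = z"
  obtains s where "star s = s" "norm (1 - s) \<le> 1" "s * s = 1 + z"
    "\<forall>b. b * z = z * b \<longrightarrow> b * s = s * b"
proof -
  define f where "f n = sqrt_coeff n *\<^sub>R z ^ n" for n
  have nz: "norm (z ^ n) \<le> 1" for n
    using norm_power_ineq[of z n] z(1) power_le_one[of "norm z" n] by simp
  have nf: "norm (f n) \<le> \<bar>sqrt_coeff n\<bar>" for n
    using nz[of n] by (simp add: f_def mult_left_le)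
  have sa: "summable (\<lambda>n. norm (f n))"
    by (rule summable_comparison_test[where g = "\<lambda>n. \<bar>sqrt_coeff n\<bar>"])
      (use nf summable_sqrt_coeff summable_Suc_iff[of "\<lambda>n. \<bar>sqrt_coeff n\<bar>"] in auto)
  then have sf: "summable f" by (rule summable_norm_cancel)
  define s where "s = suminf f"
  have f0: "f 0 = 1" by (simp add: f_def sqrt_coeff_def)
  have "star s = (\<Sum>n. star (f n))"
    unfolding s_def by (rule bounded_linear.suminf[OF bounded_linear_star sf])
  moreover have "star (f n) = f n" for n by (simp add: f_def star_power z)
  ultimately have 1: "star s = s" by (simp add: s_def)
  have "s = (\<Sum>n. f (Suc n)) + 1"
    unfolding s_def using suminf_split_head[OF sf] by (simp add: f0)
  then have "norm (1 - s) = norm (\<Sum>n. f (Suc n))" by simp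
  also have "\<dots> \<le> (\<Sum>n. \<bar>sqrt_coeff (Suc n)\<bar>)"
    by (rule norm_suminf_le[OF nf summable_sqrt_coeff])
  finally have 2: "norm (1 - s) \<le> 1" using suminf_sqrt_coeff_le by simp
  have conv: "(\<Sum>i\<le>n. f i * f (n - i)) = (1 gchoose n) *\<^sub>R z ^ n" for n
  proof -
    have "(\<Sum>i\<le>n. f i * f (n - i)) = (\<Sum>i\<le>n. sqrt_coeff i * sqrt_coeff (n - i)) *\<^sub>R z ^ n"
      unfolding scaleR_sum_left by (rule sum.cong) (auto simp: f_def power_add[symmetric])
    then show ?thesis
      using gbinomial_Vandermonde[of "1/2::real" "1/2" n] by (simp add: sqrt_coeff_def atMost_atLeast0)
  qed
  have "(\<lambda>n. \<Sum>i\<le>n. f i * f (n - i)) sums (s * s)"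
    unfolding s_def by (rule Cauchy_product_sums[OF sa sa])
  moreover have "(\<lambda>n. \<Sum>i\<le>n. f i * f (n - i)) sums (\<Sum>n\<in>{0,1}. (1 gchoose n) *\<^sub>R z ^ n)"
    unfolding conv
  proof (rule sums_finite)
    fix n :: nat assume "n \<notin> {0, 1}"
    then have "1 < n" by auto
    then have "(1::real) gchoose n = 0"
      by (metis binomial_gbinomial binomial_eq_0 of_nat_0 of_nat_1)
    then show "((1::real) gchoose n) *\<^sub>R z ^ n = 0" by simp
  qed simp
  ultimately have 3: "s * s = 1 + z"
    using sums_unique2 by fastforce
  have 4: "b * s = s * b" if "b * z = z * b" for b
  proof -
    have "b * z ^ n = z ^ n * b" for n
      using that by (metis power_commuting_commutes)
    then have "b * f n = f n * b" for n by (simp add: f_def)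
    then show ?thesis
      unfolding s_def using suminf_mult[OF sf, of b] suminf_mult2[OF sf, of b] by simp
  qed
  show ?thesis using that 1 2 3 4 by blast
qed

text \<open>
  Positivity in terms of the norm. In this form sums and limits of positive elements are visibly
  positive; the work goes into its agreement with the form \<open>star b * b\<close>.
\<close>

definition pos_by_norm :: "'a::cstar_algebra \<Rightarrow> bool" where
  "pos_by_norm a \<longleftrightarrow> star a = a \<and> (\<exists>r. norm (r *\<^sub>R 1 - a) \<le> r)"

lemma pos_by_norm_add:
  assumes "pos_by_norm a" "pos_by_norm b" shows "pos_by_norm (a + b)"
proof -
  obtain r s where "norm (r *\<^sub>R 1 - a) \<le> r" "norm (s *\<^sub>R 1 - b) \<le> s"
    using assms by (auto simp: pos_by_norm_def)
  then have "norm ((r + s) *\<^sub>R 1 - (a + b)) \<le> r + s"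
    using norm_triangle_ineq[of "r *\<^sub>R 1 - a" "s *\<^sub>R 1 - b"] by (simp add: algebra_simps)
  then show ?thesis using assms by (auto simp: pos_by_norm_def star_add)
qed

lemma pos_by_norm_scaleR:
  assumes "pos_by_norm a" "c \<ge> 0" shows "pos_by_norm (c *\<^sub>R a)"
proof -
  obtain r where "norm (r *\<^sub>R 1 - a) \<le> r"
    using assms by (auto simp: pos_by_norm_def)
  then have "norm ((c * r) *\<^sub>R 1 - c *\<^sub>R a) \<le> c * r"
    using assms(2) norm_scaleR[of c "r *\<^sub>R 1 - a"] mult_left_mono[OF _ assms(2)]
    by (simp add: scaleR_diff_right)
  then show ?thesis using assms by (auto simp: pos_by_norm_def)
qed

lemma pos_by_norm_sqrt:
  fixes a :: "'a::cstar_algebra"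
  assumes a: "pos_by_norm a"
  obtains s where "pos_by_norm s" "s * s = a" "\<forall>b. b * a = a * b \<longrightarrow> b * s = s * b"
proof -
  from a obtain r where sa: "star a = a" and r: "norm (r *\<^sub>R 1 - a) \<le> r"
    by (auto simp: pos_by_norm_def)
  show ?thesis
  proof (cases "r = 0")
    case True
    then have "a = 0" using r by simp
    then show ?thesis using that[of 0] by (auto simp: pos_by_norm_def intro: exI[of _ 0])
  next
    case False
    then have r0: "r > 0" using r norm_ge_zero[of "r *\<^sub>R 1 - a"] by linarith
    define z where "z = inverse r *\<^sub>R (a - r *\<^sub>R 1)"
    have "norm z = inverse r * norm (r *\<^sub>R 1 - a)"
      using r0 by (simp add: z_def norm_minus_commute)
    then have z1: "norm z \<le> 1" using mult_left_mono[OF r, of "inverse r"] r0 by simp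
    have z2: "star z = z" by (simp add: z_def star_diff sa)
    obtain s where s: "star s = s" "norm (1 - s) \<le> 1" "s * s = 1 + z"
      "\<forall>b. b * z = z * b \<longrightarrow> b * s = s * b"
      by (rule sqrt_series[OF z1 z2]) blast
    have "pos_by_norm s" unfolding pos_by_norm_def using s(1,2) by (auto intro!: exI[of _ 1])
    then have 1: "pos_by_norm (sqrt r *\<^sub>R s)" by (rule pos_by_norm_scaleR) (use r0 in simp)
    have "(sqrt r *\<^sub>R s) * (sqrt r *\<^sub>R s) = r *\<^sub>R (1 + z)"
      using r0 s(3) by simp
    then have 2: "(sqrt r *\<^sub>R s) * (sqrt r *\<^sub>R s) = a"
      using r0 by (simp add: z_def scaleR_add_right)
    have 3: "b * (sqrt r *\<^sub>R s) = (sqrt r *\<^sub>R s) * b" if "b * a = a * b" for b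
    proof -
      have "b * z = z * b" using that by (simp add: z_def algebra_simps)
      then have "b * s = s * b" by (rule s(4)[rule_format])
      then show ?thesis by simp
    qed
    show ?thesis using that 1 2 3 by blast
  qed
qed

text \<open>
  For a self-adjoint contraction \<open>b\<close> the element \<open>b + \<i> sqrt (1 - b\<^sup>2)\<close> is unitary, and
  \<open>2 b\<^sup>2 - 1\<close> is the real part of its square.
\<close>

lemma norm_one_minus_square:
  fixes b :: "'a::cstar_algebra"
  assumes b: "star b = b" "norm b \<le> 1"
  shows "norm (1 - b * b) \<le> 1"
proof -
  have "norm (- (b * b)) \<le> 1"
    using norm_mult_ineq[of b b] mult_le_one[OF b(2) _ b(2)] by simp
  moreover have "star (- (b * b)) = - (b * b)" by (simp add: star_mult b)
  ultimately obtain s where s: "star s = s" "s * s = 1 + - (b * b)"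
    "\<forall>c. c * (- (b * b)) = (- (b * b)) * c \<longrightarrow> c * s = s * c"
    by (rule sqrt_series) blast
  have bs: "b * s = s * b" by (rule s(3)[rule_format]) (simp add: mult.assoc)
  define u where "u = b + \<i> *\<^sub>C s"
  have "star u * u = b * b + s * s"
    by (simp add: u_def star_add star_scaleC b s(1) bs algebra_simps scaleC_simps)
  then have "star u * u = 1" by (simp add: s(2))
  then have nu: "norm u = 1" by (rule norm_unitary)
  have "u * u = (b * b - s * s) + \<i> *\<^sub>C (2 *\<^sub>R (b * s))"
    by (simp add: u_def bs algebra_simps scaleC_simps scaleR_2)
  moreover have "star (b * b - s * s) = b * b - s * s" "star (2 *\<^sub>R (b * s)) = 2 *\<^sub>R (b * s)"
    by (simp_all add: star_diff star_mult b s(1) bs)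
  ultimately have "norm (b * b - s * s) \<le> norm (u * u)"
    using norm_real_part_le by metis
  also have "\<dots> \<le> 1" using norm_mult_ineq[of u u] nu by simp
  finally have *: "norm (b * b - s * s) \<le> 1" .
  have "2 *\<^sub>R (1 - b * b) = 1 - (b * b - s * s)"
    by (simp add: s(2) scaleR_2)
  then have "2 * norm (1 - b * b) = norm (1 - (b * b - s * s))"
    by (metis abs_numeral norm_scaleR)
  also have "\<dots> \<le> 2"
    using norm_triangle_ineq4[of 1 "b * b - s * s"] * by simp
  finally show ?thesis by simp
qed

lemma norm_minus_square_le:
  fixes b :: "'a::cstar_algebra"
  assumes b: "star b = b"
  shows "norm ((norm b)\<^sup>2 *\<^sub>R 1 - b * b) \<le> (norm b)\<^sup>2"
proof (cases "b = 0")
  case False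
  define c where "c = inverse (norm b) *\<^sub>R b"
  have "norm (1 - c * c) \<le> 1"
    by (rule norm_one_minus_square) (use False b in \<open>auto simp: c_def\<close>)
  moreover have "(norm b)\<^sup>2 *\<^sub>R 1 - b * b = (norm b)\<^sup>2 *\<^sub>R (1 - c * c)"
    using False by (simp add: c_def scaleR_diff_right power2_eq_square mult.assoc[symmetric])
      (simp add: mult.assoc)
  ultimately show ?thesis by (simp add: mult_left_le)
qed simp

lemma pos_by_norm_square: "star b = b \<Longrightarrow> pos_by_norm (b * b)"
  unfolding pos_by_norm_def using norm_minus_square_le[of b] by (auto simp: star_mult)

lemma pos_by_norm_canonical:
  fixes a :: "'a::cstar_algebra"
  shows "pos_by_norm a \<longleftrightarrow> star a = a \<and> norm (norm a *\<^sub>R 1 - a) \<le> norm a"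
proof
  assume a: "pos_by_norm a"
  then obtain s where s: "pos_by_norm s" "s * s = a" by (rule pos_by_norm_sqrt) blast
  then have "star s = s" by (simp add: pos_by_norm_def)
  then show "star a = a \<and> norm (norm a *\<^sub>R 1 - a) \<le> norm a"
    using norm_minus_square_le[of s] norm_selfadj_square[of s] a s(2) by (simp add: pos_by_norm_def)
qed (auto simp: pos_by_norm_def)

lemma pos_by_norm_lim:
  assumes "\<And>n. pos_by_norm (f n)" "f \<longlonglongrightarrow> a"
  shows "pos_by_norm a"
proof -
  have "(\<lambda>n. star (f n)) \<longlonglongrightarrow> star a" by (rule tendsto_star[OF assms(2)])
  then have "star a = a"
    using assms by (auto simp: pos_by_norm_def intro: LIMSEQ_unique)
  moreover have "(\<lambda>n. norm (norm (f n) *\<^sub>R 1 - f n)) \<longlonglongrightarrow> norm (norm a *\<^sub>R 1 - a)"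
    by (intro tendsto_intros assms)
  moreover have "(\<lambda>n. norm (f n)) \<longlonglongrightarrow> norm a" by (intro tendsto_intros assms)
  ultimately show ?thesis
    unfolding pos_by_norm_canonical
    using assms(1) by (auto simp: pos_by_norm_canonical intro: LIMSEQ_le)
qed

lemma pos_by_norm_commuting_mult:
  assumes "pos_by_norm a" "pos_by_norm b" "a * b = b * a"
  shows "pos_by_norm (a * b)"
proof -
  obtain s where s: "pos_by_norm s" "s * s = a" "\<forall>c. c * a = a * c \<longrightarrow> c * s = s * c"
    by (rule pos_by_norm_sqrt[OF assms(1)]) blast
  obtain t where t: "pos_by_norm t" "t * t = b" "\<forall>c. c * b = b * c \<longrightarrow> c * t = t * c"
    by (rule pos_by_norm_sqrt[OF assms(2)]) blast
  have "b * s = s * b" by (rule s(3)[rule_format]) (simp add: assms)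
  then have st: "s * t = t * s" by (intro t(3)[rule_format]) simp
  have "star (s * t) = s * t" using s(1) t(1) st by (simp add: star_mult pos_by_norm_def)
  then have "pos_by_norm ((s * t) * (s * t))" by (rule pos_by_norm_square)
  also have "(s * t) * (s * t) = a * b"
    using st by (metis mult.assoc s(2) t(2))
  finally show ?thesis .
qed

text \<open>
  With commuting square roots \<open>w\<close> and \<open>q\<close> of \<open>x\<close> and \<open>N - x\<close>, the element \<open>w + \<i> q\<close> is a
  multiple of a unitary, which bounds \<open>w\<close>.
\<close>

lemma norm_le_if_pos_by_norm:
  fixes x :: "'a::cstar_algebra"
  assumes "pos_by_norm x" "pos_by_norm (N *\<^sub>R 1 - x)" "N \<ge> 0"
  shows "norm x \<le> N"
proof -
  obtain w where w: "pos_by_norm w" "w * w = x" "\<forall>c. c * x = x * c \<longrightarrow> c * w = w * c"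
    by (rule pos_by_norm_sqrt[OF assms(1)]) blast
  obtain q where q: "pos_by_norm q" "q * q = N *\<^sub>R 1 - x"
     "\<forall>c. c * (N *\<^sub>R 1 - x) = (N *\<^sub>R 1 - x) * c \<longrightarrow> c * q = q * c"
    by (rule pos_by_norm_sqrt[OF assms(2)]) blast
  have "w * x = x * w" by (metis mult.assoc w(2))
  then have wq: "w * q = q * w" by (intro q(3)[rule_format]) (simp add: algebra_simps)
  have sa: "star w = w" "star q = q" using w(1) q(1) by (simp_all add: pos_by_norm_def)
  define u where "u = w + \<i> *\<^sub>C q"
  have "star u * u = w * w + q * q"
    by (simp add: u_def star_add star_scaleC sa wq algebra_simps scaleC_simps)
  then have "star u * u = N *\<^sub>R 1" by (simp add: w(2) q(2))
  then have "(norm u)\<^sup>2 = N" using cstar_identity[of u] assms(3) by simp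
  moreover have "norm w \<le> norm u" unfolding u_def by (rule norm_real_part_le[OF sa])
  moreover have "norm x = (norm w)\<^sup>2" using norm_selfadj_square[OF sa(1)] w(2) by simp
  ultimately show ?thesis by (metis norm_ge_zero power_mono)
qed

lemma pos_by_norm_scaled_one [simp]: "r \<ge> 0 \<Longrightarrow> pos_by_norm (r *\<^sub>R 1)"
  unfolding pos_by_norm_def by (auto intro!: exI[of _ r])

lemma pos_by_norm_norm_minus:
  assumes "star a = a" shows "pos_by_norm (norm a *\<^sub>R 1 - a)"
  unfolding pos_by_norm_def using assms by (auto simp: star_diff intro!: exI[of _ "norm a"])

lemma one_minus_invertible:
  fixes x :: "'a::cstar_algebra"
  assumes "norm x < 1"
  obtains v where "(1 - x) * v = 1" "v * (1 - x) = 1"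
proof -
  have "summable (\<lambda>n. norm (x ^ n))"
    by (rule summable_comparison_test[where g = "\<lambda>n. norm x ^ n"])
      (use assms in \<open>auto simp: norm_power_ineq summable_geometric\<close>)
  then have sf: "summable (\<lambda>n. x ^ n)" by (rule summable_norm_cancel)
  let ?v = "\<Sum>n. x ^ n"
  have h: "?v = (\<Sum>n. x ^ Suc n) + 1" using suminf_split_head[OF sf] by simp
  have "x * ?v = (\<Sum>n. x ^ Suc n)" "?v * x = (\<Sum>n. x ^ Suc n)"
    using suminf_mult[OF sf, of x] suminf_mult2[OF sf, of x] by (auto simp: power_commutes)
  then show ?thesis using h that[of ?v] by (simp add: algebra_simps)
qed

lemma inverse_selfadj:
  fixes a :: "'a::cstar_algebra"
  assumes "star a = a" "a * v = 1" "v * a = 1"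
  shows "star v = v"
proof -
  have "star v * a = 1" using assms star_mult[of a v] by simp
  then show ?thesis by (metis assms(2) mult.assoc mult_1_left mult_1_right)
qed

lemma pos_by_norm_inverse:
  assumes "pos_by_norm a" "a * v = 1" "v * a = 1"
  shows "pos_by_norm v"
proof -
  obtain w where w: "pos_by_norm w" "w * w = a"
    by (rule pos_by_norm_sqrt[OF assms(1)]) blast
  have sv: "star v = v" using inverse_selfadj assms by (auto simp: pos_by_norm_def)
  have wa: "w * a = a * w" by (metis mult.assoc w(2))
  have wv: "w * v = v * w"
    by (metis assms(2,3) mult.assoc mult_1_left mult_1_right wa)
  have "star (v * w) = v * w" using w(1) sv wv by (simp add: star_mult pos_by_norm_def)
  then have "pos_by_norm ((v * w) * (v * w))" by (rule pos_by_norm_square)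
  also have "(v * w) * (v * w) = v"
    by (metis assms(3) mult.assoc mult_1_left w(2) wv)
  finally show ?thesis .
qed

lemma pos_by_norm_shift_invertible:
  fixes a :: "'a::cstar_algebra"
  assumes a: "pos_by_norm a" and N: "N > 0"
  obtains v where "(N *\<^sub>R 1 + a) * v = 1" "v * (N *\<^sub>R 1 + a) = 1" "pos_by_norm v"
proof -
  obtain r where r: "norm (r *\<^sub>R 1 - a) \<le> r" using a by (auto simp: pos_by_norm_def)
  then have r0: "r \<ge> 0" using norm_ge_zero order_trans by blast
  define x where "x = inverse (N + r) *\<^sub>R (r *\<^sub>R 1 - a)"
  have "norm x = inverse (N + r) * norm (r *\<^sub>R 1 - a)" using N r0 by (simp add: x_def)
  also have "\<dots> \<le> inverse (N + r) * r" using r N r0 by (intro mult_left_mono) auto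
  also have "\<dots> < 1" using N r0 by (simp add: field_simps)
  finally obtain v where v: "(1 - x) * v = 1" "v * (1 - x) = 1" by (rule one_minus_invertible)
  have e: "N *\<^sub>R 1 + a = (N + r) *\<^sub>R (1 - x)"
    using N r0 by (simp add: x_def scaleR_diff_right mult.assoc[symmetric]) (simp add: algebra_simps)
  let ?v = "inverse (N + r) *\<^sub>R v"
  have 1: "(N *\<^sub>R 1 + a) * ?v = 1" "?v * (N *\<^sub>R 1 + a) = 1"
    unfolding e using N r0 v by auto
  have "pos_by_norm (N *\<^sub>R 1 + a)" using a N by (intro pos_by_norm_add) auto
  from that[OF 1 pos_by_norm_inverse[OF this 1]] show ?thesis .
qed

text \<open>
  If \<open>- c\<^sup>* c\<close> is positive, so is \<open>c c\<^sup>* = 2 (h\<^sup>2 + k\<^sup>2) - c\<^sup>* c\<close> for \<open>c = h + \<i> k\<close>. Hence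
  \<open>N + c c\<^sup>*\<close> is invertible for all \<open>N > 0\<close>, and \<open>N + c\<^sup>* c\<close> with it. For \<open>N\<close> the norm of
  \<open>y = - c\<^sup>* c\<close> this is impossible, since an invertible positive element dominates a positive
  scalar.
\<close>

lemma pos_by_norm_neg_star_mult:
  fixes c :: "'a::cstar_algebra"
  assumes y: "pos_by_norm (- (star c * c))"
  shows "c = 0"
proof (rule ccontr)
  assume "c \<noteq> 0"
  define y where "y = - (star c * c)"
  have py: "pos_by_norm y" using assms y_def by simp
  have sy: "star y = y" using py by (simp add: pos_by_norm_def)
  define N where "N = norm y"
  have N: "N > 0" using \<open>c \<noteq> 0\<close> by (simp add: N_def y_def star_mult_self_eq_0)
  have "pos_by_norm (c * star c)"
  proof -
    define h where "h = c + star c"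
    define k where "k = \<i> *\<^sub>C (star c - c)"
    have hk: "star h = h" "star k = k"
      by (simp_all add: h_def k_def star_add star_diff star_star star_scaleC scaleC_simps)
    have "h * h + k * k = 2 *\<^sub>R (c * star c) + 2 *\<^sub>R (star c * c)"
      by (simp add: h_def k_def algebra_simps scaleC_simps scaleR_2)
    then have "c * star c = (1/2) *\<^sub>R (h * h + k * k) + y"
      by (simp add: y_def algebra_simps)
    moreover have "pos_by_norm ((1/2) *\<^sub>R (h * h + k * k) + y)"
      by (intro pos_by_norm_add pos_by_norm_scaleR pos_by_norm_square hk py) simp
    ultimately show ?thesis by simp
  qed
  then obtain v where v: "(N *\<^sub>R 1 + c * star c) * v = 1" "v * (N *\<^sub>R 1 + c * star c) = 1"
    by (rule pos_by_norm_shift_invertible[OF _ N]) blast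
  define z where "z = inverse N *\<^sub>R (1 - star c * v * c)"
  have v': "c * star c * v = 1 - N *\<^sub>R v" "v * (c * star c) = 1 - N *\<^sub>R v"
    using v by (simp_all add: algebra_simps)
  have m: "N *\<^sub>R 1 - y = N *\<^sub>R 1 + star c * c" by (simp add: y_def)
  have t1: "star c * (c * (star c * (v * c))) = star c * c - N *\<^sub>R (star c * (v * c))"
  proof -
    have "star c * (c * (star c * (v * c))) = star c * (c * star c * v) * c" by (simp add: mult.assoc)
    then show ?thesis by (simp only: v') (simp add: algebra_simps)
  qed
  have t2: "star c * (v * (c * (star c * c))) = star c * c - N *\<^sub>R (star c * (v * c))"
  proof -
    have "star c * (v * (c * (star c * c))) = star c * (v * (c * star c)) * c" by (simp add: mult.assoc)
    then show ?thesis by (simp only: v') (simp add: algebra_simps)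
  qed
  have mz: "(N *\<^sub>R 1 - y) * z = 1"
    unfolding m z_def using N t1 by (simp add: algebra_simps)
  have zm: "z * (N *\<^sub>R 1 - y) = 1"
    unfolding m z_def using N t2
    by (simp add: algebra_simps) (metis (no_types) left_inverse less_numeral_extra(3) scaleR_add_right scaleR_one scaleR_scaleR)
  have pm: "pos_by_norm (N *\<^sub>R 1 - y)" unfolding N_def by (rule pos_by_norm_norm_minus[OF sy])
  have sz: "star z = z" using inverse_selfadj[OF _ mz zm] pm by (simp add: pos_by_norm_def)
  have z0: "norm z > 0" using mz by auto
  have "pos_by_norm ((norm z *\<^sub>R 1 - z) * (N *\<^sub>R 1 - y))"
  proof (rule pos_by_norm_commuting_mult[OF pos_by_norm_norm_minus[OF sz] pm])
    show "(norm z *\<^sub>R 1 - z) * (N *\<^sub>R 1 - y) = (N *\<^sub>R 1 - y) * (norm z *\<^sub>R 1 - z)"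
      unfolding left_diff_distrib[of "norm z *\<^sub>R 1"] right_diff_distrib[of _ "norm z *\<^sub>R 1" z] mz zm by simp
  qed
  also have "(norm z *\<^sub>R 1 - z) * (N *\<^sub>R 1 - y) = norm z *\<^sub>R (N *\<^sub>R 1 - y) - 1"
    unfolding left_diff_distrib[of "norm z *\<^sub>R 1"] zm by simp
  finally have "pos_by_norm (inverse (norm z) *\<^sub>R (norm z *\<^sub>R (N *\<^sub>R 1 - y) - 1))"
    by (rule pos_by_norm_scaleR) simp
  also have "inverse (norm z) *\<^sub>R (norm z *\<^sub>R (N *\<^sub>R 1 - y) - 1) = (N - inverse (norm z)) *\<^sub>R 1 - y"
    using z0 by (simp add: scaleR_diff_right) (simp add: algebra_simps)
  finally have p: "pos_by_norm ((N - inverse (norm z)) *\<^sub>R 1 - y)" .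
  show False
  proof (cases "N - inverse (norm z) \<ge> 0")
    case True
    then have "norm y \<le> N - inverse (norm z)" by (rule norm_le_if_pos_by_norm[OF py p])
    then show False using z0 by (simp add: N_def)
  next
    case False
    have "pos_by_norm ((inverse (norm z) - N) *\<^sub>R (1::'a))"
      using False by (intro pos_by_norm_scaled_one) simp
    from pos_by_norm_add[OF p this] have "pos_by_norm (0 *\<^sub>R 1 - y)"
      by (simp add: algebra_simps)
    then have "norm y \<le> 0" by (intro norm_le_if_pos_by_norm[OF py]) auto
    then show False using N by (simp add: N_def)
  qed
qed

text \<open>
  With \<open>s = \<bar>a\<bar>\<close>, the element \<open>p = s - a\<close> is twice the negative part of \<open>a\<close>.
\<close>

lemma negative_part:
  fixes a :: "'a::cstar_algebra"
  assumes a: "star a = a"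
  obtains p where "star p = p" "pos_by_norm (- (p * a * p))" "p * a * p = 0 \<longrightarrow> pos_by_norm a"
proof -
  obtain s where s: "pos_by_norm s" "s * s = a * a" "\<forall>b. b * (a * a) = (a * a) * b \<longrightarrow> b * s = s * b"
    by (rule pos_by_norm_sqrt[OF pos_by_norm_square[OF a]]) blast
  have as: "a * s = s * a" by (rule s(3)[rule_format]) (simp add: mult.assoc)
  obtain w where w: "pos_by_norm w" "w * w = s" "\<forall>b. b * s = s * b \<longrightarrow> b * w = w * b"
    by (rule pos_by_norm_sqrt[OF s(1)]) blast
  define p where "p = s - a"
  have ss: "star s = s" "star w = w" using s(1) w(1) by (auto simp: pos_by_norm_def)
  have sp: "star p = p" by (simp add: p_def star_diff ss a)
  have ps: "p * s = s * p" by (simp add: p_def algebra_simps as)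
  then have pw: "p * w = w * p" by (rule w(3)[rule_format])
  have pp: "p * p = 2 *\<^sub>R (s * p)"
    by (simp add: p_def algebra_simps as s(2) scaleR_2)
  have ap: "a * p = - (s * p)" by (simp add: p_def algebra_simps as s(2))
  have pap: "- (p * a * p) = (p * w) * (p * w)"
    by (simp add: mult.assoc ap) (metis mult.assoc pw w(2))
  have 1: "pos_by_norm (- (p * a * p))"
    unfolding pap by (rule pos_by_norm_square) (simp add: star_mult sp ss pw)
  have 2: "pos_by_norm a" if "p * a * p = 0"
  proof -
    have "p * (s * p) = 0" using that by (simp add: mult.assoc ap)
    then have "p * p * p = 0" by (simp add: pp mult.assoc ps[symmetric])
    then have "star (p * p) * (p * p) = 0" by (simp add: star_mult sp mult.assoc[symmetric])
    then have "p * p = 0" by (simp only: star_mult_self_eq_0)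
    then have "star p * p = 0" by (simp add: sp)
    then have "p = 0" by (simp only: star_mult_self_eq_0)
    then show ?thesis using s(1) by (simp add: p_def)
  qed
  show ?thesis using that sp 1 2 by blast
qed

lemma pos_by_norm_star_mult: "pos_by_norm (star c * (c::'a::cstar_algebra))"
proof -
  have "star (star c * c) = star c * c" by (simp add: star_mult star_star)
  then obtain p where p: "star p = p" "pos_by_norm (- (p * (star c * c) * p))"
    "p * (star c * c) * p = 0 \<longrightarrow> pos_by_norm (star c * c)"
    by (rule negative_part) blast
  have e: "p * (star c * c) * p = star (c * p) * (c * p)" by (simp add: star_mult p(1) mult.assoc)
  have "c * p = 0" by (rule pos_by_norm_neg_star_mult) (use p(2) e in simp)
  then show ?thesis using p(3) e by simp
qed

lemma positive_iff: "positive a \<longleftrightarrow> pos_by_norm a"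
proof
  assume "pos_by_norm a"
  then obtain s where "pos_by_norm s" "s * s = a" by (rule pos_by_norm_sqrt) blast
  then show "positive a" unfolding positive_def pos_by_norm_def by metis
qed (auto simp: positive_def pos_by_norm_star_mult)

lemma positive_selfadj: "positive a \<Longrightarrow> star a = a"
  by (simp add: positive_iff pos_by_norm_def)

lemma positive_add: "positive a \<Longrightarrow> positive b \<Longrightarrow> positive (a + b)"
  by (simp add: positive_iff pos_by_norm_add)

lemma positive_scaleR: "positive a \<Longrightarrow> c \<ge> 0 \<Longrightarrow> positive (c *\<^sub>R a)"
  by (simp add: positive_iff pos_by_norm_scaleR)

lemma positive_0 [simp]: "positive 0" and positive_1 [simp]: "positive 1"
  and positive_star_mult [simp]: "positive (star c * c)"
  unfolding positive_def by (auto intro: exI[of _ 0] exI[of _ 1])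

lemma positive_mult_star [simp]: "positive (c * star c)"
  unfolding positive_def by (auto intro!: exI[of _ "star c"] simp: star_star)

lemma positive_scaled_one [simp]: "r \<ge> 0 \<Longrightarrow> positive (r *\<^sub>R 1)"
  by (simp add: positive_iff)

lemma positive_conj: "positive a \<Longrightarrow> positive (star b * a * b)"
  unfolding positive_def by (metis mult.assoc star_mult)

lemma positive_sqrt:
  assumes "positive a"
  obtains s where "positive s" "s * s = a" "\<forall>b. b * a = a * b \<longrightarrow> b * s = s * b"
  using assms that unfolding positive_iff by (rule pos_by_norm_sqrt) blast

lemma positive_commuting_mult:
  "positive a \<Longrightarrow> positive b \<Longrightarrow> a * b = b * a \<Longrightarrow> positive (a * b)"
  by (simp add: positive_iff pos_by_norm_commuting_mult)

lemma positive_lim: "(\<And>n. positive (f n)) \<Longrightarrow> f \<longlonglongrightarrow> a \<Longrightarrow> positive a"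
  unfolding positive_iff by (rule pos_by_norm_lim)

lemma positive_norm_minus: "star a = a \<Longrightarrow> positive (norm a *\<^sub>R 1 - a)"
  by (simp add: positive_iff pos_by_norm_norm_minus)

lemma positive_scaled_one_minus:
  assumes "star a = a" "norm a \<le> N" shows "positive (N *\<^sub>R 1 - a)"
proof -
  have "positive ((N - norm a) *\<^sub>R 1 + (norm a *\<^sub>R 1 - a))"
    using assms by (intro positive_add positive_norm_minus) auto
  then show ?thesis by (simp add: algebra_simps)
qed

lemma positive_antisym: "positive a \<Longrightarrow> positive (- a) \<Longrightarrow> a = 0"
  using norm_le_if_pos_by_norm[of a 0] by (simp add: positive_iff)

lemma norm_mono_positive:
  assumes "positive x" "positive (y - x)" shows "norm x \<le> norm y"
proof (rule norm_le_if_pos_by_norm)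
  have "positive y" using positive_add[OF assms] by simp
  then have "positive ((norm y *\<^sub>R 1 - y) + (y - x))"
    by (intro positive_add assms positive_norm_minus positive_selfadj)
  then show "pos_by_norm (norm y *\<^sub>R 1 - x)" by (simp add: positive_iff)
qed (use assms in \<open>auto simp: positive_iff\<close>)

lemma norm_le_if_positive_minus:
  assumes "positive x" "positive (N *\<^sub>R 1 - x)" "N \<ge> 0" shows "norm x \<le> N"
  using norm_le_if_pos_by_norm assms by (simp add: positive_iff)

lemma norm_le_if_between:
  fixes a :: "'a::cstar_algebra"
  assumes "positive (M *\<^sub>R 1 - a)" "positive (M *\<^sub>R 1 + a)" "M \<ge> 0"
  shows "norm a \<le> M"
proof -
  have "positive ((M *\<^sub>R 1 - a) * (M *\<^sub>R 1 + a))"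
    by (rule positive_commuting_mult[OF assms(1,2)]) (simp add: algebra_simps)
  then have p: "positive ((M * M) *\<^sub>R 1 - a * a)" by (simp add: algebra_simps)
  have sa: "star a = a"
    using positive_selfadj[OF assms(2)] by (simp add: star_add)
  have "positive (a * a)" using positive_star_mult[of a] sa by simp
  then have "norm (a * a) \<le> M * M" by (rule norm_le_if_positive_minus) (use p in auto)
  then have "(norm a)\<^sup>2 \<le> M\<^sup>2" using norm_selfadj_square[OF sa] by (simp add: power2_eq_square)
  then show ?thesis using assms(3) by (rule power2_le_imp_le)
qed

text \<open>
  Choosing \<open>a = (h + \<epsilon>)\<^bsup>-1/2\<^esup>\<close> turns the norm bound into the order bound \<open>y\<^sup>* y \<le> C (h + \<epsilon>)\<close>.
\<close>

lemma positive_of_norm_bound: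
  fixes h y :: "'a::cstar_algebra"
  assumes h: "positive h" and C: "C \<ge> 0"
    and b: "\<And>a. (norm (y * a))\<^sup>2 \<le> C * norm (star a * h * a)"
  shows "positive (C *\<^sub>R h - star y * y)"
proof -
  have e: "positive (C *\<^sub>R (e *\<^sub>R 1 + h) - star y * y)" if e: "e > 0" for e :: real
  proof -
    obtain v where v: "(e *\<^sub>R 1 + h) * v = 1" "v * (e *\<^sub>R 1 + h) = 1" "positive v"
      using h e unfolding positive_iff by (rule pos_by_norm_shift_invertible) blast
    obtain a where a: "positive a" "a * a = v" "\<forall>b. b * v = v * b \<longrightarrow> b * a = a * b"
      by (rule positive_sqrt[OF v(3)]) blast
    have sa: "star a = a" by (rule positive_selfadj[OF a(1)])
    define k where "k = e *\<^sub>R 1 + h"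
    have ka: "k * a = a * k" by (rule a(3)[rule_format]) (use v k_def in simp)
    have aka: "a * k * a = 1" using ka v a(2) by (metis k_def mult.assoc)
    have "star a * h * a = 1 - e *\<^sub>R (a * a)"
    proof -
      have "a * k * a = e *\<^sub>R (a * a) + a * h * a" by (simp add: k_def algebra_simps)
      then show ?thesis using aka sa by (simp add: algebra_simps)
    qed
    moreover have "positive (e *\<^sub>R (a * a))" using e v(3) a(2) by (simp add: positive_scaleR)
    ultimately have "norm (star a * h * a) \<le> 1"
      by (intro norm_le_if_positive_minus positive_conj h) auto
    then have "(norm (y * a))\<^sup>2 \<le> C"
      using b[of a] C by (meson mult_left_le order_trans)
    then have "norm (star (y * a) * (y * a)) \<le> C" by (simp add: cstar_identity)
    then have "positive (C *\<^sub>R 1 - star (y * a) * (y * a))"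
      by (intro positive_scaled_one_minus) (auto simp: star_mult star_star)
    \<comment> \<open>Conjugation with \<open>a * k\<close>, the inverse of \<open>a\<close>.\<close>
    then have "positive (star (a * k) * (C *\<^sub>R 1 - star (y * a) * (y * a)) * (a * k))"
      by (rule positive_conj)
    also have "star (a * k) * (C *\<^sub>R 1 - star (y * a) * (y * a)) * (a * k)
        = C *\<^sub>R (k * (a * a) * k) - (k * (a * a)) * star y * y * ((a * a) * k)"
    proof -
      have "star k = k" using positive_selfadj[OF h] by (simp add: k_def star_add)
      then show ?thesis by (simp add: star_mult sa algebra_simps)
    qed
    also have "\<dots> = C *\<^sub>R k - star y * y" using v by (simp add: k_def a(2))
    finally show ?thesis by (simp add: k_def)
  qed
  have "(\<lambda>n. C *\<^sub>R (inverse (real (Suc n)) *\<^sub>R 1 + h) - star y * y)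
      \<longlonglongrightarrow> C *\<^sub>R (0 *\<^sub>R 1 + h) - star y * y"
    by (intro tendsto_intros LIMSEQ_inverse_real_of_nat)
  then have "positive (C *\<^sub>R (0 *\<^sub>R 1 + h) - star y * y)"
    by (rule positive_lim[rotated]) (intro e, simp)
  then show ?thesis by simp
qed

lemma cartesian_decomposition:
  fixes a :: "'a::cstar_algebra"
  obtains b c where "star b = b" "star c = c" "a = b + \<i> *\<^sub>C c"
proof -
  let ?b = "(1/2) *\<^sub>R (a + star a)" and ?c = "(1/2) *\<^sub>R (\<i> *\<^sub>C (star a - a))"
  have i: "\<i> *\<^sub>C (1/2) *\<^sub>R (x::'a) = (1/2) *\<^sub>R \<i> *\<^sub>C x" for x
    by (metis (no_types) mult.commute scaleC_of_real scaleC_scaleC)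
  have "star ?b = ?b" "star ?c = ?c"
    by (simp_all add: star_add star_diff star_star star_scaleC scaleC_simps)
  moreover have "a = ?b + \<i> *\<^sub>C ?c"
    by (simp add: i scaleC_scaleC scaleC_minus1 scaleC_diff_right)
      (metis add_diff_cancel_left' add_diff_eq scaleR_add_right scaleR_half_double add.commute)
  ultimately show ?thesis by (rule that)
qed


section \<open>Continuous functions of a positive contraction\<close>

text \<open>
  For \<open>0 \<le> h \<le> 1\<close> this is the sum of \<open>f k *\<^sub>R (n choose k) *\<^sub>R h\<^sup>k (1 - h)\<^sup>n\<^sup>-\<^sup>k\<close>, the Bernstein
  operator of degree \<open>n\<close>. As \<open>n\<close> grows, its values at \<open>\<lambda>k. f (k/n)\<close> converge to \<open>f(h)\<close>
  for continuous \<open>f\<close>; the recursion makes the properties of these approximants inductive.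
\<close>

primrec bernstein_op :: "'a::cstar_algebra \<Rightarrow> nat \<Rightarrow> (nat \<Rightarrow> real) \<Rightarrow> 'a" where
  "bernstein_op h 0 f = f 0 *\<^sub>R 1"
| "bernstein_op h (Suc n) f = (1 - h) * bernstein_op h n f + h * bernstein_op h n (\<lambda>k. f (Suc k))"

lemma bernstein_op_commute: "h * bernstein_op h n f = bernstein_op h n f * h"
proof (induction n arbitrary: f)
  case (Suc n)
  have "h * ((1 - h) * bernstein_op h n f) = (1 - h) * bernstein_op h n f * h"
    using Suc[of f] by (simp add: left_diff_distrib right_diff_distrib) (metis mult.assoc)
  moreover have "h * (h * bernstein_op h n g) = h * bernstein_op h n g * h" for g
    using Suc[of g] by (simp add: mult.assoc) (metis mult.assoc)
  ultimately show ?case by (simp only: bernstein_op.simps distrib_left distrib_right)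
qed simp

lemma bernstein_op_add:
  "bernstein_op h n (\<lambda>k. f k + g k) = bernstein_op h n f + bernstein_op h n g"
  by (induction n arbitrary: f g) (simp_all add: algebra_simps)

lemma bernstein_op_scale: "bernstein_op h n (\<lambda>k. c * f k) = c *\<^sub>R bernstein_op h n f"
  by (induction n arbitrary: f) (simp_all add: algebra_simps)

lemma bernstein_op_diff:
  "bernstein_op h n (\<lambda>k. f k - g k) = bernstein_op h n f - bernstein_op h n g"
  using bernstein_op_add[of h n f "\<lambda>k. - 1 * g k"] bernstein_op_scale[of h n "- 1" g] by simp

lemma bernstein_op_const [simp]: "bernstein_op h n (\<lambda>k. c) = c *\<^sub>R 1"
  by (induction n) (simp_all add: algebra_simps)

lemma bernstein_op_cong:
  "(\<And>k. k \<le> n \<Longrightarrow> f k = g k) \<Longrightarrow> bernstein_op h n f = bernstein_op h n g"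
proof (induction n arbitrary: f g)
  case (Suc n)
  have "bernstein_op h n f = bernstein_op h n g" by (rule Suc.IH) (simp add: Suc.prems)
  moreover have "bernstein_op h n (\<lambda>k. f (Suc k)) = bernstein_op h n (\<lambda>k. g (Suc k))"
    by (rule Suc.IH) (simp add: Suc.prems)
  ultimately show ?case by simp
qed simp

lemma bernstein_op_mean: "bernstein_op h n real = real n *\<^sub>R h"
proof (induction n)
  case (Suc n)
  have "bernstein_op h n (\<lambda>k. real (Suc k)) = real n *\<^sub>R h + 1"
    using bernstein_op_add[of h n real "\<lambda>k. 1"] Suc by (simp add: add.commute)
  then show ?case using Suc by (simp add: algebra_simps)
qed simp

lemma bernstein_op_square:
  "bernstein_op h n (\<lambda>k. real k * real k) = real n *\<^sub>R h + (real n * (real n - 1)) *\<^sub>R (h * h)"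
proof (induction n)
  case (Suc n)
  have "bernstein_op h n (\<lambda>k. real (Suc k) * real (Suc k))
      = bernstein_op h n (\<lambda>k. real k * real k + (2 * real k + 1))"
    by (rule bernstein_op_cong) (simp add: algebra_simps)
  also have "\<dots> = real n *\<^sub>R h + (real n * (real n - 1)) *\<^sub>R (h * h) + (2 *\<^sub>R (real n *\<^sub>R h) + 1)"
    by (simp only: bernstein_op_add bernstein_op_scale bernstein_op_mean bernstein_op_const Suc scaleR_one)
  finally have *: "bernstein_op h n (\<lambda>k. real (Suc k) * real (Suc k))
      = real n *\<^sub>R h + (real n * (real n - 1)) *\<^sub>R (h * h) + (2 *\<^sub>R (real n *\<^sub>R h) + 1)" .
  define c where "c = real n * (real n - 1)"
  have two: "(2 * real n) *\<^sub>R (h * h) = real n *\<^sub>R (h * h) + real n *\<^sub>R (h * h)"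
    by (simp only: mult_2 scaleR_add_left)
  have "bernstein_op h (Suc n) (\<lambda>k. real k * real k) =
     (1 - h) * (real n *\<^sub>R h + (real n * (real n - 1)) *\<^sub>R (h * h))
     + h * (real n *\<^sub>R h + (real n * (real n - 1)) *\<^sub>R (h * h) + (2 *\<^sub>R (real n *\<^sub>R h) + 1))"
    by (simp only: bernstein_op.simps * Suc)
  also have "\<dots> = (real n *\<^sub>R h + h)
      + ((real n * (real n - 1)) *\<^sub>R (h * h) + (2 * real n) *\<^sub>R (h * h))"
    unfolding c_def[symmetric]
    by (simp add: distrib_left distrib_right left_diff_distrib right_diff_distrib scaleR_diff_right
        scaleR_add_right two)
  also have "\<dots> = (real n + 1) *\<^sub>R h + (real n * (real n - 1) + 2 * real n) *\<^sub>R (h * h)"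
    by (simp only: scaleR_left_distrib scaleR_one)
  also have "\<dots> = real (Suc n) *\<^sub>R h + (real (Suc n) * (real (Suc n) - 1)) *\<^sub>R (h * h)"
  proof -
    have "real n * (real n - 1) + 2 * real n = real (Suc n) * (real (Suc n) - 1)" "real n + 1 = real (Suc n)"
      by (simp_all add: algebra_simps)
    then show ?thesis by simp
  qed
  finally show ?case .
qed simp

locale positive_contraction =
  fixes h :: "'a::cstar_algebra"
  assumes h: "positive h" "positive (1 - h)"
begin

lemma commuting_convex_positive:
  assumes "positive a" "positive b" "h * a = a * h" "h * b = b * h"
  shows "positive ((1 - h) * a + h * b)"
  using assms h by (intro positive_add positive_commuting_mult) (auto simp: algebra_simps)

lemma bernstein_op_positive:
  "(\<And>k. k \<le> n \<Longrightarrow> f k \<ge> 0) \<Longrightarrow> positive (bernstein_op h n f)"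
proof (induction n arbitrary: f)
  case (Suc n)
  show ?case
    unfolding bernstein_op.simps
  proof (rule commuting_convex_positive)
    show "positive (bernstein_op h n f)" by (rule Suc.IH, rule Suc.prems) simp
    show "positive (bernstein_op h n (\<lambda>k. f (Suc k)))" by (rule Suc.IH, rule Suc.prems) simp
  qed (rule bernstein_op_commute)+
qed simp

lemma bernstein_op_bound:
  assumes "\<And>k. k \<le> n \<Longrightarrow> \<bar>f k\<bar> \<le> M"
  shows "norm (bernstein_op h n f) \<le> M"
proof (rule norm_le_if_between)
  have le: "- M \<le> f k \<and> f k \<le> M" if "k \<le> n" for k using assms[OF that] by (simp add: abs_le_iff)
  have "positive (bernstein_op h n (\<lambda>k. M - f k))" "positive (bernstein_op h n (\<lambda>k. M + f k))"
    by (rule bernstein_op_positive; use le in force)+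
  then show "positive (M *\<^sub>R 1 - bernstein_op h n f)" "positive (M *\<^sub>R 1 + bernstein_op h n f)"
    by (simp_all add: bernstein_op_add bernstein_op_diff)
  show "M \<ge> 0" using assms[of 0] by simp
qed

text \<open>
  The expression is the Bernstein average of \<open>(u k - h)\<^sup>2\<close>, and the average is a convex combination.
\<close>

lemma bernstein_op_variance:
  "positive (bernstein_op h n (\<lambda>k. u k * u k) - 2 *\<^sub>R (h * bernstein_op h n u) + h * h)"
proof (induction n arbitrary: u)
  case 0
  let ?c = "u 0 *\<^sub>R 1 - h"
  have "star ?c = ?c" using h by (simp add: star_diff positive_selfadj)
  then have "positive (?c * ?c)" using positive_star_mult[of ?c] by (simp only:)
  then show ?case by (simp add: algebra_simps scaleR_2) (simp add: mult.commute scaleR_2[symmetric])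
next
  case (Suc n)
  define V where "V u = bernstein_op h n (\<lambda>k. u k * u k) - 2 *\<^sub>R (h * bernstein_op h n u) + h * h"
    for u :: "nat \<Rightarrow> real"
  have c: "h * V u = V u * h" for u
    unfolding V_def by (simp add: algebra_simps bernstein_op_commute)
      (metis bernstein_op_commute mult.assoc)
  have "positive ((1 - h) * V u + h * V (\<lambda>k. u (Suc k)))"
    by (intro commuting_convex_positive c) (simp_all add: V_def Suc)
  also have "(1 - h) * V u + h * V (\<lambda>k. u (Suc k)) =
     bernstein_op h (Suc n) (\<lambda>k. u k * u k) - 2 *\<^sub>R (h * bernstein_op h (Suc n) u) + h * h"
    by (simp add: V_def algebra_simps)
  finally show ?case .
qed

text \<open>
  The variance inequality for \<open>u k = k/n - e * f k\<close>. Its quadratic terms are \<open>O(1/n)\<close> and its cross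
  term is \<open>2 e\<close> times the element to be estimated, so that \<open>e = 1 / sqrt n\<close> is the right balance.
\<close>

lemma bernstein_op_identity_aux:
  assumes n: "n \<ge> 1" and f: "\<And>k. k \<le> n \<Longrightarrow> \<bar>f k\<bar> \<le> 1"
  shows "positive ((1 / sqrt n) *\<^sub>R 1 - (bernstein_op h n (\<lambda>k. real k / n * f k) - h * bernstein_op h n f))"
proof -
  define y where "y = bernstein_op h n (\<lambda>k. real k / n * f k) - h * bernstein_op h n f"
  define e where "e = 1 / sqrt n"
  have e0: "e > 0" and ee: "e * e = 1 / n" using n by (simp_all add: e_def)
  define S where "S = bernstein_op h n (\<lambda>k. f k * f k)"
  have b1: "bernstein_op h n (\<lambda>k. real k / n) = h"
    using bernstein_op_scale[of h n "1/n" real] n by (simp add: bernstein_op_mean)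
  have b2: "bernstein_op h n (\<lambda>k. (real k / n) * (real k / n)) = (1/n) *\<^sub>R h + (1 - 1/n) *\<^sub>R (h * h)"
  proof -
    have "bernstein_op h n (\<lambda>k. (real k / n) * (real k / n))
        = bernstein_op h n (\<lambda>k. (1 / (real n * real n)) * (real k * real k))"
      by (rule bernstein_op_cong) simp
    also have "\<dots> = (1 / (real n * real n)) *\<^sub>R (real n *\<^sub>R h + (real n * (real n - 1)) *\<^sub>R (h * h))"
      by (simp only: bernstein_op_scale bernstein_op_square)
    also have "\<dots> = (1/n) *\<^sub>R h + (1 - 1/n) *\<^sub>R (h * h)"
    proof -
      have "1 / (real n * real n) * real n = 1/n" "1 / (real n * real n) * (real n * (real n - 1)) = 1 - 1/n"
        using n by (simp_all add: field_simps)
      then show ?thesis by (simp only: scaleR_add_right scaleR_scaleR)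
    qed
    finally show ?thesis .
  qed
  define u where "u k = real k / n - e * f k" for k
  have "bernstein_op h n (\<lambda>k. u k * u k)
      = bernstein_op h n (\<lambda>k. (real k / n) * (real k / n) - (2 * e) * (real k / n * f k) + (e * e) * (f k * f k))"
    by (rule bernstein_op_cong) (simp add: u_def algebra_simps)
  also have "\<dots> = (1/n) *\<^sub>R h + (1 - 1/n) *\<^sub>R (h * h)
      - (2 * e) *\<^sub>R bernstein_op h n (\<lambda>k. real k / n * f k) + (e * e) *\<^sub>R S"
    by (simp only: bernstein_op_add bernstein_op_diff bernstein_op_scale b2 S_def)
  finally have uu: "bernstein_op h n (\<lambda>k. u k * u k) = \<dots>" .
  have u1: "bernstein_op h n u = h - e *\<^sub>R bernstein_op h n f"
    unfolding u_def by (simp only: bernstein_op_diff bernstein_op_scale b1)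
  have "positive (bernstein_op h n (\<lambda>k. u k * u k) - 2 *\<^sub>R (h * bernstein_op h n u) + h * h)"
    by (rule bernstein_op_variance)
  also have "bernstein_op h n (\<lambda>k. u k * u k) - 2 *\<^sub>R (h * bernstein_op h n u) + h * h
      = (1/n) *\<^sub>R (h - h * h) - (2 * e) *\<^sub>R y + (1/n) *\<^sub>R S"
    unfolding uu u1 y_def ee by (simp add: algebra_simps scaleR_2)
  finally have 1: "positive ((1/n) *\<^sub>R (h - h * h) - (2 * e) *\<^sub>R y + (1/n) *\<^sub>R S)" .
  have 2: "positive ((1/n) *\<^sub>R (1 - S))"
  proof (rule positive_scaleR)
    have "positive (bernstein_op h n (\<lambda>k. 1 - f k * f k))"
    proof (rule bernstein_op_positive)
      fix k assume "k \<le> n"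
      then have "(f k)\<^sup>2 \<le> 1" using f[of k] by (simp add: abs_square_le_1)
      then show "0 \<le> 1 - f k * f k" by (simp add: power2_eq_square)
    qed
    then show "positive (1 - S)" by (simp add: bernstein_op_diff S_def)
  qed simp
  have sh: "star h = h" by (rule positive_selfadj[OF h(1)])
  have "positive (h * h)" using positive_star_mult[of h] sh by simp
  then have "positive ((1 - h) + h * h)" by (intro positive_add h)
  then have 3: "positive ((1/n) *\<^sub>R ((1 - h) + h * h))" by (rule positive_scaleR) simp
  have "positive ((sqrt n / 2) *\<^sub>R (((1/n) *\<^sub>R (h - h * h) - (2 * e) *\<^sub>R y + (1/n) *\<^sub>R S)
      + (1/n) *\<^sub>R (1 - S) + (1/n) *\<^sub>R ((1 - h) + h * h)))"
    by (intro positive_scaleR positive_add 1 2 3) simp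
  also have "((1/n) *\<^sub>R (h - h * h) - (2 * e) *\<^sub>R y + (1/n) *\<^sub>R S)
      + (1/n) *\<^sub>R (1 - S) + (1/n) *\<^sub>R ((1 - h) + h * h) = (2/n) *\<^sub>R 1 - (2 * e) *\<^sub>R y"
    by (simp add: algebra_simps scaleR_2[symmetric])
  also have "(sqrt n / 2) *\<^sub>R ((2/n) *\<^sub>R 1 - (2 * e) *\<^sub>R y) = (1 / sqrt n) *\<^sub>R 1 - y"
  proof -
    have "sqrt n / 2 * (2/n) = 1 / sqrt n" "sqrt n / 2 * (2 * e) = 1"
      using n by (simp_all add: e_def real_div_sqrt divide_simps)
    then show ?thesis by (simp only: scaleR_diff_right scaleR_scaleR scaleR_one)
  qed
  finally show ?thesis by (simp add: y_def)
qed

lemma bernstein_op_identity: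
  assumes n: "n \<ge> 1" and f: "\<And>k. k \<le> n \<Longrightarrow> \<bar>f k\<bar> \<le> 1"
  shows "norm (bernstein_op h n (\<lambda>k. real k / n * f k) - h * bernstein_op h n f) \<le> 1 / sqrt n"
proof (rule norm_le_if_between)
  show "positive ((1 / sqrt n) *\<^sub>R 1 - (bernstein_op h n (\<lambda>k. real k / n * f k) - h * bernstein_op h n f))"
    by (rule bernstein_op_identity_aux[OF n f])
  have "positive ((1 / sqrt n) *\<^sub>R 1 - (bernstein_op h n (\<lambda>k. real k / n * (- 1 * f k)) - h * bernstein_op h n (\<lambda>k. - 1 * f k)))"
    by (rule bernstein_op_identity_aux[OF n]) (simp add: f)
  also have "bernstein_op h n (\<lambda>k. real k / n * (- 1 * f k)) = bernstein_op h n (\<lambda>k. - 1 * (real k / n * f k))"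
    by (rule bernstein_op_cong) simp
  also have "bernstein_op h n (\<lambda>k. - 1 * (real k / n * f k)) = - bernstein_op h n (\<lambda>k. real k / n * f k)"
    using bernstein_op_scale[of h n "- 1" "\<lambda>k. real k / n * f k"] by simp
  also have "bernstein_op h n (\<lambda>k. - 1 * f k) = - bernstein_op h n f"
    using bernstein_op_scale[of h n "- 1" f] by simp
  finally show "positive ((1 / sqrt n) *\<^sub>R 1 + (bernstein_op h n (\<lambda>k. real k / n * f k) - h * bernstein_op h n f))"
    by (simp add: algebra_simps)
qed simp

text \<open>
  The element \<open>a\<close> is \<open>f(h)\<close>. Uniformity over the multipliers \<open>g\<close> is what makes the relation
  multiplicative.
\<close>

definition functional_calculus :: "(real \<Rightarrow> real) \<Rightarrow> 'a \<Rightarrow> bool" where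
  "functional_calculus f a \<longleftrightarrow> (\<forall>e>0. \<exists>N. \<forall>n\<ge>N. \<forall>g. (\<forall>k\<le>n. \<bar>g k\<bar> \<le> 1) \<longrightarrow>
     norm (bernstein_op h n (\<lambda>k. f (k / n) * g k) - a * bernstein_op h n g) \<le> e)"

lemma functional_calculusD:
  assumes "functional_calculus f a" "e > 0"
  shows "\<exists>N. \<forall>n\<ge>N. \<forall>g. (\<forall>k\<le>n. \<bar>g k\<bar> \<le> 1) \<longrightarrow>
     norm (bernstein_op h n (\<lambda>k. f (k / n) * g k) - a * bernstein_op h n g) \<le> e"
  using assms by (simp add: functional_calculus_def)

lemma functional_calculus_tendsto:
  assumes "functional_calculus f a"
  shows "(\<lambda>n. bernstein_op h n (\<lambda>k. f (k / n))) \<longlonglongrightarrow> a"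
proof (rule LIMSEQ_I)
  fix e :: real assume "e > 0"
  then obtain N where N: "\<forall>n\<ge>N. \<forall>g. (\<forall>k\<le>n. \<bar>g k\<bar> \<le> 1) \<longrightarrow>
     norm (bernstein_op h n (\<lambda>k. f (k / n) * g k) - a * bernstein_op h n g) \<le> e / 2"
    using functional_calculusD[OF assms, of "e / 2"] by auto
  have "norm (bernstein_op h n (\<lambda>k. f (k / n)) - a) < e" if "n \<ge> N" for n
    using N[rule_format, OF that, of "\<lambda>k. 1"] \<open>e > 0\<close> by simp
  then show "\<exists>no. \<forall>n\<ge>no. norm (bernstein_op h n (\<lambda>k. f (k / n)) - a) < e" by blast
qed

lemma functional_calculus_cong_unique:
  assumes "functional_calculus f a" "functional_calculus f' a'" "\<And>x. x \<in> {0..1} \<Longrightarrow> f x = f' x"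
  shows "a = a'"
proof -
  have "bernstein_op h n (\<lambda>k. f (k / n)) = bernstein_op h n (\<lambda>k. f' (k / n))" for n
    by (rule bernstein_op_cong, rule assms(3)) (auto simp: divide_simps)
  then have "(\<lambda>n. bernstein_op h n (\<lambda>k. f (k / n))) \<longlonglongrightarrow> a'"
    using functional_calculus_tendsto[OF assms(2)] by (simp only:)
  with functional_calculus_tendsto[OF assms(1)] show ?thesis by (rule LIMSEQ_unique)
qed

lemma functional_calculus_positive:
  assumes "functional_calculus f a" "\<And>x. x \<in> {0..1} \<Longrightarrow> f x \<ge> 0"
  shows "positive a"
  by (rule positive_lim[OF _ functional_calculus_tendsto[OF assms(1)]], rule bernstein_op_positive,
      rule assms(2)) (auto simp: divide_simps)

lemma functional_calculus_norm:
  assumes "functional_calculus f a" "\<And>x. x \<in> {0..1} \<Longrightarrow> \<bar>f x\<bar> \<le> M"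
  shows "norm a \<le> M"
proof (rule LIMSEQ_le_const2[OF tendsto_norm[OF functional_calculus_tendsto[OF assms(1)]]])
  show "\<exists>N. \<forall>n\<ge>N. norm (bernstein_op h n (\<lambda>k. f (k / n))) \<le> M"
    by (intro exI allI impI bernstein_op_bound assms(2)) (auto simp: divide_simps)
qed

lemma functional_calculus_const: "functional_calculus (\<lambda>x. c) (c *\<^sub>R 1)"
  unfolding functional_calculus_def by (simp add: bernstein_op_scale)

lemma functional_calculus_ident: "functional_calculus (\<lambda>x. x) h"
  unfolding functional_calculus_def
proof (intro allI impI)
  fix e :: real assume e: "e > 0"
  obtain N :: nat where N: "N > (1 / e)\<^sup>2" using reals_Archimedean2 by blast
  have "norm (bernstein_op h n (\<lambda>k. real k / n * g k) - h * bernstein_op h n g) \<le> e"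
    if n: "n \<ge> Suc N" and g: "\<forall>k\<le>n. \<bar>g k\<bar> \<le> 1" for n g
  proof -
    have "norm (bernstein_op h n (\<lambda>k. real k / n * g k) - h * bernstein_op h n g) \<le> 1 / sqrt n"
      by (rule bernstein_op_identity) (use n g in auto)
    also have "\<dots> \<le> e"
    proof -
      have "(1 / e)\<^sup>2 \<le> real n" using N n by linarith
      then have "1 / e \<le> sqrt n" by (rule real_le_rsqrt)
      then show ?thesis using e n by (simp add: field_simps)
    qed
    finally show ?thesis .
  qed
  then show "\<exists>N. \<forall>n\<ge>N. \<forall>g. (\<forall>k\<le>n. \<bar>g k\<bar> \<le> 1) \<longrightarrow>
      norm (bernstein_op h n (\<lambda>k. real k / real n * g k) - h * bernstein_op h n g) \<le> e"
    by (intro exI[of _ "Suc N"]) blast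
qed

lemma functional_calculus_add:
  assumes "functional_calculus f a" "functional_calculus f' a'"
  shows "functional_calculus (\<lambda>x. f x + f' x) (a + a')"
  unfolding functional_calculus_def
proof (intro allI impI)
  fix e :: real assume e: "e > 0"
  then have e2: "e / 2 > 0" by simp
  obtain N where N: "\<forall>n\<ge>N. \<forall>g. (\<forall>k\<le>n. \<bar>g k\<bar> \<le> 1) \<longrightarrow>
     norm (bernstein_op h n (\<lambda>k. f (k / n) * g k) - a * bernstein_op h n g) \<le> e / 2"
    using functional_calculusD[OF assms(1) e2] by blast
  obtain N' where N': "\<forall>n\<ge>N'. \<forall>g. (\<forall>k\<le>n. \<bar>g k\<bar> \<le> 1) \<longrightarrow>
     norm (bernstein_op h n (\<lambda>k. f' (k / n) * g k) - a' * bernstein_op h n g) \<le> e / 2"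
    using functional_calculusD[OF assms(2) e2] by blast
  have "norm (bernstein_op h n (\<lambda>k. (f (k / n) + f' (k / n)) * g k) - (a + a') * bernstein_op h n g) \<le> e"
    if n: "n \<ge> max N N'" and g: "\<forall>k\<le>n. \<bar>g k\<bar> \<le> 1" for n g
  proof -
    have eq: "bernstein_op h n (\<lambda>k. (f (k / n) + f' (k / n)) * g k) - (a + a') * bernstein_op h n g
      = (bernstein_op h n (\<lambda>k. f (k / n) * g k) - a * bernstein_op h n g)
      + (bernstein_op h n (\<lambda>k. f' (k / n) * g k) - a' * bernstein_op h n g)"
      by (simp add: distrib_right bernstein_op_add)
    show ?thesis
      unfolding eq using N[rule_format, of n g] N'[rule_format, of n g] n g by (intro norm_triangle_le) auto
  qed
  then show "\<exists>N. \<forall>n\<ge>N. \<forall>g. (\<forall>k\<le>n. \<bar>g k\<bar> \<le> 1) \<longrightarrow>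
      norm (bernstein_op h n (\<lambda>k. (f (k / n) + f' (k / n)) * g k) - (a + a') * bernstein_op h n g) \<le> e"
    by (intro exI[of _ "max N N'"]) blast
qed

lemma functional_calculus_mult:
  assumes "functional_calculus f a" "functional_calculus f' a'" and M: "\<And>x. x \<in> {0..1} \<Longrightarrow> \<bar>f' x\<bar> \<le> M"
  shows "functional_calculus (\<lambda>x. f x * f' x) (a * a')"
  unfolding functional_calculus_def
proof (intro allI impI)
  fix e :: real assume e: "e > 0"
  define M' where "M' = M + 1"
  have "M \<ge> 0" using M[of 0] by simp
  then have M'0: "M' > 0" by (simp add: M'_def)
  define A where "A = norm a + 1"
  have A0: "A > 0" by (simp add: A_def add_nonneg_pos)
  obtain N where N: "\<forall>n\<ge>N. \<forall>g. (\<forall>k\<le>n. \<bar>g k\<bar> \<le> 1) \<longrightarrow>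
     norm (bernstein_op h n (\<lambda>k. f (k / n) * g k) - a * bernstein_op h n g) \<le> e / (2 * M')"
    using functional_calculusD[OF assms(1), of "e / (2 * M')"] e M'0 by auto
  obtain N' where N': "\<forall>n\<ge>N'. \<forall>g. (\<forall>k\<le>n. \<bar>g k\<bar> \<le> 1) \<longrightarrow>
     norm (bernstein_op h n (\<lambda>k. f' (k / n) * g k) - a' * bernstein_op h n g) \<le> e / (2 * A)"
    using functional_calculusD[OF assms(2), of "e / (2 * A)"] e A0 by auto
  have "norm (bernstein_op h n (\<lambda>k. (f (k / n) * f' (k / n)) * g k) - (a * a') * bernstein_op h n g) \<le> e"
    if n: "n \<ge> max N N'" and g: "\<forall>k\<le>n. \<bar>g k\<bar> \<le> 1" for n g
  proof -
    define g' where "g' k = f' (k / n) * g k" for k :: nat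
    define g'' where "g'' k = inverse M' * g' k" for k :: nat
    have g'': "\<bar>g'' k\<bar> \<le> 1" if k: "k \<le> n" for k
    proof -
      have "\<bar>f' (k / n)\<bar> \<le> M" by (rule M) (use k in \<open>auto simp: divide_simps\<close>)
      then have "\<bar>f' (k / n)\<bar> * \<bar>g k\<bar> \<le> M * 1"
        using g k \<open>M \<ge> 0\<close> by (intro mult_mono) auto
      then have "\<bar>f' (k / n)\<bar> * \<bar>g k\<bar> \<le> M'" by (simp add: M'_def)
      then show ?thesis using M'0 by (simp add: g''_def g'_def abs_mult field_simps)
    qed
    have s1: "bernstein_op h n (\<lambda>k. (f (k / n) * f' (k / n)) * g k)
        = M' *\<^sub>R bernstein_op h n (\<lambda>k. f (k / n) * g'' k)"
      unfolding bernstein_op_scale[symmetric]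
      by (rule bernstein_op_cong) (use M'0 in \<open>simp add: g''_def g'_def\<close>)
    have s2: "bernstein_op h n g' = M' *\<^sub>R bernstein_op h n g''"
      unfolding bernstein_op_scale[symmetric]
      by (rule bernstein_op_cong) (use M'0 in \<open>simp add: g''_def\<close>)
    have "bernstein_op h n (\<lambda>k. (f (k / n) * f' (k / n)) * g k) - (a * a') * bernstein_op h n g
       = M' *\<^sub>R (bernstein_op h n (\<lambda>k. f (k / n) * g'' k) - a * bernstein_op h n g'')
        + a * (bernstein_op h n g' - a' * bernstein_op h n g)"
      unfolding s1 s2 by (simp add: algebra_simps)
    also have "norm \<dots> \<le> M' * (e / (2 * M')) + norm a * (e / (2 * A))"
    proof (rule norm_triangle_le, rule add_mono)
      have "norm (bernstein_op h n (\<lambda>k. f (k / n) * g'' k) - a * bernstein_op h n g'') \<le> e / (2 * M')"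
        by (rule N[rule_format]) (use n g'' in auto)
      then show "norm (M' *\<^sub>R (bernstein_op h n (\<lambda>k. f (k / n) * g'' k) - a * bernstein_op h n g''))
         \<le> M' * (e / (2 * M'))"
        unfolding norm_scaleR using M'0 by (intro mult_mono) auto
      have "norm (bernstein_op h n g' - a' * bernstein_op h n g) \<le> e / (2 * A)"
        unfolding g'_def by (rule N'[rule_format]) (use n g in auto)
      then show "norm (a * (bernstein_op h n g' - a' * bernstein_op h n g)) \<le> norm a * (e / (2 * A))"
        by (intro order_trans[OF norm_mult_ineq] mult_left_mono) auto
    qed
    also have "\<dots> \<le> M' * (e / (2 * M')) + A * (e / (2 * A))"
      using e A0 by (intro add_left_mono mult_right_mono) (auto simp: A_def)
    also have "\<dots> = e" using M'0 A0 by simp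
    finally show ?thesis .
  qed
  then show "\<exists>N. \<forall>n\<ge>N. \<forall>g. (\<forall>k\<le>n. \<bar>g k\<bar> \<le> 1) \<longrightarrow>
      norm (bernstein_op h n (\<lambda>k. (f (k / n) * f' (k / n)) * g k) - (a * a') * bernstein_op h n g) \<le> e"
    by (intro exI[of _ "max N N'"]) blast
qed

lemma functional_calculus_diff:
  assumes "functional_calculus f a" "functional_calculus f' a'"
  shows "functional_calculus (\<lambda>x. f x - f' x) (a - a')"
proof -
  have "functional_calculus (\<lambda>x. f' x * (- 1)) (a' * ((- 1) *\<^sub>R 1))"
    by (rule functional_calculus_mult[OF assms(2) functional_calculus_const, of _ 1]) simp
  from functional_calculus_add[OF assms(1) this] show ?thesis by simp
qed

lemma functional_calculus_polynomial:
  "real_polynomial_function p \<Longrightarrow> (\<exists>a. functional_calculus p a) \<and> (\<exists>M. \<forall>x\<in>{0..1}. \<bar>p x\<bar> \<le> M)"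
proof (induction rule: real_polynomial_function.induct)
  case (linear f)
  define c where "c = f 1"
  have f: "f x = c * x" for x
    using linear_scale[OF bounded_linear.linear[OF linear], of x 1] by (simp add: c_def)
  have "functional_calculus (\<lambda>x. c * x) (c *\<^sub>R 1 * h)"
    by (rule functional_calculus_mult[OF functional_calculus_const functional_calculus_ident, of 1]) auto
  moreover have "\<bar>c * x\<bar> \<le> \<bar>c\<bar>" if "x \<in> {0..1}" for x
    using that by (auto simp: abs_mult mult_left_le)
  moreover have "f = (\<lambda>x. c * x)" using f by blast
  ultimately show ?case by blast
next
  case (const c)
  then show ?case using functional_calculus_const by blast
next
  case (add f g)
  then obtain a b M M' where *: "functional_calculus f a" "functional_calculus g b"
    "\<forall>x\<in>{0..1}. \<bar>f x\<bar> \<le> M" "\<forall>x\<in>{0..1}. \<bar>g x\<bar> \<le> M'" by auto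
  have "\<bar>f x + g x\<bar> \<le> M + M'" if "x \<in> {0..1}" for x
    using *(3,4) that abs_triangle_ineq[of "f x" "g x"] by fastforce
  then show ?case using functional_calculus_add[OF *(1,2)] by blast
next
  case (mult f g)
  then obtain a b M M' where *: "functional_calculus f a" "functional_calculus g b"
    "\<forall>x\<in>{0..1}. \<bar>f x\<bar> \<le> M" "\<forall>x\<in>{0..1}. \<bar>g x\<bar> \<le> M'" by auto
  have "\<bar>f x * g x\<bar> \<le> M * M'" if "x \<in> {0..1}" for x
    unfolding abs_mult using *(3,4) that by (intro mult_mono) (auto intro: order_trans[OF abs_ge_zero])
  then show ?case using functional_calculus_mult[OF *(1,2), of M'] *(4) by blast
qed

text \<open>Polynomial approximation extends the calculus to continuous functions.\<close>

lemma functional_calculus_continuous: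
  assumes f: "continuous_on {0..1} f"
  obtains a where "functional_calculus f a"
proof -
  have "\<exists>p a. (\<forall>x\<in>{0..1}. \<bar>f x - p x\<bar> < inverse (real (Suc m))) \<and> functional_calculus p a" for m
  proof -
    obtain p where "real_polynomial_function p" "\<And>x. x \<in> {0..1} \<Longrightarrow> \<bar>f x - p x\<bar> < inverse (real (Suc m))"
      by (rule Stone_Weierstrass_real_polynomial_function[OF compact_Icc f, of "inverse (real (Suc m))"]) auto
    then show ?thesis using functional_calculus_polynomial[of p] by blast
  qed
  then obtain p a where p: "\<And>m x. x \<in> {0..1} \<Longrightarrow> \<bar>f x - p m x\<bar> < inverse (real (Suc m))"
    and a: "\<And>m. functional_calculus (p m) (a m)" by metis
  have "Cauchy a"
  proof (rule CauchyI)
    fix e :: real assume e: "e > 0"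
    obtain M where M: "inverse (real (Suc M)) < e / 3" using reals_Archimedean[of "e / 3"] e by auto
    have "norm (a m - a n) < e" if mn: "m \<ge> M" "n \<ge> M" for m n
    proof -
      have "norm (a m - a n) \<le> 2 * e / 3"
      proof (rule functional_calculus_norm[OF functional_calculus_diff[OF a a]])
        fix x :: real assume x: "x \<in> {0..1}"
        have "inverse (real (Suc m)) \<le> inverse (real (Suc M))" "inverse (real (Suc n)) \<le> inverse (real (Suc M))"
          using mn by auto
        then show "\<bar>p m x - p n x\<bar> \<le> 2 * e / 3" using p[OF x, of m] p[OF x, of n] M by linarith
      qed
      then show ?thesis using e by linarith
    qed
    then show "\<exists>M. \<forall>m\<ge>M. \<forall>n\<ge>M. norm (a m - a n) < e" by blast
  qed
  then obtain b where b: "a \<longlonglongrightarrow> b" using Cauchy_convergent convergent_def by blast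
  have "functional_calculus f b"
    unfolding functional_calculus_def
  proof (intro allI impI)
    fix e :: real assume e: "e > 0"
    then have e3: "e / 3 > 0" by simp
    obtain M1 where M1: "inverse (real (Suc M1)) < e / 3" using reals_Archimedean[OF e3] by auto
    obtain M2 where M2: "\<And>m. m \<ge> M2 \<Longrightarrow> norm (a m - b) < e / 3" using LIMSEQ_D[OF b e3] by blast
    define m where "m = max M1 M2"
    have "inverse (real (Suc m)) \<le> inverse (real (Suc M1))" by (auto simp: m_def)
    then have m1: "inverse (real (Suc m)) < e / 3" using M1 by linarith
    obtain N where N: "\<forall>n\<ge>N. \<forall>g. (\<forall>k\<le>n. \<bar>g k\<bar> \<le> 1) \<longrightarrow>
       norm (bernstein_op h n (\<lambda>k. p m (k / n) * g k) - a m * bernstein_op h n g) \<le> e / 3"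
      using functional_calculusD[OF a e3] by blast
    have "norm (bernstein_op h n (\<lambda>k. f (k / n) * g k) - b * bernstein_op h n g) \<le> e"
      if n: "n \<ge> N" and g: "\<forall>k\<le>n. \<bar>g k\<bar> \<le> 1" for n g
    proof -
      have "norm (bernstein_op h n (\<lambda>k. f (k / n) * g k - p m (k / n) * g k)) \<le> e / 3"
      proof (rule bernstein_op_bound)
        fix k assume k: "k \<le> n"
        have "real k / real n \<in> {0..1}" using k by (auto simp: divide_simps)
        then have "\<bar>f (k / n) - p m (k / n)\<bar> < e / 3"
          using p[of "k / n" m] m1 by linarith
        then have "\<bar>f (k / n) - p m (k / n)\<bar> * \<bar>g k\<bar> \<le> e / 3 * 1"
          using g k e by (intro mult_mono) auto
        then show "\<bar>f (k / n) * g k - p m (k / n) * g k\<bar> \<le> e / 3"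
          by (simp add: abs_mult[symmetric] left_diff_distrib)
      qed
      moreover have "norm (bernstein_op h n (\<lambda>k. p m (k / n) * g k) - a m * bernstein_op h n g) \<le> e / 3"
        by (rule N[rule_format]) (use n g in auto)
      moreover have "norm ((a m - b) * bernstein_op h n g) \<le> e / 3 * 1"
        using M2[of m] bernstein_op_bound[of n g 1] g e
        by (intro order_trans[OF norm_mult_ineq] mult_mono) (auto simp: m_def intro: less_imp_le)
      moreover have "norm (x + y + z) \<le> e"
        if "norm x \<le> e / 3" "norm y \<le> e / 3" "norm z \<le> e / 3 * 1" for x y z :: 'a
        using that norm_triangle_ineq[of "x + y" z] norm_triangle_ineq[of x y] by linarith
      ultimately have "norm (bernstein_op h n (\<lambda>k. f (k / n) * g k - p m (k / n) * g k)
         + (bernstein_op h n (\<lambda>k. p m (k / n) * g k) - a m * bernstein_op h n g)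
         + (a m - b) * bernstein_op h n g) \<le> e" by blast
      then show ?thesis by (simp add: bernstein_op_diff algebra_simps)
    qed
    then show "\<exists>N. \<forall>n\<ge>N. \<forall>g. (\<forall>k\<le>n. \<bar>g k\<bar> \<le> 1) \<longrightarrow>
        norm (bernstein_op h n (\<lambda>k. f (k / n) * g k) - b * bernstein_op h n g) \<le> e"
      by (intro exI[of _ N]) blast
  qed
  then show ?thesis by (rule that)
qed

end


section \<open>Norm one projections are module maps\<close>

lemma bounded_family_const: "bounded (range (\<lambda>i. a :: 'a::real_normed_vector))"
  by (auto simp: bounded_iff)

lemma bounded_family_add:
  "bounded (range x) \<Longrightarrow> bounded (range y) \<Longrightarrow> bounded (range (\<lambda>i. x i + y i :: 'a::real_normed_vector))"
  by (simp add: bounded_plus_comp)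

lemma bounded_family_mult:
  fixes a :: "'a::real_normed_algebra"
  assumes "bounded (range x)" shows "bounded (range (\<lambda>i. a * x i))"
proof -
  obtain M where "\<And>i. norm (x i) \<le> M" using assms by (auto simp: bounded_iff)
  then have "norm (a * x i) \<le> norm a * M" for i
    by (intro order_trans[OF norm_mult_ineq] mult_left_mono) auto
  then show ?thesis by (auto simp: bounded_iff)
qed

text \<open>
  A contraction of the bounded families in an algebra onto the constant families. Weak*
  limits along an ultrafilter are of this form.
\<close>

locale norm_one_projection =
  fixes E :: "('i \<Rightarrow> 'a::cstar_algebra) \<Rightarrow> 'a"
  assumes E_add: "bounded (range x) \<Longrightarrow> bounded (range y) \<Longrightarrow> E (\<lambda>i. x i + y i) = E x + E y"
    and E_scaleC: "bounded (range x) \<Longrightarrow> E (\<lambda>i. c *\<^sub>C x i) = c *\<^sub>C E x"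
    and E_norm: "(\<And>i. norm (x i) \<le> M) \<Longrightarrow> norm (E x) \<le> M"
    and E_const: "E (\<lambda>i. a) = a"
begin

lemma E_scaleR: "bounded (range x) \<Longrightarrow> E (\<lambda>i. r *\<^sub>R x i) = r *\<^sub>R E x"
  using E_scaleC[of x "complex_of_real r"] by (simp add: scaleC_of_real)

lemma E_minus: "bounded (range x) \<Longrightarrow> E (\<lambda>i. - x i) = - E x"
  using E_scaleR[of x "- 1"] by simp

lemma E_diff:
  assumes "bounded (range x)" "bounded (range y)" shows "E (\<lambda>i. x i - y i) = E x - E y"
proof -
  have "bounded (range (\<lambda>i. - y i))" using assms(2) by (simp add: bounded_iff)
  from E_add[OF assms(1) this] show ?thesis using E_minus[OF assms(2)] by simp
qed

lemma E_sum:
  assumes "finite J" "\<And>j. j \<in> J \<Longrightarrow> bounded (range (y j))"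
  shows "E (\<lambda>i. \<Sum>j\<in>J. y j i) = (\<Sum>j\<in>J. E (y j)) \<and> bounded (range (\<lambda>i. \<Sum>j\<in>J. y j i))"
  using assms
proof (induction J rule: finite_induct)
  case empty
  have "range (\<lambda>i::'i. 0::'a) \<subseteq> {0}" by auto
  then show ?case using E_const[of 0] by (simp add: bounded_subset[OF bounded_insert[THEN iffD2]])
next
  case (insert j J)
  then show ?case by (simp add: E_add bounded_family_add)
qed

text \<open>
  For \<open>z = p E(q x)\<close>, Pythagoras bounds the square of the norm of \<open>q x + t z\<close> by
  \<open>N\<^sup>2 + t\<^sup>2 (norm z)\<^sup>2\<close>, where \<open>N\<close> bounds \<open>q x\<close>, since \<open>z\<^sup>* q x = 0\<close>. The projection maps this family to
  \<open>(1 + t p) E(q x)\<close>, where the square of the norm is at least \<open>(2 t / norm p + t\<^sup>2) (norm z)\<^sup>2\<close>.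
  For large \<open>t\<close> this forces \<open>z = 0\<close>.
\<close>

lemma E_orthogonal:
  assumes p: "positive p" and pq: "p * q = 0" and x: "bounded (range x)"
  shows "p * E (\<lambda>i. q * x i) = 0"
proof (rule ccontr)
  define w where "w = E (\<lambda>i. q * x i)"
  define z where "z = p * w"
  assume "p * E (\<lambda>i. q * x i) \<noteq> 0"
  then have z: "z \<noteq> 0" by (simp add: z_def w_def)
  then have "p \<noteq> 0" by (auto simp: z_def)
  define c where "c = norm p"
  have c: "c > 0" using \<open>p \<noteq> 0\<close> by (simp add: c_def)
  have sp: "star p = p" by (rule positive_selfadj[OF p])
  have bq: "bounded (range (\<lambda>i. q * x i))" by (rule bounded_family_mult[OF x])
  then obtain N where N: "\<And>i. norm (q * x i) \<le> N" by (auto simp: bounded_iff)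
  have N0: "N \<ge> 0" using N order_trans[OF norm_ge_zero] by blast
  have zq: "star z * (q * x i) = 0" for i
  proof -
    have "star z * (q * x i) = star w * ((p * q) * x i)" by (simp add: z_def star_mult sp mult.assoc)
    then show ?thesis by (simp add: pq)
  qed
  have qz: "star (q * x i) * z = 0" for i
    using arg_cong[OF zq[of i], of star] by (simp add: star_mult star_star)
  have bound: "(2 * t / c) * (norm z)\<^sup>2 \<le> N\<^sup>2" if t: "t > 0" for t
  proof -
    define M where "M = sqrt (N\<^sup>2 + t\<^sup>2 * (norm z)\<^sup>2)"
    have "norm (q * x i + t *\<^sub>R z) \<le> M" for i
    proof -
      have "star (q * x i + t *\<^sub>R z) * (q * x i + t *\<^sub>R z)
          = star (q * x i) * (q * x i) + (t * t) *\<^sub>R (star z * z)"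
        by (simp only: star_add star_scaleR distrib_left distrib_right mult_scaleR_left mult_scaleR_right
            zq qz) simp
      then have "(norm (q * x i + t *\<^sub>R z))\<^sup>2 \<le> norm (star (q * x i) * (q * x i)) + norm ((t * t) *\<^sub>R (star z * z))"
        by (metis cstar_identity norm_triangle_ineq)
      also have "\<dots> \<le> N\<^sup>2 + t\<^sup>2 * (norm z)\<^sup>2"
        using N[of i] by (simp add: cstar_identity power2_eq_square[of t] power_mono)
      finally show ?thesis unfolding M_def by (rule real_le_rsqrt)
    qed
    then have "norm (E (\<lambda>i. q * x i + t *\<^sub>R z)) \<le> M" by (rule E_norm)
    moreover have "E (\<lambda>i. q * x i + t *\<^sub>R z) = w + t *\<^sub>R z"
      using E_add[OF bq bounded_family_const, of "t *\<^sub>R z"] E_const[of "t *\<^sub>R z"] by (simp add: w_def)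
    moreover have "w + t *\<^sub>R z = (1 + t *\<^sub>R p) * w" by (simp add: z_def distrib_right)
    ultimately have "(norm ((1 + t *\<^sub>R p) * w))\<^sup>2 \<le> M\<^sup>2" by (simp add: power_mono)
    then have up: "norm (star ((1 + t *\<^sub>R p) * w) * ((1 + t *\<^sub>R p) * w)) \<le> N\<^sup>2 + t\<^sup>2 * (norm z)\<^sup>2"
      using N0 by (simp add: cstar_identity M_def)
    define r where "r = 2 * t / c + t * t"
    have "positive ((2 * t / c) *\<^sub>R (p * (c *\<^sub>R 1 - p)) + 1)"
      using t c p sp by (intro positive_add positive_scaleR positive_commuting_mult)
        (auto simp: c_def positive_norm_minus algebra_simps)
    also have "(2 * t / c) *\<^sub>R (p * (c *\<^sub>R 1 - p)) + 1 = (1 + t *\<^sub>R p) * (1 + t *\<^sub>R p) - r *\<^sub>R (p * p)"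
    proof -
      have "(2 * t / c) *\<^sub>R (p * (c *\<^sub>R 1 - p)) = (2 * t / c * c) *\<^sub>R p - (2 * t / c) *\<^sub>R (p * p)"
        by (simp add: right_diff_distrib scaleR_diff_right)
      also have "2 * t / c * c = t + t" using c by simp
      finally show ?thesis
        by (simp only: r_def scaleR_add_left distrib_left distrib_right mult_scaleR_left mult_scaleR_right
            mult_1_left mult_1_right scaleR_scaleR) (simp add: scaleR_add_right)
    qed
    finally have "positive (star w * ((1 + t *\<^sub>R p) * (1 + t *\<^sub>R p) - r *\<^sub>R (p * p)) * w)"
      by (rule positive_conj)
    also have "star w * ((1 + t *\<^sub>R p) * (1 + t *\<^sub>R p) - r *\<^sub>R (p * p)) * w
       = star ((1 + t *\<^sub>R p) * w) * ((1 + t *\<^sub>R p) * w) - r *\<^sub>R (star z * z)"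
      by (simp add: z_def star_mult star_add sp left_diff_distrib right_diff_distrib mult.assoc)
    finally have "norm (r *\<^sub>R (star z * z)) \<le> norm (star ((1 + t *\<^sub>R p) * w) * ((1 + t *\<^sub>R p) * w))"
      using t c by (intro norm_mono_positive positive_scaleR) (auto simp: r_def)
    then have "r * (norm z)\<^sup>2 \<le> N\<^sup>2 + t\<^sup>2 * (norm z)\<^sup>2"
      using up t c by (simp add: cstar_identity r_def)
    then show ?thesis by (simp add: r_def power2_eq_square algebra_simps)
  qed
  have z2: "(norm z)\<^sup>2 > 0" using z by simp
  have "N\<^sup>2 + 1 > 0" by (simp add: add_nonneg_pos)
  then have "(2 * (c * (N\<^sup>2 + 1) / (2 * (norm z)\<^sup>2)) / c) * (norm z)\<^sup>2 \<le> N\<^sup>2"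
    using c z2 by (intro bound) simp
  then show False using c z2 by simp
qed

end

text \<open>A partition of unity on the unit interval, subordinate to intervals of length \<open>2/N\<close>.\<close>

definition ramp :: "real \<Rightarrow> real" where
  "ramp s = max 0 (min 1 s)"

definition tent :: "nat \<Rightarrow> nat \<Rightarrow> real \<Rightarrow> real" where
  "tent N j x = ramp (N * x - j + 1) - ramp (N * x - j)"

lemma tent_continuous: "continuous_on A (tent N j)"
  unfolding tent_def ramp_def by (intro continuous_intros)

lemma tent_bounds: "0 \<le> tent N j x" "tent N j x \<le> 1" "\<bar>tent N j x\<bar> \<le> 1"
  by (auto simp: tent_def ramp_def)

lemma tent_sum:
  assumes "x \<in> {0..1}" shows "(\<Sum>j\<le>N. tent N j x) = 1"
proof -
  have "(\<Sum>j\<le>n. tent N j x) = ramp (N * x + 1) - ramp (N * x - n)" for n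
    by (induction n) (auto simp: tent_def algebra_simps)
  moreover have "real N * x \<le> N" "real N * x \<ge> 0" using assms by (auto simp: mult_left_le)
  ultimately show ?thesis by (simp add: ramp_def)
qed

lemma tent_mult:
  assumes "i + 2 \<le> j" shows "tent N i x * tent N j x = 0"
proof -
  have "real i + 2 \<le> real j" using assms by linarith
  then have "tent N i x = 0 \<or> tent N j x = 0" by (auto simp: tent_def ramp_def max_def min_def)
  then show ?thesis by auto
qed

lemma tent_local:
  assumes "N \<ge> 1" shows "\<bar>(x - j / N) * tent N j x\<bar> \<le> 1 / N"
proof -
  have "\<bar>(N * x - j) * tent N j x\<bar> \<le> 1"
  proof (cases "\<bar>N * x - j\<bar> \<le> 1")
    case True
    then show ?thesis using tent_bounds[of N j x] by (simp add: abs_mult mult_le_one)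
  next
    case False
    then have "tent N j x = 0" by (auto simp: tent_def ramp_def)
    then show ?thesis by simp
  qed
  moreover have "(x - j / N) * tent N j x = (N * x - j) * tent N j x / N"
    using assms by (simp add: field_simps)
  ultimately show ?thesis using assms by (simp add: divide_right_mono)
qed

text \<open>
  Only neighbouring indices contribute to \<open>d\<^sup>* d\<close> for the sum \<open>d\<close>.
\<close>

lemma norm_almost_orthogonal_sum:
  fixes d :: "nat \<Rightarrow> 'a::cstar_algebra"
  assumes orth: "\<And>i k. i + 2 \<le> k \<or> k + 2 \<le> i \<Longrightarrow> star (d i) * d k = 0"
    and B: "\<And>i. i \<le> N \<Longrightarrow> norm (d i) \<le> B"
  shows "(norm (\<Sum>i\<le>N. d i))\<^sup>2 \<le> 3 * (real N + 1) * B\<^sup>2"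
proof -
  have B0: "B \<ge> 0" using B[of 0] norm_ge_zero order_trans by blast
  have "(norm (\<Sum>i\<le>N. d i))\<^sup>2 = norm (\<Sum>i\<le>N. \<Sum>k\<le>N. star (d i) * d k)"
    by (simp add: cstar_identity[symmetric] star_sum sum_product)
  also have "\<dots> \<le> (\<Sum>i\<le>N. \<Sum>k\<le>N. norm (star (d i) * d k))"
    by (intro order_trans[OF norm_sum] sum_mono norm_sum)
  also have "\<dots> \<le> (\<Sum>i\<le>N. 3 * B\<^sup>2)"
  proof (rule sum_mono)
    fix i assume i: "i \<in> {..N}"
    have "(\<Sum>k\<le>N. norm (star (d i) * d k)) = (\<Sum>k\<in>{..N} \<inter> {i - 1, i, i + 1}. norm (star (d i) * d k))"
    proof (rule sum.mono_neutral_right)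
      show "\<forall>k\<in>{..N} - {..N} \<inter> {i - 1, i, i + 1}. norm (star (d i) * d k) = 0"
      proof
        fix k assume "k \<in> {..N} - {..N} \<inter> {i - 1, i, i + 1}"
        then have "i + 2 \<le> k \<or> k + 2 \<le> i" by auto
        then show "norm (star (d i) * d k) = 0" by (simp add: orth)
      qed
    qed auto
    also have "\<dots> \<le> (\<Sum>k\<in>{..N} \<inter> {i - 1, i, i + 1}. B\<^sup>2)"
    proof (rule sum_mono)
      fix k assume "k \<in> {..N} \<inter> {i - 1, i, i + 1}"
      then have "norm (star (d i)) * norm (d k) \<le> B * B"
        using B i B0 by (intro mult_mono) auto
      then show "norm (star (d i) * d k) \<le> B\<^sup>2"
        using norm_mult_ineq[of "star (d i)" "d k"] by (simp add: power2_eq_square)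
    qed
    also have "\<dots> = real (card ({..N} \<inter> {i - 1, i, i + 1})) * B\<^sup>2" by simp
    also have "\<dots> \<le> 3 * B\<^sup>2"
    proof (rule mult_right_mono)
      have "card ({..N} \<inter> {i - 1, i, i + 1}) \<le> card {i - 1, i, i + 1}" by (rule card_mono) auto
      also have "\<dots> \<le> 3" by (auto simp: card_insert_if)
      finally show "real (card ({..N} \<inter> {i - 1, i, i + 1})) \<le> 3" by simp
    qed simp
    finally show "(\<Sum>k\<le>N. norm (star (d i) * d k)) \<le> 3 * B\<^sup>2" .
  qed
  also have "\<dots> = 3 * (real N + 1) * B\<^sup>2" by simp
  finally show ?thesis .
qed

context positive_contraction
begin

lemma functional_calculus_sum:
  assumes "\<And>j. functional_calculus (f j) (a j)"
  shows "functional_calculus (\<lambda>x. \<Sum>j\<le>n. f j x) (\<Sum>j\<le>n. a (j::nat))"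
  by (induction n) (auto intro: functional_calculus_add assms)

text \<open>
  The tent functions of \<open>h\<close>. Their properties are inherited from the functions, because the calculus
  is multiplicative and unique.
\<close>

lemma tents_exist:
  fixes N :: nat
  assumes N: "N \<ge> 1"
  obtains a where "\<And>j. positive (a j)" "\<And>j. norm (a j) \<le> 1" "\<And>j. a j * h = h * a j"
    "\<And>i j. i + 2 \<le> j \<or> j + 2 \<le> i \<Longrightarrow> a i * a j = 0" "(\<Sum>j\<le>N. a j) = 1"
    "\<And>j. norm ((h - (j / N) *\<^sub>R 1) * a j) \<le> 1 / N"
proof -
  have "\<exists>a. functional_calculus (tent N j) a" for j
    using functional_calculus_continuous[OF tent_continuous, of N j] by blast
  then obtain a where a: "\<And>j. functional_calculus (tent N j) (a j)" by metis
  have b: "\<bar>tent N j x\<bar> \<le> 1" for j x by (rule tent_bounds)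
  have 1: "positive (a j)" for j by (rule functional_calculus_positive[OF a]) (rule tent_bounds)
  have 2: "norm (a j) \<le> 1" for j by (rule functional_calculus_norm[OF a b])
  have 3: "a j * h = h * a j" for j
    by (rule functional_calculus_cong_unique[OF functional_calculus_mult[OF a functional_calculus_ident, of 1]
          functional_calculus_mult[OF functional_calculus_ident a b]]) auto
  have 4: "a i * a j = 0" if "i + 2 \<le> j \<or> j + 2 \<le> i" for i j
  proof -
    have "a i * a j = 0 *\<^sub>R 1"
      by (rule functional_calculus_cong_unique[OF functional_calculus_mult[OF a a b] functional_calculus_const])
        (use tent_mult that in \<open>auto simp: mult.commute\<close>)
    then show ?thesis by simp
  qed
  have "(\<Sum>j\<le>N. a j) = 1 *\<^sub>R 1"
    by (rule functional_calculus_cong_unique[OF functional_calculus_sum functional_calculus_const])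
      (use a tent_sum in auto)
  then have 5: "(\<Sum>j\<le>N. a j) = 1" by simp
  have 6: "norm ((h - (j / N) *\<^sub>R 1) * a j) \<le> 1 / N" for j
    by (rule functional_calculus_norm[OF functional_calculus_mult[OF
          functional_calculus_diff[OF functional_calculus_ident functional_calculus_const] a b]])
      (rule tent_local[OF N])
  show ?thesis using that[of a] 1 2 3 4 5 6 by blast
qed

end

context norm_one_projection
begin

text \<open>
  The defect \<open>D = h E(x) - E(h x)\<close> is a sum of pieces \<open>a\<^sub>i D\<close> that are almost orthogonal and,
  because only \<open>a\<^sub>j x\<close> with \<open>j\<close> next to \<open>i\<close> contribute to \<open>a\<^sub>i D\<close> and \<open>h\<close> is almost constant
  there, of norm \<open>O(1/N)\<close>. There are \<open>N + 1\<close> of them, so that \<open>D\<close> has norm \<open>O(N\<^bsup>-1/2\<^esup>)\<close>.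
\<close>

lemma E_positive_contraction:
  assumes "positive_contraction h" and x: "bounded (range x)"
  shows "E (\<lambda>i. h * x i) = h * E x"
proof -
  interpret positive_contraction h by fact
  obtain M where M: "\<And>i. norm (x i) \<le> M" using x by (auto simp: bounded_iff)
  have M0: "M \<ge> 0" using M norm_ge_zero order_trans by blast
  define defect where "defect y = h * E y - E (\<lambda>i. h * y i)" for y
  define D where "D = defect x"
  have bound: "(norm D)\<^sup>2 \<le> 486 * M\<^sup>2 / N" if N: "N \<ge> 1" for N :: nat
  proof -
    obtain a where a: "\<And>j. positive (a j)" "\<And>j. norm (a j) \<le> 1" "\<And>j. a j * h = h * a j"
      "\<And>i j. i + 2 \<le> j \<or> j + 2 \<le> i \<Longrightarrow> a i * a j = 0" "(\<Sum>j\<le>N. a j) = 1"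
      "\<And>j. norm ((h - (j / N) *\<^sub>R 1) * a j) \<le> 1 / N"
      by (rule tents_exist[OF N]) blast
    have sa: "star (a j) = a j" for j by (rule positive_selfadj[OF a(1)])
    have bx: "bounded (range (\<lambda>i. b * x i))" for b by (rule bounded_family_mult[OF x])
    have b2: "bounded (range (\<lambda>i. h * (b * x i)))" for b by (rule bounded_family_mult[OF bx])
    have far: "a i * defect (\<lambda>k. a j * x k) = 0" if ij: "i + 2 \<le> j \<or> j + 2 \<le> i" for i j
    proof -
      have "(h * a i) * a j = h * (a i * a j)" by (simp add: mult.assoc)
      then have 1: "(h * a i) * a j = 0" by (simp add: a(4)[OF ij])
      have "positive (h * a i)" by (rule positive_commuting_mult[OF h(1) a(1)]) (simp add: a(3))
      then have 2: "h * a i * E (\<lambda>k. a j * x k) = 0" by (rule E_orthogonal[OF _ 1 x])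
      have "a i * (h * a j) = (a i * a j) * h" by (simp add: mult.assoc a(3))
      then have "a i * (h * a j) = 0" by (simp add: a(4)[OF ij])
      then have "a i * E (\<lambda>k. (h * a j) * x k) = 0" by (rule E_orthogonal[OF a(1) _ x])
      then show ?thesis using 2 by (simp add: defect_def right_diff_distrib mult.assoc[symmetric] a(3))
    qed
    have D_split: "D = (\<Sum>j\<le>N. defect (\<lambda>k. a j * x k))"
    proof -
      have "E (\<lambda>k. \<Sum>j\<le>N. a j * x k) = (\<Sum>j\<le>N. E (\<lambda>k. a j * x k))"
        "E (\<lambda>k. \<Sum>j\<le>N. h * (a j * x k)) = (\<Sum>j\<le>N. E (\<lambda>k. h * (a j * x k)))"
        using E_sum[of "{..N}" "\<lambda>j k. a j * x k"] E_sum[of "{..N}" "\<lambda>j k. h * (a j * x k)"] bx b2 by auto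
      moreover have "(\<Sum>j\<le>N. a j * x k) = x k" "(\<Sum>j\<le>N. h * (a j * x k)) = h * x k" for k
        by (simp_all add: sum_distrib_right[symmetric] sum_distrib_left[symmetric] a(5))
      ultimately show ?thesis
        by (simp add: D_def defect_def sum_subtractf sum_distrib_left)
    qed
    define nb where "nb i = {..N} \<inter> {i - 1, i, i + 1}" for i
    have card_nb: "card (nb i) \<le> 3" for i
    proof -
      have "card (nb i) \<le> card {i - 1, i, i + 1}" unfolding nb_def by (rule card_mono) auto
      also have "\<dots> \<le> 3" by (auto simp: card_insert_if)
      finally show ?thesis .
    qed
    have fin: "finite (nb i)" for i by (simp add: nb_def)
    define g where "g i = (\<Sum>j\<in>nb i. a j)" for i
    have aD: "a i * D = a i * defect (\<lambda>k. g i * x k)" for i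
    proof -
      have "a i * D = (\<Sum>j\<le>N. a i * defect (\<lambda>k. a j * x k))" by (simp add: D_split sum_distrib_left)
      also have "\<dots> = (\<Sum>j\<in>nb i. a i * defect (\<lambda>k. a j * x k))"
      proof (rule sum.mono_neutral_right)
        show "\<forall>j\<in>{..N} - nb i. a i * defect (\<lambda>k. a j * x k) = 0"
          by (intro ballI far) (auto simp: nb_def)
      qed (auto simp: nb_def)
      also have "\<dots> = a i * (\<Sum>j\<in>nb i. defect (\<lambda>k. a j * x k))" by (simp add: sum_distrib_left)
      also have "(\<Sum>j\<in>nb i. defect (\<lambda>k. a j * x k)) = defect (\<lambda>k. g i * x k)"
      proof -
        have "E (\<lambda>k. \<Sum>j\<in>nb i. a j * x k) = (\<Sum>j\<in>nb i. E (\<lambda>k. a j * x k))"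
          "E (\<lambda>k. \<Sum>j\<in>nb i. h * (a j * x k)) = (\<Sum>j\<in>nb i. E (\<lambda>k. h * (a j * x k)))"
          using E_sum[OF fin, of i "\<lambda>j k. a j * x k"] E_sum[OF fin, of i "\<lambda>j k. h * (a j * x k)"] bx b2 by auto
        then show ?thesis
          by (simp add: defect_def g_def sum_subtractf sum_distrib_left sum_distrib_right)
      qed
      finally show ?thesis .
    qed
    have norm_aD: "norm (a i * D) \<le> 9 * M / N" if i: "i \<le> N" for i
    proof -
      define l where "l = h - (i / N) *\<^sub>R 1"
      have y: "defect (\<lambda>k. g i * x k) = l * E (\<lambda>k. g i * x k) - E (\<lambda>k. l * (g i * x k))"
      proof -
        have "E (\<lambda>k. l * (g i * x k)) = E (\<lambda>k. h * (g i * x k) - (i / N) *\<^sub>R (g i * x k))"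
          by (simp add: l_def left_diff_distrib)
        also have "\<dots> = E (\<lambda>k. h * (g i * x k)) - (i / N) *\<^sub>R E (\<lambda>k. g i * x k)"
          using bx by (subst E_diff) (auto simp: b2 E_scaleR intro!: bounded_scaleR_comp)
        finally show ?thesis by (simp add: defect_def l_def left_diff_distrib)
      qed
      have sum3: "norm (\<Sum>j\<in>nb i. f j) \<le> 3 * B" if "\<And>j. j \<in> nb i \<Longrightarrow> norm (f j) \<le> B" "B \<ge> 0" for f :: "nat \<Rightarrow> 'a" and B
      proof -
        have "norm (\<Sum>j\<in>nb i. f j) \<le> of_nat (card (nb i)) * B" by (rule sum_norm_bound) (rule that)
        also have "\<dots> \<le> 3 * B" using card_nb[of i] that(2) by (intro mult_right_mono) auto
        finally show ?thesis .
      qed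
      have g1: "norm (g i) \<le> 3" unfolding g_def using sum3[of a 1] a(2) by simp
      have lg: "norm (l * g i) \<le> 3 * (2 / N)"
        unfolding g_def sum_distrib_left
      proof (rule sum3)
        fix j assume j: "j \<in> nb i"
        have "l * a j = (h - (j / N) *\<^sub>R 1) * a j + ((real j - real i) / N) *\<^sub>R a j"
          by (simp add: l_def left_diff_distrib diff_divide_distrib scaleR_diff_left)
        moreover have "norm (((real j - real i) / N) *\<^sub>R a j) \<le> 1 / N"
        proof -
          have "\<bar>real j - real i\<bar> \<le> 1" using j by (auto simp: nb_def)
          then have "\<bar>real j - real i\<bar> * norm (a j) \<le> 1" using a(2)[of j] by (simp add: mult_le_one)
          then show ?thesis using N by (simp add: divide_right_mono)
        qed
        ultimately show "norm (l * a j) \<le> 2 / N"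
          using a(6)[of j] norm_triangle_ineq[of "(h - (j / N) *\<^sub>R 1) * a j" "((real j - real i) / N) *\<^sub>R a j"]
          by simp
      qed simp
      have e1: "norm (E (\<lambda>k. g i * x k)) \<le> 3 * M"
        using g1 M by (intro E_norm order_trans[OF norm_mult_ineq] mult_mono) auto
      have "norm (E (\<lambda>k. (l * g i) * x k)) \<le> 3 * (2 / N) * M"
      proof (rule E_norm)
        fix k
        have "norm ((l * g i) * x k) \<le> norm (l * g i) * norm (x k)" by (rule norm_mult_ineq)
        also have "\<dots> \<le> 3 * (2 / N) * M" by (rule mult_mono[OF lg M]) auto
        finally show "norm ((l * g i) * x k) \<le> 3 * (2 / N) * M" .
      qed
      then have e2: "norm (E (\<lambda>k. l * (g i * x k))) \<le> 6 / N * M" by (simp add: mult.assoc)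
      have "a i * l = l * a i" by (simp add: l_def algebra_simps a(3))
      then have al: "norm (a i * l) \<le> 1 / N" using a(6)[of i] by (simp add: l_def)
      have "norm (a i * D) \<le> norm (a i * l * E (\<lambda>k. g i * x k)) + norm (a i * E (\<lambda>k. l * (g i * x k)))"
        unfolding aD y right_diff_distrib mult.assoc[symmetric] by (rule norm_triangle_ineq4)
      also have "\<dots> \<le> 1 / N * (3 * M) + 1 * (6 / N * M)"
      proof (rule add_mono)
        show "norm (a i * l * E (\<lambda>k. g i * x k)) \<le> 1 / N * (3 * M)"
          by (rule order_trans[OF norm_mult_ineq], rule mult_mono[OF al e1]) auto
        show "norm (a i * E (\<lambda>k. l * (g i * x k))) \<le> 1 * (6 / N * M)"
          by (rule order_trans[OF norm_mult_ineq], rule mult_mono[OF a(2) e2]) auto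
      qed
      also have "\<dots> = 9 * M / N" by (simp add: field_simps)
      finally show ?thesis .
    qed
    have "D = (\<Sum>i\<le>N. a i) * D" by (simp add: a(5))
    then have "D = (\<Sum>i\<le>N. a i * D)" by (simp add: sum_distrib_right)
    moreover have "(norm (\<Sum>i\<le>N. a i * D))\<^sup>2 \<le> 3 * (real N + 1) * (9 * M / N)\<^sup>2"
    proof (rule norm_almost_orthogonal_sum[OF _ norm_aD])
      fix i k :: nat assume "i + 2 \<le> k \<or> k + 2 \<le> i"
      then have "star D * ((a i * a k) * D) = 0" by (simp add: a(4))
      then show "star (a i * D) * (a k * D) = 0" by (simp add: star_mult sa mult.assoc)
    qed
    moreover have "3 * (real N + 1) * (9 * M / N)\<^sup>2 \<le> 486 * M\<^sup>2 / N"
    proof -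
      have "3 * (real N + 1) * (9 * M / N)\<^sup>2 \<le> 3 * (2 * real N) * (9 * M / N)\<^sup>2"
        using N by (intro mult_right_mono) auto
      also have "\<dots> = 486 * M\<^sup>2 / N" using N by (simp add: power2_eq_square field_simps)
      finally show ?thesis .
    qed
    ultimately show ?thesis by simp
  qed
  have "(norm D)\<^sup>2 \<le> 0"
  proof (rule field_le_epsilon)
    fix e :: real assume e: "e > 0"
    obtain N :: nat where N: "N > 486 * M\<^sup>2 / e" using reals_Archimedean2 by blast
    have "486 * M\<^sup>2 / e \<ge> 0" using e by simp
    then have N1: "real N > 0" using N by linarith
    then have "486 * M\<^sup>2 / N \<le> e" using N e by (simp add: field_simps)
    then show "(norm D)\<^sup>2 \<le> 0 + e" using bound[of N] N1 by simp
  qed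
  then show ?thesis by (simp add: D_def defect_def)
qed

lemma E_mult_left:
  assumes x: "bounded (range x)"
  shows "E (\<lambda>i. a * x i) = a * E x"
proof -
  have pos: "E (\<lambda>i. a * x i) = a * E x" if a: "positive a" for a
  proof (cases "a = 0")
    case True
    then show ?thesis using E_const[of 0] by simp
  next
    case False
    define h where "h = inverse (norm a) *\<^sub>R a"
    have "norm h = 1" using False by (simp add: h_def)
    moreover have "positive h" using a by (simp add: h_def positive_scaleR)
    ultimately have "positive_contraction h"
      using positive_scaled_one_minus[of h 1] by (simp add: positive_contraction_def positive_selfadj)
    then have "E (\<lambda>i. h * x i) = h * E x" by (rule E_positive_contraction[OF _ x])
    then have "norm a *\<^sub>R E (\<lambda>i. h * x i) = norm a *\<^sub>R (h * E x)" by simp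
    then show ?thesis
      using False E_scaleR[OF bounded_family_mult[OF x], of "norm a" h] by (simp add: h_def)
  qed
  have sa: "E (\<lambda>i. a * x i) = a * E x" if a: "star a = a" for a
  proof -
    have "positive (norm a *\<^sub>R 1 + a)" using positive_scaled_one_minus[of "- a" "norm a"] a by simp
    then have "E (\<lambda>i. (norm a *\<^sub>R 1 + a) * x i) = (norm a *\<^sub>R 1 + a) * E x" by (rule pos)
    moreover have "E (\<lambda>i. (norm a *\<^sub>R 1 + a) * x i) = norm a *\<^sub>R E x + E (\<lambda>i. a * x i)"
      using E_add[OF bounded_family_mult[OF x, of "norm a *\<^sub>R 1"] bounded_family_mult[OF x, of a]]
      by (simp add: distrib_right E_scaleR[OF x])
    ultimately show ?thesis by (simp add: distrib_right)
  qed
  obtain b c where bc: "star b = b" "star c = c" "a = b + \<i> *\<^sub>C c" by (rule cartesian_decomposition)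
  have "E (\<lambda>i. a * x i) = E (\<lambda>i. b * x i + \<i> *\<^sub>C (c * x i))"
    by (simp add: bc(3) distrib_right mult_scaleC_left)
  also have "\<dots> = E (\<lambda>i. b * x i) + \<i> *\<^sub>C E (\<lambda>i. c * x i)"
  proof -
    have "bounded (range (\<lambda>i. \<i> *\<^sub>C (c * x i)))"
      using bounded_family_mult[OF x, of "\<i> *\<^sub>C c"] by (simp add: mult_scaleC_left)
    then show ?thesis
      by (simp add: E_add bounded_family_mult[OF x] E_scaleC)
  qed
  also have "\<dots> = a * E x" by (simp add: bc distrib_right mult_scaleC_left sa)
  finally show ?thesis .
qed

text \<open>
  For self-adjoint \<open>x\<close> with \<open>E(x) = a + \<i> b\<close>, the norm of \<open>x + \<i> n\<close> is at most
  \<open>sqrt (M\<^sup>2 + n\<^sup>2)\<close>, while that of \<open>a + \<i> (b + n)\<close> is at least that of \<open>b + n\<close>, which grows faster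
  unless \<open>b = 0\<close>.
\<close>

lemma E_selfadj:
  assumes x: "bounded (range x)" and sx: "\<And>i. star (x i) = x i"
  shows "star (E x) = E x"
proof -
  obtain M where M: "\<And>i. norm (x i) \<le> M" using x by (auto simp: bounded_iff)
  have M0: "M \<ge> 0" using M norm_ge_zero order_trans by blast
  obtain a b where ab: "star a = a" "star b = b" "E x = a + \<i> *\<^sub>C b" by (rule cartesian_decomposition)
  have key: "positive (M\<^sup>2 *\<^sub>R 1 - (2 * n) *\<^sub>R b)" for n :: real
  proof -
    define K where "K = sqrt (M\<^sup>2 + n\<^sup>2)"
    have "norm (x i + \<i> *\<^sub>C (n *\<^sub>R 1)) \<le> K" for i
    proof -
      have "star (x i + \<i> *\<^sub>C (n *\<^sub>R 1)) * (x i + \<i> *\<^sub>C (n *\<^sub>R 1)) = x i * x i + (n * n) *\<^sub>R 1"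
        by (simp add: star_add star_scaleC sx algebra_simps scaleC_simps scaleC_scaleR)
      then have "(norm (x i + \<i> *\<^sub>C (n *\<^sub>R 1)))\<^sup>2 \<le> norm (x i * x i) + norm ((n * n) *\<^sub>R (1::'a))"
        by (metis cstar_identity norm_triangle_ineq)
      also have "\<dots> \<le> M\<^sup>2 + n\<^sup>2"
        using M[of i] by (simp add: norm_selfadj_square[OF sx] power2_eq_square[of n] power_mono)
      finally show ?thesis unfolding K_def by (rule real_le_rsqrt)
    qed
    then have "norm (E (\<lambda>i. x i + \<i> *\<^sub>C (n *\<^sub>R 1))) \<le> K" by (rule E_norm)
    also have "E (\<lambda>i. x i + \<i> *\<^sub>C (n *\<^sub>R 1)) = a + \<i> *\<^sub>C (b + n *\<^sub>R 1)"
      using E_add[OF x bounded_family_const, of "\<i> *\<^sub>C (n *\<^sub>R 1)"] E_const[of "\<i> *\<^sub>C (n *\<^sub>R 1)"]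
      by (simp add: ab(3) scaleC_add_right add.assoc)
    finally have "norm (a + \<i> *\<^sub>C (b + n *\<^sub>R 1)) \<le> K" .
    moreover have "norm (b + n *\<^sub>R 1) \<le> norm ((b + n *\<^sub>R 1) + \<i> *\<^sub>C (- a))"
      by (rule norm_real_part_le) (simp_all add: star_add ab)
    moreover have "(b + n *\<^sub>R 1) + \<i> *\<^sub>C (- a) = (- \<i>) *\<^sub>C (a + \<i> *\<^sub>C (b + n *\<^sub>R 1))"
      by (simp add: scaleC_simps algebra_simps)
    ultimately have "norm (b + n *\<^sub>R 1) \<le> K" by (simp add: norm_scaleC)
    then have "(norm (b + n *\<^sub>R 1))\<^sup>2 \<le> K\<^sup>2" by (simp add: power_mono)
    then have "norm ((b + n *\<^sub>R 1) * (b + n *\<^sub>R 1)) \<le> M\<^sup>2 + n\<^sup>2"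
      by (simp add: norm_selfadj_square star_add ab K_def)
    then have "positive ((M\<^sup>2 + n\<^sup>2) *\<^sub>R 1 - (b + n *\<^sub>R 1) * (b + n *\<^sub>R 1))"
      by (intro positive_scaled_one_minus) (simp_all add: star_mult star_add ab)
    moreover have "positive (b * b)" using positive_star_mult[of b] ab by simp
    ultimately have "positive (((M\<^sup>2 + n\<^sup>2) *\<^sub>R 1 - (b + n *\<^sub>R 1) * (b + n *\<^sub>R 1)) + b * b)"
      by (rule positive_add)
    moreover have "((M\<^sup>2 + n\<^sup>2) *\<^sub>R 1 - (b + n *\<^sub>R 1) * (b + n *\<^sub>R 1)) + b * b = M\<^sup>2 *\<^sub>R 1 - (2 * n) *\<^sub>R b"
    proof -
      have "(2 * n) *\<^sub>R b = n *\<^sub>R b + n *\<^sub>R b" by (simp only: mult_2 scaleR_add_left)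
      then show ?thesis by (simp add: algebra_simps power2_eq_square)
    qed
    ultimately show ?thesis by simp
  qed
  have nb: "positive (- c)" if c: "\<And>n::real. n > 0 \<Longrightarrow> positive (M\<^sup>2 *\<^sub>R 1 - (2 * n) *\<^sub>R c)" for c :: 'a
  proof -
    have "positive (inverse (real (Suc n)) *\<^sub>R (M\<^sup>2 *\<^sub>R 1) - 2 *\<^sub>R c)" for n
    proof -
      have "positive (inverse (real (Suc n)) *\<^sub>R (M\<^sup>2 *\<^sub>R 1 - (2 * real (Suc n)) *\<^sub>R c))"
        by (intro positive_scaleR c) auto
      also have "inverse (real (Suc n)) *\<^sub>R (M\<^sup>2 *\<^sub>R 1 - (2 * real (Suc n)) *\<^sub>R c)
          = inverse (real (Suc n)) *\<^sub>R (M\<^sup>2 *\<^sub>R 1) - (inverse (real (Suc n)) * (2 * real (Suc n))) *\<^sub>R c"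
        by (simp only: scaleR_diff_right scaleR_scaleR)
      also have "inverse (real (Suc n)) * (2 * real (Suc n)) = 2" by (simp add: field_simps)
      finally show ?thesis .
    qed
    moreover have "(\<lambda>n. inverse (real (Suc n)) *\<^sub>R (M\<^sup>2 *\<^sub>R 1) - 2 *\<^sub>R c) \<longlonglongrightarrow> 0 *\<^sub>R (M\<^sup>2 *\<^sub>R 1) - 2 *\<^sub>R c"
      by (intro tendsto_intros LIMSEQ_inverse_real_of_nat)
    ultimately have "positive (0 *\<^sub>R (M\<^sup>2 *\<^sub>R 1) - 2 *\<^sub>R c)" by (rule positive_lim)
    then show ?thesis using positive_scaleR[of _ "1/2"] by fastforce
  qed
  have "positive (- b)" by (rule nb) (rule key)
  moreover have "positive (- (- b))" by (rule nb) (use key[of "- n" for n] in simp)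
  ultimately have "- b = 0" by (rule positive_antisym)
  then show ?thesis using ab by simp
qed

lemma E_star:
  assumes x: "bounded (range x)"
  shows "E (\<lambda>i. star (x i)) = star (E x)"
proof -
  have bs: "bounded (range (\<lambda>i. star (x i)))" using x by (simp add: bounded_iff)
  have "star (E (\<lambda>i. x i + star (x i))) = E (\<lambda>i. x i + star (x i))"
    by (rule E_selfadj) (auto simp: bounded_family_add x bs star_add star_star add.commute)
  then have 1: "star (E x) + star (E (\<lambda>i. star (x i))) = E x + E (\<lambda>i. star (x i))"
    by (simp add: E_add x bs star_add)
  have b2: "bounded (range (\<lambda>i. \<i> *\<^sub>C (x i - star (x i))))"
  proof -
    have "bounded (range (\<lambda>i. (\<i> *\<^sub>C 1) * (x i + - star (x i))))"
      by (intro bounded_family_mult bounded_family_add x) (use bs in \<open>simp add: bounded_iff\<close>)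
    then show ?thesis by (simp add: mult_scaleC_left)
  qed
  have b3: "bounded (range (\<lambda>i. x i - star (x i)))"
    using bounded_family_add[OF x, of "\<lambda>i. - star (x i)"] bs by (simp add: bounded_iff)
  have "star (E (\<lambda>i. \<i> *\<^sub>C (x i - star (x i)))) = E (\<lambda>i. \<i> *\<^sub>C (x i - star (x i)))"
    by (rule E_selfadj[OF b2]) (simp add: star_scaleC star_diff star_star scaleC_simps)
  moreover have "E (\<lambda>i. \<i> *\<^sub>C (x i - star (x i))) = \<i> *\<^sub>C (E x - E (\<lambda>i. star (x i)))"
    by (simp only: E_scaleC[OF b3] E_diff[OF x bs])
  ultimately have "\<i> *\<^sub>C (star (E (\<lambda>i. star (x i))) - star (E x)) = \<i> *\<^sub>C (E x - E (\<lambda>i. star (x i)))"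
    by (simp add: star_scaleC star_diff scaleC_simps)
  then have "(- \<i>) *\<^sub>C \<i> *\<^sub>C (star (E (\<lambda>i. star (x i))) - star (E x)) = (- \<i>) *\<^sub>C \<i> *\<^sub>C (E x - E (\<lambda>i. star (x i)))"
    by simp
  then have 2: "star (E (\<lambda>i. star (x i))) - star (E x) = E x - E (\<lambda>i. star (x i))"
    by (simp only: scaleC_scaleC) simp
  let ?e = "E (\<lambda>i. star (x i))"
  have "(star (E x) + star ?e) - (star ?e - star (E x)) = (E x + ?e) - (E x - ?e)"
    by (simp only: 1 2)
  then have "2 *\<^sub>R ?e = 2 *\<^sub>R star (E x)"
    by (simp add: scaleR_2)
  then show ?thesis by simp
qed

end


section \<open>Ultralimits\<close>

definition ultrafilter :: "'i filter \<Rightarrow> bool" where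
  "ultrafilter U \<longleftrightarrow> U \<noteq> bot \<and> (\<forall>Q. eventually Q U \<or> eventually (\<lambda>x. \<not> Q x) U)"

text \<open>
  Zorn's lemma: the infimum of a chain of proper filters is proper, and a minimal proper filter decides
  every property.
\<close>

lemma ultrafilter_exists:
  fixes F :: "'i filter"
  assumes F: "F \<noteq> bot"
  obtains U where "ultrafilter U" "U \<le> F"
proof -
  define sets where "sets U = {Q. eventually Q U}" for U :: "'i filter"
  define A where "A = sets ` {U. U \<noteq> bot \<and> U \<le> F}"
  have mono: "sets U \<subseteq> sets V \<longleftrightarrow> V \<le> U" for U V by (auto simp: sets_def le_filter_def)
  have "\<exists>M\<in>A. \<forall>X\<in>A. M \<subseteq> X \<longrightarrow> X = M"
  proof (rule Zorn_Lemma2, rule ballI)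
    fix C assume C: "C \<in> chains A"
    define \<U> where "\<U> = insert F {U. U \<noteq> bot \<and> U \<le> F \<and> sets U \<in> C}"
    have chain: "U \<le> V \<or> V \<le> U" if "U \<in> \<U>" "V \<in> \<U>" for U V
      using that chainsD[OF C, of "sets U" "sets V"] by (auto simp: \<U>_def mono)
    have fin: "X = {} \<or> Inf X \<in> X" if "finite X" "X \<subseteq> \<U>" for X
      using that
    proof (induction X rule: finite_induct)
      case (insert U X)
      show ?case
      proof (cases "X = {}")
        case False
        then have "Inf X \<in> X" "Inf X \<in> \<U>" "U \<in> \<U>" using insert by auto
        then have "inf U (Inf X) \<in> insert U X" using chain[of U "Inf X"] by (auto simp: inf_absorb1 inf_absorb2)
        then show ?thesis by simp
      qed simp
    qed simp
    have "Inf \<U> \<noteq> bot"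
    proof (rule Inf_filter_not_bot)
      fix X assume X: "X \<subseteq> \<U>" "finite X"
      have nb: "U \<noteq> bot" if "U \<in> \<U>" for U using that F by (auto simp: \<U>_def)
      show "Inf X \<noteq> bot"
      proof (cases "X = {}")
        case True
        then have "F \<le> Inf X" by simp
        then show ?thesis using F by (auto simp: bot_unique)
      next
        case False
        then have "Inf X \<in> \<U>" using fin[OF X(2,1)] X(1) by blast
        then show ?thesis by (rule nb)
      qed
    qed
    moreover have "Inf \<U> \<le> F" by (rule Inf_lower) (simp add: \<U>_def)
    ultimately have "sets (Inf \<U>) \<in> A" by (auto simp: A_def)
    moreover have "X \<subseteq> sets (Inf \<U>)" if X: "X \<in> C" for X
    proof -
      have "X \<in> A" using C X by (auto simp: chains_def)
      then obtain U where "U \<noteq> bot" "U \<le> F" "X = sets U" by (auto simp: A_def)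
      then have "U \<in> \<U>" using X by (simp add: \<U>_def)
      then show ?thesis using \<open>X = sets U\<close> mono Inf_lower by blast
    qed
    ultimately show "\<exists>V\<in>A. \<forall>X\<in>C. X \<subseteq> V" by blast
  qed
  then obtain U where U: "U \<noteq> bot" "U \<le> F" and max': "\<forall>X\<in>A. sets U \<subseteq> X \<longrightarrow> X = sets U"
    by (auto simp: A_def)
  have max: "U \<le> V" if "V \<noteq> bot" "V \<le> F" "V \<le> U" for V
  proof -
    have "sets V \<in> A" using that by (simp add: A_def)
    then have "sets V = sets U" using max' that(3) mono by blast
    then show ?thesis using mono by blast
  qed
  have "ultrafilter U"
    unfolding ultrafilter_def
  proof (intro conjI allI disjCI U)
    fix Q assume Q: "\<not> eventually (\<lambda>x. \<not> Q x) U"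
    let ?V = "inf U (principal {x. Q x})"
    have "?V \<noteq> bot" using Q by (simp add: trivial_limit_def eventually_inf_principal)
    moreover have "?V \<le> F" using U(2) by (meson inf.cobounded1 order_trans)
    ultimately have "U \<le> ?V" by (intro max) auto
    then show "eventually Q U" by (simp add: le_principal)
  qed
  then show ?thesis using that U by blast
qed

lemma ultrafilter_not_bot: "ultrafilter U \<Longrightarrow> U \<noteq> bot"
  by (simp add: ultrafilter_def)

lemma ultrafilter_convergent:
  fixes f :: "'i \<Rightarrow> complex"
  assumes U: "ultrafilter U" and M: "eventually (\<lambda>i. cmod (f i) \<le> M) U"
  obtains l where "(f \<longlongrightarrow> l) U"
proof -
  have "filtermap f U \<noteq> bot" using U by (simp add: filtermap_bot_iff ultrafilter_def)
  moreover have "eventually (\<lambda>z. z \<in> cball 0 M) (filtermap f U)"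
    using M by (simp add: eventually_filtermap)
  ultimately obtain l where l: "inf (nhds l) (filtermap f U) \<noteq> bot"
    using compact_cball[of "0::complex" M] unfolding compact_filter by blast
  have "eventually (\<lambda>i. f i \<in> S) U" if S: "open S" "l \<in> S" for S
  proof (rule ccontr)
    assume "\<not> ?thesis"
    then have "eventually (\<lambda>i. f i \<notin> S) U" using U unfolding ultrafilter_def by blast
    then have "eventually (\<lambda>z. z \<notin> S) (filtermap f U)" by (simp add: eventually_filtermap)
    moreover have "eventually (\<lambda>z. z \<in> S) (nhds l)" using S by (rule eventually_nhds_in_open)
    ultimately have "eventually (\<lambda>z. False) (inf (nhds l) (filtermap f U))"
      unfolding eventually_inf by (intro exI[of _ "\<lambda>z. z \<in> S"] exI[of _ "\<lambda>z. z \<notin> S"]) auto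
    then show False using l by (simp add: trivial_limit_def)
  qed
  then have "(f \<longlongrightarrow> l) U" by (rule topological_tendstoI)
  then show ?thesis by (rule that)
qed


section \<open>The predual of a W*-algebra\<close>

lemma dual_spaceD:
  assumes "\<phi> \<in> dual_space"
  shows "bounded_linear \<phi>" "\<phi> (a + b) = \<phi> a + \<phi> b" "\<phi> (c *\<^sub>C a) = c * \<phi> a"
    "\<phi> (a - b) = \<phi> a - \<phi> b" "\<phi> (- a) = - \<phi> a" "\<phi> 0 = 0" "cmod (\<phi> a) \<le> onorm \<phi> * norm a" "\<phi> (r *\<^sub>R a) = r *\<^sub>R \<phi> a"
    "onorm \<phi> \<ge> 0"
proof -
  show bl: "bounded_linear \<phi>" using assms by (simp add: dual_space_def)
  show "\<phi> (a + b) = \<phi> a + \<phi> b" "\<phi> (a - b) = \<phi> a - \<phi> b" "\<phi> (- a) = - \<phi> a" "\<phi> 0 = 0" "\<phi> (r *\<^sub>R a) = r *\<^sub>R \<phi> a"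
    using bounded_linear.linear[OF bl] by (simp_all add: linear_add linear_diff linear_neg linear_0 linear_scale)
  show "\<phi> (c *\<^sub>C a) = c * \<phi> a" using assms by (simp add: dual_space_def)
  show "cmod (\<phi> a) \<le> onorm \<phi> * norm a" by (rule onorm[OF bl])
  show "onorm \<phi> \<ge> 0" by (rule onorm_pos_le[OF bl])
qed

text \<open>
  One step of the Hahn-Banach extension: \<open>c\<close> separates the values forced from below and from above.
\<close>

lemma one_step_domination:
  fixes f g :: "'b::real_normed_vector \<Rightarrow> real"
  assumes f: "linear f" and g: "linear g" and S: "subspace S"
    and dom: "\<And>a. a \<in> S \<Longrightarrow> g a = 0 \<Longrightarrow> f a \<le> e * norm a" and e: "e \<ge> 0"
  obtains c where "\<And>a. a \<in> S \<Longrightarrow> f a - c * g a \<le> e * norm a"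
proof (cases "\<exists>a\<in>S. g a \<noteq> 0")
  case False
  then show ?thesis using that[of 0] dom by simp
next
  case True
  then obtain s where s: "s \<in> S" "g s \<noteq> 0" by blast
  define lows where "lows = (\<lambda>a. f a - e * norm a) ` {a \<in> S. g a = 1}"
  have sep: "f a - e * norm a \<le> e * norm b - f b" if "a \<in> S" "g a = 1" "b \<in> S" "g b = - 1" for a b
  proof -
    have "f (a + b) \<le> e * norm (a + b)"
      by (rule dom) (use that g in \<open>auto simp: linear_add subspace_add[OF S]\<close>)
    also have "\<dots> \<le> e * (norm a + norm b)" using e by (intro mult_left_mono norm_triangle_ineq)
    finally show ?thesis using f by (simp add: linear_add algebra_simps)
  qed
  define s1 where "s1 = inverse (g s) *\<^sub>R s"
  have s1: "s1 \<in> S" "g s1 = 1" using s g by (auto simp: s1_def linear_scale subspace_scale[OF S])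
  have ms1: "- s1 \<in> S" "g (- s1) = - 1" using s1 g by (auto simp: linear_neg subspace_neg[OF S])
  have ne: "lows \<noteq> {}" using s1 by (auto simp: lows_def)
  have bdd: "bdd_above lows"
    unfolding lows_def using sep[OF _ _ ms1] by (intro bdd_aboveI[of _ "e * norm (- s1) - f (- s1)"]) auto
  define c where "c = Sup lows"
  have lo: "f a - e * norm a \<le> c" if "a \<in> S" "g a = 1" for a
    unfolding c_def by (rule cSup_upper[OF _ bdd]) (use that in \<open>auto simp: lows_def\<close>)
  have hi: "c \<le> e * norm b - f b" if "b \<in> S" "g b = - 1" for b
    unfolding c_def by (rule cSup_least[OF ne]) (use that sep in \<open>auto simp: lows_def\<close>)
  have "f a - c * g a \<le> e * norm a" if a: "a \<in> S" for a
  proof -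
    consider "g a = 0" | "g a > 0" | "g a < 0" by linarith
    then show ?thesis
    proof cases
      case 1
      then show ?thesis using dom[OF a] by simp
    next
      case 2
      have "f (inverse (g a) *\<^sub>R a) - e * norm (inverse (g a) *\<^sub>R a) \<le> c"
        by (rule lo) (use a 2 g in \<open>auto simp: linear_scale subspace_scale[OF S]\<close>)
      then have "inverse (g a) * (f a - e * norm a) \<le> c" using 2 f by (simp add: linear_scale algebra_simps)
      then have "g a * (inverse (g a) * (f a - e * norm a)) \<le> g a * c" using 2 by (intro mult_left_mono) auto
      moreover have "g a * (inverse (g a) * (f a - e * norm a)) = f a - e * norm a" using 2 by simp
      ultimately show ?thesis by (simp add: mult.commute)
    next
      case 3
      define k where "k = - g a"
      have k: "k > 0" using 3 by (simp add: k_def)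
      have "c \<le> e * norm (inverse k *\<^sub>R a) - f (inverse k *\<^sub>R a)"
        by (rule hi) (use a 3 g in \<open>auto simp: k_def linear_scale linear_neg subspace_scale[OF S] subspace_neg[OF S]\<close>)
      then have "c \<le> inverse k * (e * norm a - f a)"
        using k f by (simp add: linear_scale algebra_simps)
      then have "k * c \<le> k * (inverse k * (e * norm a - f a))" using k by (intro mult_left_mono) auto
      moreover have "k * (inverse k * (e * norm a - f a)) = e * norm a - f a" using k by simp
      ultimately have "k * c \<le> e * norm a - f a" by (simp only:)
      then show ?thesis by (simp add: mult.commute k_def)
    qed
  qed
  then show ?thesis by (rule that)
qed

locale predual =
  fixes P :: "('a::cstar_algebra \<Rightarrow> complex) set"
  assumes predual: "is_predual P"
begin

lemma P_dual: "\<phi> \<in> P \<Longrightarrow> \<phi> \<in> dual_space"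
  using predual by (auto simp: is_predual_def)

lemma P_0: "(\<lambda>a. 0) \<in> P"
  and P_add: "\<phi> \<in> P \<Longrightarrow> \<psi> \<in> P \<Longrightarrow> (\<lambda>a. \<phi> a + \<psi> a) \<in> P"
  and P_scale: "\<phi> \<in> P \<Longrightarrow> (\<lambda>a. c * \<phi> a) \<in> P"
  using predual by (simp_all add: is_predual_def)

lemma P_closed:
  "(\<And>n::nat. f n \<in> P) \<Longrightarrow> \<psi> \<in> dual_space \<Longrightarrow> (\<lambda>n. onorm (\<lambda>a. f n a - \<psi> a)) \<longlonglongrightarrow> 0 \<Longrightarrow> \<psi> \<in> P"
  using predual unfolding is_predual_def by blast

lemma P_norm_le:
  assumes "\<And>\<phi>. \<phi> \<in> P \<Longrightarrow> onorm \<phi> \<le> 1 \<Longrightarrow> cmod (\<phi> a) \<le> M"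
  shows "norm a \<le> M"
proof -
  have "norm a = (SUP \<phi>\<in>{\<phi> \<in> P. onorm \<phi> \<le> 1}. cmod (\<phi> a))"
    using predual by (simp add: is_predual_def)
  also have "\<dots> \<le> M"
  proof (rule cSUP_least)
    have "(\<lambda>a. 0) \<in> {\<phi> \<in> P. onorm \<phi> \<le> 1}" by (simp add: P_0 onorm_zero)
    then show "{\<phi> \<in> P. onorm \<phi> \<le> 1} \<noteq> {}" by blast
  qed (use assms in auto)
  finally show ?thesis .
qed

lemma P_separates: "(\<And>\<phi>. \<phi> \<in> P \<Longrightarrow> \<phi> a = \<phi> b) \<Longrightarrow> a = b"
  using P_norm_le[of "a - b" 0] dual_spaceD(4)[OF P_dual] by fastforce

lemma P_represents:
  assumes "\<And>\<phi> \<psi>. \<phi> \<in> P \<Longrightarrow> \<psi> \<in> P \<Longrightarrow> F (\<lambda>a. \<phi> a + \<psi> a) = F \<phi> + F \<psi>"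
    and "\<And>\<phi> c. \<phi> \<in> P \<Longrightarrow> F (\<lambda>a. c * \<phi> a) = c * F \<phi>"
    and "\<And>\<phi>. \<phi> \<in> P \<Longrightarrow> cmod (F \<phi>) \<le> B * onorm \<phi>"
  obtains a where "\<And>\<phi>. \<phi> \<in> P \<Longrightarrow> F \<phi> = \<phi> a"
proof -
  have "\<forall>F. (\<forall>\<phi>\<in>P. \<forall>\<psi>\<in>P. F (\<lambda>a. \<phi> a + \<psi> a) = F \<phi> + F \<psi>) \<and>
        (\<forall>\<phi>\<in>P. \<forall>c. F (\<lambda>a. c * \<phi> a) = c * F \<phi>) \<and>
        (\<exists>B. \<forall>\<phi>\<in>P. cmod (F \<phi>) \<le> B * onorm \<phi>) \<longrightarrow> (\<exists>a. \<forall>\<phi>\<in>P. F \<phi> = \<phi> a)"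
    using predual by (simp add: is_predual_def)
  then show ?thesis using assms that by blast
qed

text \<open>
  The limits depend linearly and boundedly on the functional, and bounded functionals on the predual
  are elements of the algebra.
\<close>

lemma weak_star_limit_exists:
  assumes nb: "U \<noteq> bot"
    and lim: "\<And>\<phi>. \<phi> \<in> P \<Longrightarrow> \<exists>l. ((\<lambda>i. \<phi> (x i)) \<longlongrightarrow> l) U \<and> cmod l \<le> B * onorm \<phi>"
  shows "\<exists>a. \<forall>\<phi>\<in>P. ((\<lambda>i. \<phi> (x i)) \<longlongrightarrow> \<phi> a) U"
proof -
  obtain F where F: "\<And>\<phi>. \<phi> \<in> P \<Longrightarrow> ((\<lambda>i. \<phi> (x i)) \<longlongrightarrow> F \<phi>) U" "\<And>\<phi>. \<phi> \<in> P \<Longrightarrow> cmod (F \<phi>) \<le> B * onorm \<phi>"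
    using lim by metis
  obtain a where a: "\<And>\<phi>. \<phi> \<in> P \<Longrightarrow> F \<phi> = \<phi> a"
  proof (rule P_represents)
    fix \<phi> \<psi> assume "\<phi> \<in> P" "\<psi> \<in> P"
    then show "F (\<lambda>a. \<phi> a + \<psi> a) = F \<phi> + F \<psi>"
      by (intro tendsto_unique[OF nb F(1)[OF P_add] tendsto_add[OF F(1) F(1)]])
  next
    fix \<phi> c assume "\<phi> \<in> P"
    then show "F (\<lambda>a. c * \<phi> a) = c * F \<phi>"
      by (intro tendsto_unique[OF nb F(1)[OF P_scale] tendsto_mult[OF tendsto_const F(1)]])
  qed (use F(2) in blast)+
  show ?thesis using F(1) a by auto
qed

definition ultralimit :: "'i filter \<Rightarrow> ('i \<Rightarrow> 'a) \<Rightarrow> 'a" where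
  "ultralimit U x = (SOME a. \<forall>\<phi>\<in>P. ((\<lambda>i. \<phi> (x i)) \<longlongrightarrow> \<phi> a) U)"

lemma ultralimit_tendsto:
  assumes U: "ultrafilter U" and x: "bounded (range x)" and \<phi>: "\<phi> \<in> P"
  shows "((\<lambda>i. \<phi> (x i)) \<longlongrightarrow> \<phi> (ultralimit U x)) U"
proof -
  obtain M where M: "\<And>i. norm (x i) \<le> M" using x by (auto simp: bounded_iff)
  note nb = ultrafilter_not_bot[OF U]
  have "\<exists>l. ((\<lambda>i. \<phi> (x i)) \<longlongrightarrow> l) U \<and> cmod l \<le> M * onorm \<phi>" if "\<phi> \<in> P" for \<phi>
  proof -
    have le: "cmod (\<phi> (x i)) \<le> M * onorm \<phi>" for i
      using order_trans[OF dual_spaceD(7)[OF P_dual[OF that], of "x i"] mult_left_mono[OF M dual_spaceD(9)[OF P_dual[OF that]]]]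
      by (simp add: mult.commute)
    then have "eventually (\<lambda>i. cmod (\<phi> (x i)) \<le> M * onorm \<phi>) U" by simp
    then obtain l where l: "((\<lambda>i. \<phi> (x i)) \<longlongrightarrow> l) U" by (rule ultrafilter_convergent[OF U])
    then have "cmod l \<le> M * onorm \<phi>"
      by (intro tendsto_upperbound[OF tendsto_norm[OF l] _ nb]) (auto simp: le)
    then show ?thesis using l by blast
  qed
  then have "\<exists>a. \<forall>\<phi>\<in>P. ((\<lambda>i. \<phi> (x i)) \<longlongrightarrow> \<phi> a) U" by (rule weak_star_limit_exists[OF nb])
  then have "\<forall>\<phi>\<in>P. ((\<lambda>i. \<phi> (x i)) \<longlongrightarrow> \<phi> (ultralimit U x)) U"
    unfolding ultralimit_def by (rule someI_ex)
  then show ?thesis using \<phi> by blast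
qed

lemma ultralimit_projection:
  assumes U: "ultrafilter U"
  shows "norm_one_projection (ultralimit U)"
proof
  note nb = ultrafilter_not_bot[OF U]
  note lim = ultralimit_tendsto[OF U]
  fix x y :: "'b \<Rightarrow> 'a" and c a M
  show "ultralimit U (\<lambda>i. x i + y i) = ultralimit U x + ultralimit U y"
    if b: "bounded (range x)" "bounded (range y)"
  proof (rule P_separates)
    fix \<phi> assume \<phi>: "\<phi> \<in> P"
    have "((\<lambda>i. \<phi> (x i + y i)) \<longlongrightarrow> \<phi> (ultralimit U (\<lambda>i. x i + y i))) U"
      by (rule lim[OF _ \<phi>]) (simp add: bounded_plus_comp b)
    moreover have "((\<lambda>i. \<phi> (x i + y i)) \<longlongrightarrow> \<phi> (ultralimit U x + ultralimit U y)) U"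
      unfolding dual_spaceD(2)[OF P_dual[OF \<phi>]] by (intro tendsto_add lim b \<phi>)
    ultimately show "\<phi> (ultralimit U (\<lambda>i. x i + y i)) = \<phi> (ultralimit U x + ultralimit U y)"
      by (rule tendsto_unique[OF nb])
  qed
  show "ultralimit U (\<lambda>i. c *\<^sub>C x i) = c *\<^sub>C ultralimit U x" if b: "bounded (range x)"
  proof (rule P_separates)
    fix \<phi> assume \<phi>: "\<phi> \<in> P"
    obtain M where M: "\<And>i. norm (x i) \<le> M" using b by (auto simp: bounded_iff)
    have "norm (c *\<^sub>C x i) \<le> cmod c * M" for i using M[of i] by (simp add: norm_scaleC mult_left_mono)
    then have "((\<lambda>i. \<phi> (c *\<^sub>C x i)) \<longlongrightarrow> \<phi> (ultralimit U (\<lambda>i. c *\<^sub>C x i))) U"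
      by (intro lim[OF _ \<phi>]) (auto simp: bounded_iff)
    moreover have "((\<lambda>i. \<phi> (c *\<^sub>C x i)) \<longlongrightarrow> \<phi> (c *\<^sub>C ultralimit U x)) U"
      unfolding dual_spaceD(3)[OF P_dual[OF \<phi>]] by (intro tendsto_mult tendsto_const lim b \<phi>)
    ultimately show "\<phi> (ultralimit U (\<lambda>i. c *\<^sub>C x i)) = \<phi> (c *\<^sub>C ultralimit U x)"
      by (rule tendsto_unique[OF nb])
  qed
  show "norm (ultralimit U x) \<le> M" if M: "\<And>i. norm (x i) \<le> M"
  proof (rule P_norm_le)
    fix \<phi> assume \<phi>: "\<phi> \<in> P" "onorm \<phi> \<le> 1"
    have "((\<lambda>i. cmod (\<phi> (x i))) \<longlongrightarrow> cmod (\<phi> (ultralimit U x))) U"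
      by (intro tendsto_norm lim \<phi>) (use M in \<open>auto simp: bounded_iff\<close>)
    moreover have "cmod (\<phi> (x i)) \<le> M" for i
    proof -
      have "cmod (\<phi> (x i)) \<le> onorm \<phi> * norm (x i)" by (rule dual_spaceD(7)[OF P_dual[OF \<phi>(1)]])
      also have "\<dots> \<le> 1 * M" using \<phi>(2) M by (intro mult_mono) auto
      finally show ?thesis by simp
    qed
    ultimately show "cmod (\<phi> (ultralimit U x)) \<le> M"
      by (intro tendsto_upperbound[OF _ _ nb]) auto
  qed
  show "ultralimit U (\<lambda>i. a) = a"
  proof (rule P_separates)
    fix \<phi> assume \<phi>: "\<phi> \<in> P"
    have "((\<lambda>i. \<phi> a) \<longlongrightarrow> \<phi> (ultralimit U (\<lambda>i. a))) U"
      by (rule lim[OF _ \<phi>]) (auto simp: bounded_iff)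
    then show "\<phi> (ultralimit U (\<lambda>i. a)) = \<phi> a"
      by (rule tendsto_unique[OF nb _ tendsto_const])
  qed
qed

text \<open>
  The elements of \<open>\<Phi>\<close> are removed one at a time, each after subtracting from \<open>f\<close> the multiple of it that
  the Hahn-Banach step supplies.
\<close>

lemma approximation_from_kernel:
  assumes "finite \<Phi>" "\<Phi> \<subseteq> P" "linear f" "e \<ge> 0"
    and "\<And>a. (\<And>\<phi>. \<phi> \<in> \<Phi> \<Longrightarrow> Re (\<phi> a) = 0) \<Longrightarrow> f a \<le> e * norm a"
  shows "\<exists>\<psi>\<in>P. \<forall>a. f a - Re (\<psi> a) \<le> e * norm a"
  using assms
proof (induction \<Phi> arbitrary: f rule: finite_induct)
  case empty
  then show ?case using P_0 by (intro bexI[of _ "\<lambda>a. 0"]) auto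
next
  case (insert \<phi> \<Phi>)
  have \<phi>: "\<phi> \<in> P" using insert by simp
  have lin: "linear (\<lambda>a. Re (\<phi> a))" if "\<phi> \<in> P" for \<phi>
    using bounded_linear.linear[OF dual_spaceD(1)[OF P_dual[OF that]]]
    by (auto simp: linear_iff)
  let ?S = "{a. \<forall>\<psi>\<in>\<Phi>. Re (\<psi> a) = 0}"
  have S: "subspace ?S"
  proof -
    have "Re (\<psi> 0) = 0" "Re (\<psi> (a + b)) = Re (\<psi> a) + Re (\<psi> b)" "Re (\<psi> (r *\<^sub>R a)) = r * Re (\<psi> a)"
      if "\<psi> \<in> \<Phi>" for \<psi> a b r
    proof -
      have "\<psi> \<in> dual_space" using P_dual insert.prems(1) that by auto
      then show "Re (\<psi> 0) = 0" "Re (\<psi> (a + b)) = Re (\<psi> a) + Re (\<psi> b)" "Re (\<psi> (r *\<^sub>R a)) = r * Re (\<psi> a)"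
        by (simp_all add: dual_spaceD)
    qed
    then show ?thesis by (simp add: subspace_def)
  qed
  have dom: "f a \<le> e * norm a" if "a \<in> ?S" "Re (\<phi> a) = 0" for a
    by (rule insert.prems(4)) (use that in auto)
  obtain c where c: "\<And>a. a \<in> ?S \<Longrightarrow> f a - c * Re (\<phi> a) \<le> e * norm a"
    by (rule one_step_domination[OF insert.prems(2) lin[OF \<phi>] S dom insert.prems(3)]) blast+
  have "linear (\<lambda>a. f a - c * Re (\<phi> a))"
    using insert.prems(2) lin[OF \<phi>] by (simp add: linear_iff algebra_simps)
  then obtain \<psi> where \<psi>: "\<psi> \<in> P" "\<forall>a. (f a - c * Re (\<phi> a)) - Re (\<psi> a) \<le> e * norm a"
    using insert.IH[of "\<lambda>a. f a - c * Re (\<phi> a)"] insert.prems c by auto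
  show ?case
  proof (rule bexI)
    show "(\<lambda>a. complex_of_real c * \<phi> a + \<psi> a) \<in> P" by (rule P_add[OF P_scale[OF \<phi>] \<psi>(1)])
    show "\<forall>a. f a - Re (complex_of_real c * \<phi> a + \<psi> a) \<le> e * norm a" using \<psi>(2) by (simp add: algebra_simps)
  qed
qed

text \<open>
  A functional that is continuous along weak* convergent bounded nets is, on the unit ball, small
  on the common kernel of finitely many elements of \<open>P\<close>: otherwise witnesses of the contrary for
  larger and larger finite sets would converge to \<open>0\<close> in the weak* topology while the values of the
  functional stay away from \<open>0\<close>. It is then close in norm to the span
  of these elements, and \<open>P\<close> is norm-closed.
\<close>

lemma P_memI:
  fixes f :: "'a \<Rightarrow> complex"
  assumes f: "f \<in> dual_space"
    and cont: "\<And>(U :: ('a \<Rightarrow> complex) set filter) x. ultrafilter U \<Longrightarrow> bounded (range x) \<Longrightarrow>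
        ((\<lambda>i. f (x i)) \<longlongrightarrow> f (ultralimit U x)) U"
  shows "f \<in> P"
proof -
  have small: "\<exists>\<Phi>. finite \<Phi> \<and> \<Phi> \<subseteq> P \<and> (\<forall>a. (\<forall>\<phi>\<in>\<Phi>. \<phi> a = 0) \<longrightarrow> cmod (f a) \<le> e * norm a)"
    if e: "e > 0" for e
  proof (rule ccontr)
    assume contr: "\<not> ?thesis"
    define Q where "Q \<Phi> a \<longleftrightarrow> (finite \<Phi> \<and> \<Phi> \<subseteq> P \<longrightarrow> (\<forall>\<phi>\<in>\<Phi>. \<phi> a = 0) \<and> cmod (f a) > e) \<and> norm a \<le> 1"
      for \<Phi> a
    have "\<exists>a. (finite \<Phi> \<and> \<Phi> \<subseteq> P \<longrightarrow> (\<forall>\<phi>\<in>\<Phi>. \<phi> a = 0) \<and> cmod (f a) > e) \<and> norm a \<le> 1" for \<Phi>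
    proof (cases "finite \<Phi> \<and> \<Phi> \<subseteq> P")
      case True
      then have "\<not> (\<forall>a. (\<forall>\<phi>\<in>\<Phi>. \<phi> a = 0) \<longrightarrow> cmod (f a) \<le> e * norm a)" using contr by blast
      then obtain a where a: "\<forall>\<phi>\<in>\<Phi>. \<phi> a = 0" "cmod (f a) > e * norm a" by (auto simp: not_le)
      then have "a \<noteq> 0" using dual_spaceD(6)[OF f] by auto
      then have "cmod (f (inverse (norm a) *\<^sub>R a)) > e" "norm (inverse (norm a) *\<^sub>R a) \<le> 1"
        using a(2) by (simp_all add: dual_spaceD(8)[OF f] field_simps)
      moreover have "\<forall>\<phi>\<in>\<Phi>. \<phi> (inverse (norm a) *\<^sub>R a) = 0"
      proof
        fix \<phi> assume \<phi>: "\<phi> \<in> \<Phi>"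
        then have "\<phi> \<in> dual_space" using True P_dual by blast
        then show "\<phi> (inverse (norm a) *\<^sub>R a) = 0" using a(1) \<phi> by (simp add: dual_spaceD(8))
      qed
      ultimately show ?thesis by blast
    qed (auto intro: exI[of _ 0])
    then have "\<exists>a. Q \<Phi> a" for \<Phi> by (simp only: Q_def)
    then obtain x where "\<And>\<Phi>. Q \<Phi> (x \<Phi>)" by metis
    then have x: "\<And>\<Phi>. finite \<Phi> \<Longrightarrow> \<Phi> \<subseteq> P \<Longrightarrow> (\<forall>\<phi>\<in>\<Phi>. \<phi> (x \<Phi>) = 0) \<and> cmod (f (x \<Phi>)) > e"
      "\<And>\<Phi>. norm (x \<Phi>) \<le> 1"
      by (auto simp: Q_def)
    obtain U where U: "ultrafilter U" "U \<le> finite_subsets_at_top P"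
      by (rule ultrafilter_exists[OF finite_subsets_at_top_neq_bot])
    note nb = ultrafilter_not_bot[OF U(1)]
    have bx: "bounded (range x)" using x(2) by (auto simp: bounded_iff)
    have "ultralimit U x = 0"
    proof (rule P_separates)
      fix \<phi> assume \<phi>: "\<phi> \<in> P"
      have "eventually (\<lambda>\<Phi>. finite \<Phi> \<and> {\<phi>} \<subseteq> \<Phi> \<and> \<Phi> \<subseteq> P) (finite_subsets_at_top P)"
        unfolding eventually_finite_subsets_at_top by (rule exI[of _ "{\<phi>}"]) (use \<phi> in auto)
      then have "eventually (\<lambda>\<Phi>. \<phi> (x \<Phi>) = 0) (finite_subsets_at_top P)"
        by (rule eventually_mono) (use x(1) in blast)
      then have "eventually (\<lambda>\<Phi>. \<phi> (x \<Phi>) = 0) U" using U(2) by (rule filter_leD[rotated])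
      then have "((\<lambda>\<Phi>. \<phi> (x \<Phi>)) \<longlongrightarrow> 0) U" by (rule tendsto_eventually)
      then have "\<phi> (ultralimit U x) = 0"
        by (rule tendsto_unique[OF nb ultralimit_tendsto[OF U(1) bx \<phi>]])
      then show "\<phi> (ultralimit U x) = \<phi> 0" by (simp add: dual_spaceD(6)[OF P_dual[OF \<phi>]])
    qed
    then have "((\<lambda>\<Phi>. cmod (f (x \<Phi>))) \<longlongrightarrow> 0) U"
      using tendsto_norm[OF cont[OF U(1) bx]] dual_spaceD(6)[OF f] by simp
    moreover have "eventually (\<lambda>\<Phi>. cmod (f (x \<Phi>)) \<ge> e) U"
    proof -
      have "eventually (\<lambda>\<Phi>. cmod (f (x \<Phi>)) \<ge> e) (finite_subsets_at_top P)"
        by (rule eventually_finite_subsets_at_top_weakI) (use x(1) in \<open>auto intro: less_imp_le\<close>)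
      then show ?thesis using U(2) by (rule filter_leD[rotated])
    qed
    ultimately have "e \<le> 0" by (rule tendsto_lowerbound[OF _ _ nb])
    then show False using e by simp
  qed
  have approx: "\<exists>\<psi>\<in>P. \<forall>a. cmod (f a - \<psi> a) \<le> e * norm a" if e: "e > 0" for e
  proof -
    obtain \<Phi> where \<Phi>: "finite \<Phi>" "\<Phi> \<subseteq> P" "\<And>a. (\<forall>\<phi>\<in>\<Phi>. \<phi> a = 0) \<Longrightarrow> cmod (f a) \<le> e * norm a"
      using small[OF e] by blast
    \<comment> \<open>The real parts of \<open>\<phi>\<close> and \<open>- \<i> \<phi>\<close> determine \<open>\<phi>\<close>.\<close>
    define \<Phi>' where "\<Phi>' = \<Phi> \<union> (\<lambda>\<phi> a. - \<i> * \<phi> a) ` \<Phi>"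
    have lin: "linear (\<lambda>a. Re (f a))"
      using bounded_linear.linear[OF dual_spaceD(1)[OF f]] by (auto simp: linear_iff)
    have "\<exists>\<psi>\<in>P. \<forall>a. Re (f a) - Re (\<psi> a) \<le> e * norm a"
    proof (rule approximation_from_kernel[of \<Phi>'])
      show "finite \<Phi>'" "\<Phi>' \<subseteq> P" using \<Phi>(1,2) P_scale[of _ "- \<i>"] by (auto simp: \<Phi>'_def)
      fix a assume a: "\<And>\<phi>. \<phi> \<in> \<Phi>' \<Longrightarrow> Re (\<phi> a) = 0"
      have "\<phi> a = 0" if "\<phi> \<in> \<Phi>" for \<phi>
      proof -
        have "Re (\<phi> a) = 0" "Re (- \<i> * \<phi> a) = 0"
          using a[of \<phi>] a[of "\<lambda>a. - \<i> * \<phi> a"] that by (auto simp: \<Phi>'_def)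
        then show ?thesis by (simp add: complex_eq_iff)
      qed
      then have "cmod (f a) \<le> e * norm a" using \<Phi>(3) by blast
      then show "Re (f a) \<le> e * norm a" using complex_Re_le_cmod[of "f a"] by linarith
    qed (use lin e in auto)
    then obtain \<psi> where \<psi>: "\<psi> \<in> P" "\<And>a. Re (f a) - Re (\<psi> a) \<le> e * norm a" by blast
    have "cmod (f a - \<psi> a) \<le> e * norm a" for a
    proof (cases "f a - \<psi> a = 0")
      case True
      then show ?thesis using e by simp
    next
      case False
      define z where "z = f a - \<psi> a"
      define c where "c = cnj z / cmod z"
      have z: "z \<noteq> 0" using False by (simp add: z_def)
      have c1: "cmod c = 1" using z by (simp add: c_def norm_divide)
      have "c * z = of_real (cmod z)"
        using z complex_norm_square[of z] by (simp add: c_def divide_simps power2_eq_square mult.commute)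
      then have "c * (f a - \<psi> a) = of_real (cmod (f a - \<psi> a))" by (simp only: z_def)
      then have "cmod (f a - \<psi> a) = Re (c * f a - c * \<psi> a)" by (simp add: right_diff_distrib[symmetric])
      also have "\<dots> = Re (f (c *\<^sub>C a)) - Re (\<psi> (c *\<^sub>C a))"
        using dual_spaceD(3)[OF f] dual_spaceD(3)[OF P_dual[OF \<psi>(1)]] by simp
      also have "\<dots> \<le> e * norm a" using \<psi>(2)[of "c *\<^sub>C a"] c1 by (simp add: norm_scaleC)
      finally show ?thesis .
    qed
    then show ?thesis using \<psi>(1) by blast
  qed
  have "\<exists>\<psi>. \<psi> \<in> P \<and> (\<forall>a. cmod (f a - \<psi> a) \<le> inverse (real (Suc n)) * norm a)" for n
    using approx[of "inverse (real (Suc n))"] by auto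
  then obtain \<psi> where \<psi>: "\<And>n. \<psi> n \<in> P" "\<And>n a. cmod (f a - \<psi> n a) \<le> inverse (real (Suc n)) * norm a"
    by metis
  show ?thesis
  proof (rule P_closed[OF \<psi>(1) f])
    have bl: "bounded_linear (\<lambda>a. \<psi> n a - f a)" for n
      by (rule bounded_linear_sub[OF dual_spaceD(1)[OF P_dual[OF \<psi>(1)]] dual_spaceD(1)[OF f]])
    show "(\<lambda>n. onorm (\<lambda>a. \<psi> n a - f a)) \<longlonglongrightarrow> 0"
    proof (rule tendsto_sandwich[OF _ _ tendsto_const LIMSEQ_inverse_real_of_nat])
      show "\<forall>\<^sub>F n in sequentially. 0 \<le> onorm (\<lambda>a. \<psi> n a - f a)" using onorm_pos_le[OF bl] by simp
      have "onorm (\<lambda>a. \<psi> n a - f a) \<le> inverse (real (Suc n))" for n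
        by (rule onorm_bound) (use \<psi>(2) in \<open>auto simp: norm_minus_commute\<close>)
      then show "\<forall>\<^sub>F n in sequentially. onorm (\<lambda>a. \<psi> n a - f a) \<le> inverse (real (Suc n))" by simp
    qed
  qed
qed

text \<open>
  Left multiplication commutes with ultralimits, which are norm one projections, and so preserves the
  continuity that characterizes \<open>P\<close>.
\<close>

lemma P_mult_left:
  assumes \<phi>: "\<phi> \<in> P"
  shows "(\<lambda>a. \<phi> (b * a)) \<in> P"
proof (rule P_memI)
  show "(\<lambda>a. \<phi> (b * a)) \<in> dual_space"
    unfolding dual_space_def
    using bounded_linear_compose[OF dual_spaceD(1)[OF P_dual[OF \<phi>]] bounded_linear_mult_right[of b]]
    by (simp add: mult_scaleC_right dual_spaceD(3)[OF P_dual[OF \<phi>]])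
  fix U :: "('a \<Rightarrow> complex) set filter" and x :: "('a \<Rightarrow> complex) set \<Rightarrow> 'a"
  assume U: "ultrafilter U" and x: "bounded (range x)"
  interpret norm_one_projection "ultralimit U" by (rule ultralimit_projection[OF U])
  have "((\<lambda>i. \<phi> (b * x i)) \<longlongrightarrow> \<phi> (ultralimit U (\<lambda>i. b * x i))) U"
    by (rule ultralimit_tendsto[OF U bounded_family_mult[OF x] \<phi>])
  then show "((\<lambda>i. \<phi> (b * x i)) \<longlongrightarrow> \<phi> (b * ultralimit U x)) U" by (simp add: E_mult_left[OF x])
qed

lemma P_star:
  assumes \<phi>: "\<phi> \<in> P"
  shows "(\<lambda>a. cnj (\<phi> (star a))) \<in> P"
proof (rule P_memI)
  show "(\<lambda>a. cnj (\<phi> (star a))) \<in> dual_space"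
    unfolding dual_space_def
    using bounded_linear_compose[OF bounded_linear_cnj
        bounded_linear_compose[OF dual_spaceD(1)[OF P_dual[OF \<phi>]] bounded_linear_star]]
    by (simp add: star_scaleC dual_spaceD(3)[OF P_dual[OF \<phi>]])
  fix U :: "('a \<Rightarrow> complex) set filter" and x :: "('a \<Rightarrow> complex) set \<Rightarrow> 'a"
  assume U: "ultrafilter U" and x: "bounded (range x)"
  interpret norm_one_projection "ultralimit U" by (rule ultralimit_projection[OF U])
  have "bounded (range (\<lambda>i. star (x i)))" using x by (simp add: bounded_iff)
  then have "((\<lambda>i. \<phi> (star (x i))) \<longlongrightarrow> \<phi> (ultralimit U (\<lambda>i. star (x i)))) U"
    by (rule ultralimit_tendsto[OF U _ \<phi>])
  then show "((\<lambda>i. cnj (\<phi> (star (x i)))) \<longlongrightarrow> cnj (\<phi> (star (ultralimit U x)))) U"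
    by (simp add: E_star[OF x] tendsto_cnj)
qed

lemma P_mult_right:
  assumes \<phi>: "\<phi> \<in> P"
  shows "(\<lambda>a. \<phi> (a * b)) \<in> P"
  using P_star[OF P_mult_left[OF P_star[OF \<phi>], of "star b"]] by (simp add: star_mult star_star)

end


section \<open>Positive functionals in the predual\<close>

lemma quadratic_discriminant_complex:
  fixes z :: complex
  assumes pos: "\<And>c. 0 \<le> A + 2 * Re (cnj c * z) + (cmod c)\<^sup>2 * B" and B: "B \<ge> 0"
  shows "(cmod z)\<^sup>2 \<le> A * B"
proof -
  have real: "0 \<le> A - 2 * t * cmod z + t\<^sup>2 * B" for t
  proof (cases "z = 0")
    case True
    then show ?thesis using pos[of "of_real t"] by simp
  next
    case False
    define c where "c = - of_real t * (z / cmod z)"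
    have "cnj c * z = - of_real t * (cnj z * z / cmod z)" by (simp add: c_def)
    also have "cnj z * z / cmod z = of_real (cmod z)"
      using False complex_norm_square[of z] by (simp add: mult.commute power2_eq_square divide_simps)
    finally have "Re (cnj c * z) = - (t * cmod z)" by simp
    moreover have "(cmod c)\<^sup>2 = t\<^sup>2" using False by (simp add: c_def norm_mult norm_divide)
    ultimately show ?thesis using pos[of c] by simp
  qed
  show ?thesis
  proof (cases "B = 0")
    case True
    have "cmod z \<le> 0"
    proof (rule ccontr)
      assume "\<not> ?thesis"
      then have "cmod z > 0" by simp
      then show False using real[of "(A + 1) / (2 * cmod z)"] True by (simp add: field_simps)
    qed
    then show ?thesis using True by simp
  next
    case False
    then have "B > 0" using B by simp
    then show ?thesis using real[of "cmod z / B"] by (simp add: power2_eq_square field_simps)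
  qed
qed

text \<open>
  The bound on \<open>\<psi> (a + \<i> t)\<close> by \<open>N * sqrt ((norm a)\<^sup>2 + t\<^sup>2)\<close> leaves no room for an imaginary part of
  \<open>\<psi> a\<close> when \<open>t\<close> is large, and the bound on \<open>\<psi> (norm a - a)\<close> by \<open>N * norm a\<close> keeps the real part
  nonnegative.
\<close>

lemma positive_functionalI:
  assumes \<psi>: "\<psi> \<in> dual_space" and one: "\<psi> 1 = of_real N" and bound: "\<And>a. cmod (\<psi> a) \<le> N * norm a"
    and N: "N > 0" and a: "positive a"
  shows "\<psi> a \<in> \<real>\<^sub>\<ge>\<^sub>0"
proof -
  have sa: "star a = a" by (rule positive_selfadj[OF a])
  have q: "(Im (\<psi> a))\<^sup>2 + 2 * t * N * Im (\<psi> a) \<le> N\<^sup>2 * (norm a)\<^sup>2" for t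
  proof -
    define y where "y = a + (\<i> * of_real t) *\<^sub>C 1"
    have "star y * y = a * a + (t * t) *\<^sub>R 1"
      by (simp add: y_def star_add star_scaleC sa algebra_simps scaleC_simps scaleC_of_real[symmetric])
    then have "(norm y)\<^sup>2 \<le> norm (a * a) + norm ((t * t) *\<^sub>R (1::'a))"
      by (metis cstar_identity norm_triangle_ineq)
    then have y: "(norm y)\<^sup>2 \<le> (norm a)\<^sup>2 + t\<^sup>2" by (simp add: norm_selfadj_square[OF sa] power2_eq_square[of t])
    have "\<psi> y = \<psi> a + \<i> * of_real (t * N)" by (simp add: y_def dual_spaceD[OF \<psi>] one)
    then have "\<bar>Im (\<psi> a) + t * N\<bar> \<le> cmod (\<psi> y)" using abs_Im_le_cmod[of "\<psi> y"] by simp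
    then have "\<bar>Im (\<psi> a) + t * N\<bar> \<le> N * norm y" using bound[of y] by linarith
    then have "(Im (\<psi> a) + t * N)\<^sup>2 \<le> (N * norm y)\<^sup>2" using N by (simp add: abs_le_square_iff[symmetric])
    also have "\<dots> \<le> N\<^sup>2 * ((norm a)\<^sup>2 + t\<^sup>2)" using y by (simp add: power_mult_distrib mult_left_mono)
    finally show ?thesis by (simp add: power2_eq_square algebra_simps)
  qed
  have "Im (\<psi> a) = 0"
  proof (rule ccontr)
    assume I: "Im (\<psi> a) \<noteq> 0"
    define t where "t = (N\<^sup>2 * (norm a)\<^sup>2 + 1) / (2 * N * Im (\<psi> a))"
    have "2 * t * N * Im (\<psi> a) = N\<^sup>2 * (norm a)\<^sup>2 + 1" using I N by (simp add: t_def field_simps)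
    then show False using q[of t] zero_le_power2[of "Im (\<psi> a)"] by linarith
  qed
  moreover have "Re (\<psi> a) \<ge> 0"
  proof -
    have "norm (norm a *\<^sub>R 1 - a) \<le> norm a" using a by (simp add: positive_iff pos_by_norm_canonical)
    then have "N * norm (norm a *\<^sub>R 1 - a) \<le> N * norm a" using N by (simp add: mult_left_mono)
    then have "cmod (\<psi> (norm a *\<^sub>R 1 - a)) \<le> N * norm a" using bound[of "norm a *\<^sub>R 1 - a"] by linarith
    moreover have "Re (\<psi> (norm a *\<^sub>R 1 - a)) = norm a * N - Re (\<psi> a)" by (simp add: dual_spaceD[OF \<psi>] one)
    ultimately show ?thesis using complex_Re_le_cmod[of "\<psi> (norm a *\<^sub>R 1 - a)"] by (simp add: mult.commute)
  qed
  ultimately show ?thesis by (auto simp: complex_nonneg_Reals_iff)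
qed

context predual
begin

abbreviation "P\<^sub>p \<equiv> positive_cone P"

lemma Pp_P: "\<phi> \<in> P\<^sub>p \<Longrightarrow> \<phi> \<in> P"
  by (simp add: positive_cone_def)

lemma Pp_dual: "\<phi> \<in> P\<^sub>p \<Longrightarrow> \<phi> \<in> dual_space"
  by (simp add: Pp_P P_dual)

lemma Pp_nonneg: "\<phi> \<in> P\<^sub>p \<Longrightarrow> positive a \<Longrightarrow> Re (\<phi> a) \<ge> 0"
  and Pp_real: "\<phi> \<in> P\<^sub>p \<Longrightarrow> positive a \<Longrightarrow> \<phi> a = of_real (Re (\<phi> a))"
  by (auto simp: positive_cone_def complex_nonneg_Reals_iff complex_eq_iff)

lemma Pp_0: "(\<lambda>a. 0) \<in> P\<^sub>p"
  by (simp add: positive_cone_def P_0)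

lemma Pp_add: "\<phi> \<in> P\<^sub>p \<Longrightarrow> \<psi> \<in> P\<^sub>p \<Longrightarrow> (\<lambda>a. \<phi> a + \<psi> a) \<in> P\<^sub>p"
  by (auto simp: positive_cone_def P_add nonneg_Reals_add_I)

lemma Pp_scale: "\<phi> \<in> P\<^sub>p \<Longrightarrow> r \<ge> 0 \<Longrightarrow> (\<lambda>a. of_real r * \<phi> a) \<in> P\<^sub>p"
  by (auto simp: positive_cone_def P_scale nonneg_Reals_mult_I)

lemma Pp_conj:
  assumes "\<phi> \<in> P\<^sub>p" shows "(\<lambda>a. \<phi> (star b * a * b)) \<in> P\<^sub>p"
proof -
  have "(\<lambda>a. \<phi> ((star b * a) * b)) \<in> P"
    by (rule P_mult_left[where \<phi> = "\<lambda>a. \<phi> (a * b)"]) (rule P_mult_right[OF Pp_P[OF assms]])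
  then show ?thesis using assms positive_conj by (auto simp: positive_cone_def)
qed

lemma Pp_mono: "\<phi> \<in> P\<^sub>p \<Longrightarrow> positive (b - a) \<Longrightarrow> Re (\<phi> a) \<le> Re (\<phi> b)"
  using Pp_nonneg[of \<phi> "b - a"] by (simp add: dual_spaceD[OF Pp_dual])

lemma Pp_selfadj:
  assumes \<phi>: "\<phi> \<in> P\<^sub>p" and a: "star a = a" shows "\<phi> a = of_real (Re (\<phi> a))"
proof -
  have "\<phi> (norm a *\<^sub>R 1 - a) = of_real (Re (\<phi> (norm a *\<^sub>R 1 - a)))"
    by (rule Pp_real[OF \<phi> positive_norm_minus[OF a]])
  moreover have "\<phi> 1 = of_real (Re (\<phi> 1))" by (rule Pp_real[OF \<phi>]) simp
  ultimately show ?thesis by (simp add: dual_spaceD[OF Pp_dual[OF \<phi>]] complex_eq_iff)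
qed

lemma Pp_star:
  assumes \<phi>: "\<phi> \<in> P\<^sub>p" shows "\<phi> (star a) = cnj (\<phi> a)"
proof -
  obtain b c where bc: "star b = b" "star c = c" "a = b + \<i> *\<^sub>C c" by (rule cartesian_decomposition)
  have "cnj (\<phi> b) = \<phi> b" "cnj (\<phi> c) = \<phi> c"
    using Pp_selfadj[OF \<phi> bc(1)] Pp_selfadj[OF \<phi> bc(2)] by (metis complex_cnj_complex_of_real)+
  then show ?thesis
    by (simp add: bc star_add star_scaleC scaleC_simps dual_spaceD[OF Pp_dual[OF \<phi>]])
qed

lemma Pp_Cauchy_Schwarz:
  assumes \<phi>: "\<phi> \<in> P\<^sub>p"
  shows "(cmod (\<phi> (star a * b)))\<^sup>2 \<le> Re (\<phi> (star b * b)) * Re (\<phi> (star a * a))"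
proof (rule quadratic_discriminant_complex)
  note lin = dual_spaceD[OF Pp_dual[OF \<phi>]]
  show "Re (\<phi> (star a * a)) \<ge> 0" by (simp add: Pp_nonneg[OF \<phi>])
  fix c
  have "0 \<le> Re (\<phi> (star (b + c *\<^sub>C a) * (b + c *\<^sub>C a)))" by (simp add: Pp_nonneg[OF \<phi>])
  also have "star (b + c *\<^sub>C a) * (b + c *\<^sub>C a)
      = star b * b + cnj c *\<^sub>C (star a * b) + star (cnj c *\<^sub>C (star a * b)) + (c * cnj c) *\<^sub>C (star a * a)"
    by (simp add: star_add star_scaleC star_mult star_star distrib_left distrib_right scaleC_simps mult.commute)
  also have "\<phi> \<dots> = \<phi> (star b * b) + cnj c * \<phi> (star a * b) + cnj (cnj c * \<phi> (star a * b)) + (c * cnj c) * \<phi> (star a * a)"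
    by (simp only: lin Pp_star[OF \<phi>])
  also have "c * cnj c = of_real ((cmod c)\<^sup>2)" by (rule complex_norm_square[symmetric])
  finally show "0 \<le> Re (\<phi> (star b * b)) + 2 * Re (cnj c * \<phi> (star a * b)) + (cmod c)\<^sup>2 * Re (\<phi> (star a * a))"
    by simp
qed

lemma Pp_square_bound:
  assumes "\<phi> \<in> P\<^sub>p"
  shows "(cmod (\<phi> a))\<^sup>2 \<le> Re (\<phi> 1) * Re (\<phi> (star a * a))"
    and "(cmod (\<phi> a))\<^sup>2 \<le> Re (\<phi> 1) * Re (\<phi> (a * star a))"
  using Pp_Cauchy_Schwarz[OF assms, of 1 a] Pp_Cauchy_Schwarz[OF assms, of "star a" 1]
  by (simp_all add: star_star mult.commute)

lemma norm_attaining_sequence: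
  assumes \<phi>: "\<phi> \<in> P" and e: "e > 0"
  obtains a r where "norm a \<le> 1" "\<phi> a = complex_of_real r" "onorm \<phi> - e < r" "r \<le> onorm \<phi>"
proof -
  note lin = dual_spaceD[OF P_dual[OF \<phi>]]
  have "\<exists>a. cmod (\<phi> a) > (onorm \<phi> - e) * norm a"
  proof (rule ccontr)
    assume "\<not> ?thesis"
    then have "onorm \<phi> \<le> onorm \<phi> - e" by (intro onorm_le) (simp add: not_less)
    then show False using e by simp
  qed
  then obtain a where a: "cmod (\<phi> a) > (onorm \<phi> - e) * norm a" by blast
  then have a0: "a \<noteq> 0" by (auto simp: lin)
  define z where "z = \<phi> a"
  define c where "c = (if z = 0 then 1 else cnj z / cmod z)"
  have c: "cmod c = 1" by (simp add: c_def norm_divide)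
  have cz: "c * z = of_real (cmod z)"
    using complex_norm_square[of z] by (simp add: c_def divide_simps power2_eq_square mult.commute)
  define b where "b = inverse (norm a) *\<^sub>R (c *\<^sub>C a)"
  have b1: "norm b \<le> 1" using a0 c by (simp add: b_def norm_scaleC)
  have b2: "\<phi> b = of_real (cmod z / norm a)"
    by (simp add: b_def lin z_def[symmetric] cz) (simp add: scaleR_conv_of_real divide_inverse mult.commute)
  have "onorm \<phi> - e < cmod z / norm a" using a a0 by (simp add: z_def field_simps)
  moreover have "cmod z / norm a \<le> onorm \<phi>" using lin(7)[of a] a0 by (simp add: z_def field_simps)
  ultimately show ?thesis using that b1 b2 by blast
qed

text \<open>
  The unit ball is weak* compact: the ultralimit of a norming sequence attains the norm.
\<close>

lemma norm_attained:
  assumes \<phi>: "\<phi> \<in> P"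
  obtains b where "norm b \<le> 1" "\<phi> b = of_real (onorm \<phi>)"
proof -
  have "\<exists>a r. norm a \<le> 1 \<and> \<phi> a = complex_of_real r \<and> onorm \<phi> - inverse (real (Suc n)) < r \<and> r \<le> onorm \<phi>" for n
  proof -
    have "inverse (real (Suc n)) > 0" by simp
    then show ?thesis by (rule norm_attaining_sequence[OF \<phi>]) blast
  qed
  then obtain a r where a: "\<And>n. norm (a n) \<le> 1" and r: "\<And>n. \<phi> (a n) = complex_of_real (r n)"
    "\<And>n. onorm \<phi> - inverse (real (Suc n)) < r n" "\<And>n. r n \<le> onorm \<phi>"
    by metis
  have "r \<longlonglongrightarrow> onorm \<phi>"
  proof (rule tendsto_sandwich[OF _ _ _ tendsto_const])
    show "(\<lambda>n. onorm \<phi> - inverse (real (Suc n))) \<longlonglongrightarrow> onorm \<phi>"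
      using tendsto_diff[OF tendsto_const LIMSEQ_inverse_real_of_nat, of "onorm \<phi>"] by simp
    show "\<forall>\<^sub>F n in sequentially. onorm \<phi> - inverse (real (Suc n)) \<le> r n"
      by (intro always_eventually allI less_imp_le r(2))
    show "\<forall>\<^sub>F n in sequentially. r n \<le> onorm \<phi>" by (intro always_eventually allI r(3))
  qed
  then have lim: "(\<lambda>n. \<phi> (a n)) \<longlonglongrightarrow> of_real (onorm \<phi>)" unfolding r(1) by (rule tendsto_of_real)
  obtain U where U: "ultrafilter U" "U \<le> (sequentially :: nat filter)"
    by (rule ultrafilter_exists[OF sequentially_bot])
  have b: "bounded (range a)" using a by (auto simp: bounded_iff)
  have "((\<lambda>n. \<phi> (a n)) \<longlongrightarrow> \<phi> (ultralimit U a)) U" by (rule ultralimit_tendsto[OF U(1) b \<phi>])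
  moreover have "((\<lambda>n. \<phi> (a n)) \<longlongrightarrow> of_real (onorm \<phi>)) U" by (rule tendsto_mono[OF U(2) lim])
  ultimately have "\<phi> (ultralimit U a) = of_real (onorm \<phi>)" by (rule tendsto_unique[OF ultrafilter_not_bot[OF U(1)]])
  moreover have "norm (ultralimit U a) \<le> 1"
    by (rule norm_one_projection.E_norm[OF ultralimit_projection[OF U(1)] a])
  ultimately show ?thesis using that by blast
qed

text \<open>
  If \<open>\<phi>\<close> attains its norm at a contraction \<open>b\<close>, then adding a multiple of \<open>s x\<close> to
  \<open>b\<close>, where \<open>s\<^sup>2 = 1 - b b\<^sup>*\<close>, changes the norm of \<open>b\<close> in second order only, so that \<open>\<phi>\<close>
  vanishes on \<open>s x\<close>.
\<close>

lemma norm_attained_support: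
  assumes \<phi>: "\<phi> \<in> P" and b: "norm b \<le> 1" "\<phi> b = of_real (onorm \<phi>)"
  shows "\<phi> (b * star b * a) = \<phi> a"
proof -
  note lin = dual_spaceD[OF P_dual[OF \<phi>]]
  define N where "N = onorm \<phi>"
  have N0: "N \<ge> 0" by (simp add: N_def lin)
  have "norm (b * star b) \<le> 1 * 1" using b(1) by (intro order_trans[OF norm_mult_ineq] mult_mono) auto
  then have "positive (1 *\<^sub>R 1 - b * star b)"
    by (intro positive_scaled_one_minus) (auto simp: star_mult star_star)
  then have "positive (1 - b * star b)" by simp
  then obtain s where s: "positive s" "s * s = 1 - b * star b" by (rule positive_sqrt) blast
  have ss: "star s = s" by (rule positive_selfadj[OF s(1)])
  have nonpos: "r \<le> 0" if r: "\<phi> (s * x) = of_real r" for x r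
  proof -
    have key: "2 * r * N \<le> N\<^sup>2 * t * (norm x)\<^sup>2" if t: "t > 0" for t
    proof -
      define d where "d = t *\<^sub>R x"
      define y where "y = b + s * d"
      have bs: "b * (star b * y) = y - s * (s * y)"
        unfolding mult.assoc[symmetric] s(2) by (simp add: left_diff_distrib)
      have "star (1 - star b * y) * (1 - star b * y) + star (d - s * y) * (d - s * y)
         = 1 + star d * d - star y * (b + s * d) - (star b * y + star d * (s * y)) + star y * (b * (star b * y) + s * (s * y))"
        by (simp add: star_diff star_mult star_star ss algebra_simps)
      also have "star b * y + star d * (s * y) = star (b + s * d) * y"
        by (simp add: star_add star_mult ss distrib_right mult.assoc)
      also have "1 + star d * d - star y * (b + s * d) - star (b + s * d) * y + star y * (b * (star b * y) + s * (s * y))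
         = (1 + star d * d) - star y * y"
        unfolding bs y_def[symmetric] by (simp add: algebra_simps)
      finally have "positive ((1 + star d * d) - star y * y)"
        by (metis positive_add positive_star_mult)
      then have "norm (star y * y) \<le> norm (1 + star d * d)" by (rule norm_mono_positive[rotated]) simp
      also have "\<dots> \<le> 1 + (norm d)\<^sup>2" using norm_triangle_ineq[of 1 "star d * d"] by (simp add: cstar_identity)
      finally have y1: "(norm y)\<^sup>2 \<le> 1 + t\<^sup>2 * (norm x)\<^sup>2"
        by (simp add: cstar_identity d_def power_mult_distrib)
      have "\<phi> (t *\<^sub>R (s * x)) = of_real (t * r)" by (simp only: lin r) (simp add: scaleR_conv_of_real)
      then have "\<phi> y = of_real (N + t * r)" by (simp add: y_def d_def lin(2) b(2) N_def)
      then have "\<bar>N + t * r\<bar> \<le> N * norm y" using lin(7)[of y] by (simp only: norm_of_real N_def)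
      then have "(N + t * r)\<^sup>2 \<le> (N * norm y)\<^sup>2" using N0 by (simp add: abs_le_square_iff[symmetric])
      also have "\<dots> \<le> N\<^sup>2 * (1 + t\<^sup>2 * (norm x)\<^sup>2)" using y1 by (simp add: power_mult_distrib mult_left_mono)
      finally have "t * (2 * r * N) + (t * r)\<^sup>2 \<le> t * (N\<^sup>2 * t * (norm x)\<^sup>2)"
        by (simp add: power2_eq_square algebra_simps)
      then have "t * (2 * r * N) \<le> t * (N\<^sup>2 * t * (norm x)\<^sup>2)" using zero_le_power2[of "t * r"] by linarith
      then show ?thesis using t by simp
    qed
    show ?thesis
    proof (rule ccontr)
      assume "\<not> r \<le> 0"
      then have r0: "r > 0" by simp
      have "r \<le> N * norm (s * x)" using lin(7)[of "s * x"] r r0 by (simp add: N_def)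
      then have N1: "N > 0" using r0 N0 by (cases "N = 0") auto
      define q where "q = (norm x)\<^sup>2 + 1"
      have q: "q > 0" by (simp add: q_def add_nonneg_pos)
      define t where "t = r / (N * q)"
      have t: "t > 0" using r0 N1 q by (simp add: t_def)
      have "N\<^sup>2 * t * (norm x)\<^sup>2 \<le> N\<^sup>2 * t * q"
        using t by (intro mult_left_mono) (auto simp: q_def)
      also have "\<dots> = N * r" using N1 q by (simp add: t_def power2_eq_square)
      finally have "2 * (N * r) \<le> N * r" using key[OF t] by (simp add: mult.assoc mult.commute mult.left_commute)
      then show False using mult_pos_pos[OF N1 r0] by simp
    qed
  qed
  have zero: "\<phi> (s * x) = 0" for x
  proof -
    define z where "z = \<phi> (s * x)"
    have "cmod z \<le> 0"
    proof (rule nonpos)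
      show "\<phi> (s * ((if z = 0 then 1 else cnj z / cmod z) *\<^sub>C x)) = of_real (cmod z)"
        using complex_norm_square[of z]
        by (simp add: mult_scaleC_right lin z_def[symmetric] divide_simps power2_eq_square mult.commute)
    qed
    then show ?thesis by (simp add: z_def)
  qed
  have "b * star b * a = a - s * (s * a)"
    unfolding mult.assoc[symmetric, of s s a] s(2) by (simp add: left_diff_distrib)
  then show ?thesis by (simp only: lin zero diff_zero)
qed

text \<open>
  By polarization of \<open>\<phi> = \<psi>(b\<^sup>* \<cdot>)\<close>, where \<open>\<psi> = \<phi>(b \<cdot>)\<close> is positive.
\<close>

lemma positive_decomposition:
  assumes \<phi>: "\<phi> \<in> P"
  shows "\<exists>\<psi>0\<in>P\<^sub>p. \<exists>\<psi>1\<in>P\<^sub>p. \<exists>\<psi>2\<in>P\<^sub>p. \<exists>\<psi>3\<in>P\<^sub>p. (\<forall>a. \<phi> a = \<psi>0 a - \<psi>2 a + \<i> * (\<psi>3 a - \<psi>1 a)) \<and>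
    Re (\<psi>0 1) \<le> onorm \<phi> \<and> Re (\<psi>1 1) \<le> onorm \<phi> \<and> Re (\<psi>2 1) \<le> onorm \<phi> \<and> Re (\<psi>3 1) \<le> onorm \<phi>"
proof (cases "onorm \<phi> = 0")
  case True
  then have "\<phi> a = 0" for a using dual_spaceD(7)[OF P_dual[OF \<phi>], of a] by simp
  then show ?thesis using True Pp_0 by (intro bexI[of _ "\<lambda>a. 0"]) auto
next
  case False
  then have N: "onorm \<phi> > 0" using dual_spaceD(9)[OF P_dual[OF \<phi>]] by simp
  obtain b where b: "norm b \<le> 1" "\<phi> b = of_real (onorm \<phi>)" by (rule norm_attained[OF \<phi>])
  define \<psi> where "\<psi> a = \<phi> (b * a)" for a
  have \<psi>P: "\<psi> \<in> P" unfolding \<psi>_def by (rule P_mult_left[OF \<phi>])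
  note lin = dual_spaceD[OF P_dual[OF \<psi>P]]
  have bound: "cmod (\<psi> a) \<le> onorm \<phi> * norm a" for a
  proof -
    have "cmod (\<psi> a) \<le> onorm \<phi> * norm (b * a)" unfolding \<psi>_def by (rule dual_spaceD(7)[OF P_dual[OF \<phi>]])
    also have "norm (b * a) \<le> 1 * norm a" using b(1) by (intro order_trans[OF norm_mult_ineq] mult_right_mono) auto
    finally show ?thesis using N by (simp add: mult_left_mono)
  qed
  have \<psi>: "\<psi> \<in> P\<^sub>p"
    unfolding positive_cone_def
    using \<psi>P positive_functionalI[OF P_dual[OF \<psi>P] _ bound N] b(2) by (auto simp: \<psi>_def)
  define \<eta> where "\<eta> c a = of_real (1/4) * \<psi> (star (b + c *\<^sub>C 1) * a * (b + c *\<^sub>C 1))" for c a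
  have \<eta>: "\<eta> c \<in> P\<^sub>p" for c
    unfolding \<eta>_def by (rule Pp_scale[OF Pp_conj[OF \<psi>]]) simp
  have \<eta>1: "Re (\<eta> c 1) \<le> onorm \<phi>" if c: "cmod c = 1" for c
  proof -
    have "norm (b + c *\<^sub>C 1) \<le> 2" using norm_triangle_ineq[of b "c *\<^sub>C 1"] b(1) c by (simp add: norm_scaleC)
    then have "(norm (b + c *\<^sub>C 1))\<^sup>2 \<le> 2\<^sup>2" by (rule power_mono) simp
    then have "norm (star (b + c *\<^sub>C 1) * (b + c *\<^sub>C 1)) \<le> 4" by (simp add: cstar_identity)
    then have "onorm \<phi> * norm (star (b + c *\<^sub>C 1) * (b + c *\<^sub>C 1)) \<le> onorm \<phi> * 4"
      using N by (intro mult_left_mono) auto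
    then have "cmod (\<psi> (star (b + c *\<^sub>C 1) * (b + c *\<^sub>C 1))) \<le> onorm \<phi> * 4" using bound order_trans by blast
    then show ?thesis
      using complex_Re_le_cmod[of "\<psi> (star (b + c *\<^sub>C 1) * (b + c *\<^sub>C 1))"] by (simp add: \<eta>_def)
  qed
  have "\<phi> a = \<eta> 1 a - \<eta> (- 1) a + \<i> * (\<eta> (- \<i>) a - \<eta> \<i> a)" for a
  proof -
    have e: "\<eta> c a = (\<psi> (star b * a * b) + cnj c * \<psi> (a * b) + c * \<psi> (star b * a) + (c * cnj c) * \<psi> a) / 4" for c
      by (simp add: \<eta>_def star_add star_scaleC distrib_left distrib_right scaleC_simps lin)
    have "\<phi> a = \<psi> (star b * a)"
      using norm_attained_support[OF \<phi> b, of a] by (simp add: \<psi>_def mult.assoc)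
    then show ?thesis unfolding e by (simp add: field_simps)
  qed
  then show ?thesis
    by (intro bexI[of _ "\<eta> 1"] bexI[of _ "\<eta> \<i>"] bexI[of _ "\<eta> (- 1)"] bexI[of _ "\<eta> (- \<i>)"] \<eta>)
      (simp add: \<eta>1)
qed

lemma Pp_separates:
  assumes "\<And>\<phi>. \<phi> \<in> P\<^sub>p \<Longrightarrow> \<phi> a = \<phi> b" shows "a = b"
proof (rule P_separates)
  fix \<phi> assume "\<phi> \<in> P"
  then obtain \<psi>0 \<psi>1 \<psi>2 \<psi>3 where "\<psi>0 \<in> P\<^sub>p" "\<psi>1 \<in> P\<^sub>p" "\<psi>2 \<in> P\<^sub>p" "\<psi>3 \<in> P\<^sub>p"
    "\<forall>a. \<phi> a = \<psi>0 a - \<psi>2 a + \<i> * (\<psi>3 a - \<psi>1 a)"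
    using positive_decomposition by blast
  moreover from this have "\<psi>0 a = \<psi>0 b" "\<psi>1 a = \<psi>1 b" "\<psi>2 a = \<psi>2 b" "\<psi>3 a = \<psi>3 b"
    by (auto intro: assms)
  ultimately show "\<phi> a = \<phi> b" by simp
qed

text \<open>
  Compressing the test functionals by the negative part \<open>p\<close> of \<open>a\<close> shows that \<open>p a p = 0\<close>.
\<close>

lemma Pp_detects_positive:
  assumes nonneg: "\<And>\<phi>. \<phi> \<in> P\<^sub>p \<Longrightarrow> \<phi> a \<in> \<real>\<^sub>\<ge>\<^sub>0" shows "positive a"
proof -
  have "star a = a"
  proof (rule Pp_separates)
    fix \<phi> assume \<phi>: "\<phi> \<in> P\<^sub>p"
    show "\<phi> (star a) = \<phi> a"
      using nonneg[OF \<phi>] by (simp add: Pp_star[OF \<phi>] complex_nonneg_Reals_iff complex_eq_iff)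
  qed
  then obtain p where p: "star p = p" "pos_by_norm (- (p * a * p))" "p * a * p = 0 \<longrightarrow> pos_by_norm a"
    by (rule negative_part) blast
  have "p * a * p = 0"
  proof (rule Pp_separates)
    fix \<phi> assume \<phi>: "\<phi> \<in> P\<^sub>p"
    have "\<phi> (star p * a * p) \<in> \<real>\<^sub>\<ge>\<^sub>0" by (rule nonneg[OF Pp_conj[OF \<phi>]])
    moreover have "\<phi> (- (p * a * p)) \<in> \<real>\<^sub>\<ge>\<^sub>0"
      using \<phi> p(2) by (auto simp: positive_cone_def positive_iff)
    ultimately show "\<phi> (p * a * p) = \<phi> 0"
      by (simp add: p(1) dual_spaceD[OF Pp_dual[OF \<phi>]] complex_nonneg_Reals_iff complex_eq_iff)
  qed
  then show ?thesis using p(3) by (simp add: positive_iff)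
qed

lemma positive_le_scaled_one:
  assumes "star a = a" "\<And>\<phi>. \<phi> \<in> P\<^sub>p \<Longrightarrow> Re (\<phi> a) \<le> C * Re (\<phi> 1)" shows "positive (C *\<^sub>R 1 - a)"
proof (rule Pp_detects_positive)
  fix \<phi> assume \<phi>: "\<phi> \<in> P\<^sub>p"
  have "\<phi> 1 = of_real (Re (\<phi> 1))" by (rule Pp_real[OF \<phi>]) simp
  moreover have "\<phi> a = of_real (Re (\<phi> a))" by (rule Pp_selfadj[OF \<phi> assms(1)])
  ultimately show "\<phi> (C *\<^sub>R 1 - a) \<in> \<real>\<^sub>\<ge>\<^sub>0"
    using assms(2)[OF \<phi>] by (simp add: dual_spaceD[OF Pp_dual[OF \<phi>]] complex_nonneg_Reals_iff complex_eq_iff)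
qed

end


section \<open>Modules with a semi-inner product and their duals\<close>

text \<open>
  The operations are tied to the form \<open>k\<close> only. The typical elements are formal sums represented by
  lists, which satisfy the laws of a module only up to the kernel of \<open>k\<close>.
\<close>

locale semi_inner_module =
  fixes E :: "'s set" and add :: "'s \<Rightarrow> 's \<Rightarrow> 's" and scl :: "complex \<Rightarrow> 's \<Rightarrow> 's"
    and act :: "'s \<Rightarrow> 'a::cstar_algebra \<Rightarrow> 's" and k :: "'s \<Rightarrow> 's \<Rightarrow> 'a"
  assumes E_nonempty: "E \<noteq> {}"
    and add_closed: "e \<in> E \<Longrightarrow> f \<in> E \<Longrightarrow> add e f \<in> E"
    and scl_closed: "e \<in> E \<Longrightarrow> scl c e \<in> E"
    and act_closed: "e \<in> E \<Longrightarrow> act e a \<in> E"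
    and k_add: "d \<in> E \<Longrightarrow> e \<in> E \<Longrightarrow> f \<in> E \<Longrightarrow> k d (add e f) = k d e + k d f"
    and k_scl: "d \<in> E \<Longrightarrow> e \<in> E \<Longrightarrow> k d (scl c e) = c *\<^sub>C k d e"
    and k_act: "d \<in> E \<Longrightarrow> e \<in> E \<Longrightarrow> k d (act e a) = k d e * a"
    and k_star: "e \<in> E \<Longrightarrow> f \<in> E \<Longrightarrow> star (k e f) = k f e"
    and k_positive: "e \<in> E \<Longrightarrow> positive (k e e)"
begin

lemmas closed = add_closed scl_closed act_closed

lemma k_add_left: "d \<in> E \<Longrightarrow> e \<in> E \<Longrightarrow> f \<in> E \<Longrightarrow> k (add e f) d = k e d + k f d"
  using k_star[of d "add e f"] k_add[of d e f] by (simp add: closed star_add k_star)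

lemma k_scl_left: "d \<in> E \<Longrightarrow> e \<in> E \<Longrightarrow> k (scl c e) d = cnj c *\<^sub>C k e d"
  using k_star[of d "scl c e"] k_scl[of d e c] by (simp add: closed star_scaleC k_star)

lemma k_act_left: "d \<in> E \<Longrightarrow> e \<in> E \<Longrightarrow> k (act e a) d = star a * k e d"
  using k_star[of d "act e a"] k_act[of d e a] by (simp add: closed star_mult k_star)

lemmas k_expand = k_add k_scl k_act k_add_left k_scl_left k_act_left closed

lemma Cauchy_Schwarz_scaled:
  assumes e: "e \<in> E" and f: "f \<in> E" and c: "c > 0" "c \<ge> norm (k e e)"
  shows "(norm (k e f))\<^sup>2 \<le> c * norm (k f f)"
proof -
  define y where "y = k e f"
  define g where "g = add f (scl (- 1) (act e (inverse c *\<^sub>R y)))"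
  have "positive (k g g)" using e f by (intro k_positive) (simp add: g_def closed)
  also have "k g g = k f f - (2 * inverse c) *\<^sub>R (star y * y) + (inverse c * inverse c) *\<^sub>R (star y * k e e * y)"
  proof -
    have "star y = k f e" using k_star[OF e f] by (simp add: y_def)
    then have "k g g = k f f - inverse c *\<^sub>R (star y * y) - inverse c *\<^sub>R (star y * y)
        + (inverse c * inverse c) *\<^sub>R (star y * k e e * y)"
      using e f by (simp add: g_def k_expand scaleC_simps) (simp add: y_def[symmetric] algebra_simps)
    then show ?thesis by (simp only: mult_2 scaleR_add_left) simp
  qed
  finally have 1: "positive (k f f - (2 * inverse c) *\<^sub>R (star y * y) + (inverse c * inverse c) *\<^sub>R (star y * k e e * y))" .
  have "positive (c *\<^sub>R 1 - k e e)"
    by (rule positive_scaled_one_minus[OF positive_selfadj[OF k_positive[OF e]] c(2)])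
  then have "positive (star y * (c *\<^sub>R 1 - k e e) * y)" by (rule positive_conj)
  then have 2: "positive ((inverse c * inverse c) *\<^sub>R (star y * (c *\<^sub>R 1 - k e e) * y))"
    using c by (intro positive_scaleR) auto
  have 3: "(inverse c * inverse c) *\<^sub>R (star y * (c *\<^sub>R 1 - k e e) * y)
     = inverse c *\<^sub>R (star y * y) - (inverse c * inverse c) *\<^sub>R (star y * k e e * y)"
    using c by (simp add: right_diff_distrib left_diff_distrib scaleR_diff_right mult.assoc)
  have 4: "(2 * inverse c) *\<^sub>R (star y * y) = inverse c *\<^sub>R (star y * y) + inverse c *\<^sub>R (star y * y)"
    by (simp only: mult_2 scaleR_add_left)
  have "positive (k f f - inverse c *\<^sub>R (star y * y))"
    using positive_add[OF 1 2] unfolding 3 4 by (simp add: algebra_simps)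
  then have "norm (inverse c *\<^sub>R (star y * y)) \<le> norm (k f f)"
    using c by (intro norm_mono_positive positive_scaleR) auto
  then show ?thesis using c by (simp add: cstar_identity y_def field_simps)
qed

lemma Cauchy_Schwarz:
  assumes e: "e \<in> E" and f: "f \<in> E"
  shows "(norm (k e f))\<^sup>2 \<le> norm (k e e) * norm (k f f)"
proof (rule field_le_epsilon)
  fix d :: real assume d: "d > 0"
  define r where "r = d / (norm (k f f) + 1)"
  have p: "norm (k f f) + 1 > 0" by (simp add: add_nonneg_pos)
  have r: "r > 0" using d p by (simp add: r_def)
  have "(norm (k e f))\<^sup>2 \<le> (norm (k e e) + r) * norm (k f f)"
    by (rule Cauchy_Schwarz_scaled[OF e f]) (use r in \<open>auto simp: add_nonneg_pos\<close>)
  also have "r * norm (k f f) \<le> r * (norm (k f f) + 1)" using r by (intro mult_left_mono) auto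
  then have "(norm (k e e) + r) * norm (k f f) \<le> norm (k e e) * norm (k f f) + d"
    using p by (simp add: distrib_right r_def)
  finally show "(norm (k e f))\<^sup>2 \<le> norm (k e e) * norm (k f f) + d" .
qed

text \<open>
  The bounded functionals of the form \<open>\<langle>\<cdot>|F\<rangle>\<close>. The bound is kept as a separate predicate because
  its least constant becomes the norm of \<open>\<langle>F|F\<rangle>\<close>.
\<close>

definition functional_bound :: "real \<Rightarrow> ('s \<Rightarrow> 'a) \<Rightarrow> bool" where
  "functional_bound C F \<longleftrightarrow> C \<ge> 0 \<and> (\<forall>e\<in>E. (norm (F e))\<^sup>2 \<le> C * norm (k e e))"

definition dual :: "('s \<Rightarrow> 'a) set" where
  "dual = {F. (\<forall>e\<in>E. \<forall>f\<in>E. F (add e f) = F e + F f) \<and>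
    (\<forall>e\<in>E. \<forall>c. F (scl c e) = cnj c *\<^sub>C F e) \<and> (\<forall>e\<in>E. \<forall>a. F (act e a) = star a * F e) \<and>
    (\<exists>C. functional_bound C F)}"

lemma dualD:
  assumes "F \<in> dual" "e \<in> E"
  shows "f \<in> E \<Longrightarrow> F (add e f) = F e + F f" "F (scl c e) = cnj c *\<^sub>C F e" "F (act e a) = star a * F e"
  using assms by (auto simp: dual_def)

lemma dual_bound: 
  assumes "F \<in> dual" obtains C where "functional_bound C F"
  using assms by (auto simp: dual_def)

text \<open>
  The norm bound at all multiples \<open>e a\<close> amounts to an inequality in the order of the algebra.
\<close>

lemma functional_bound_order:
  assumes F: "F \<in> dual" and C: "functional_bound C F" and e: "e \<in> E"
  shows "positive (C *\<^sub>R k e e - F e * star (F e))"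
proof -
  have "positive (C *\<^sub>R k e e - star (star (F e)) * star (F e))"
  proof (rule positive_of_norm_bound[OF k_positive[OF e]])
    show "C \<ge> 0" using C by (simp add: functional_bound_def)
    fix a
    have "star (F e) * a = star (F (act e a))" by (simp add: dualD[OF F e] star_mult star_star)
    moreover have "(norm (F (act e a)))\<^sup>2 \<le> C * norm (k (act e a) (act e a))"
      using C closed(3)[OF e] by (simp add: functional_bound_def)
    moreover have "k (act e a) (act e a) = star a * k e e * a" using e by (simp add: k_expand mult.assoc)
    ultimately show "(norm (star (F e) * a))\<^sup>2 \<le> C * norm (star a * k e e * a)" by simp
  qed
  then show ?thesis by (simp add: star_star)
qed

definition embed :: "'s \<Rightarrow> 's \<Rightarrow> 'a" where
  "embed e = (\<lambda>e'. k e' e)"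

lemma embed_bound: "e \<in> E \<Longrightarrow> functional_bound (norm (k e e)) (embed e)"
  using Cauchy_Schwarz by (auto simp: functional_bound_def embed_def mult.commute)

lemma embed_dual: "e \<in> E \<Longrightarrow> embed e \<in> dual"
  using embed_bound[of e] by (auto simp: dual_def embed_def k_expand)

lemma dual_add:
  assumes F: "F \<in> dual" and G: "G \<in> dual" shows "(\<lambda>e. F e + G e) \<in> dual"
proof -
  obtain C D where C: "functional_bound C F" and D: "functional_bound D G" using F G by (auto simp: dual_def)
  have "functional_bound (2 * C + 2 * D) (\<lambda>e. F e + G e)"
    unfolding functional_bound_def
  proof (intro conjI ballI)
    show "0 \<le> 2 * C + 2 * D" using C D by (simp add: functional_bound_def)
    fix e assume e: "e \<in> E"
    have "(norm (F e + G e))\<^sup>2 \<le> (norm (F e) + norm (G e))\<^sup>2" by (intro power_mono norm_triangle_ineq) auto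
    also have "\<dots> \<le> 2 * (norm (F e))\<^sup>2 + 2 * (norm (G e))\<^sup>2"
      using zero_le_power2[of "norm (F e) - norm (G e)"] by (simp add: power2_eq_square algebra_simps)
    also have "\<dots> \<le> 2 * (C * norm (k e e)) + 2 * (D * norm (k e e))"
      using C D e by (intro add_mono mult_left_mono) (auto simp: functional_bound_def)
    finally show "(norm (F e + G e))\<^sup>2 \<le> (2 * C + 2 * D) * norm (k e e)" by (simp add: algebra_simps)
  qed
  then show ?thesis using dualD[OF F] dualD[OF G] by (auto simp: dual_def scaleC_simps distrib_left)
qed

lemma dual_act:
  assumes F: "F \<in> dual" shows "(\<lambda>e. F e * a) \<in> dual"
proof -
  obtain C where C: "functional_bound C F" using F by (auto simp: dual_def)
  have "functional_bound (C * (norm a)\<^sup>2) (\<lambda>e. F e * a)"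
    unfolding functional_bound_def
  proof (intro conjI ballI)
    show "0 \<le> C * (norm a)\<^sup>2" using C by (simp add: functional_bound_def)
    fix e assume e: "e \<in> E"
    have "(norm (F e * a))\<^sup>2 \<le> (norm (F e) * norm a)\<^sup>2" by (intro power_mono norm_mult_ineq) auto
    also have "\<dots> \<le> (C * norm (k e e)) * (norm a)\<^sup>2"
      using C e by (simp add: power_mult_distrib functional_bound_def mult_right_mono)
    finally show "(norm (F e * a))\<^sup>2 \<le> C * (norm a)\<^sup>2 * norm (k e e)" by (simp add: algebra_simps)
  qed
  then show ?thesis using dualD[OF F] by (auto simp: dual_def scaleC_simps distrib_right mult.assoc)
qed

lemma dual_scl:
  assumes F: "F \<in> dual" shows "(\<lambda>e. c *\<^sub>C F e) \<in> dual"
  using dual_act[OF F, of "c *\<^sub>C 1"] by (simp add: mult_scaleC_right)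

end


section \<open>The inner product on the dual of a module over a W*-algebra\<close>

locale dual_module = predual P + semi_inner_module E add scl act k
  for P :: "('a::cstar_algebra \<Rightarrow> complex) set"
    and E :: "'s set" and add scl act and k :: "'s \<Rightarrow> 's \<Rightarrow> 'a"
begin

abbreviation sn :: "('a \<Rightarrow> complex) \<Rightarrow> 's \<Rightarrow> real" where
  "sn \<phi> e \<equiv> Re (\<phi> (k e e))"

lemma sn_nonneg: "\<phi> \<in> P\<^sub>p \<Longrightarrow> e \<in> E \<Longrightarrow> sn \<phi> e \<ge> 0"
  by (rule Pp_nonneg[OF _ k_positive])

lemma sn_add_scl:
  assumes \<phi>: "\<phi> \<in> P\<^sub>p" and e: "e \<in> E" "f \<in> E"
  shows "sn \<phi> (add e (scl c f)) = sn \<phi> e + 2 * Re (cnj c * \<phi> (k f e)) + (cmod c)\<^sup>2 * sn \<phi> f"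
proof -
  have "\<phi> (k (add e (scl c f)) (add e (scl c f)))
     = \<phi> (k e e) + c * \<phi> (k e f) + cnj c * \<phi> (k f e) + c * cnj c * \<phi> (k f f)"
    using e by (simp add: k_expand scaleC_simps dual_spaceD[OF Pp_dual[OF \<phi>]] algebra_simps)
  also have "\<phi> (k e f) = cnj (\<phi> (k f e))"
    using Pp_star[OF \<phi>, of "k f e"] e by (simp add: k_star)
  also have "c * cnj c = of_real ((cmod c)\<^sup>2)" by (rule complex_norm_square[symmetric])
  finally show ?thesis by simp
qed

lemma sn_Cauchy_Schwarz:
  assumes \<phi>: "\<phi> \<in> P\<^sub>p" and e: "e \<in> E" "f \<in> E"
  shows "cmod (\<phi> (k e f)) \<le> sqrt (sn \<phi> e) * sqrt (sn \<phi> f)"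
proof -
  have "(cmod (\<phi> (k e f)))\<^sup>2 \<le> sn \<phi> f * sn \<phi> e"
  proof (rule quadratic_discriminant_complex)
    fix c
    show "0 \<le> sn \<phi> f + 2 * Re (cnj c * \<phi> (k e f)) + (cmod c)\<^sup>2 * sn \<phi> e"
      unfolding sn_add_scl[OF \<phi> e(2,1), symmetric] using e by (intro sn_nonneg[OF \<phi>] closed)
  qed (rule sn_nonneg[OF \<phi> e(1)])
  then show ?thesis by (simp add: real_sqrt_mult[symmetric] mult.commute real_le_rsqrt)
qed

text \<open>
  The vector \<open>e\<close> approximates \<open>F\<close> up to \<open>d\<close> in the dual norm of the \<open>\<phi>\<close>-seminorm. In the Hilbert space
  completion for \<open>\<phi>\<close> this is the distance of \<open>e\<close> from the Riesz vector of \<open>\<phi> \<circ> F\<close>.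
\<close>

definition approximates :: "('a \<Rightarrow> complex) \<Rightarrow> real \<Rightarrow> ('s \<Rightarrow> 'a) \<Rightarrow> 's \<Rightarrow> bool" where
  "approximates \<phi> d F e \<longleftrightarrow> e \<in> E \<and> (\<forall>e'\<in>E. cmod (\<phi> (F e') - \<phi> (k e' e)) \<le> d * sqrt (sn \<phi> e'))"

lemma functional_phi_bound:
  assumes \<phi>: "\<phi> \<in> P\<^sub>p" and F: "F \<in> dual" and C: "functional_bound C F" and e: "e \<in> E"
  shows "cmod (\<phi> (F e)) \<le> sqrt (C * Re (\<phi> 1)) * sqrt (sn \<phi> e)"
proof -
  have "(cmod (\<phi> (F e)))\<^sup>2 \<le> Re (\<phi> 1) * Re (\<phi> (F e * star (F e)))" by (rule Pp_square_bound[OF \<phi>])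
  also have "Re (\<phi> (F e * star (F e))) \<le> C * sn \<phi> e"
    using Pp_mono[OF \<phi> functional_bound_order[OF F C e]] by (simp add: dual_spaceD[OF Pp_dual[OF \<phi>]])
  then have "Re (\<phi> 1) * Re (\<phi> (F e * star (F e))) \<le> Re (\<phi> 1) * (C * sn \<phi> e)"
    by (rule mult_left_mono) (simp add: Pp_nonneg[OF \<phi>])
  finally show ?thesis by (simp add: real_sqrt_mult[symmetric] mult.commute mult.left_commute real_le_rsqrt)
qed

text \<open>
  An almost minimizer of \<open>\<langle>e|e\<rangle> - 2 Re F(e)\<close>, evaluated by \<open>\<phi>\<close>, as in the Riesz representation theorem.
\<close>

lemma approximates_exists:
  assumes \<phi>: "\<phi> \<in> P\<^sub>p" and F: "F \<in> dual" and d: "d > 0"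
  obtains e where "approximates \<phi> d F e"
proof -
  obtain C where C: "functional_bound C F" by (rule dual_bound[OF F])
  note lin = dual_spaceD[OF Pp_dual[OF \<phi>]]
  define J where "J e = sn \<phi> e - 2 * Re (\<phi> (F e))" for e
  define B where "B = sqrt (C * Re (\<phi> 1))"
  have lower: "- B\<^sup>2 \<le> J e" if e: "e \<in> E" for e
  proof -
    have "Re (\<phi> (F e)) \<le> B * sqrt (sn \<phi> e)"
      using functional_phi_bound[OF \<phi> F C e] complex_Re_le_cmod[of "\<phi> (F e)"] by (simp add: B_def)
    moreover have "(sqrt (sn \<phi> e))\<^sup>2 = sn \<phi> e" using sn_nonneg[OF \<phi> e] by simp
    ultimately show ?thesis
      using zero_le_power2[of "sqrt (sn \<phi> e) - B"] by (simp add: J_def power2_diff mult.commute)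
  qed
  have bdd: "bdd_below (J ` E)" using lower by (intro bdd_belowI[of _ "- B\<^sup>2"]) auto
  have "Inf (J ` E) < Inf (J ` E) + d\<^sup>2" using d by simp
  then have "\<exists>x\<in>J ` E. x < Inf (J ` E) + d\<^sup>2" by (intro cInf_lessD) (use E_nonempty in auto)
  then obtain e where e: "e \<in> E" "J e < Inf (J ` E) + d\<^sup>2" by auto
  have "approximates \<phi> d F e"
    unfolding approximates_def
  proof (intro conjI ballI e(1))
    fix e' assume e': "e' \<in> E"
    define z where "z = \<phi> (k e' e) - \<phi> (F e')"
    have "(cmod z)\<^sup>2 \<le> d\<^sup>2 * sn \<phi> e'"
    proof (rule quadratic_discriminant_complex)
      fix c
      have "Inf (J ` E) \<le> J (add e (scl c e'))"
        by (rule cInf_lower[OF _ bdd]) (use e e' closed in auto)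
      also have "J (add e (scl c e')) = J e + 2 * Re (cnj c * z) + (cmod c)\<^sup>2 * sn \<phi> e'"
        unfolding J_def sn_add_scl[OF \<phi> e(1) e']
        by (simp add: dualD[OF F] e e' closed lin z_def algebra_simps)
      finally show "0 \<le> d\<^sup>2 + 2 * Re (cnj c * z) + (cmod c)\<^sup>2 * sn \<phi> e'" using e(2) by simp
    qed (rule sn_nonneg[OF \<phi> e'])
    then have "cmod z \<le> sqrt (d\<^sup>2 * sn \<phi> e')" by (rule real_le_rsqrt)
    then show "cmod (\<phi> (F e') - \<phi> (k e' e)) \<le> d * sqrt (sn \<phi> e')"
      using d by (simp add: z_def real_sqrt_mult norm_minus_commute)
  qed
  then show ?thesis by (rule that)
qed

text \<open>
  Testing the approximation at \<open>e' D\<close> with \<open>D = F e' - k e' e\<close> itself bounds \<open>\<phi>(D\<^sup>* D)\<close>,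
  which is monotone in \<open>\<phi>\<close>.
\<close>

lemma approximates_pointwise:
  assumes \<phi>: "\<phi> \<in> P\<^sub>p" and F: "F \<in> dual" and ap: "approximates \<phi> d F e" and e': "e' \<in> E" and d: "d \<ge> 0"
  shows "Re (\<phi> (star (F e' - k e' e) * (F e' - k e' e))) \<le> d\<^sup>2 * norm (k e' e')"
proof -
  have e: "e \<in> E" using ap by (simp add: approximates_def)
  note lin = dual_spaceD[OF Pp_dual[OF \<phi>]]
  define D where "D = F e' - k e' e"
  define x where "x = Re (\<phi> (star D * D))"
  define N where "N = norm (k e' e')"
  have x0: "x \<ge> 0" unfolding x_def by (rule Pp_nonneg[OF \<phi>]) simp
  have sn': "sn \<phi> (act e' D) \<le> N * x"
  proof -
    have "positive (star D * (N *\<^sub>R 1 - k e' e') * D)"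
      unfolding N_def by (intro positive_conj positive_norm_minus positive_selfadj k_positive e')
    then have "positive (N *\<^sub>R (star D * D) - star D * k e' e' * D)"
      by (simp add: right_diff_distrib left_diff_distrib)
    from Pp_mono[OF \<phi> this] show ?thesis
      using e' by (simp add: k_expand x_def lin mult.assoc)
  qed
  have "\<phi> (F (act e' D)) - \<phi> (k (act e' D) e) = \<phi> (star D * D)"
  proof -
    have "star D * F e' - star D * k e' e = star D * D" by (simp add: D_def right_diff_distrib)
    then show ?thesis using e e' by (simp add: dualD[OF F] k_expand lin(4)[symmetric])
  qed
  then have "x \<le> cmod (\<phi> (F (act e' D)) - \<phi> (k (act e' D) e))"
    using complex_Re_le_cmod[of "\<phi> (star D * D)"] by (simp add: x_def)
  also have "\<dots> \<le> d * sqrt (sn \<phi> (act e' D))"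
    using ap closed(3)[OF e'] by (simp add: approximates_def)
  also have "\<dots> \<le> d * sqrt (N * x)" using sn' d by (intro mult_left_mono) auto
  finally have "x\<^sup>2 \<le> (d * sqrt (N * x))\<^sup>2" using x0 by (rule power_mono)
  also have "\<dots> = d\<^sup>2 * N * x" using x0 by (simp add: power_mult_distrib N_def)
  finally have "x * x \<le> (d\<^sup>2 * N) * x" by (simp add: power2_eq_square)
  then have "x \<le> d\<^sup>2 * N" using x0 by (cases "x = 0") (auto simp: N_def)
  then show ?thesis by (simp add: x_def D_def N_def)
qed

lemma approximates_close:
  assumes \<phi>: "\<phi> \<in> P\<^sub>p" and a: "approximates \<phi> d F e" and b: "approximates \<phi> d' F e'" and d: "d + d' \<ge> 0"
  shows "sqrt (sn \<phi> (add e' (scl (- 1) e))) \<le> d + d'"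
proof -
  have e: "e \<in> E" "e' \<in> E" using a b by (simp_all add: approximates_def)
  note lin = dual_spaceD[OF Pp_dual[OF \<phi>]]
  define f where "f = add e' (scl (- 1) e)"
  have f: "f \<in> E" using e by (simp add: f_def closed)
  have "k f f = k f e' - k f e" using e f by (subst (2) f_def) (simp add: k_expand scaleC_minus1)
  then have "\<phi> (k f f) = (\<phi> (F f) - \<phi> (k f e)) - (\<phi> (F f) - \<phi> (k f e'))" by (simp add: lin)
  then have "cmod (\<phi> (k f f)) \<le> cmod (\<phi> (F f) - \<phi> (k f e)) + cmod (\<phi> (F f) - \<phi> (k f e'))"
    by (simp only: norm_triangle_ineq4)
  also have "\<dots> \<le> d * sqrt (sn \<phi> f) + d' * sqrt (sn \<phi> f)"
    using a b f by (intro add_mono) (auto simp: approximates_def)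
  finally have "sn \<phi> f \<le> (d + d') * sqrt (sn \<phi> f)"
    using complex_Re_le_cmod[of "\<phi> (k f f)"] by (simp add: algebra_simps)
  then have le: "sqrt (sn \<phi> f) * sqrt (sn \<phi> f) \<le> (d + d') * sqrt (sn \<phi> f)"
    using sn_nonneg[OF \<phi> f] by simp
  show ?thesis
  proof (cases "sqrt (sn \<phi> f) = 0")
    case True
    then show ?thesis using d by (simp add: f_def)
  next
    case False
    then have "sqrt (sn \<phi> f) > 0" using sn_nonneg[OF \<phi> f] by (simp add: less_le)
    with le show ?thesis unfolding f_def by (rule mult_right_le_imp_le)
  qed
qed

text \<open>
  The Riesz vectors for different functionals are compatible. In the seminorm of \<open>\<psi>\<close>, hence in that of
  \<open>\<phi>\<close>, the vector \<open>e\<close> is almost within \<open>d\<close> of approximants \<open>e1\<close> of high precision for \<open>\<psi>\<close>; and these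
  reproduce the values of \<open>F\<close> under \<open>\<phi>\<close> too, by the pointwise estimate.
\<close>

lemma approximates_mono:
  assumes \<phi>: "\<phi> \<in> P\<^sub>p" and \<psi>: "\<psi> \<in> P\<^sub>p" and le: "\<And>a. positive a \<Longrightarrow> Re (\<phi> a) \<le> Re (\<psi> a)"
    and F: "F \<in> dual" and ap: "approximates \<psi> d F e" and d: "d \<ge> 0"
  shows "approximates \<phi> d F e"
  unfolding approximates_def
proof (intro conjI ballI)
  show e: "e \<in> E" using ap by (simp add: approximates_def)
  note lin = dual_spaceD[OF Pp_dual[OF \<phi>]]
  fix e' assume e': "e' \<in> E"
  define B where "B = sqrt (Re (\<phi> 1) * norm (k e' e')) + sqrt (sn \<phi> e')"
  have B0: "B \<ge> 0" using sn_nonneg[OF \<phi> e'] Pp_nonneg[OF \<phi>, of 1] by (simp add: B_def)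
  have key: "cmod (\<phi> (F e') - \<phi> (k e' e)) \<le> d * sqrt (sn \<phi> e') + \<eta> * B" if \<eta>: "\<eta> > 0" for \<eta>
  proof -
    obtain e1 where ap1: "approximates \<psi> \<eta> F e1" by (rule approximates_exists[OF \<psi> F \<eta>])
    have e1: "e1 \<in> E" using ap1 by (simp add: approximates_def)
    define D where "D = F e' - k e' e1"
    define f where "f = add e1 (scl (- 1) e)"
    have f: "f \<in> E" using e e1 by (simp add: f_def closed)
    have "Re (\<phi> (star D * D)) \<le> Re (\<psi> (star D * D))" by (rule le) simp
    also have "\<dots> \<le> \<eta>\<^sup>2 * norm (k e' e')"
      unfolding D_def by (rule approximates_pointwise[OF \<psi> F ap1 e']) (use \<eta> in simp)
    finally have "Re (\<phi> 1) * Re (\<phi> (star D * D)) \<le> Re (\<phi> 1) * (\<eta>\<^sup>2 * norm (k e' e'))"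
      by (rule mult_left_mono) (simp add: Pp_nonneg[OF \<phi>])
    then have "(cmod (\<phi> D))\<^sup>2 \<le> \<eta>\<^sup>2 * (Re (\<phi> 1) * norm (k e' e'))"
      using Pp_square_bound(1)[OF \<phi>, of D] by (simp add: mult.left_commute)
    then have "cmod (\<phi> D) \<le> sqrt (\<eta>\<^sup>2 * (Re (\<phi> 1) * norm (k e' e')))" by (rule real_le_rsqrt)
    then have 1: "cmod (\<phi> D) \<le> \<eta> * sqrt (Re (\<phi> 1) * norm (k e' e'))" using \<eta> by (simp add: real_sqrt_mult)
    have "sqrt (sn \<phi> f) \<le> sqrt (sn \<psi> f)" using le[OF k_positive[OF f]] by simp
    also have "\<dots> \<le> d + \<eta>" unfolding f_def by (rule approximates_close[OF \<psi> ap ap1]) (use d \<eta> in simp)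
    finally have "sqrt (sn \<phi> e') * sqrt (sn \<phi> f) \<le> sqrt (sn \<phi> e') * (d + \<eta>)"
      using sn_nonneg[OF \<phi> e'] by (intro mult_left_mono) auto
    then have 2: "cmod (\<phi> (k e' f)) \<le> sqrt (sn \<phi> e') * (d + \<eta>)"
      using sn_Cauchy_Schwarz[OF \<phi> e' f] by linarith
    have "\<phi> (F e') - \<phi> (k e' e) = \<phi> D + \<phi> (k e' f)"
      using e e' e1 by (simp add: D_def f_def k_expand lin scaleC_minus1)
    then have "cmod (\<phi> (F e') - \<phi> (k e' e)) \<le> cmod (\<phi> D) + cmod (\<phi> (k e' f))" by (simp only: norm_triangle_ineq)
    also have "\<dots> \<le> \<eta> * sqrt (Re (\<phi> 1) * norm (k e' e')) + sqrt (sn \<phi> e') * (d + \<eta>)" by (rule add_mono[OF 1 2])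
    finally show ?thesis by (simp add: B_def algebra_simps)
  qed
  show "cmod (\<phi> (F e') - \<phi> (k e' e)) \<le> d * sqrt (sn \<phi> e')"
  proof (rule field_le_epsilon)
    fix r :: real assume r: "r > 0"
    have B1: "B + 1 > 0" using B0 by simp
    have "cmod (\<phi> (F e') - \<phi> (k e' e)) \<le> d * sqrt (sn \<phi> e') + r / (B + 1) * B"
      by (rule key) (use r B1 in simp)
    also have "r / (B + 1) * B \<le> r / (B + 1) * (B + 1)" using r B1 by (intro mult_left_mono) auto
    also have "\<dots> = r" using B1 by simp
    finally show "cmod (\<phi> (F e') - \<phi> (k e' e)) \<le> d * sqrt (sn \<phi> e') + r" by simp
  qed
qed

text \<open>
  The positive functionals are directed by their order; \<open>\<U>\<close> is an ultrafilter of functionals that are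
  eventually above any given one.
\<close>

definition above :: "('a \<Rightarrow> complex) \<Rightarrow> ('a \<Rightarrow> complex) set" where
  "above \<phi> = {\<psi> \<in> P\<^sub>p. \<forall>a. positive a \<longrightarrow> Re (\<phi> a) \<le> Re (\<psi> a)}"

definition \<U> :: "('a \<Rightarrow> complex) filter" where
  "\<U> = (SOME U. ultrafilter U \<and> U \<le> (INF \<phi>\<in>P\<^sub>p. principal (above \<phi>)))"

lemma \<U>: "ultrafilter \<U>" and eventually_above: "\<phi> \<in> P\<^sub>p \<Longrightarrow> eventually (\<lambda>\<psi>. \<psi> \<in> above \<phi>) \<U>"
proof -
  have "(INF \<phi>\<in>P\<^sub>p. principal (above \<phi>)) \<noteq> bot"
  proof -
    have "\<not> eventually (\<lambda>\<psi>. False) (INF \<phi>\<in>P\<^sub>p. principal (above \<phi>))"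
    proof (subst eventually_INF_base)
      show "P\<^sub>p \<noteq> {}" using Pp_0 by blast
      show "\<exists>\<phi>\<in>P\<^sub>p. principal (above \<phi>) \<le> inf (principal (above \<phi>1)) (principal (above \<phi>2))"
        if "\<phi>1 \<in> P\<^sub>p" "\<phi>2 \<in> P\<^sub>p" for \<phi>1 \<phi>2
      proof (rule bexI[OF _ Pp_add[OF that]])
        show "principal (above (\<lambda>a. \<phi>1 a + \<phi>2 a)) \<le> inf (principal (above \<phi>1)) (principal (above \<phi>2))"
          using Pp_nonneg[OF that(1)] Pp_nonneg[OF that(2)] by (fastforce simp: above_def)
      qed
      show "\<not> (\<exists>\<phi>\<in>P\<^sub>p. eventually (\<lambda>\<psi>. False) (principal (above \<phi>)))"
        by (auto simp: eventually_principal above_def)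
    qed
    then show ?thesis by (simp add: trivial_limit_def)
  qed
  then obtain U where "ultrafilter U" "U \<le> (INF \<phi>\<in>P\<^sub>p. principal (above \<phi>))" by (rule ultrafilter_exists)
  then have *: "ultrafilter \<U> \<and> \<U> \<le> (INF \<phi>\<in>P\<^sub>p. principal (above \<phi>))"
    unfolding \<U>_def by (intro someI[of "\<lambda>U. ultrafilter U \<and> U \<le> (INF \<phi>\<in>P\<^sub>p. principal (above \<phi>))" U]) simp
  then show "ultrafilter \<U>" by simp
  show "eventually (\<lambda>\<psi>. \<psi> \<in> above \<phi>) \<U>" if "\<phi> \<in> P\<^sub>p"
    using * that by (metis INF_lower2 eventually_principal le_principal order_refl order_trans)
qed

lemma \<U>_not_bot: "\<U> \<noteq> bot"
  by (rule ultrafilter_not_bot[OF \<U>])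

definition near :: "('s \<Rightarrow> 'a) \<Rightarrow> ('a \<Rightarrow> complex) \<Rightarrow> 's" where
  "near F \<psi> = (SOME e. approximates \<psi> 1 F e)"

text \<open>Multiples of \<open>\<phi>\<close> lie below \<open>\<psi>\<close> eventually, which turns the error \<open>1\<close> into any \<open>d > 0\<close>.\<close>

lemma eventually_near:
  assumes F: "F \<in> dual" and \<phi>: "\<phi> \<in> P\<^sub>p" and d: "d > 0"
  shows "eventually (\<lambda>\<psi>. approximates \<phi> d F (near F \<psi>)) \<U>"
proof -
  define r where "r = 1 / d\<^sup>2"
  have r: "r > 0" using d by (simp add: r_def)
  have r\<phi>: "(\<lambda>a. of_real r * \<phi> a) \<in> P\<^sub>p" by (rule Pp_scale[OF \<phi>]) (use r in simp)
  have sr: "sqrt r = 1 / d" using d by (simp add: r_def real_sqrt_divide)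
  show ?thesis
  proof (rule eventually_mono[OF eventually_above[OF r\<phi>]])
    fix \<psi> assume "\<psi> \<in> above (\<lambda>a. of_real r * \<phi> a)"
    then have \<psi>: "\<psi> \<in> P\<^sub>p" "\<And>a. positive a \<Longrightarrow> Re (of_real r * \<phi> a) \<le> Re (\<psi> a)" by (auto simp: above_def)
    have "\<exists>e. approximates \<psi> 1 F e" by (rule approximates_exists[OF \<psi>(1) F zero_less_one]) blast
    then have ap1: "approximates \<psi> 1 F (near F \<psi>)" unfolding near_def by (rule someI_ex)
    have ap: "approximates (\<lambda>a. of_real r * \<phi> a) 1 F (near F \<psi>)"
      by (rule approximates_mono[OF r\<phi> \<psi>(1) \<psi>(2) F ap1 zero_le_one])
    show "approximates \<phi> d F (near F \<psi>)"
      unfolding approximates_def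
    proof (intro conjI ballI)
      show "near F \<psi> \<in> E" using ap by (simp add: approximates_def)
      fix e' assume e': "e' \<in> E"
      have "cmod (of_real r * \<phi> (F e') - of_real r * \<phi> (k e' (near F \<psi>))) \<le> sqrt (r * sn \<phi> e')"
        using ap e' by (simp add: approximates_def)
      then have "r * cmod (\<phi> (F e') - \<phi> (k e' (near F \<psi>))) \<le> sqrt r * sqrt (sn \<phi> e')"
        using r by (simp add: right_diff_distrib[symmetric] norm_mult real_sqrt_mult)
      then have "(1 / d\<^sup>2) * cmod (\<phi> (F e') - \<phi> (k e' (near F \<psi>))) \<le> (1 / d) * sqrt (sn \<phi> e')"
        by (simp only: sr) (simp only: r_def)
      then show "cmod (\<phi> (F e') - \<phi> (k e' (near F \<psi>))) \<le> d * sqrt (sn \<phi> e')"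
        using d by (simp add: field_simps power2_eq_square)
    qed
  qed
qed

lemma eventually_near_mem:
  assumes "F \<in> dual" shows "eventually (\<lambda>\<psi>. near F \<psi> \<in> E) \<U>"
  by (rule eventually_mono[OF eventually_near[OF assms Pp_0 zero_less_one]]) (simp add: approximates_def)

lemma approximates_sn:
  assumes \<phi>: "\<phi> \<in> P\<^sub>p" and F: "F \<in> dual" and C: "functional_bound C F" and ap: "approximates \<phi> d F e" and d: "d \<ge> 0"
  shows "sqrt (sn \<phi> e) \<le> sqrt (C * Re (\<phi> 1)) + d"
proof -
  have e: "e \<in> E" using ap by (simp add: approximates_def)
  have "cmod (\<phi> (k e e)) \<le> cmod (\<phi> (F e)) + cmod (\<phi> (F e) - \<phi> (k e e))"
    using norm_triangle_ineq4[of "\<phi> (F e)" "\<phi> (F e) - \<phi> (k e e)"] by simp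
  also have "\<dots> \<le> sqrt (C * Re (\<phi> 1)) * sqrt (sn \<phi> e) + d * sqrt (sn \<phi> e)"
    using ap e functional_phi_bound[OF \<phi> F C e] by (intro add_mono) (auto simp: approximates_def)
  finally have "sn \<phi> e \<le> (sqrt (C * Re (\<phi> 1)) + d) * sqrt (sn \<phi> e)"
    using complex_Re_le_cmod[of "\<phi> (k e e)"] by (simp add: algebra_simps)
  then have le: "sqrt (sn \<phi> e) * sqrt (sn \<phi> e) \<le> (sqrt (C * Re (\<phi> 1)) + d) * sqrt (sn \<phi> e)"
    using sn_nonneg[OF \<phi> e] by simp
  have C0: "C * Re (\<phi> 1) \<ge> 0" using C Pp_nonneg[OF \<phi>, of 1] by (simp add: functional_bound_def)
  show ?thesis
  proof (cases "sqrt (sn \<phi> e) = 0")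
    case True
    then show ?thesis using d C0 by (simp only: True) simp
  next
    case False
    then have "sqrt (sn \<phi> e) > 0" using sn_nonneg[OF \<phi> e] by (simp add: less_le)
    with le show ?thesis by (rule mult_right_le_imp_le)
  qed
qed

text \<open>
  The vectors \<open>near F \<psi>\<close> have \<open>\<phi>\<close>-seminorm asymptotically at most \<open>sqrt (C * Re (\<phi> 1))\<close>, and \<open>G\<close> is
  bounded in terms of this seminorm.
\<close>

lemma near_limit:
  assumes F: "F \<in> dual" "functional_bound C F" and G: "G \<in> dual" "functional_bound D G" and \<phi>: "\<phi> \<in> P\<^sub>p"
  obtains l where "((\<lambda>\<psi>. \<phi> (G (near F \<psi>))) \<longlongrightarrow> l) \<U>" "cmod l \<le> sqrt (C * D) * Re (\<phi> 1)"
proof -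
  define c where "c = sqrt (C * Re (\<phi> 1))"
  define b where "b = sqrt (D * Re (\<phi> 1))"
  have \<phi>1: "Re (\<phi> 1) \<ge> 0" by (rule Pp_nonneg[OF \<phi>]) simp
  have CD: "C \<ge> 0" "D \<ge> 0" using F G by (simp_all add: functional_bound_def)
  have b0: "b \<ge> 0" using CD \<phi>1 by (simp add: b_def)
  have ev: "eventually (\<lambda>\<psi>. cmod (\<phi> (G (near F \<psi>))) \<le> b * (c + d)) \<U>" if d: "d > 0" for d
  proof (rule eventually_mono[OF eventually_near[OF F(1) \<phi> d]])
    fix \<psi> assume ap: "approximates \<phi> d F (near F \<psi>)"
    then have e: "near F \<psi> \<in> E" by (simp add: approximates_def)
    have "cmod (\<phi> (G (near F \<psi>))) \<le> b * sqrt (sn \<phi> (near F \<psi>))"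
      unfolding b_def by (rule functional_phi_bound[OF \<phi> G e])
    also have "\<dots> \<le> b * (c + d)"
      using approximates_sn[OF \<phi> F ap] d b0 by (intro mult_left_mono) (auto simp: c_def)
    finally show "cmod (\<phi> (G (near F \<psi>))) \<le> b * (c + d)" .
  qed
  obtain l where l: "((\<lambda>\<psi>. \<phi> (G (near F \<psi>))) \<longlongrightarrow> l) \<U>"
    by (rule ultrafilter_convergent[OF \<U> ev[OF zero_less_one]])
  have "cmod l \<le> b * c"
  proof (rule field_le_epsilon)
    fix r :: real assume r: "r > 0"
    have "cmod l \<le> b * (c + r / (b + 1))"
      by (rule tendsto_upperbound[OF tendsto_norm[OF l] ev \<U>_not_bot]) (use r b0 in simp)
    also have "b * (r / (b + 1)) \<le> (b + 1) * (r / (b + 1))" using r b0 by (intro mult_right_mono) auto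
    then have "b * (c + r / (b + 1)) \<le> b * c + r" using b0 by (simp add: distrib_left)
    finally show "cmod l \<le> b * c + r" .
  qed
  also have "b * c = sqrt (C * D) * Re (\<phi> 1)"
  proof -
    have "b * c = sqrt ((C * D) * (Re (\<phi> 1))\<^sup>2)"
      unfolding b_def c_def real_sqrt_mult[symmetric] by (simp add: power2_eq_square algebra_simps)
    then show ?thesis using \<phi>1 by (simp add: real_sqrt_mult)
  qed
  finally show ?thesis by (rule that[OF l])
qed

text \<open>
  The inner product is the weak* limit of \<open>G\<close> along vectors approximating \<open>F\<close>. In this asymmetric
  form linearity over the algebra in \<open>G\<close> is immediate; the symmetry uses the approximation of both
  arguments.
\<close>

definition dual_ip :: "('s \<Rightarrow> 'a) \<Rightarrow> ('s \<Rightarrow> 'a) \<Rightarrow> 'a" where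
  "dual_ip F G = (SOME a. \<forall>\<phi>\<in>P. ((\<lambda>\<psi>. \<phi> (G (near F \<psi>))) \<longlongrightarrow> \<phi> a) \<U>)"

lemma dual_ip_tendsto:
  assumes F: "F \<in> dual" and G: "G \<in> dual" and \<phi>: "\<phi> \<in> P"
  shows "((\<lambda>\<psi>. \<phi> (G (near F \<psi>))) \<longlongrightarrow> \<phi> (dual_ip F G)) \<U>"
proof -
  obtain C where C: "functional_bound C F" by (rule dual_bound[OF F])
  obtain D where D: "functional_bound D G" by (rule dual_bound[OF G])
  have CD: "C * D \<ge> 0" using C D by (simp add: functional_bound_def)
  have pos: "\<exists>l. ((\<lambda>\<psi>. \<phi> (G (near F \<psi>))) \<longlongrightarrow> l) \<U> \<and> cmod l \<le> sqrt (C * D) * Re (\<phi> 1)" if "\<phi> \<in> P\<^sub>p" for \<phi>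
    by (rule near_limit[OF F C G D that]) blast
  have "\<exists>l. ((\<lambda>\<psi>. \<phi> (G (near F \<psi>))) \<longlongrightarrow> l) \<U> \<and> cmod l \<le> (4 * sqrt (C * D)) * onorm \<phi>" if \<phi>: "\<phi> \<in> P" for \<phi>
  proof -
    obtain \<psi>0 \<psi>1 \<psi>2 \<psi>3 where \<psi>: "\<psi>0 \<in> P\<^sub>p" "\<psi>1 \<in> P\<^sub>p" "\<psi>2 \<in> P\<^sub>p" "\<psi>3 \<in> P\<^sub>p"
      and dec: "\<And>a. \<phi> a = \<psi>0 a - \<psi>2 a + \<i> * (\<psi>3 a - \<psi>1 a)"
      and n: "Re (\<psi>0 1) \<le> onorm \<phi>" "Re (\<psi>1 1) \<le> onorm \<phi>" "Re (\<psi>2 1) \<le> onorm \<phi>" "Re (\<psi>3 1) \<le> onorm \<phi>"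
      using positive_decomposition[OF \<phi>] by blast
    obtain l0 l1 l2 l3 where l: "((\<lambda>\<psi>. \<psi>0 (G (near F \<psi>))) \<longlongrightarrow> l0) \<U>" "((\<lambda>\<psi>. \<psi>1 (G (near F \<psi>))) \<longlongrightarrow> l1) \<U>"
      "((\<lambda>\<psi>. \<psi>2 (G (near F \<psi>))) \<longlongrightarrow> l2) \<U>" "((\<lambda>\<psi>. \<psi>3 (G (near F \<psi>))) \<longlongrightarrow> l3) \<U>"
      and b: "cmod l0 \<le> sqrt (C * D) * Re (\<psi>0 1)" "cmod l1 \<le> sqrt (C * D) * Re (\<psi>1 1)"
      "cmod l2 \<le> sqrt (C * D) * Re (\<psi>2 1)" "cmod l3 \<le> sqrt (C * D) * Re (\<psi>3 1)"
      using pos[OF \<psi>(1)] pos[OF \<psi>(2)] pos[OF \<psi>(3)] pos[OF \<psi>(4)] by blast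
    have "((\<lambda>\<psi>. \<phi> (G (near F \<psi>))) \<longlongrightarrow> l0 - l2 + \<i> * (l3 - l1)) \<U>"
      unfolding dec by (intro tendsto_intros l)
    moreover have "cmod (l0 - l2 + \<i> * (l3 - l1)) \<le> (cmod l0 + cmod l2) + (cmod l3 + cmod l1)"
    proof (rule norm_triangle_le, rule add_mono)
      show "cmod (l0 - l2) \<le> cmod l0 + cmod l2" by (rule norm_triangle_ineq4)
      show "cmod (\<i> * (l3 - l1)) \<le> cmod l3 + cmod l1" using norm_triangle_ineq4[of l3 l1] by (simp add: norm_mult)
    qed
    moreover have "cmod l0 \<le> sqrt (C * D) * onorm \<phi>" "cmod l1 \<le> sqrt (C * D) * onorm \<phi>"
      "cmod l2 \<le> sqrt (C * D) * onorm \<phi>" "cmod l3 \<le> sqrt (C * D) * onorm \<phi>"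
    proof -
      have h: "x \<le> sqrt (C * D) * onorm \<phi>" if "x \<le> sqrt (C * D) * y" "y \<le> onorm \<phi>" for x y :: real
        using order_trans[OF that(1) mult_left_mono[OF that(2)]] CD by simp
      show "cmod l0 \<le> sqrt (C * D) * onorm \<phi>" "cmod l1 \<le> sqrt (C * D) * onorm \<phi>"
        "cmod l2 \<le> sqrt (C * D) * onorm \<phi>" "cmod l3 \<le> sqrt (C * D) * onorm \<phi>"
        using h[OF b(1) n(1)] h[OF b(2) n(2)] h[OF b(3) n(3)] h[OF b(4) n(4)] by auto
    qed
    ultimately show ?thesis by (intro exI[of _ "l0 - l2 + \<i> * (l3 - l1)"]) linarith
  qed
  then have "\<exists>a. \<forall>\<phi>\<in>P. ((\<lambda>\<psi>. \<phi> (G (near F \<psi>))) \<longlongrightarrow> \<phi> a) \<U>" by (rule weak_star_limit_exists[OF \<U>_not_bot])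
  then have "\<forall>\<phi>\<in>P. ((\<lambda>\<psi>. \<phi> (G (near F \<psi>))) \<longlongrightarrow> \<phi> (dual_ip F G)) \<U>" unfolding dual_ip_def by (rule someI_ex)
  then show ?thesis using \<phi> by blast
qed

lemma dual_ip_bound:
  assumes F: "F \<in> dual" "functional_bound C F" and G: "G \<in> dual" "functional_bound D G" and \<phi>: "\<phi> \<in> P\<^sub>p"
  shows "cmod (\<phi> (dual_ip F G)) \<le> sqrt (C * D) * Re (\<phi> 1)"
proof -
  obtain l where l: "((\<lambda>\<psi>. \<phi> (G (near F \<psi>))) \<longlongrightarrow> l) \<U>" "cmod l \<le> sqrt (C * D) * Re (\<phi> 1)"
    by (rule near_limit[OF F G \<phi>])
  have "\<phi> (dual_ip F G) = l"
    by (rule tendsto_unique[OF \<U>_not_bot dual_ip_tendsto[OF F(1) G(1) Pp_P[OF \<phi>]] l(1)])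
  then show ?thesis using l(2) by simp
qed

lemma dual_ip_combine:
  assumes F: "F \<in> dual" and G: "G \<in> dual" "G' \<in> dual" "H \<in> dual"
    and eq: "\<And>e. e \<in> E \<Longrightarrow> H e = G e * a + G' e * b"
  shows "dual_ip F H = dual_ip F G * a + dual_ip F G' * b"
proof (rule P_separates)
  fix \<phi> assume \<phi>: "\<phi> \<in> P"
  note lin = dual_spaceD[OF P_dual[OF \<phi>]]
  have "((\<lambda>\<psi>. \<phi> (G (near F \<psi>) * a) + \<phi> (G' (near F \<psi>) * b)) \<longlongrightarrow> \<phi> (dual_ip F G * a) + \<phi> (dual_ip F G' * b)) \<U>"
    by (intro tendsto_add dual_ip_tendsto[OF F G(1) P_mult_right[OF \<phi>]] dual_ip_tendsto[OF F G(2) P_mult_right[OF \<phi>]])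
  moreover have "eventually (\<lambda>\<psi>. \<phi> (G (near F \<psi>) * a) + \<phi> (G' (near F \<psi>) * b) = \<phi> (H (near F \<psi>))) \<U>"
    by (rule eventually_mono[OF eventually_near_mem[OF F]]) (simp add: eq lin)
  ultimately have "((\<lambda>\<psi>. \<phi> (H (near F \<psi>))) \<longlongrightarrow> \<phi> (dual_ip F G * a) + \<phi> (dual_ip F G' * b)) \<U>"
    by (rule Lim_transform_eventually)
  then show "\<phi> (dual_ip F H) = \<phi> (dual_ip F G * a + dual_ip F G' * b)"
    unfolding lin(2) by (rule tendsto_unique[OF \<U>_not_bot dual_ip_tendsto[OF F G(3) \<phi>]])
qed

lemma dual_ip_star:
  assumes F: "F \<in> dual" and G: "G \<in> dual"
  shows "star (dual_ip F G) = dual_ip G F"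
proof (rule Pp_separates)
  fix \<phi> assume \<phi>: "\<phi> \<in> P\<^sub>p"
  obtain C where C: "functional_bound C F" by (rule dual_bound[OF F])
  obtain D where D: "functional_bound D G" by (rule dual_bound[OF G])
  define A where "A = sqrt (C * Re (\<phi> 1)) + sqrt (D * Re (\<phi> 1)) + 2"
  have "Re (\<phi> 1) \<ge> 0" by (rule Pp_nonneg[OF \<phi>]) simp
  then have A0: "A > 0" using C D by (simp add: A_def functional_bound_def add_nonneg_pos)
  have lim: "((\<lambda>\<psi>. cmod (cnj (\<phi> (G (near F \<psi>))) - \<phi> (F (near G \<psi>)))) \<longlongrightarrow>
      cmod (cnj (\<phi> (dual_ip F G)) - \<phi> (dual_ip G F))) \<U>"
    by (intro tendsto_intros tendsto_cnj dual_ip_tendsto F G Pp_P[OF \<phi>])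
  have "cmod (cnj (\<phi> (dual_ip F G)) - \<phi> (dual_ip G F)) \<le> 0"
  proof (rule field_le_epsilon)
    fix r :: real assume r: "r > 0"
    define d where "d = min 1 (r / A)"
    have d: "d > 0" "d \<le> 1" using r A0 by (auto simp: d_def)
    have "eventually (\<lambda>\<psi>. cmod (cnj (\<phi> (G (near F \<psi>))) - \<phi> (F (near G \<psi>))) \<le> d * A) \<U>"
    proof (rule eventually_mono[OF eventually_conj[OF eventually_near[OF F \<phi> d(1)] eventually_near[OF G \<phi> d(1)]]])
      fix \<psi> assume ap: "approximates \<phi> d F (near F \<psi>) \<and> approximates \<phi> d G (near G \<psi>)"
      define e where "e = near F \<psi>"
      define f where "f = near G \<psi>"
      have ap: "approximates \<phi> d F e" "approximates \<phi> d G f" using ap by (simp_all add: e_def f_def)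
      have ef: "e \<in> E" "f \<in> E" using ap by (simp_all add: approximates_def)
      have "\<phi> (k f e) = cnj (\<phi> (k e f))" using Pp_star[OF \<phi>, of "k e f"] ef by (simp add: k_star)
      then have "cnj (\<phi> (G e)) - \<phi> (F f) = cnj (\<phi> (G e) - \<phi> (k e f)) - (\<phi> (F f) - \<phi> (k f e))" by simp
      then have "cmod (cnj (\<phi> (G e)) - \<phi> (F f)) \<le> cmod (\<phi> (G e) - \<phi> (k e f)) + cmod (\<phi> (F f) - \<phi> (k f e))"
        using norm_triangle_ineq4[of "cnj (\<phi> (G e) - \<phi> (k e f))" "\<phi> (F f) - \<phi> (k f e)"]
        by (simp only: complex_mod_cnj)
      also have "\<dots> \<le> d * sqrt (sn \<phi> e) + d * sqrt (sn \<phi> f)"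
        using ap ef by (intro add_mono) (auto simp: approximates_def)
      also have "\<dots> \<le> d * (sqrt (C * Re (\<phi> 1)) + d) + d * (sqrt (D * Re (\<phi> 1)) + d)"
        using approximates_sn[OF \<phi> F C ap(1)] approximates_sn[OF \<phi> G D ap(2)] d
        by (intro add_mono mult_left_mono) auto
      also have "\<dots> \<le> d * A"
      proof -
        have "(sqrt (C * Re (\<phi> 1)) + d) + (sqrt (D * Re (\<phi> 1)) + d) \<le> A" using d by (simp add: A_def)
        then show ?thesis unfolding distrib_left[symmetric] using d by (intro mult_left_mono) auto
      qed
      finally show "cmod (cnj (\<phi> (G (near F \<psi>))) - \<phi> (F (near G \<psi>))) \<le> d * A" by (simp add: e_def f_def)
    qed
    then have "cmod (cnj (\<phi> (dual_ip F G)) - \<phi> (dual_ip G F)) \<le> d * A" by (rule tendsto_upperbound[OF lim _ \<U>_not_bot])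
    also have "\<dots> \<le> r / A * A" using A0 by (intro mult_right_mono) (auto simp: d_def)
    finally show "cmod (cnj (\<phi> (dual_ip F G)) - \<phi> (dual_ip G F)) \<le> 0 + r" using A0 by simp
  qed
  then show "\<phi> (star (dual_ip F G)) = \<phi> (dual_ip G F)" by (simp add: Pp_star[OF \<phi>])
qed

lemma dual_ip_embed_right:
  assumes F: "F \<in> dual" and e: "e \<in> E"
  shows "dual_ip F (embed e) = star (F e)"
proof (rule Pp_separates)
  fix \<phi> assume \<phi>: "\<phi> \<in> P\<^sub>p"
  have lim: "((\<lambda>\<psi>. \<phi> (embed e (near F \<psi>))) \<longlongrightarrow> \<phi> (dual_ip F (embed e))) \<U>"
    by (rule dual_ip_tendsto[OF F embed_dual[OF e] Pp_P[OF \<phi>]])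
  have "((\<lambda>\<psi>. cnj (\<phi> (embed e (near F \<psi>))) - \<phi> (F e)) \<longlongrightarrow> 0) \<U>"
  proof (rule tendsto_norm_zero_cancel, rule tendstoI)
    fix r :: real assume r: "r > 0"
    define d where "d = r / (sqrt (sn \<phi> e) + 1)"
    have p: "sqrt (sn \<phi> e) + 1 > 0" using sn_nonneg[OF \<phi> e] by (simp add: add_nonneg_pos)
    have d: "d > 0" using r p by (simp add: d_def)
    show "eventually (\<lambda>\<psi>. dist (cmod (cnj (\<phi> (embed e (near F \<psi>))) - \<phi> (F e))) 0 < r) \<U>"
    proof (rule eventually_mono[OF eventually_near[OF F \<phi> d]])
      fix \<psi> assume ap: "approximates \<phi> d F (near F \<psi>)"
      then have n: "near F \<psi> \<in> E" by (simp add: approximates_def)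
      have "cmod (cnj (\<phi> (embed e (near F \<psi>))) - \<phi> (F e)) = cmod (\<phi> (F e) - \<phi> (k e (near F \<psi>)))"
        using Pp_star[OF \<phi>, of "k (near F \<psi>) e"] k_star[OF n e] by (simp add: embed_def norm_minus_commute)
      also have "\<dots> \<le> d * sqrt (sn \<phi> e)" using ap e by (simp add: approximates_def)
      also have "\<dots> < d * (sqrt (sn \<phi> e) + 1)" using d by (intro mult_strict_left_mono) auto
      also have "\<dots> = r" using p by (simp add: d_def)
      finally show "dist (cmod (cnj (\<phi> (embed e (near F \<psi>))) - \<phi> (F e))) 0 < r" by simp
    qed
  qed
  moreover have "((\<lambda>\<psi>. cnj (\<phi> (embed e (near F \<psi>))) - \<phi> (F e)) \<longlongrightarrow> cnj (\<phi> (dual_ip F (embed e))) - \<phi> (F e)) \<U>"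
    by (intro tendsto_intros tendsto_cnj lim)
  ultimately have "cnj (\<phi> (dual_ip F (embed e))) - \<phi> (F e) = 0" by (rule tendsto_unique[OF \<U>_not_bot, rotated])
  then have "cnj (cnj (\<phi> (dual_ip F (embed e)))) = cnj (\<phi> (F e))" by simp
  then show "\<phi> (dual_ip F (embed e)) = \<phi> (star (F e))" by (simp add: Pp_star[OF \<phi>])
qed

lemma dual_ip_embed:
  assumes "F \<in> dual" "e \<in> E" shows "dual_ip (embed e) F = F e"
  using dual_ip_star[OF assms(1) embed_dual[OF assms(2)]] dual_ip_embed_right[OF assms] by (simp add: star_star)

text \<open>
  A single vector at which \<open>F\<close>, the form and the new inner product nearly agree under \<open>\<phi>\<close>: this is behind
  both the positivity of the inner product and the density of the image of \<open>E\<close>.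
\<close>

lemma dual_ip_near:
  assumes F: "F \<in> dual" and \<phi>: "\<phi> \<in> P\<^sub>p" and r: "r > 0"
  shows "\<exists>e\<in>E. \<bar>Re (\<phi> (dual_ip F F)) - Re (\<phi> (F e))\<bar> < r \<and> \<bar>sn \<phi> e - Re (\<phi> (F e))\<bar> < r"
proof -
  obtain C where C: "functional_bound C F" by (rule dual_bound[OF F])
  define A where "A = sqrt (C * Re (\<phi> 1)) + 1"
  have "Re (\<phi> 1) \<ge> 0" by (rule Pp_nonneg[OF \<phi>]) simp
  then have A0: "A > 0" using C by (simp add: A_def functional_bound_def add_nonneg_pos)
  define d where "d = min 1 (r / (2 * A))"
  have d: "d > 0" "d \<le> 1" using r A0 by (auto simp: d_def)
  have "((\<lambda>\<psi>. Re (\<phi> (F (near F \<psi>)))) \<longlongrightarrow> Re (\<phi> (dual_ip F F))) \<U>"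
    by (intro tendsto_Re dual_ip_tendsto F Pp_P[OF \<phi>])
  then have "eventually (\<lambda>\<psi>. dist (Re (\<phi> (F (near F \<psi>)))) (Re (\<phi> (dual_ip F F))) < r) \<U>" using r by (rule tendstoD)
  then have "eventually (\<lambda>\<psi>. dist (Re (\<phi> (F (near F \<psi>)))) (Re (\<phi> (dual_ip F F))) < r \<and> approximates \<phi> d F (near F \<psi>)) \<U>"
    using eventually_near[OF F \<phi> d(1)] by (rule eventually_conj)
  then obtain \<psi> where \<psi>: "dist (Re (\<phi> (F (near F \<psi>)))) (Re (\<phi> (dual_ip F F))) < r" "approximates \<phi> d F (near F \<psi>)"
    using eventually_happens'[OF \<U>_not_bot] by blast
  have e: "near F \<psi> \<in> E" using \<psi> by (simp add: approximates_def)
  have "\<bar>sn \<phi> (near F \<psi>) - Re (\<phi> (F (near F \<psi>)))\<bar> \<le> cmod (\<phi> (F (near F \<psi>)) - \<phi> (k (near F \<psi>) (near F \<psi>)))"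
    using abs_Re_le_cmod[of "\<phi> (F (near F \<psi>)) - \<phi> (k (near F \<psi>) (near F \<psi>))"] by simp
  also have "\<dots> \<le> d * sqrt (sn \<phi> (near F \<psi>))" using \<psi>(2) e by (simp add: approximates_def)
  also have "\<dots> \<le> d * A" using approximates_sn[OF \<phi> F C \<psi>(2)] d by (intro mult_left_mono) (auto simp: A_def)
  also have "\<dots> \<le> r / (2 * A) * A" using A0 by (intro mult_right_mono) (auto simp: d_def)
  also have "\<dots> < r" using A0 r by simp
  finally show ?thesis using \<psi>(1) e by (intro bexI[of _ "near F \<psi>"]) (auto simp: dist_real_def abs_minus_commute)
qed

lemma dual_ip_positive:
  assumes F: "F \<in> dual" shows "positive (dual_ip F F)"
proof (rule Pp_detects_positive)
  fix \<phi> assume \<phi>: "\<phi> \<in> P\<^sub>p"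
  have "- Re (\<phi> (dual_ip F F)) \<le> 0"
  proof (rule field_le_epsilon)
    fix r :: real assume r: "r > 0"
    obtain e where e: "e \<in> E" "\<bar>Re (\<phi> (dual_ip F F)) - Re (\<phi> (F e))\<bar> < r / 2" "\<bar>sn \<phi> e - Re (\<phi> (F e))\<bar> < r / 2"
      using dual_ip_near[OF F \<phi>, of "r / 2"] r by auto
    then show "- Re (\<phi> (dual_ip F F)) \<le> 0 + r" using sn_nonneg[OF \<phi> e(1)] by linarith
  qed
  moreover have "\<phi> (dual_ip F F) = of_real (Re (\<phi> (dual_ip F F)))"
    by (rule Pp_selfadj[OF \<phi> dual_ip_star[OF F F]])
  ultimately show "\<phi> (dual_ip F F) \<in> \<real>\<^sub>\<ge>\<^sub>0" by (simp add: complex_nonneg_Reals_iff complex_eq_iff)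
qed

lemma dual_ip_norm:
  assumes F: "F \<in> dual" and C: "functional_bound C F" shows "norm (dual_ip F F) \<le> C"
proof (rule norm_le_if_positive_minus[OF dual_ip_positive[OF F]])
  show C0: "C \<ge> 0" using C by (simp add: functional_bound_def)
  show "positive (C *\<^sub>R 1 - dual_ip F F)"
  proof (rule positive_le_scaled_one[OF dual_ip_star[OF F F]])
    fix \<phi> assume \<phi>: "\<phi> \<in> P\<^sub>p"
    show "Re (\<phi> (dual_ip F F)) \<le> C * Re (\<phi> 1)"
      using dual_ip_bound[OF F C F C \<phi>] complex_Re_le_cmod[of "\<phi> (dual_ip F F)"] C0 by simp
  qed
qed

sublocale dual: semi_inner_module dual "\<lambda>F G e. F e + G e" "\<lambda>c F e. c *\<^sub>C F e" "\<lambda>F a e. F e * a" dual_ip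
proof
  show "dual \<noteq> {}" using E_nonempty embed_dual by blast
  fix F G H :: "'s \<Rightarrow> 'a" and c a
  show "F \<in> dual \<Longrightarrow> G \<in> dual \<Longrightarrow> (\<lambda>e. F e + G e) \<in> dual" by (rule dual_add)
  show "F \<in> dual \<Longrightarrow> (\<lambda>e. c *\<^sub>C F e) \<in> dual" by (rule dual_scl)
  show "F \<in> dual \<Longrightarrow> (\<lambda>e. F e * a) \<in> dual" by (rule dual_act)
  show "dual_ip H (\<lambda>e. F e + G e) = dual_ip H F + dual_ip H G" if "H \<in> dual" "F \<in> dual" "G \<in> dual"
    using dual_ip_combine[OF that dual_add[OF that(2,3)], of 1 1] by simp
  show "dual_ip H (\<lambda>e. c *\<^sub>C F e) = c *\<^sub>C dual_ip H F" if "H \<in> dual" "F \<in> dual"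
    using dual_ip_combine[OF that that(2) dual_scl[OF that(2)], of c "c *\<^sub>C 1" 0] by (simp add: mult_scaleC_right)
  show "dual_ip H (\<lambda>e. F e * a) = dual_ip H F * a" if "H \<in> dual" "F \<in> dual"
    using dual_ip_combine[OF that that(2) dual_act[OF that(2)], of a a 0] by simp
qed (rule dual_ip_star dual_ip_positive; assumption)+

text \<open>
  For varying \<open>\<phi>\<close> this is the density of the image of \<open>E\<close> in the topology \<open>\<tau>\<^sub>1\<close>.
\<close>

lemma dual_ip_dense:
  assumes F: "F \<in> dual" and \<phi>: "\<phi> \<in> P\<^sub>p" and r: "r > 0"
  obtains e where "e \<in> E" "Re (\<phi> (dual_ip (\<lambda>x. F x + (- 1) *\<^sub>C embed e x) (\<lambda>x. F x + (- 1) *\<^sub>C embed e x))) < r"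
proof -
  note lin = dual_spaceD[OF Pp_dual[OF \<phi>]]
  obtain e where e: "e \<in> E" "\<bar>Re (\<phi> (dual_ip F F)) - Re (\<phi> (F e))\<bar> < r / 2" "\<bar>sn \<phi> e - Re (\<phi> (F e))\<bar> < r / 2"
    using dual_ip_near[OF F \<phi>, of "r / 2"] r by auto
  note d = F embed_dual[OF e(1)] dual.closed
  have "dual_ip (\<lambda>x. F x + (- 1) *\<^sub>C embed e x) (\<lambda>x. F x + (- 1) *\<^sub>C embed e x)
     = dual_ip F F - star (F e) - F e + k e e"
    by (simp only: dual.k_add dual.k_scl dual.k_add_left dual.k_scl_left d dual_ip_embed dual_ip_embed_right e(1))
      (simp add: scaleC_simps embed_def k_star e(1))
  then have "Re (\<phi> (dual_ip (\<lambda>x. F x + (- 1) *\<^sub>C embed e x) (\<lambda>x. F x + (- 1) *\<^sub>C embed e x)))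
     = (Re (\<phi> (dual_ip F F)) - Re (\<phi> (F e))) + (sn \<phi> e - Re (\<phi> (F e)))"
    by (simp add: lin Pp_star[OF \<phi>])
  then show ?thesis using that[OF e(1)] e(2,3) by linarith
qed

lemma dual_eval_bound:
  assumes F: "F \<in> dual" and e: "e \<in> E"
  shows "(norm (F e))\<^sup>2 \<le> norm (dual_ip F F) * norm (k e e)"
  using dual.Cauchy_Schwarz[OF embed_dual[OF e] F] by (simp add: dual_ip_embed F e embed_dual mult.commute) (simp add: embed_def)

text \<open>
  A bounded module map on the dual is continuous for the seminorms of \<open>\<tau>\<^sub>1\<close>, because
  \<open>g(F)\<^sup>* g(F) \<le> C \<langle>F|F\<rangle>\<close>; hence it is determined by its values on the image of \<open>E\<close>.
\<close>

lemma module_map_zero: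
  assumes add: "\<And>F G. F \<in> dual \<Longrightarrow> G \<in> dual \<Longrightarrow> g (\<lambda>e. F e + G e) = g F + g G"
    and scl: "\<And>F c. F \<in> dual \<Longrightarrow> g (\<lambda>e. c *\<^sub>C F e) = c *\<^sub>C g F"
    and act: "\<And>F a. F \<in> dual \<Longrightarrow> g (\<lambda>e. F e * a) = g F * a"
    and C: "C \<ge> 0" "\<And>F. F \<in> dual \<Longrightarrow> (norm (g F))\<^sup>2 \<le> C * norm (dual_ip F F)"
    and zero: "\<And>e. e \<in> E \<Longrightarrow> g (embed e) = 0" and F: "F \<in> dual"
  shows "g F = (0 :: 'a)"
proof -
  have order: "positive (C *\<^sub>R dual_ip H H - star (g H) * g H)" if H: "H \<in> dual" for H
  proof (rule positive_of_norm_bound[OF dual_ip_positive[OF H] C(1)])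
    fix a
    have "dual_ip (\<lambda>e. H e * a) (\<lambda>e. H e * a) = star a * dual_ip H H * a"
      using H by (simp add: dual.k_expand mult.assoc)
    then show "(norm (g H * a))\<^sup>2 \<le> C * norm (star a * dual_ip H H * a)"
      using C(2)[OF dual_act[OF H, of a]] act[OF H] by simp
  qed
  have "star (g F) * g F = 0"
  proof (rule Pp_separates)
    fix \<phi> assume \<phi>: "\<phi> \<in> P\<^sub>p"
    note lin = dual_spaceD[OF Pp_dual[OF \<phi>]]
    have "Re (\<phi> (star (g F) * g F)) \<le> 0"
    proof (rule field_le_epsilon)
      fix r :: real assume r: "r > 0"
      have C1: "C + 1 > 0" using C by simp
      obtain e where e: "e \<in> E" "Re (\<phi> (dual_ip (\<lambda>x. F x + (- 1) *\<^sub>C embed e x) (\<lambda>x. F x + (- 1) *\<^sub>C embed e x))) < r / (C + 1)"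
        using dual_ip_dense[OF F \<phi>, of "r / (C + 1)"] r C1 by (metis divide_pos_pos)
      define H where "H = (\<lambda>x. F x + (- 1) *\<^sub>C embed e x)"
      have H: "H \<in> dual" unfolding H_def by (intro dual.closed F embed_dual e(1))
      have "g H = g F" unfolding H_def by (simp only: add scl zero F embed_dual e(1) dual_scl) simp
      then have "positive (C *\<^sub>R dual_ip H H - star (g F) * g F)" using order[OF H] by simp
      from Pp_mono[OF \<phi> this] have "Re (\<phi> (star (g F) * g F)) \<le> C * Re (\<phi> (dual_ip H H))" by (simp add: lin)
      also have "\<dots> \<le> C * (r / (C + 1))" using C(1) e(2) by (intro mult_left_mono) (auto simp: H_def)
      also have "\<dots> \<le> (C + 1) * (r / (C + 1))" using r C1 by (intro mult_right_mono) auto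
      also have "\<dots> = r" using C1 by simp
      finally show "Re (\<phi> (star (g F) * g F)) \<le> 0 + r" by simp
    qed
    moreover have "Re (\<phi> (star (g F) * g F)) \<ge> 0" by (rule Pp_nonneg[OF \<phi>]) simp
    ultimately have "Re (\<phi> (star (g F) * g F)) = 0" by simp
    moreover have "\<phi> (star (g F) * g F) = of_real (Re (\<phi> (star (g F) * g F)))" by (rule Pp_real[OF \<phi>]) simp
    ultimately show "\<phi> (star (g F) * g F) = \<phi> 0" by (simp add: lin)
  qed
  then show ?thesis by (simp only: star_mult_self_eq_0)
qed

lemma dual_cong:
  assumes F: "F \<in> dual" and eq: "\<And>e. e \<in> E \<Longrightarrow> G e = F e"
  shows "G \<in> dual"
  using F unfolding dual_def functional_bound_def by (simp add: eq closed)

lemma dual_ip_cong: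
  assumes F: "F \<in> dual" and G: "G \<in> dual"
    and eq: "\<And>e. e \<in> E \<Longrightarrow> F' e = F e" "\<And>e. e \<in> E \<Longrightarrow> G' e = G e"
  shows "dual_ip F' G' = dual_ip F G"
proof -
  have right: "dual_ip H G2 = dual_ip H G1"
    if "H \<in> dual" "G1 \<in> dual" "\<And>e. e \<in> E \<Longrightarrow> G2 e = G1 e" for H G1 G2
    using dual_ip_combine[OF that(1,2,2) dual_cong[OF that(2,3)], of 1 0] that(3) by simp
  have F': "F' \<in> dual" by (rule dual_cong[OF F eq(1)])
  have G': "G' \<in> dual" by (rule dual_cong[OF G eq(2)])
  have "dual_ip F' G' = dual_ip F' G" by (rule right[OF F' G eq(2)])
  also have "\<dots> = star (dual_ip G F')" by (simp add: dual_ip_star G F')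
  also have "\<dots> = star (dual_ip G F)" using right[OF G F eq(1)] by simp
  also have "\<dots> = dual_ip F G" by (rule dual_ip_star[OF G F])
  finally show ?thesis .
qed

text \<open>
  The bounds of a Cauchy sequence pass to its pointwise limit and make it a limit in norm.
\<close>

lemma dual_complete:
  assumes S: "\<And>n::nat. S n \<in> dual"
    and cauchy: "\<And>r. r > 0 \<Longrightarrow> \<exists>N. \<forall>m\<ge>N. \<forall>n\<ge>N.
      norm (dual_ip (\<lambda>e. S m e + (- 1) *\<^sub>C S n e) (\<lambda>e. S m e + (- 1) *\<^sub>C S n e)) \<le> r"
    and lim: "\<And>e. e \<in> E \<Longrightarrow> (\<lambda>n. S n e) \<longlonglongrightarrow> F e"
  shows "F \<in> dual"
    and "r > 0 \<Longrightarrow> \<exists>N. \<forall>n\<ge>N. norm (dual_ip (\<lambda>e. S n e + (- 1) *\<^sub>C F e) (\<lambda>e. S n e + (- 1) *\<^sub>C F e)) \<le> r"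
proof -
  have linear: "F (add e f) = F e + F f" "F (scl c e) = cnj c *\<^sub>C F e" "F (act e a) = star a * F e"
    if e: "e \<in> E" "f \<in> E" for e f c a
  proof -
    have "(\<lambda>n. S n (add e f)) \<longlonglongrightarrow> F e + F f" "(\<lambda>n. S n (act e a)) \<longlonglongrightarrow> star a * F e"
      unfolding dualD[OF S e(1)] dualD(1)[OF S e] by (intro tendsto_intros lim e)+
    then show "F (add e f) = F e + F f" "F (act e a) = star a * F e"
      using lim closed e LIMSEQ_unique by metis+
    have "(\<lambda>n. (cnj c *\<^sub>C 1) * S n e) \<longlonglongrightarrow> (cnj c *\<^sub>C 1) * F e" by (intro tendsto_intros lim e)
    then have "(\<lambda>n. S n (scl c e)) \<longlonglongrightarrow> cnj c *\<^sub>C F e"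
      by (simp add: dualD[OF S e(1)] mult_scaleC_left)
    then show "F (scl c e) = cnj c *\<^sub>C F e" using lim closed e LIMSEQ_unique by metis
  qed
  have bound: "\<exists>N. \<forall>n\<ge>N. functional_bound r (\<lambda>e. S n e + (- 1) *\<^sub>C F e)" if r: "r > 0" for r
  proof -
    obtain N where N: "\<forall>m\<ge>N. \<forall>n\<ge>N.
      norm (dual_ip (\<lambda>e. S m e + (- 1) *\<^sub>C S n e) (\<lambda>e. S m e + (- 1) *\<^sub>C S n e)) \<le> r"
      using cauchy[OF r] by blast
    have "functional_bound r (\<lambda>e. S n e + (- 1) *\<^sub>C F e)" if n: "n \<ge> N" for n
      unfolding functional_bound_def
    proof (intro conjI ballI)
      fix e assume e: "e \<in> E"
      have "(\<lambda>m. (norm (S n e - S m e))\<^sup>2) \<longlonglongrightarrow> (norm (S n e - F e))\<^sup>2"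
        by (intro tendsto_intros lim e)
      moreover have "(norm (S n e - S m e))\<^sup>2 \<le> r * norm (k e e)" if m: "m \<ge> N" for m
      proof -
        have "(norm (S n e + (- 1) *\<^sub>C S m e))\<^sup>2
            \<le> norm (dual_ip (\<lambda>e. S n e + (- 1) *\<^sub>C S m e) (\<lambda>e. S n e + (- 1) *\<^sub>C S m e)) * norm (k e e)"
          by (rule dual_eval_bound[OF dual_add[OF S dual_scl[OF S]] e])
        also have "\<dots> \<le> r * norm (k e e)" using N n m by (intro mult_right_mono) auto
        finally show ?thesis by (simp add: scaleC_simps)
      qed
      ultimately have "(norm (S n e - F e))\<^sup>2 \<le> r * norm (k e e)"
        by (intro LIMSEQ_le_const2) auto
      then show "(norm (S n e + (- 1) *\<^sub>C F e))\<^sup>2 \<le> r * norm (k e e)" by (simp add: scaleC_simps)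
    qed (use r in simp)
    then show ?thesis by blast
  qed
  have D: "(\<lambda>e. S n e + (- 1) *\<^sub>C F e) \<in> dual" if "functional_bound r (\<lambda>e. S n e + (- 1) *\<^sub>C F e)" for n r
    unfolding dual_def using that dualD[OF S] linear by (auto simp: scaleC_simps algebra_simps mult.commute[of _ "- 1::complex"])
  show F: "F \<in> dual"
  proof -
    obtain N where "functional_bound 1 (\<lambda>e. S N e + (- 1) *\<^sub>C F e)" using bound[of 1] by auto
    then have "(\<lambda>e. S N e + (- 1) *\<^sub>C (S N e + (- 1) *\<^sub>C F e)) \<in> dual" by (intro dual_add dual_scl S D)
    then show ?thesis by (simp add: scaleC_simps)
  qed
  show "\<exists>N. \<forall>n\<ge>N. norm (dual_ip (\<lambda>e. S n e + (- 1) *\<^sub>C F e) (\<lambda>e. S n e + (- 1) *\<^sub>C F e)) \<le> r" if "r > 0"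
    using bound[OF that] dual_ip_norm[OF D] by blast
qed

text \<open>
  The representing element is \<open>e \<mapsto> g(e)\<^sup>*\<close>. It represents \<open>g\<close> on the image of \<open>E\<close> by construction, and
  everywhere because bounded module maps are determined there.
\<close>

lemma dual_self_dual:
  assumes cong: "\<And>F G. F \<in> dual \<Longrightarrow> G \<in> dual \<Longrightarrow> (\<And>e. e \<in> E \<Longrightarrow> F e = G e) \<Longrightarrow> g F = g G"
    and add: "\<And>F G. F \<in> dual \<Longrightarrow> G \<in> dual \<Longrightarrow> g (\<lambda>e. F e + G e) = g F + g G"
    and scl: "\<And>F c. F \<in> dual \<Longrightarrow> g (\<lambda>e. c *\<^sub>C F e) = c *\<^sub>C g F"
    and act: "\<And>F a. F \<in> dual \<Longrightarrow> g (\<lambda>e. F e * a) = g F * a"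
    and C: "C \<ge> 0" "\<And>F. F \<in> dual \<Longrightarrow> (norm (g F))\<^sup>2 \<le> C * norm (dual_ip F F)"
  obtains L where "L \<in> dual" "\<And>F. F \<in> dual \<Longrightarrow> g F = dual_ip L F"
proof -
  define L where "L e = star (g (embed e))" for e
  have "functional_bound C L"
    unfolding functional_bound_def
  proof (intro conjI ballI C(1))
    fix e assume e: "e \<in> E"
    then show "(norm (L e))\<^sup>2 \<le> C * norm (k e e)"
      using C(2)[OF embed_dual[OF e]] dual_ip_embed[OF embed_dual[OF e] e] by (simp add: L_def) (simp add: embed_def)
  qed
  moreover have "L (add e f) = L e + L f" "L (scl c e) = cnj c *\<^sub>C L e" "L (act e a) = star a * L e"
    if e: "e \<in> E" "f \<in> E" for e f c a
  proof -
    have "g (embed (add e f)) = g (\<lambda>x. embed e x + embed f x)"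
      by (rule cong) (use e in \<open>auto simp: embed_def k_expand intro: closed embed_dual dual_add[OF embed_dual embed_dual, unfolded embed_def] embed_dual[unfolded embed_def]\<close>)
    then show "L (add e f) = L e + L f" using e by (simp add: L_def add embed_dual star_add)
    have "g (embed (scl c e)) = g (\<lambda>x. c *\<^sub>C embed e x)"
      by (rule cong) (use e in \<open>auto simp: embed_def k_expand intro: closed dual_scl[OF embed_dual, unfolded embed_def] embed_dual[unfolded embed_def]\<close>)
    then show "L (scl c e) = cnj c *\<^sub>C L e" using e by (simp add: L_def scl embed_dual star_scaleC)
    have "g (embed (act e a)) = g (\<lambda>x. embed e x * a)"
      by (rule cong) (use e in \<open>auto simp: embed_def k_expand intro: closed dual_act[OF embed_dual, unfolded embed_def] embed_dual[unfolded embed_def]\<close>)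
    then show "L (act e a) = star a * L e" using e by (simp add: L_def act embed_dual star_mult)
  qed
  ultimately have L: "L \<in> dual" by (auto simp: dual_def)
  have "g F = dual_ip L F" if F: "F \<in> dual" for F
  proof -
    define D where "D = 2 * C + 2 * norm (dual_ip L L)"
    have "g F - dual_ip L F = 0"
    proof (rule module_map_zero[where C = D and g = "\<lambda>F. g F - dual_ip L F"])
      show "D \<ge> 0" using C by (simp add: D_def)
      fix H assume H: "H \<in> dual"
      have "(norm (g H - dual_ip L H))\<^sup>2 \<le> (norm (g H) + norm (dual_ip L H))\<^sup>2"
        by (intro power_mono norm_triangle_ineq4) auto
      also have "\<dots> \<le> 2 * (norm (g H))\<^sup>2 + 2 * (norm (dual_ip L H))\<^sup>2"
        using zero_le_power2[of "norm (g H) - norm (dual_ip L H)"] by (simp add: power2_eq_square algebra_simps)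
      also have "\<dots> \<le> D * norm (dual_ip H H)"
        using C(2)[OF H] dual.Cauchy_Schwarz[OF L H] by (simp add: D_def algebra_simps)
      finally show "(norm (g H - dual_ip L H))\<^sup>2 \<le> D * norm (dual_ip H H)" .
    qed (simp_all add: add scl act dual.k_expand L F dual_ip_embed_right scaleC_simps left_diff_distrib L_def star_star)
    then show ?thesis by simp
  qed
  with L show ?thesis by (rule that)
qed

end


section \<open>Hilbert modules and their topologies\<close>

context A_module
begin

lemma carrier_closed:
  "v \<in> carrier M \<Longrightarrow> w \<in> carrier M \<Longrightarrow> v + w \<in> carrier M"
  "v \<in> carrier M \<Longrightarrow> mscale M c v \<in> carrier M"
  "0 \<in> carrier M"
  "v \<in> carrier M \<Longrightarrow> w \<in> carrier M \<Longrightarrow> v - w \<in> carrier M"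
proof -
  interpret vector_space "mscale M" by (rule vector_space)
  show "v \<in> carrier M \<Longrightarrow> w \<in> carrier M \<Longrightarrow> v + w \<in> carrier M"
    "v \<in> carrier M \<Longrightarrow> mscale M c v \<in> carrier M" "0 \<in> carrier M"
    "v \<in> carrier M \<Longrightarrow> w \<in> carrier M \<Longrightarrow> v - w \<in> carrier M"
    using subspace by (simp_all add: subspace_add subspace_scale subspace_0 subspace_diff)
qed

lemma scale_minus_one: "mscale M (- 1) v = - v"
proof -
  interpret vector_space "mscale M" by (rule vector_space)
  show ?thesis by (simp add: scale_minus_left)
qed

end

lemma LinD:
  assumes "f \<in> Lin M N" "v \<in> carrier M"
  shows "f v \<in> carrier N" "w \<in> carrier M \<Longrightarrow> f (v + w) = f v + f w" "f (mscale M c v) = mscale N c (f v)"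
    "f (mact M v a) = mact N (f v) a"
  using assms by (auto simp: Lin_def)

context hilbert_module
begin

lemma semi_inner_module: "semi_inner_module (carrier L) (+) (mscale L) (mact L) (ip L)"
proof
  show "carrier L \<noteq> {}" using carrier_closed(3) by blast
  fix d e f c a
  show "d \<in> carrier L \<Longrightarrow> e \<in> carrier L \<Longrightarrow> f \<in> carrier L \<Longrightarrow> ip L d (e + f) = ip L d e + ip L d f"
    "d \<in> carrier L \<Longrightarrow> e \<in> carrier L \<Longrightarrow> ip L d (mscale L c e) = c *\<^sub>C ip L d e"
    "d \<in> carrier L \<Longrightarrow> e \<in> carrier L \<Longrightarrow> ip L d (mact L e a) = ip L d e * a"
    using ip_sesquilinear by (auto simp: sesquilinear_forms_def)
qed (simp_all add: carrier_closed act_closed ip_star ip_positive)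

end

sublocale hilbert_module \<subseteq> S: semi_inner_module "carrier L" "(+)" "mscale L" "mact L" "ip L"
  by (rule semi_inner_module)

context hilbert_module
begin

lemma ip_diff_right: "l \<in> carrier L \<Longrightarrow> v \<in> carrier L \<Longrightarrow> w \<in> carrier L \<Longrightarrow> ip L l (v - w) = ip L l v - ip L l w"
  using S.k_add[of l v "mscale L (- 1) w"] S.k_scl[of l w "- 1"]
  by (simp add: scale_minus_one carrier_closed scaleC_minus1) (metis carrier_closed(2) scale_minus_one)

lemma ip_zero_right: "l \<in> carrier L \<Longrightarrow> ip L l 0 = 0"
  using ip_diff_right[of l 0 0] carrier_closed(3) by simp

lemma hnorm_power2: "v \<in> carrier L \<Longrightarrow> (hnorm L v)\<^sup>2 = norm (ip L v v)"
  by (simp add: hnorm_def)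

lemma continuous_module_map_bounded:
  assumes f: "f \<in> Lin L self_module"
    and cont: "\<And>u e. u \<in> carrier L \<Longrightarrow> e > 0 \<Longrightarrow> \<exists>d>0. \<forall>v\<in>carrier L. hnorm L (v - u) < d \<longrightarrow> norm (f v - f u) < e"
  obtains C where "C \<ge> 0" "\<And>v. v \<in> carrier L \<Longrightarrow> (norm (f v))\<^sup>2 \<le> C * norm (ip L v v)"
proof -
  have f0: "f 0 = 0" using LinD(3)[OF f carrier_closed(3), of 0] LinD(3)[OF f carrier_closed(3), of 1]
    using LinD(2)[OF f carrier_closed(3) carrier_closed(3)] by simp
  have fs: "f (mscale L c v) = c *\<^sub>C f v" if "v \<in> carrier L" for c v
    using LinD(3)[OF f that, of c] by (simp add: self_module_def)
  obtain d where d: "d > 0" "\<forall>v\<in>carrier L. hnorm L (v - 0) < d \<longrightarrow> norm (f v - f 0) < 1"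
    using cont[OF carrier_closed(3) zero_less_one] by blast
  have "(norm (f v))\<^sup>2 \<le> (2 / d)\<^sup>2 * norm (ip L v v)" if v: "v \<in> carrier L" for v
  proof (cases "ip L v v = 0")
    case True
    then show ?thesis using ip_definite[OF v] f0 by simp
  next
    case False
    define n where "n = hnorm L v"
    have n: "n > 0" using False by (simp add: n_def hnorm_def)
    define t where "t = d / (2 * n)"
    have t: "t > 0" using d n by (simp add: t_def)
    have "ip L (mscale L (of_real t) v) (mscale L (of_real t) v) = (t * t) *\<^sub>R ip L v v"
      using v by (simp add: S.k_expand scaleC_of_real)
    then have "hnorm L (mscale L (of_real t) v) = t * n"
      using t by (simp add: hnorm_def n_def real_sqrt_mult)
    also have "\<dots> < d" using d n by (simp add: t_def)
    finally have "norm (f (mscale L (of_real t) v)) < 1" using d(2) v carrier_closed(2) f0 by simp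
    then have "t * norm (f v) < 1" using t by (simp add: fs v scaleC_of_real)
    then have "norm (f v) \<le> 2 / d * n" using t d n by (simp add: t_def field_simps)
    then have "(norm (f v))\<^sup>2 \<le> (2 / d * n)\<^sup>2" by (rule power_mono) simp
    also have "(2 / d * n)\<^sup>2 = (2 / d)\<^sup>2 * norm (ip L v v)"
      by (simp only: power_mult_distrib n_def hnorm_power2[OF v])
    finally show ?thesis .
  qed
  then show ?thesis using that[of "(2 / d)\<^sup>2"] by simp
qed

lemma bounded_module_map_continuous:
  assumes f: "f \<in> Lin L self_module" and C: "\<And>v. v \<in> carrier L \<Longrightarrow> (norm (f v))\<^sup>2 \<le> C * norm (ip L v v)"
    and u: "u \<in> carrier L" and e: "e > 0" and C0: "C \<ge> 0"
  shows "\<exists>d>0. \<forall>v\<in>carrier L. hnorm L (v - u) < d \<longrightarrow> norm (f v - f u) < e"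
proof (intro exI[of _ "e / (sqrt C + 1)"] conjI ballI impI)
  have p: "sqrt C + 1 > 0" using C0 by (simp add: add_nonneg_pos)
  show "e / (sqrt C + 1) > 0" using e p by simp
  fix v assume v: "v \<in> carrier L" and lt: "hnorm L (v - u) < e / (sqrt C + 1)"
  have vu: "v - u \<in> carrier L" using v u by (rule carrier_closed(4))
  have "f (v - u + u) = f (v - u) + f u" by (rule LinD(2)[OF f vu u])
  then have fd: "f v - f u = f (v - u)" by simp
  have "norm (f (v - u)) \<le> sqrt (C * norm (ip L (v - u) (v - u)))" by (rule real_le_rsqrt[OF C[OF vu]])
  also have "\<dots> = sqrt C * hnorm L (v - u)" by (simp add: hnorm_def real_sqrt_mult)
  also have "\<dots> \<le> (sqrt C + 1) * hnorm L (v - u)" by (intro mult_right_mono) (auto simp: hnorm_def)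
  also have "\<dots> < (sqrt C + 1) * (e / (sqrt C + 1))" using lt p by (rule mult_strict_left_mono)
  also have "\<dots> = e" using p by simp
  finally show "norm (f v - f u) < e" by (simp add: fd)
qed

end

text \<open>
  A neighbourhood of \<open>x\<close> contains a finite intersection of semiballs around \<open>x\<close> itself.
\<close>

lemma seminorm_topology_openD:
  assumes "generate_topology_on {{w \<in> C. p (w - v) < e} | p v e. p \<in> S \<and> v \<in> C \<and> e > 0} T"
    and tri: "\<And>p u v w. p \<in> S \<Longrightarrow> u \<in> C \<Longrightarrow> v \<in> C \<Longrightarrow> w \<in> C \<Longrightarrow> p (u - w) \<le> p (u - v) + p (v - w)"
    and "x \<in> T" "x \<in> C"
  shows "\<exists>S0 e. finite S0 \<and> S0 \<subseteq> S \<and> e > (0::real) \<and> {w \<in> C. \<forall>p\<in>S0. p (w - x) < e} \<subseteq> T"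
  using assms(1,3,4)
proof (induction rule: generate_topology_on.induct)
  case Empty
  then show ?case by simp
next
  case (Int a b)
  then obtain S1 e1 S2 e2 where *: "finite S1" "S1 \<subseteq> S" "e1 > 0" "{w \<in> C. \<forall>p\<in>S1. p (w - x) < e1} \<subseteq> a"
    "finite S2" "S2 \<subseteq> S" "e2 > 0" "{w \<in> C. \<forall>p\<in>S2. p (w - x) < e2} \<subseteq> b" by auto
  then show ?case by (intro exI[of _ "S1 \<union> S2"] exI[of _ "min e1 e2"]) auto
next
  case (UN K)
  then show ?case by (meson Union_iff Union_upper order_trans)
next
  case (Basis s)
  then obtain p v e where s: "s = {w \<in> C. p (w - v) < e}" "p \<in> S" "v \<in> C" "e > 0" by blast
  have "{w \<in> C. \<forall>p'\<in>{p}. p' (w - x) < e - p (x - v)} \<subseteq> s"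
  proof
    fix w assume w: "w \<in> {w \<in> C. \<forall>p'\<in>{p}. p' (w - x) < e - p (x - v)}"
    then have "p (w - v) \<le> p (w - x) + p (x - v)" using s Basis by (intro tri) auto
    then show "w \<in> s" using w s(1) by auto
  qed
  then show ?case using s Basis by (intro exI[of _ "{p}"] exI[of _ "e - p (x - v)"]) auto
qed

lemma seminorm_topology_topspace:
  assumes "p \<in> S" "p (0::'m::ab_group_add) = (0::real)" shows "topspace (seminorm_topology C S) = C"
proof
  show "topspace (seminorm_topology C S) \<subseteq> C" by (auto simp: seminorm_topology_def)
  show "C \<subseteq> topspace (seminorm_topology C S)"
  proof
    fix x assume "x \<in> C"
    define T where "T = {w \<in> C. p (w - x) < 1}"
    have "x \<in> T" using assms \<open>x \<in> C\<close> by (simp add: T_def)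
    moreover have "T \<in> {{w \<in> C. p (w - v) < e} | p v e. p \<in> S \<and> v \<in> C \<and> e > 0}"
      unfolding T_def using assms(1) \<open>x \<in> C\<close> zero_less_one by blast
    ultimately show "x \<in> topspace (seminorm_topology C S)"
      unfolding seminorm_topology_def topology_generated_by_topspace by (rule UnionI[rotated])
  qed
qed

lemma seminorm_topology_dense:
  assumes ne: "p0 \<in> S" "p0 (0::'m::ab_group_add) = (0::real)"
    and tri: "\<And>p u v w. p \<in> S \<Longrightarrow> u \<in> C \<Longrightarrow> v \<in> C \<Longrightarrow> w \<in> C \<Longrightarrow> p (u - w) \<le> p (u - v) + p (v - w)"
    and dense: "\<And>x S0 e. x \<in> C \<Longrightarrow> finite S0 \<Longrightarrow> S0 \<subseteq> S \<Longrightarrow> e > 0 \<Longrightarrow> \<exists>d\<in>D. d \<in> C \<and> (\<forall>p\<in>S0. p (d - x) < e)"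
  shows "seminorm_topology C S closure_of D = C"
proof
  show "seminorm_topology C S closure_of D \<subseteq> C"
    using closure_of_subset_topspace seminorm_topology_topspace[OF ne] by metis
  show "C \<subseteq> seminorm_topology C S closure_of D"
  proof
    fix x assume x: "x \<in> C"
    have "\<exists>d\<in>D. d \<in> T" if T: "x \<in> T" "openin (seminorm_topology C S) T" for T
    proof -
      have gen: "generate_topology_on {{w \<in> C. p (w - v) < e} | p v e. p \<in> S \<and> v \<in> C \<and> e > 0} T"
        using T(2) by (simp only: seminorm_topology_def openin_topology_generated_by_iff)
      have "\<exists>S0 e. finite S0 \<and> S0 \<subseteq> S \<and> e > 0 \<and> {w \<in> C. \<forall>p\<in>S0. p (w - x) < e} \<subseteq> T"
        by (rule seminorm_topology_openD[OF gen tri T(1) x])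
      then obtain S0 and e :: real where S0: "finite S0" "S0 \<subseteq> S" "e > 0" "{w \<in> C. \<forall>p\<in>S0. p (w - x) < e} \<subseteq> T"
        by (elim exE conjE)
      obtain d where "d \<in> D" "d \<in> C" "\<forall>p\<in>S0. p (d - x) < e"
        using dense[OF x S0(1-3)] by (elim bexE conjE)
      then show ?thesis using S0(4) by auto
    qed
    then have "\<forall>T. x \<in> T \<and> openin (seminorm_topology C S) T \<longrightarrow> (\<exists>d. d \<in> D \<and> d \<in> T)" by blast
    moreover have "x \<in> topspace (seminorm_topology C S)"
      using x seminorm_topology_topspace[OF ne, of C] by simp
    ultimately show "x \<in> seminorm_topology C S closure_of D" unfolding in_closure_of by (rule conjI[rotated])
  qed
qed

lemma seminorm_topology_closure_approx:
  assumes x: "x \<in> seminorm_topology C S closure_of D" "x \<in> C" and p: "p \<in> S" "p (0::'m::ab_group_add) = (0::real)" and e: "e > 0"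
  shows "\<exists>d\<in>D. d \<in> C \<and> p (d - x) < e"
proof -
  define T where "T = {w \<in> C. p (w - x) < e}"
  have "T \<in> {{w \<in> C. p (w - v) < e} | p v e. p \<in> S \<and> v \<in> C \<and> e > 0}"
    unfolding T_def using x(2) p(1) e by blast
  then have "openin (seminorm_topology C S) T"
    unfolding seminorm_topology_def by (rule topology_generated_by_Basis)
  moreover have "x \<in> T" using x(2) p e by (simp add: T_def)
  ultimately have "\<exists>d. d \<in> D \<and> d \<in> T" using x(1) by (simp add: in_closure_of)
  then show ?thesis by (auto simp: T_def)
qed

locale hilbert_module_predual = predual P + hilbert_module L
  for P :: "('a::cstar_algebra \<Rightarrow> complex) set" and L :: "('a, 'm::ab_group_add, 'z) hmodule_scheme"
begin

sublocale D: dual_module P "carrier L" "(+)" "mscale L" "mact L" "ip L" ..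

lemma sn_triangle:
  assumes \<phi>: "\<phi> \<in> P\<^sub>p" and v: "v \<in> carrier L" "w \<in> carrier L"
  shows "sqrt (D.sn \<phi> (v + w)) \<le> sqrt (D.sn \<phi> v) + sqrt (D.sn \<phi> w)"
proof (rule real_le_lsqrt)
  interpret vector_space "mscale L" by (rule vector_space)
  have "D.sn \<phi> (v + mscale L 1 w) = D.sn \<phi> v + 2 * Re (\<phi> (ip L w v)) + D.sn \<phi> w"
    using D.sn_add_scl[OF \<phi> v, of 1] by simp
  then have "D.sn \<phi> (v + w) = D.sn \<phi> v + 2 * Re (\<phi> (ip L w v)) + D.sn \<phi> w" by simp
  also have "\<dots> \<le> D.sn \<phi> v + 2 * (sqrt (D.sn \<phi> w) * sqrt (D.sn \<phi> v)) + D.sn \<phi> w"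
    using D.sn_Cauchy_Schwarz[OF \<phi> v(2,1)] complex_Re_le_cmod[of "\<phi> (ip L w v)"] by simp
  also have "\<dots> = (sqrt (D.sn \<phi> v) + sqrt (D.sn \<phi> w))\<^sup>2"
    using D.sn_nonneg[OF \<phi> v(1)] D.sn_nonneg[OF \<phi> v(2)] by (simp add: power2_sum algebra_simps)
  finally show "D.sn \<phi> (v + w) \<le> (sqrt (D.sn \<phi> v) + sqrt (D.sn \<phi> w))\<^sup>2" .
qed (use D.sn_nonneg[OF \<phi>] v carrier_closed in auto)

text \<open>Both topologies come from seminorms dominated by those of \<open>\<tau>\<^sub>1\<close>.\<close>

definition seminorms :: "tau \<Rightarrow> ('m \<Rightarrow> real) set" where
  "seminorms t = (case t of Tau1 \<Rightarrow> {(\<lambda>l. sqrt (Re (\<phi> (ip L l l)))) | \<phi>. \<phi> \<in> P\<^sub>p}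
    | Tau2 \<Rightarrow> {(\<lambda>l. cmod (\<phi> (ip L l' l))) | \<phi> l'. \<phi> \<in> P\<^sub>p \<and> l' \<in> carrier L})"

lemma module_topology_eq: "module_topology P t L = seminorm_topology (carrier L) (seminorms t)"
  by (cases t) (simp_all add: seminorms_def)

lemma seminorms_zero: "p \<in> seminorms t \<Longrightarrow> p 0 = 0"
  by (cases t) (auto simp: seminorms_def ip_zero_right carrier_closed dual_spaceD[OF Pp_dual])

lemma seminorms_nonempty: "seminorms t \<noteq> {}"
  using Pp_0 carrier_closed(3) by (cases t) (auto simp: seminorms_def)

lemma seminorms_dominated:
  assumes "p \<in> seminorms t"
  obtains \<phi> B where "\<phi> \<in> P\<^sub>p" "B \<ge> 0" "\<And>v. v \<in> carrier L \<Longrightarrow> p v \<le> B * sqrt (D.sn \<phi> v)"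
proof (cases t)
  case Tau1
  then obtain \<phi> where "\<phi> \<in> P\<^sub>p" "p = (\<lambda>l. sqrt (Re (\<phi> (ip L l l))))" using assms by (auto simp: seminorms_def)
  then show ?thesis using that[of \<phi> 1] by simp
next
  case Tau2
  then obtain \<phi> l where l: "\<phi> \<in> P\<^sub>p" "l \<in> carrier L" "p = (\<lambda>v. cmod (\<phi> (ip L l v)))" using assms by (auto simp: seminorms_def)
  then show ?thesis using that[of \<phi> "sqrt (D.sn \<phi> l)"] D.sn_Cauchy_Schwarz[OF l(1,2)] D.sn_nonneg[OF l(1,2)] by simp
qed

lemma seminorms_triangle:
  assumes "p \<in> seminorms t" "u \<in> carrier L" "v \<in> carrier L" "w \<in> carrier L"
  shows "p (u - w) \<le> p (u - v) + p (v - w)"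
proof -
  have c: "u - v \<in> carrier L" "v - w \<in> carrier L" using assms carrier_closed(4) by auto
  have e: "u - w = (u - v) + (v - w)" by simp
  show ?thesis
  proof (cases t)
    case Tau1
    then obtain \<phi> where \<phi>: "\<phi> \<in> P\<^sub>p" "p = (\<lambda>l. sqrt (Re (\<phi> (ip L l l))))" using assms by (auto simp: seminorms_def)
    show ?thesis unfolding \<phi>(2) e using sn_triangle[OF \<phi>(1) c] by simp
  next
    case Tau2
    then obtain \<phi> l where l: "\<phi> \<in> P\<^sub>p" "l \<in> carrier L" "p = (\<lambda>v. cmod (\<phi> (ip L l v)))" using assms by (auto simp: seminorms_def)
    have "\<phi> (ip L l (u - w)) = \<phi> (ip L l (u - v)) + \<phi> (ip L l (v - w))"
      unfolding e S.k_add[OF l(2) c] by (rule dual_spaceD(2)[OF Pp_dual[OF l(1)]])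
    then show ?thesis unfolding l(3) by (simp only: norm_triangle_ineq)
  qed
qed

lemma seminorms_finite_dominated:
  assumes "finite S0" "S0 \<subseteq> seminorms t"
  shows "\<exists>\<phi>\<in>P\<^sub>p. \<exists>B\<ge>0. \<forall>p\<in>S0. \<forall>v\<in>carrier L. p v \<le> B * sqrt (D.sn \<phi> v)"
  using assms
proof (induction S0 rule: finite_induct)
  case empty
  then show ?case using Pp_0 by (intro bexI[of _ "\<lambda>a. 0"] exI[of _ 0]) auto
next
  case (insert p S0)
  then obtain \<phi> B where \<phi>: "\<phi> \<in> P\<^sub>p" "B \<ge> 0" "\<forall>p\<in>S0. \<forall>v\<in>carrier L. p v \<le> B * sqrt (D.sn \<phi> v)" by auto
  have "p \<in> seminorms t" using insert by simp
  then obtain \<psi> B' where \<psi>: "\<psi> \<in> P\<^sub>p" "B' \<ge> 0" "\<And>v. v \<in> carrier L \<Longrightarrow> p v \<le> B' * sqrt (D.sn \<psi> v)"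
    by (rule seminorms_dominated) blast
  have le: "sqrt (D.sn \<phi> v) \<le> sqrt (D.sn (\<lambda>a. \<phi> a + \<psi> a) v)" "sqrt (D.sn \<psi> v) \<le> sqrt (D.sn (\<lambda>a. \<phi> a + \<psi> a) v)"
    if "v \<in> carrier L" for v
    using D.sn_nonneg[OF \<phi>(1) that] D.sn_nonneg[OF \<psi>(1) that] by auto
  have "q v \<le> max B B' * sqrt (D.sn (\<lambda>a. \<phi> a + \<psi> a) v)" if q: "q \<in> insert p S0" and v: "v \<in> carrier L" for q v
  proof (cases "q = p")
    case True
    have "q v \<le> B' * sqrt (D.sn \<psi> v)" using \<psi>(3)[OF v] True by simp
    also have "\<dots> \<le> max B B' * sqrt (D.sn (\<lambda>a. \<phi> a + \<psi> a) v)"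
      using \<psi>(2) le(2)[OF v] D.sn_nonneg[OF \<psi>(1) v] by (intro mult_mono) auto
    finally show ?thesis .
  next
    case False
    then have "q v \<le> B * sqrt (D.sn \<phi> v)" using \<phi>(3) q v by auto
    also have "\<dots> \<le> max B B' * sqrt (D.sn (\<lambda>a. \<phi> a + \<psi> a) v)"
      using \<phi>(2) le(1)[OF v] D.sn_nonneg[OF \<phi>(1) v] by (intro mult_mono) auto
    finally show ?thesis .
  qed
  then show ?case using Pp_add[OF \<phi>(1) \<psi>(1)] \<phi>(2) by (intro bexI[of _ "\<lambda>a. \<phi> a + \<psi> a"] exI[of _ "max B B'"]) auto
qed

text \<open>
  Finitely many seminorms of either topology are dominated by a multiple of a single seminorm of
  \<open>\<tau>\<^sub>1\<close>, because positive functionals can be added.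
\<close>

lemma module_topology_dense:
  assumes D: "D \<subseteq> carrier L"
    and dense: "\<And>v \<phi> r. v \<in> carrier L \<Longrightarrow> \<phi> \<in> P\<^sub>p \<Longrightarrow> r > 0 \<Longrightarrow> \<exists>d\<in>D. D.sn \<phi> (d - v) < r"
  shows "module_topology P t L closure_of D = carrier L"
proof -
  obtain p0 where p0: "p0 \<in> seminorms t" using seminorms_nonempty by blast
  show ?thesis
    unfolding module_topology_eq
  proof (rule seminorm_topology_dense[OF p0 seminorms_zero[OF p0] seminorms_triangle])
    fix x S0 and e :: real assume x: "x \<in> carrier L" and S0: "finite S0" "S0 \<subseteq> seminorms t" and e: "e > 0"
    obtain \<phi> B where \<phi>: "\<phi> \<in> P\<^sub>p" "B \<ge> 0" "\<forall>p\<in>S0. \<forall>v\<in>carrier L. p v \<le> B * sqrt (D.sn \<phi> v)"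
      using seminorms_finite_dominated[OF S0] by blast
    define r where "r = e / (B + 1)"
    have r: "r > 0" using e \<phi>(2) by (simp add: r_def)
    obtain d where d: "d \<in> D" "D.sn \<phi> (d - x) < r\<^sup>2" using dense[OF x \<phi>(1), of "r\<^sup>2"] r by auto
    have dx: "d - x \<in> carrier L" using D d x carrier_closed(4) by blast
    have s: "sqrt (D.sn \<phi> (d - x)) \<le> r" using d(2) r by (intro real_le_lsqrt) auto
    have "p (d - x) < e" if "p \<in> S0" for p
    proof -
      have "p (d - x) \<le> B * sqrt (D.sn \<phi> (d - x))" using \<phi>(3) that dx by blast
      also have "\<dots> \<le> B * r" using s \<phi>(2) by (rule mult_left_mono)
      also have "\<dots> < (B + 1) * r" using r by simp
      also have "\<dots> = e" using \<phi>(2) by (simp add: r_def)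
      finally show ?thesis .
    qed
    then show "\<exists>d\<in>D. d \<in> carrier L \<and> (\<forall>p\<in>S0. p (d - x) < e)" using d(1) D by blast
  qed
qed

text \<open>
  In both topologies the functional \<open>\<phi> \<circ> \<langle>l|\<cdot>\<rangle>\<close> is continuous.
\<close>

lemma dense_orthogonal_zero:
  assumes cl: "module_topology P t L closure_of D = carrier L" and l: "l \<in> carrier L"
    and orth: "\<And>d. d \<in> D \<Longrightarrow> d \<in> carrier L \<Longrightarrow> ip L l d = 0"
  shows "l = 0"
proof (rule ip_definite[OF l], rule Pp_separates)
  fix \<phi> assume \<phi>: "\<phi> \<in> P\<^sub>p"
  note lin = dual_spaceD[OF Pp_dual[OF \<phi>]]
  have le: "cmod (\<phi> (ip L l l)) \<le> cmod (\<phi> (ip L l (d - l)))" if d: "d \<in> D" "d \<in> carrier L" for d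
    using orth[OF d] by (simp add: ip_diff_right l d lin)
  have "cmod (\<phi> (ip L l l)) \<le> 0"
  proof (rule field_le_epsilon)
    fix e :: real assume e: "e > 0"
    show "cmod (\<phi> (ip L l l)) \<le> 0 + e"
    proof (cases t)
      case Tau1
      define q where "q = (\<lambda>v. sqrt (Re (\<phi> (ip L v v))))"
      have q: "q \<in> seminorms t" using Tau1 \<phi> by (auto simp: seminorms_def q_def)
      define s where "s = sqrt (D.sn \<phi> l) + 1"
      have s: "s > 0" using D.sn_nonneg[OF \<phi> l] by (simp add: s_def add_nonneg_pos)
      obtain d where d: "d \<in> D" "d \<in> carrier L" "q (d - l) < e / s"
        using seminorm_topology_closure_approx[OF _ l q seminorms_zero[OF q], of D "e / s"] cl e s l
        by (auto simp: module_topology_eq)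
      have "cmod (\<phi> (ip L l (d - l))) \<le> sqrt (D.sn \<phi> l) * q (d - l)"
        unfolding q_def by (rule D.sn_Cauchy_Schwarz[OF \<phi> l carrier_closed(4)[OF d(2) l]])
      also have "\<dots> \<le> s * (e / s)"
        using d(3) D.sn_nonneg[OF \<phi> l] D.sn_nonneg[OF \<phi> carrier_closed(4)[OF d(2) l]] s
        by (intro mult_mono) (auto simp: s_def q_def)
      finally show ?thesis using le[OF d(1,2)] s by simp
    next
      case Tau2
      define q where "q = (\<lambda>v. cmod (\<phi> (ip L l v)))"
      have q: "q \<in> seminorms t" using Tau2 \<phi> l by (auto simp: seminorms_def q_def)
      obtain d where d: "d \<in> D" "d \<in> carrier L" "q (d - l) < e"
        using seminorm_topology_closure_approx[OF _ l q seminorms_zero[OF q], of D e] cl e l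
        by (auto simp: module_topology_eq)
      then show ?thesis using le[OF d(1,2)] by (simp add: q_def)
    qed
  qed
  then show "\<phi> (ip L l l) = \<phi> 0" by (simp add: lin)
qed

end


section \<open>The module of a positive kernel\<close>

text \<open>
  Formal sums of pairs are represented by the lists of their terms; this is the additive extension of
  a function to them.
\<close>

definition extend :: "('x \<Rightarrow> 'v \<Rightarrow> 'a::cstar_algebra) \<Rightarrow> ('x \<times> 'v) list \<Rightarrow> 'a" where
  "extend F l = (\<Sum>(x, v)\<leftarrow>l. F x v)"

lemma extend_simps [simp]: "extend F [] = 0" "extend F ((x, v) # l) = F x v + extend F l"
  by (simp_all add: extend_def)

lemma extend_append: "extend F (l @ m) = extend F l + extend F m"
  by (simp add: extend_def)

lemma extend_add: "extend (\<lambda>x v. F x v + G x v) l = extend F l + extend G l"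
  by (induction l) (auto simp: extend_def)

lemma extend_scaleC: "extend (\<lambda>x v. c *\<^sub>C F x v) l = c *\<^sub>C extend F l"
  by (induction l) (auto simp: extend_def scaleC_add_right)

lemma extend_mult_right: "extend (\<lambda>x v. F x v * a) l = extend F l * a"
  by (induction l) (auto simp: extend_def distrib_right)

lemma extend_mult_left: "extend (\<lambda>x v. a * F x v) l = a * extend F l"
  by (induction l) (auto simp: extend_def distrib_left)

lemma extend_star: "star (extend F l) = extend (\<lambda>x v. star (F x v)) l"
  by (induction l) (auto simp: extend_def star_add)

lemma extend_cong: "(\<And>x v. (x, v) \<in> set l \<Longrightarrow> F x v = G x v) \<Longrightarrow> extend F l = extend G l"
  by (induction l) auto

lemma extend_map: "extend F (map (\<lambda>(x, v). (g x v, h x v)) l) = extend (\<lambda>x v. F (g x v) (h x v)) l"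
  by (induction l) auto

locale positive_kernel = predual P + V: A_module V
  for P :: "('a::cstar_algebra \<Rightarrow> complex) set" and V :: "('a, 'v::ab_group_add) amodule" +
  fixes X :: "'x set" and K :: "'x \<Rightarrow> 'x \<Rightarrow> 'v \<Rightarrow> 'v \<Rightarrow> 'a"
  assumes K_sesquilinear: "x \<in> X \<Longrightarrow> y \<in> X \<Longrightarrow> K x y \<in> sesquilinear_forms V"
    and K_positive: "\<And>(n::nat) x v. (\<forall>j<n. x j \<in> X \<and> v j \<in> carrier V) \<Longrightarrow>
        positive (\<Sum>j<n. \<Sum>k<n. K (x j) (x k) (v j) (v k))"
begin

text \<open>Values outside \<open>X\<close> and \<open>V\<close> are set to \<open>0\<close>, so that functions are determined by their values inside.\<close>

definition kernel0 :: "'x \<Rightarrow> 'x \<Rightarrow> 'v \<Rightarrow> 'v \<Rightarrow> 'a" where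
  "kernel0 x y v w = (if x \<in> X \<and> y \<in> X \<and> v \<in> carrier V \<and> w \<in> carrier V then K x y v w else 0)"

definition formal_sums :: "('x \<times> 'v) list set" where
  "formal_sums = {l. set l \<subseteq> X \<times> carrier V}"

definition sum_scale :: "complex \<Rightarrow> ('x \<times> 'v) list \<Rightarrow> ('x \<times> 'v) list" where
  "sum_scale c = map (\<lambda>(x, v). (x, mscale V c v))"

definition sum_act :: "('x \<times> 'v) list \<Rightarrow> 'a \<Rightarrow> ('x \<times> 'v) list" where
  "sum_act l a = map (\<lambda>(x, v). (x, mact V v a)) l"

definition kform :: "('x \<times> 'v) list \<Rightarrow> ('x \<times> 'v) list \<Rightarrow> 'a" where
  "kform l m = extend (\<lambda>x v. extend (\<lambda>y w. kernel0 x y v w) m) l"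

lemma formal_sums_closed:
  "[] \<in> formal_sums" "l \<in> formal_sums \<Longrightarrow> m \<in> formal_sums \<Longrightarrow> l @ m \<in> formal_sums"
  "l \<in> formal_sums \<Longrightarrow> sum_scale c l \<in> formal_sums" "l \<in> formal_sums \<Longrightarrow> sum_act l a \<in> formal_sums"
  "x \<in> X \<Longrightarrow> v \<in> carrier V \<Longrightarrow> [(x, v)] \<in> formal_sums"
  by (auto simp: formal_sums_def sum_scale_def sum_act_def V.carrier_closed V.act_closed)

lemma K_linear:
  assumes "x \<in> X" "y \<in> X" "v \<in> carrier V" "w \<in> carrier V"
  shows "u \<in> carrier V \<Longrightarrow> K x y v (w + u) = K x y v w + K x y v u"
    "u \<in> carrier V \<Longrightarrow> K x y (v + u) w = K x y v w + K x y u w"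
    "K x y v (mscale V c w) = c *\<^sub>C K x y v w" "K x y (mscale V c v) w = cnj c *\<^sub>C K x y v w"
    "K x y v (mact V w a) = K x y v w * a" "K x y (mact V v a) w = star a * K x y v w"
  using K_sesquilinear[OF assms(1,2)] assms(3,4) by (auto simp: sesquilinear_forms_def)

lemma kernel0_linear:
  assumes "w \<in> carrier V"
  shows "kernel0 x y v (mscale V c w) = c *\<^sub>C kernel0 x y v w" "kernel0 y x (mscale V c w) v = cnj c *\<^sub>C kernel0 y x w v"
    "kernel0 x y v (mact V w a) = kernel0 x y v w * a" "kernel0 y x (mact V w a) v = star a * kernel0 y x w v"
    "u \<in> carrier V \<Longrightarrow> kernel0 x y v (w + u) = kernel0 x y v w + kernel0 x y v u"
  using assms by (auto simp: kernel0_def K_linear V.carrier_closed V.act_closed)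

lemma kform_right:
  assumes m: "m \<in> formal_sums"
  shows "kform l (m @ m') = kform l m + kform l m'" "kform l (sum_scale c m) = c *\<^sub>C kform l m"
    "kform l (sum_act m a) = kform l m * a"
proof -
  show "kform l (m @ m') = kform l m + kform l m'" by (simp add: kform_def extend_append extend_add)
  have in_V: "w \<in> carrier V" if "(y, w) \<in> set m" for y w using that m by (auto simp: formal_sums_def)
  have "extend (\<lambda>y w. kernel0 x y v (mscale V c w)) m = c *\<^sub>C extend (\<lambda>y w. kernel0 x y v w) m" for x v
    unfolding extend_scaleC[symmetric] by (rule extend_cong) (simp add: kernel0_linear in_V)
  then show "kform l (sum_scale c m) = c *\<^sub>C kform l m"
    by (simp add: kform_def sum_scale_def extend_map extend_scaleC)
  have "extend (\<lambda>y w. kernel0 x y v (mact V w a)) m = extend (\<lambda>y w. kernel0 x y v w) m * a" for x v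
    unfolding extend_mult_right[symmetric] by (rule extend_cong) (simp add: kernel0_linear in_V)
  then show "kform l (sum_act m a) = kform l m * a"
    by (simp add: kform_def sum_act_def extend_map extend_mult_right)
qed

lemma kform_left:
  assumes l: "l \<in> formal_sums"
  shows "kform (l @ l') m = kform l m + kform l' m" "kform (sum_scale c l) m = cnj c *\<^sub>C kform l m"
proof -
  show "kform (l @ l') m = kform l m + kform l' m" by (simp add: kform_def extend_append)
  have in_V: "w \<in> carrier V" if "(y, w) \<in> set l" for y w using that l by (auto simp: formal_sums_def)
  have "extend (\<lambda>x v. extend (\<lambda>y w. kernel0 x y (mscale V c v) w) m) l
      = extend (\<lambda>x v. cnj c *\<^sub>C extend (\<lambda>y w. kernel0 x y v w) m) l"
    unfolding extend_scaleC[symmetric] by (intro extend_cong) (simp add: kernel0_linear in_V)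
  then show "kform (sum_scale c l) m = cnj c *\<^sub>C kform l m"
    by (simp add: kform_def sum_scale_def extend_map extend_scaleC)
qed

lemma kform_positive:
  assumes l: "l \<in> formal_sums" shows "positive (kform l l)"
proof -
  define x where "x j = fst (l ! j)" for j
  define v where "v j = snd (l ! j)" for j
  have ext: "extend F l = (\<Sum>j<length l. F (x j) (v j))" for F :: "'x \<Rightarrow> 'v \<Rightarrow> 'a"
    unfolding extend_def by (simp add: sum_list_sum_nth atLeast0LessThan case_prod_beta x_def v_def)
  have mem: "x j \<in> X \<and> v j \<in> carrier V" if "j < length l" for j
  proof -
    have "l ! j \<in> X \<times> carrier V" using l nth_mem[OF that] by (auto simp only: formal_sums_def)
    then show ?thesis by (simp add: x_def v_def mem_Times_iff)
  qed
  have "kform l l = (\<Sum>j<length l. \<Sum>k<length l. K (x j) (x k) (v j) (v k))"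
    unfolding kform_def ext by (intro sum.cong) (use mem in \<open>auto simp: kernel0_def\<close>)
  then show ?thesis using K_positive[of "length l" x v] mem by simp
qed

text \<open>Hermitian symmetry follows from positivity by polarization.\<close>

lemma kform_star:
  assumes l: "l \<in> formal_sums" and m: "m \<in> formal_sums"
  shows "star (kform l m) = kform m l"
proof -
  define a where "a = kform l m"
  define b where "b = kform m l"
  have sl: "star (kform l l) = kform l l" "star (kform m m) = kform m m"
    by (rule positive_selfadj[OF kform_positive[OF l]] positive_selfadj[OF kform_positive[OF m]])+
  have key: "star (c *\<^sub>C a + cnj c *\<^sub>C b) = c *\<^sub>C a + cnj c *\<^sub>C b" for c
  proof -
    have mem: "l @ sum_scale c m \<in> formal_sums" by (intro formal_sums_closed l m)
    have "star (kform (l @ sum_scale c m) (l @ sum_scale c m)) = kform (l @ sum_scale c m) (l @ sum_scale c m)"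
      by (rule positive_selfadj[OF kform_positive[OF mem]])
    moreover have "kform (l @ sum_scale c m) (l @ sum_scale c m)
        = kform l l + (c *\<^sub>C a + cnj c *\<^sub>C b) + (c * cnj c) *\<^sub>C kform m m"
      by (simp add: kform_left[OF l] kform_left[OF m] kform_right[OF l] kform_right[OF m] a_def b_def scaleC_simps mult.commute)
    ultimately show ?thesis by (simp add: star_add star_scaleC sl mult.commute)
  qed
  have 1: "star a + star b = a + b" using key[of 1] by (simp add: star_add)
  have "\<i> *\<^sub>C (star b - star a) = \<i> *\<^sub>C (a - b)"
    using key[of \<i>] by (simp add: star_add star_scaleC star_diff scaleC_simps)
  then have "(- \<i>) *\<^sub>C \<i> *\<^sub>C (star b - star a) = (- \<i>) *\<^sub>C \<i> *\<^sub>C (a - b)" by simp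
  then have 2: "star b - star a = a - b" by (simp only: scaleC_scaleC) simp
  have "(star a + star b) - (star b - star a) = (a + b) - (a - b)" by (simp only: 1 2)
  then have "2 *\<^sub>R star a = 2 *\<^sub>R b" by (simp add: scaleR_2)
  then show ?thesis by (simp add: a_def b_def)
qed

sublocale S: dual_module P formal_sums "(@)" sum_scale sum_act kform
proof
  show "formal_sums \<noteq> {}" using formal_sums_closed(1) by blast
qed (simp_all add: formal_sums_closed kform_right kform_star kform_positive)

text \<open>
  The dual of the module of formal sums, with each functional recorded by its values on single terms.
\<close>

definition model_carrier :: "('x \<Rightarrow> 'v \<Rightarrow> 'a) set" where
  "model_carrier = {F. extend F \<in> S.dual \<and> (\<forall>x v. \<not> (x \<in> X \<and> v \<in> carrier V) \<longrightarrow> F x v = 0)}"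

definition model :: "('a, 'x \<Rightarrow> 'v \<Rightarrow> 'a) hmodule" where
  "model = \<lparr>carrier = model_carrier, mscale = (\<lambda>c F x v. c *\<^sub>C F x v), mact = (\<lambda>F a x v. F x v * a),
    ip = (\<lambda>F G. S.dual_ip (extend F) (extend G))\<rparr>"

definition restrict_dual :: "(('x \<times> 'v) list \<Rightarrow> 'a) \<Rightarrow> 'x \<Rightarrow> 'v \<Rightarrow> 'a" where
  "restrict_dual G x v = (if x \<in> X \<and> v \<in> carrier V then G [(x, v)] else 0)"

text \<open>
  The image of a formal sum in its dual, in the same form.
\<close>

definition model_vector :: "('x \<times> 'v) list \<Rightarrow> 'x \<Rightarrow> 'v \<Rightarrow> 'a" where
  "model_vector l y u = extend (\<lambda>x v. kernel0 y x u v) l"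

lemma extend_plus: "extend (F + G) = (\<lambda>e. extend F e + extend G e)"
  by (rule ext) (simp add: extend_add plus_fun_def)

lemma extend_minus: "extend (F - G) = (\<lambda>e. extend F e + (- 1) *\<^sub>C extend G e)"
proof
  fix e
  have "F - G = (\<lambda>x v. F x v + (- 1) *\<^sub>C G x v)" by (intro ext) (simp add: scaleC_minus1)
  then show "extend (F - G) e = extend F e + (- 1) *\<^sub>C extend G e" by (simp only: extend_add extend_scaleC)
qed

lemma extend_restrict_dual:
  assumes G: "G \<in> S.dual" and e: "e \<in> formal_sums" shows "extend (restrict_dual G) e = G e"
  using e
proof (induction e)
  case Nil
  have "G (sum_scale 0 []) = cnj 0 *\<^sub>C G []" by (rule S.dualD(2)[OF G formal_sums_closed(1)])
  then show ?case by (simp add: sum_scale_def)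
next
  case (Cons p e)
  obtain x v where p: "p = (x, v)" by (cases p)
  have mem: "[(x, v)] \<in> formal_sums" "e \<in> formal_sums" "x \<in> X" "v \<in> carrier V"
    using Cons.prems by (auto simp: formal_sums_def p)
  have "G ([(x, v)] @ e) = G [(x, v)] + G e" by (rule S.dualD(1)[OF G mem(1,2)])
  then show ?case using Cons.IH mem by (simp add: p restrict_dual_def)
qed

lemma restrict_dual_mem: "G \<in> S.dual \<Longrightarrow> restrict_dual G \<in> model_carrier"
  unfolding model_carrier_def
  using S.dual_cong[of G "extend (restrict_dual G)"] extend_restrict_dual by (simp add: restrict_dual_def)

lemma restrict_extend: "F \<in> model_carrier \<Longrightarrow> restrict_dual (extend F) = F"
  by (intro ext) (auto simp: restrict_dual_def model_carrier_def)

lemma model_vector_extend: "extend (model_vector l) = S.embed l"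
  by (rule ext) (simp add: S.embed_def kform_def model_vector_def[abs_def])

lemma model_vector_mem: "l \<in> formal_sums \<Longrightarrow> model_vector l \<in> model_carrier"
  unfolding model_carrier_def mem_Collect_eq model_vector_extend
proof (intro conjI allI impI S.embed_dual)
  fix y u assume "\<not> (y \<in> X \<and> u \<in> carrier V)"
  then have "model_vector l y u = extend (\<lambda>x v. 0) l" by (auto simp: model_vector_def kernel0_def)
  also have "\<dots> = 0" by (induction l) auto
  finally show "model_vector l y u = 0" .
qed

lemma model_vector_append: "model_vector (l @ m) = model_vector l + model_vector m"
  by (intro ext) (simp add: model_vector_def extend_append)

lemma model_ip: "ip model F G = S.dual_ip (extend F) (extend G)"
  and model_mscale: "mscale model c F = (\<lambda>x v. c *\<^sub>C F x v)"
  and model_mact: "mact model F a = (\<lambda>x v. F x v * a)"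
  and model_carrier: "carrier model = model_carrier"
  by (simp_all add: model_def)

lemma extend_mscale: "extend (mscale model c F) = (\<lambda>e. c *\<^sub>C extend F e)"
  by (rule ext) (simp add: model_mscale extend_scaleC)

lemma extend_mact: "extend (mact model F a) = (\<lambda>e. extend F e * a)"
  by (rule ext) (simp add: model_mact extend_mult_right)

lemma model_dual: "F \<in> model_carrier \<Longrightarrow> extend F \<in> S.dual"
  by (simp add: model_carrier_def)

lemma model_A_module: "A_module model"
proof (rule A_module.intro)
  show vs: "vector_space (mscale model)"
    by unfold_locales (auto simp: model_mscale scaleC_add_right scaleC_add_left scaleC_scaleC fun_eq_iff)
  interpret vector_space "mscale model" by (rule vs)
  show "subspace (carrier model)"
  proof (rule subspaceI)
    have "extend (0 :: 'x \<Rightarrow> 'v \<Rightarrow> 'a) = (\<lambda>e. 0 *\<^sub>C S.embed [] e)"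
    proof
      fix e :: "('x \<times> 'v) list" show "extend 0 e = 0 *\<^sub>C S.embed [] e" by (induction e) auto
    qed
    then show "0 \<in> carrier model"
      using S.dual_scl[OF S.embed_dual[OF formal_sums_closed(1)], of 0] by (simp add: model_carrier model_carrier_def)
    show "F + G \<in> carrier model" if "F \<in> carrier model" "G \<in> carrier model" for F G
      using that by (simp add: model_carrier model_carrier_def extend_plus S.dual_add)
    show "mscale model c F \<in> carrier model" if "F \<in> carrier model" for c F
      using that by (simp add: model_carrier model_carrier_def extend_mscale S.dual_scl) (simp add: model_mscale)
  qed
  fix F G :: "'x \<Rightarrow> 'v \<Rightarrow> 'a" and a b c
  show "mact model F a \<in> carrier model" if "F \<in> carrier model"
    using that by (simp add: model_carrier model_carrier_def extend_mact S.dual_act) (simp add: model_mact)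
qed (auto simp: model_mact model_mscale fun_eq_iff algebra_simps scaleC_simps)

sublocale M: A_module model
  by (rule model_A_module)

lemma model_eval_bound:
  assumes F: "F \<in> model_carrier" and e: "e \<in> formal_sums"
  shows "(norm (extend F e))\<^sup>2 \<le> norm (ip model F F) * norm (kform e e)"
  unfolding model_ip by (rule S.dual_eval_bound[OF model_dual[OF F] e])

lemma model_hilbert: "hilbert_module model"
proof (rule hilbert_module.intro[OF model_A_module], unfold_locales)
  show "ip model \<in> sesquilinear_forms model"
    unfolding sesquilinear_forms_def
    by (auto simp: model_ip model_carrier extend_plus extend_mscale extend_mact model_dual S.dual.k_expand)
  fix F G :: "'x \<Rightarrow> 'v \<Rightarrow> 'a"
  show "star (ip model F G) = ip model G F" if "F \<in> carrier model" "G \<in> carrier model"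
    using that by (simp add: model_ip model_carrier model_dual S.dual_ip_star)
  show "positive (ip model F F)" if "F \<in> carrier model"
    using that by (simp add: model_ip model_carrier model_dual S.dual_ip_positive)
  show "F = 0" if F: "F \<in> carrier model" "ip model F F = 0"
  proof (intro ext)
    fix x v
    show "F x v = 0 x v"
    proof (cases "x \<in> X \<and> v \<in> carrier V")
      case True
      then show ?thesis
        using model_eval_bound[of F "[(x, v)]"] F formal_sums_closed(5) by (simp add: model_carrier)
    next
      case False
      then show ?thesis using F by (auto simp: model_carrier model_carrier_def)
    qed
  qed
next
  fix u :: "nat \<Rightarrow> 'x \<Rightarrow> 'v \<Rightarrow> 'a"
  assume u: "\<And>n. u n \<in> carrier model"
    and cauchy: "\<And>e. e > 0 \<Longrightarrow> \<exists>N. \<forall>m\<ge>N. \<forall>n\<ge>N. hnorm model (u m - u n) < e"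
  have u': "u n \<in> model_carrier" for n using u by (simp add: model_carrier)
  have ip_diff: "ip model (F - G) (F - G)
      = S.dual_ip (\<lambda>e. extend F e + (- 1) *\<^sub>C extend G e) (\<lambda>e. extend F e + (- 1) *\<^sub>C extend G e)" for F G
    by (simp only: model_ip extend_minus)
  have cauchy2: "\<exists>N. \<forall>m\<ge>N. \<forall>n\<ge>N. norm (ip model (u m - u n) (u m - u n)) \<le> r" if r: "r > 0" for r
  proof -
    obtain N where N: "\<forall>m\<ge>N. \<forall>n\<ge>N. hnorm model (u m - u n) < sqrt r" using cauchy[of "sqrt r"] r by auto
    then show ?thesis by (auto simp: hnorm_def intro: less_imp_le)
  qed
  have conv: "\<exists>z. (\<lambda>n. u n x v) \<longlonglongrightarrow> z" for x v
  proof (cases "x \<in> X \<and> v \<in> carrier V")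
    case True
    define k where "k = norm (kform [(x, v)] [(x, v)]) + 1"
    have k: "k > 0" by (simp add: k_def add_nonneg_pos)
    have "Cauchy (\<lambda>n. u n x v)"
    proof (rule CauchyI)
      fix e :: real assume e: "e > 0"
      define r where "r = e\<^sup>2 / (2 * k)"
      have r: "r > 0" using e k by (simp add: r_def)
      obtain N where N: "\<forall>m\<ge>N. \<forall>n\<ge>N. norm (ip model (u m - u n) (u m - u n)) \<le> r" using cauchy2[OF r] by blast
      have "norm (u m x v - u n x v) < e" if mn: "m \<ge> N" "n \<ge> N" for m n
      proof -
        have mem: "u m - u n \<in> model_carrier" using M.carrier_closed(4)[OF u u] by (simp add: model_carrier)
        have "(norm (extend (u m - u n) [(x, v)]))\<^sup>2 \<le> norm (ip model (u m - u n) (u m - u n)) * norm (kform [(x, v)] [(x, v)])"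
          by (rule model_eval_bound[OF mem]) (use True formal_sums_closed(5) in blast)
        also have "\<dots> \<le> r * k" using N mn r by (intro mult_mono) (auto simp: k_def)
        also have "\<dots> = e\<^sup>2 / 2" using k by (simp add: r_def)
        also have "\<dots> < e\<^sup>2" using e by simp
        finally have "(norm (u m x v - u n x v))\<^sup>2 < e\<^sup>2" by simp
        then show ?thesis using e by (simp add: power2_less_imp_less)
      qed
      then show "\<exists>M. \<forall>m\<ge>M. \<forall>n\<ge>M. norm (u m x v - u n x v) < e" by blast
    qed
    then show ?thesis using Cauchy_convergent convergent_def by blast
  next
    case False
    then have "u n x v = 0" for n using u'[of n] by (auto simp: model_carrier_def)
    then show ?thesis using tendsto_const[of "0::'a"] by auto
  qed
  then obtain F where F: "\<And>x v. (\<lambda>n. u n x v) \<longlonglongrightarrow> F x v" by metis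
  have lim: "(\<lambda>n. extend (u n) e) \<longlonglongrightarrow> extend F e" for e
  proof (induction e)
    case (Cons p e)
    then show ?case by (cases p) (simp add: tendsto_add F)
  qed simp
  note complete = S.dual_complete[of "\<lambda>n. extend (u n)" "extend F", OF model_dual[OF u'] cauchy2[unfolded ip_diff] lim]
  have "F x v = 0" if "\<not> (x \<in> X \<and> v \<in> carrier V)" for x v
  proof -
    have "u n x v = 0" for n using u'[of n] that by (auto simp: model_carrier_def)
    then show ?thesis using F[of x v] by (simp add: LIMSEQ_const_iff)
  qed
  then have Fm: "F \<in> carrier model" using complete(1) by (auto simp: model_carrier model_carrier_def)
  moreover have "(\<lambda>n. hnorm model (u n - F)) \<longlonglongrightarrow> 0"
  proof (rule LIMSEQ_I)
    fix r :: real assume r: "r > 0"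
    then obtain N where N: "\<forall>n\<ge>N. norm (ip model (u n - F) (u n - F)) \<le> (r / 2)\<^sup>2"
      unfolding ip_diff using complete(2)[of "(r / 2)\<^sup>2"] by auto
    have "hnorm model (u n - F) \<le> r / 2" if "n \<ge> N" for n
      unfolding hnorm_def using N that r by (intro real_le_lsqrt) auto
    then have "norm (hnorm model (u n - F) - 0) < r" if "n \<ge> N" for n
      using that r by (simp add: hnorm_def) (smt (verit) field_sum_of_halves)
    then show "\<exists>no. \<forall>n\<ge>no. norm (hnorm model (u n - F) - 0) < r" by blast
  qed
  ultimately show "\<exists>l\<in>carrier model. (\<lambda>n. hnorm model (u n - l)) \<longlonglongrightarrow> 0" by blast
qed

sublocale M: hilbert_module model
  by (rule model_hilbert)

sublocale MP: hilbert_module_predual P model ..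

text \<open>
  Self-duality of the dual of the formal sums, transported along \<open>restrict_dual\<close>.
\<close>

lemma model_riesz:
  assumes f: "f \<in> Lin model self_module"
    and C: "C \<ge> 0" "\<And>F. F \<in> carrier model \<Longrightarrow> (norm (f F))\<^sup>2 \<le> C * norm (ip model F F)"
  obtains L where "L \<in> carrier model" "\<And>F. F \<in> carrier model \<Longrightarrow> f F = ip model L F"
proof -
  define g where "g G = f (restrict_dual G)" for G
  have rm: "restrict_dual G \<in> carrier model" if "G \<in> S.dual" for G
    using restrict_dual_mem[OF that] by (simp add: model_carrier)
  have ip_r: "ip model (restrict_dual G) (restrict_dual H) = S.dual_ip G H" if "G \<in> S.dual" "H \<in> S.dual" for G H
    unfolding model_ip by (rule S.dual_ip_cong[OF that]) (simp_all add: extend_restrict_dual that)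
  obtain L where L: "L \<in> S.dual" "\<And>G. G \<in> S.dual \<Longrightarrow> g G = S.dual_ip L G"
  proof (rule S.dual_self_dual[of g C])
    fix F G c a assume F: "F \<in> S.dual"
    show "g F = g G" if "G \<in> S.dual" "\<And>e. e \<in> formal_sums \<Longrightarrow> F e = G e"
    proof -
      have "restrict_dual F = restrict_dual G"
        by (intro ext) (auto simp: restrict_dual_def that(2) formal_sums_closed(5))
      then show ?thesis by (simp add: g_def)
    qed
    show "g (\<lambda>e. F e + G e) = g F + g G" if "G \<in> S.dual"
    proof -
      have "restrict_dual (\<lambda>e. F e + G e) = restrict_dual F + restrict_dual G"
        by (intro ext) (simp add: restrict_dual_def)
      then show ?thesis using LinD(2)[OF f rm[OF F] rm[OF that]] by (simp add: g_def)
    qed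
    have "restrict_dual (\<lambda>e. c *\<^sub>C F e) = mscale model c (restrict_dual F)"
      by (intro ext) (simp add: restrict_dual_def model_mscale)
    then show "g (\<lambda>e. c *\<^sub>C F e) = c *\<^sub>C g F" using LinD(3)[OF f rm[OF F]] by (simp add: g_def self_module_def)
    have "restrict_dual (\<lambda>e. F e * a) = mact model (restrict_dual F) a"
      by (intro ext) (simp add: restrict_dual_def model_mact)
    then show "g (\<lambda>e. F e * a) = g F * a" using LinD(4)[OF f rm[OF F]] by (simp add: g_def self_module_def)
    show "(norm (g F))\<^sup>2 \<le> C * norm (S.dual_ip F F)"
      using C(2)[OF rm[OF F]] by (simp add: g_def ip_r[OF F F])
  qed (use C in auto)
  show ?thesis
  proof (rule that[of "restrict_dual L"])
    show "restrict_dual L \<in> carrier model" by (rule rm[OF L(1)])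
    fix F assume F: "F \<in> carrier model"
    then have F': "F \<in> model_carrier" by (simp add: model_carrier)
    have "f F = g (extend F)" by (simp add: g_def restrict_extend[OF F'])
    also have "\<dots> = S.dual_ip L (extend F)" by (rule L(2)[OF model_dual[OF F']])
    also have "\<dots> = ip model (restrict_dual L) F"
      using ip_r[OF L(1) model_dual[OF F']] by (simp add: restrict_extend[OF F'])
    finally show "f F = ip model (restrict_dual L) F" .
  qed
qed

lemma model_self_dual: "self_dual_hilbert_module model"
proof (rule self_dual_hilbert_module.intro[OF model_hilbert], unfold_locales)
  fix f assume f: "f \<in> Lin model self_module"
    and cont: "\<And>u e. u \<in> carrier model \<Longrightarrow> e > 0 \<Longrightarrow>
      \<exists>d>0. \<forall>v\<in>carrier model. hnorm model (v - u) < d \<longrightarrow> norm (f v - f u) < e"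
  obtain C where C: "C \<ge> 0" "\<And>v. v \<in> carrier model \<Longrightarrow> (norm (f v))\<^sup>2 \<le> C * norm (ip model v v)"
    using M.continuous_module_map_bounded[OF f cont] by blast
  show "\<exists>l\<in>carrier model. \<forall>v\<in>carrier model. f v = ip model l v"
    by (rule model_riesz[OF f C]) blast+
qed

lemma model_ip_vector:
  assumes "l \<in> formal_sums" "F \<in> carrier model" shows "ip model (model_vector l) F = extend F l"
  using S.dual_ip_embed[OF model_dual assms(1), of F] assms(2) by (simp add: model_ip model_vector_extend model_carrier)

lemma model_ext:
  assumes "F \<in> carrier model" "G \<in> carrier model" "\<And>x v. x \<in> X \<Longrightarrow> v \<in> carrier V \<Longrightarrow> F x v = G x v"
  shows "F = G"
  using assms by (intro ext) (metis (mono_tags, lifting) mem_Collect_eq model_carrier model_carrier_def)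

definition model_R :: "'x \<Rightarrow> 'v \<Rightarrow> 'x \<Rightarrow> 'v \<Rightarrow> 'a" where
  "model_R x v = model_vector [(x, v)]"

lemma model_R_apply: "model_R x v y u = kernel0 y x u v"
  by (simp add: model_R_def model_vector_def)

lemma model_R_mem: "x \<in> X \<Longrightarrow> v \<in> carrier V \<Longrightarrow> model_R x v \<in> carrier model"
  unfolding model_R_def model_carrier by (intro model_vector_mem formal_sums_closed)

lemma model_R_ip: "x \<in> X \<Longrightarrow> v \<in> carrier V \<Longrightarrow> F \<in> carrier model \<Longrightarrow> ip model (model_R x v) F = F x v"
  using model_ip_vector[OF formal_sums_closed(5), of x v F] by (simp add: model_R_def)

lemma model_R_Lin: "x \<in> X \<Longrightarrow> model_R x \<in> Lin V model"
  unfolding Lin_def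
  by (auto simp: model_R_mem model_R_apply fun_eq_iff kernel0_linear model_mscale model_mact)

lemma model_vector_span:
  assumes "l \<in> formal_sums"
  shows "model_vector l \<in> module.span (mscale model) {model_R x v | x v. x \<in> X \<and> v \<in> carrier V}"
proof -
  interpret vector_space "mscale model" by (rule M.vector_space)
  show ?thesis using assms
  proof (induction l)
    case Nil
    have "model_vector [] = 0" by (intro ext) (simp add: model_vector_def)
    then show ?case by (simp only: span_zero)
  next
    case (Cons p l)
    obtain x v where p: "p = (x, v)" by (cases p)
    have eq: "model_vector (p # l) = model_R x v + model_vector l"
      using model_vector_append[of "[p]" l] by (simp add: p model_R_def)
    have mem: "x \<in> X" "v \<in> carrier V" "l \<in> formal_sums" using Cons.prems by (auto simp: formal_sums_def p)
    have "model_R x v \<in> span {model_R x v | x v. x \<in> X \<and> v \<in> carrier V}"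
      by (rule span_base) (use mem in blast)
    from span_add[OF this Cons.IH[OF mem(3)]] show ?case by (simp only: eq)
  qed
qed

lemma span_subset_carrier:
  assumes "A_module N" "S \<subseteq> carrier N" shows "module.span (mscale N) S \<subseteq> carrier N"
proof -
  interpret vector_space "mscale N" by (rule A_module.vector_space[OF assms(1)])
  show ?thesis by (rule span_minimal[OF assms(2) A_module.subspace[OF assms(1)]])
qed

lemma model_dense:
  "module_topology P t model closure_of module.span (mscale model) {model_R x v | x v. x \<in> X \<and> v \<in> carrier V} = carrier model"
proof (rule MP.module_topology_dense)
  show "module.span (mscale model) {model_R x v | x v. x \<in> X \<and> v \<in> carrier V} \<subseteq> carrier model"
    by (rule span_subset_carrier[OF model_A_module]) (auto simp: model_R_mem)
  fix F \<phi> and r :: real assume F: "F \<in> carrier model" and \<phi>: "\<phi> \<in> P\<^sub>p" and r: "r > 0"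
  then have F': "F \<in> model_carrier" by (simp add: model_carrier)
  obtain e where e: "e \<in> formal_sums"
    "Re (\<phi> (S.dual_ip (\<lambda>x. extend F x + (- 1) *\<^sub>C S.embed e x) (\<lambda>x. extend F x + (- 1) *\<^sub>C S.embed e x))) < r"
    by (rule S.dual_ip_dense[OF model_dual[OF F'] \<phi> r])
  define H where "H = F - model_vector e"
  have H: "H \<in> carrier model"
    unfolding H_def using model_vector_mem[OF e(1)] F by (intro M.carrier_closed(4)) (simp_all add: model_carrier)
  have "Re (\<phi> (ip model H H)) < r" using e(2) by (simp add: H_def model_ip extend_minus model_vector_extend)
  moreover have "model_vector e - F = mscale model (- 1) H" by (simp add: M.scale_minus_one H_def)
  moreover have "ip model (mscale model (- 1) H) (mscale model (- 1) H) = ip model H H"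
    using H by (simp add: M.S.k_expand scaleC_simps)
  ultimately show "\<exists>d\<in>module.span (mscale model) {model_R x v | x v. x \<in> X \<and> v \<in> carrier V}. Re (\<phi> (ip model (d - F) (d - F))) < r"
    using model_vector_span[OF e(1)] by (intro bexI[of _ "model_vector e"]) simp_all
qed

end


section \<open>Unitary operators\<close>

lemma central_star:
  assumes "z \<in> center" shows "star z \<in> (center :: 'a::cstar_algebra set)"
proof -
  have "star z * b = b * star z" for b
  proof -
    have "star (star b * z) = star (z * star b)" using assms by (simp add: center_def)
    then show ?thesis by (simp add: star_mult star_star)
  qed
  then show ?thesis by (simp add: center_def)
qed

context hilbert_module
begin

text \<open>
  The norm bound for all \<open>v a\<close> in place of \<open>v\<close> amounts to an inequality between inner products.
\<close>

lemma contraction_order: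
  assumes T: "T \<in> Lin L L" and contr: "\<And>v. v \<in> carrier L \<Longrightarrow> norm (ip L (T v) (T v)) \<le> norm (ip L v v)"
    and v: "v \<in> carrier L"
  shows "positive (ip L v v - ip L (T v) (T v))"
proof -
  note Tv = LinD(1)[OF T v]
  obtain y where y: "positive y" "y * y = ip L (T v) (T v)" by (rule positive_sqrt[OF ip_positive[OF Tv]]) blast
  have sy: "star y = y" by (rule positive_selfadj[OF y(1)])
  have "positive (1 *\<^sub>R ip L v v - star y * y)"
  proof (rule positive_of_norm_bound[OF ip_positive[OF v]])
    fix a
    have va: "mact L v a \<in> carrier L" by (rule act_closed[OF v])
    have "(norm (y * a))\<^sup>2 = norm (star (y * a) * (y * a))" by (simp add: cstar_identity)
    also have "star (y * a) * (y * a) = star a * (y * y) * a" by (simp add: star_mult sy mult.assoc)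
    also have "\<dots> = ip L (T (mact L v a)) (T (mact L v a))"
      using Tv by (simp add: y(2) LinD(4)[OF T v] S.k_expand mult.assoc)
    also have "norm \<dots> \<le> norm (ip L (mact L v a) (mact L v a))" by (rule contr[OF va])
    also have "ip L (mact L v a) (mact L v a) = star a * ip L v v * a" using v by (simp add: S.k_expand mult.assoc)
    finally show "(norm (y * a))\<^sup>2 \<le> 1 * norm (star a * ip L v v * a)" by simp
  qed simp
  then show ?thesis by (simp add: sy y(2))
qed

text \<open>
  Since \<open>T\<close> and its inverse both decrease \<open>\<langle>v|v\<rangle>\<close> in the order of the algebra, both preserve it;
  polarization does the rest.
\<close>

lemma unitary_from_contractions:
  assumes T: "T \<in> Lin L L" "\<And>v. v \<in> carrier L \<Longrightarrow> norm (ip L (T v) (T v)) \<le> norm (ip L v v)"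
    and S: "S \<in> Lin L L" "\<And>v. v \<in> carrier L \<Longrightarrow> norm (ip L (S v) (S v)) \<le> norm (ip L v v)"
    and ST: "\<And>v. v \<in> carrier L \<Longrightarrow> S (T v) = v" and TS: "\<And>v. v \<in> carrier L \<Longrightarrow> T (S v) = v"
  shows "T \<in> unitary_operators L"
proof -
  have diag: "ip L (T v) (T v) = ip L v v" if v: "v \<in> carrier L" for v
  proof -
    have "positive (ip L v v - ip L (T v) (T v))" by (rule contraction_order[OF T v])
    moreover have "positive (- (ip L v v - ip L (T v) (T v)))"
      using contraction_order[OF S LinD(1)[OF T(1) v]] by (simp add: ST v)
    ultimately have "ip L v v - ip L (T v) (T v) = 0" by (rule positive_antisym)
    then show ?thesis by simp
  qed
  have iso: "ip L (T v) (T w) = ip L v w" if v: "v \<in> carrier L" and w: "w \<in> carrier L" for v w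
  proof -
    define B where "B v w = ip L (T v) (T w) - ip L v w" for v w
    note m = v w LinD(1)[OF T(1) v] LinD(1)[OF T(1) w]
    have key: "c *\<^sub>C B v w + cnj c *\<^sub>C B w v = 0" for c
    proof -
      have "ip L (T (v + mscale L c w)) (T (v + mscale L c w)) = ip L (v + mscale L c w) (v + mscale L c w)"
        by (rule diag) (intro carrier_closed v w)
      moreover have "T (v + mscale L c w) = T v + mscale L c (T w)"
        by (simp add: LinD[OF T(1) v] LinD[OF T(1) w] carrier_closed w)
      ultimately show ?thesis
        by (simp add: m S.k_expand diag B_def scaleC_simps algebra_simps)
    qed
    have 1: "B v w + B w v = 0" using key[of 1] by simp
    have "\<i> *\<^sub>C (B v w - B w v) = 0" using key[of \<i>] by (simp add: scaleC_simps)
    then have "(- \<i>) *\<^sub>C \<i> *\<^sub>C (B v w - B w v) = 0" by simp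
    then have 2: "B v w = B w v" by (simp only: scaleC_scaleC) simp
    have "2 *\<^sub>R B v w = 0" using 1 2 by (simp add: scaleR_2)
    then show ?thesis by (simp add: B_def)
  qed
  have "ip L (T v) w = ip L v (S w)" if "v \<in> carrier L" "w \<in> carrier L" for v w
    using iso[OF that(1) LinD(1)[OF S(1) that(2)]] TS[OF that(2)] by simp
  then show ?thesis unfolding unitary_operators_def using T(1) S(1) ST TS by blast
qed

end


section \<open>The dilation of a covariant kernel\<close>

locale covariant_kernel = positive_kernel P V X K
  for P :: "('a::cstar_algebra \<Rightarrow> complex) set" and V :: "('a, 'v::ab_group_add) amodule"
    and X :: "'x set" and K :: "'x \<Rightarrow> 'x \<Rightarrow> 'v \<Rightarrow> 'v \<Rightarrow> 'a" +
  fixes G :: "'g monoid" and act :: "'g \<Rightarrow> 'x \<Rightarrow> 'x" and U :: "'g \<Rightarrow> 'v \<Rightarrow> 'v"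
    and \<alpha> :: "'g \<Rightarrow> 'x \<Rightarrow> 'a" and \<sigma> :: "'g \<Rightarrow> 'g \<Rightarrow> 'a"
  assumes G: "group G" and action: "group_action G X act" and U_hom: "U \<in> hom G (GL V)"
    and cocycle: "two_cocycle G \<sigma>"
    and \<alpha>_center: "\<And>g x. g \<in> carrier G \<Longrightarrow> x \<in> X \<Longrightarrow> \<alpha> g x \<in> center"
    and \<alpha>_one: "\<And>x. x \<in> X \<Longrightarrow> \<alpha> \<one>\<^bsub>G\<^esub> x = 1"
    and \<alpha>_mult: "\<And>g h x. g \<in> carrier G \<Longrightarrow> h \<in> carrier G \<Longrightarrow> x \<in> X \<Longrightarrow>
      \<alpha> (g \<otimes>\<^bsub>G\<^esub> h) x = \<sigma> g h * \<alpha> h x * \<alpha> g (act h x)"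
    and covariance: "\<And>g x y v w. g \<in> carrier G \<Longrightarrow> x \<in> X \<Longrightarrow> y \<in> X \<Longrightarrow> v \<in> carrier V \<Longrightarrow> w \<in> carrier V \<Longrightarrow>
      K (act g x) (act g y) v w = star (\<alpha> g x) * K x y (U (inv\<^bsub>G\<^esub> g) v) (U (inv\<^bsub>G\<^esub> g) w) * \<alpha> g y"
begin

abbreviation ginv :: "'g \<Rightarrow> 'g" where "ginv g \<equiv> inv\<^bsub>G\<^esub> g"

interpretation G: group G by (rule G)
interpretation act: group_action G X act by (rule action)

lemma act_mem: "g \<in> carrier G \<Longrightarrow> x \<in> X \<Longrightarrow> act g x \<in> X"
  using act.element_image by blast

lemma act_mult: "g \<in> carrier G \<Longrightarrow> h \<in> carrier G \<Longrightarrow> x \<in> X \<Longrightarrow> act (g \<otimes>\<^bsub>G\<^esub> h) x = act g (act h x)"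
  by (rule act.composition_rule)

lemma act_one: "x \<in> X \<Longrightarrow> act \<one>\<^bsub>G\<^esub> x = x"
  using act.id_eq_one by (metis restrict_apply')

lemma act_ginv: "g \<in> carrier G \<Longrightarrow> x \<in> X \<Longrightarrow> act g (act (ginv g) x) = x"
  using act_mult[of g "ginv g" x] by (simp add: act_one)

lemma U_GL: "g \<in> carrier G \<Longrightarrow> U g \<in> Bij (carrier V) \<inter> Lin V V"
  using U_hom by (auto simp: hom_def GL_def)

lemma U_Lin: "g \<in> carrier G \<Longrightarrow> U g \<in> Lin V V"
  using U_GL by blast

lemma U_mem: "g \<in> carrier G \<Longrightarrow> v \<in> carrier V \<Longrightarrow> U g v \<in> carrier V"
  by (rule LinD(1)[OF U_Lin])

lemma U_mult:
  assumes "g \<in> carrier G" "h \<in> carrier G" "v \<in> carrier V"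
  shows "U (g \<otimes>\<^bsub>G\<^esub> h) v = U g (U h v)"
proof -
  have "U (g \<otimes>\<^bsub>G\<^esub> h) = U g \<otimes>\<^bsub>GL V\<^esub> U h" using U_hom assms by (simp add: hom_def)
  also have "\<dots> = compose (carrier V) (U g) (U h)"
    using U_GL[OF assms(1)] U_GL[OF assms(2)] by (simp add: GL_def BijGroup_def)
  finally show ?thesis using assms(3) by (simp add: compose_def)
qed

lemma U_one:
  assumes v: "v \<in> carrier V" shows "U \<one>\<^bsub>G\<^esub> v = v"
proof -
  have "U \<one>\<^bsub>G\<^esub> (U \<one>\<^bsub>G\<^esub> v) = U \<one>\<^bsub>G\<^esub> v" using U_mult[of "\<one>\<^bsub>G\<^esub>" "\<one>\<^bsub>G\<^esub>" v] v by simp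
  moreover have "inj_on (U \<one>\<^bsub>G\<^esub>) (carrier V)"
    using U_GL[of "\<one>\<^bsub>G\<^esub>"] by (simp add: Bij_def bij_betw_def)
  ultimately show ?thesis using v U_mem[of "\<one>\<^bsub>G\<^esub>" v] by (simp add: inj_on_eq_iff)
qed

lemma U_ginv: "g \<in> carrier G \<Longrightarrow> v \<in> carrier V \<Longrightarrow> U g (U (ginv g) v) = v" "g \<in> carrier G \<Longrightarrow> v \<in> carrier V \<Longrightarrow> U (ginv g) (U g v) = v"
  using U_mult[of g "ginv g" v] U_mult[of "ginv g" g v] by (simp_all add: U_one)

lemma \<sigma>_facts:
  assumes "g \<in> carrier G" "h \<in> carrier G"
  shows "\<sigma> g h \<in> center" "star (\<sigma> g h) * \<sigma> g h = 1" "\<sigma> g h * star (\<sigma> g h) = 1"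
  using cocycle assms by (auto simp: two_cocycle_def unitaries_def)

lemma \<sigma>_inverse:
  assumes g: "g \<in> carrier G" shows "\<sigma> (ginv g) g = \<sigma> g (ginv g)"
proof -
  have "\<sigma> g (ginv g \<otimes>\<^bsub>G\<^esub> g) * \<sigma> (ginv g) g = \<sigma> (g \<otimes>\<^bsub>G\<^esub> ginv g) g * \<sigma> g (ginv g)"
    using cocycle g unfolding two_cocycle_def by blast
  moreover have "\<sigma> g (ginv g \<otimes>\<^bsub>G\<^esub> g) = 1" "\<sigma> (g \<otimes>\<^bsub>G\<^esub> ginv g) g = 1"
    using cocycle g by (simp_all add: two_cocycle_def)
  ultimately show ?thesis by simp
qed

lemma model_memI:
  assumes scl: "\<And>x v c. x \<in> X \<Longrightarrow> v \<in> carrier V \<Longrightarrow> F x (mscale V c v) = cnj c *\<^sub>C F x v"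
    and act: "\<And>x v a. x \<in> X \<Longrightarrow> v \<in> carrier V \<Longrightarrow> F x (mact V v a) = star a * F x v"
    and zero: "\<And>x v. \<not> (x \<in> X \<and> v \<in> carrier V) \<Longrightarrow> F x v = 0"
    and bound: "S.functional_bound C (extend F)"
  shows "F \<in> carrier model" "norm (ip model F F) \<le> C"
proof -
  have "extend F (sum_scale c e) = cnj c *\<^sub>C extend F e" "extend F (sum_act e a) = star a * extend F e"
    if e: "e \<in> formal_sums" for e c a
  proof -
    have mem: "x \<in> X \<and> v \<in> carrier V" if "(x, v) \<in> set e" for x v using that e by (auto simp: formal_sums_def)
    show "extend F (sum_scale c e) = cnj c *\<^sub>C extend F e"
      unfolding sum_scale_def extend_map extend_scaleC[symmetric] by (rule extend_cong) (simp add: scl mem)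
    show "extend F (sum_act e a) = star a * extend F e"
      unfolding sum_act_def extend_map extend_mult_left[symmetric] by (rule extend_cong) (simp add: act mem)
  qed
  then have dual: "extend F \<in> S.dual" using bound by (auto simp: S.dual_def extend_append)
  then show "F \<in> carrier model" using zero by (auto simp: model_carrier model_carrier_def)
  show "norm (ip model F F) \<le> C" unfolding model_ip by (rule S.dual_ip_norm[OF dual bound])
qed

lemma model_linear:
  assumes F: "F \<in> carrier model" and x: "x \<in> X" "v \<in> carrier V"
  shows "F x (mscale V c v) = cnj c *\<^sub>C F x v" "F x (mact V v a) = star a * F x v"
proof -
  have d: "extend F \<in> S.dual" using F by (simp add: model_carrier model_dual)
  show "F x (mscale V c v) = cnj c *\<^sub>C F x v" "F x (mact V v a) = star a * F x v"
    using S.dualD(2,3)[OF d formal_sums_closed(5)[OF x]] by (simp_all add: sum_scale_def sum_act_def)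
qed

lemma model_functional_bound:
  "F \<in> carrier model \<Longrightarrow> S.functional_bound (norm (ip model F F)) (extend F)"
  using model_eval_bound[of F] by (simp add: S.functional_bound_def model_carrier)

text \<open>
  As \<open>F x v = \<langle>R(x) v|F\<rangle>\<close> in the model, the covariance of \<open>R\<close> and unitarity leave no other choice.
\<close>

definition model_U :: "'g \<Rightarrow> ('x \<Rightarrow> 'v \<Rightarrow> 'a) \<Rightarrow> 'x \<Rightarrow> 'v \<Rightarrow> 'a" where
  "model_U g F x v = (if x \<in> X \<and> v \<in> carrier V
    then star (\<alpha> g (act (ginv g) x)) * F (act (ginv g) x) (U (ginv g) v) else 0)"

text \<open>
  The transformation of formal sums that \<open>model_U g\<close> is the transpose of. By covariance it
  preserves the form of the kernel.
\<close>

definition move :: "'g \<Rightarrow> ('x \<times> 'v) list \<Rightarrow> ('x \<times> 'v) list" where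
  "move g = map (\<lambda>(x, v). (act (ginv g) x, mact V (U (ginv g) v) (\<alpha> g (act (ginv g) x))))"

lemma move_mem: "g \<in> carrier G \<Longrightarrow> e \<in> formal_sums \<Longrightarrow> move g e \<in> formal_sums"
  by (auto simp: move_def formal_sums_def intro!: act_mem V.act_closed U_mem)

lemma kform_move:
  assumes g: "g \<in> carrier G" and e: "e \<in> formal_sums" "f \<in> formal_sums"
  shows "kform (move g e) (move g f) = kform e f"
proof -
  have mem: "x \<in> X \<and> v \<in> carrier V" if "(x, v) \<in> set e" for x v using that e(1) by (auto simp: formal_sums_def)
  have mem': "x \<in> X \<and> v \<in> carrier V" if "(x, v) \<in> set f" for x v using that e(2) by (auto simp: formal_sums_def)
  note gi = G.inv_closed[OF g]
  have eq: "kernel0 (act (ginv g) x) (act (ginv g) y) (mact V (U (ginv g) v) (\<alpha> g (act (ginv g) x)))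
      (mact V (U (ginv g) w) (\<alpha> g (act (ginv g) y))) = kernel0 x y v w"
    if "x \<in> X" "v \<in> carrier V" "y \<in> X" "w \<in> carrier V" for x y v w
  proof -
    have m: "act (ginv g) x \<in> X" "act (ginv g) y \<in> X" "U (ginv g) v \<in> carrier V" "U (ginv g) w \<in> carrier V"
      using that gi by (auto intro: act_mem U_mem)
    have "K x y v w = K (act g (act (ginv g) x)) (act g (act (ginv g) y)) v w"
      using that by (simp add: act_ginv g)
    also have "\<dots> = star (\<alpha> g (act (ginv g) x)) * K (act (ginv g) x) (act (ginv g) y) (U (ginv g) v) (U (ginv g) w)
        * \<alpha> g (act (ginv g) y)"
      by (rule covariance[OF g m(1,2) that(2,4)])
    finally show ?thesis using that m by (simp add: kernel0_def V.act_closed K_linear mult.assoc)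
  qed
  have inner: "extend (\<lambda>y w. kernel0 (act (ginv g) x) (act (ginv g) y) (mact V (U (ginv g) v) (\<alpha> g (act (ginv g) x)))
      (mact V (U (ginv g) w) (\<alpha> g (act (ginv g) y)))) f = extend (\<lambda>y w. kernel0 x y v w) f" if "(x, v) \<in> set e" for x v
    by (rule extend_cong) (use mem[OF that] mem' eq in blast)
  show ?thesis
    unfolding kform_def move_def extend_map by (rule extend_cong) (rule inner)
qed

lemma extend_model_U:
  assumes F: "F \<in> carrier model" and g: "g \<in> carrier G" and e: "e \<in> formal_sums"
  shows "extend (model_U g F) e = extend F (move g e)"
  unfolding move_def extend_map
proof (rule extend_cong)
  fix x v assume "(x, v) \<in> set e"
  then have xv: "x \<in> X" "v \<in> carrier V" using e by (auto simp: formal_sums_def)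
  then have m: "act (ginv g) x \<in> X" "U (ginv g) v \<in> carrier V" using g by (auto intro: act_mem U_mem)
  show "model_U g F x v = F (act (ginv g) x) (mact V (U (ginv g) v) (\<alpha> g (act (ginv g) x)))"
    by (simp add: model_U_def xv model_linear(2)[OF F m])
qed

lemma star_\<alpha>_commute: "g \<in> carrier G \<Longrightarrow> x \<in> X \<Longrightarrow> star (\<alpha> g x) * a = a * star (\<alpha> g x)"
  using central_star[OF \<alpha>_center] by (auto simp: center_def)

lemma model_U_mem:
  assumes F: "F \<in> carrier model" and g: "g \<in> carrier G"
  shows "model_U g F \<in> carrier model" "norm (ip model (model_U g F) (model_U g F)) \<le> norm (ip model F F)"
proof -
  have xv: "act (ginv g) x \<in> X" "U (ginv g) v \<in> carrier V" if "x \<in> X" "v \<in> carrier V" for x v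
    using that g by (auto intro: act_mem U_mem)
  have b: "S.functional_bound (norm (ip model F F)) (extend (model_U g F))"
    unfolding S.functional_bound_def
  proof (intro conjI ballI)
    fix e assume e: "e \<in> formal_sums"
    show "(norm (extend (model_U g F) e))\<^sup>2 \<le> norm (ip model F F) * norm (kform e e)"
      using model_functional_bound[OF F] move_mem[OF g e] kform_move[OF g e e]
      by (auto simp: extend_model_U[OF F g e] S.functional_bound_def)
  qed simp
  have scl: "model_U g F x (mscale V c v) = cnj c *\<^sub>C model_U g F x v" if "x \<in> X" "v \<in> carrier V" for x v c
    using that xv[OF that] model_linear(1)[OF F xv[OF that]] LinD(3)[OF U_Lin[OF G.inv_closed[OF g]] that(2)]
    by (simp add: model_U_def V.carrier_closed mult_scaleC_right)
  have act: "model_U g F x (mact V v a) = star a * model_U g F x v" if "x \<in> X" "v \<in> carrier V" for x v a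
  proof -
    have "model_U g F x (mact V v a) = star (\<alpha> g (act (ginv g) x)) * (star a * F (act (ginv g) x) (U (ginv g) v))"
      using that model_linear(2)[OF F xv[OF that]] LinD(4)[OF U_Lin[OF G.inv_closed[OF g]] that(2)]
      by (simp add: model_U_def V.act_closed)
    also have "\<dots> = star a * (star (\<alpha> g (act (ginv g) x)) * F (act (ginv g) x) (U (ginv g) v))"
      using star_\<alpha>_commute[OF g xv(1)[OF that], of "star a"] by (simp add: mult.assoc[symmetric])
    finally show ?thesis using that by (simp add: model_U_def)
  qed
  have zero: "model_U g F x v = 0" if "\<not> (x \<in> X \<and> v \<in> carrier V)" for x v using that by (auto simp: model_U_def)
  show "model_U g F \<in> carrier model" "norm (ip model (model_U g F) (model_U g F)) \<le> norm (ip model F F)"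
    using model_memI[OF scl act zero b] by blast+
qed

lemma model_U_Lin: "g \<in> carrier G \<Longrightarrow> model_U g \<in> Lin model model"
  unfolding Lin_def
  by (auto simp: model_U_mem model_U_def fun_eq_iff model_mscale model_mact distrib_left mult_scaleC_right mult.assoc)

lemma model_U_one: "F \<in> carrier model \<Longrightarrow> model_U \<one>\<^bsub>G\<^esub> F = F"
  by (rule model_ext) (simp_all add: model_U_mem, simp add: model_U_def act_one \<alpha>_one U_one)

lemma model_U_mult:
  assumes g: "g \<in> carrier G" and h: "h \<in> carrier G" and F: "F \<in> carrier model"
  shows "model_U g (model_U h F) = mact model (model_U (g \<otimes>\<^bsub>G\<^esub> h) F) (\<sigma> g h)"
proof (rule model_ext)
  note gh = G.m_closed[OF g h]
  show "model_U g (model_U h F) \<in> carrier model" by (intro model_U_mem g h F)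
  show "mact model (model_U (g \<otimes>\<^bsub>G\<^esub> h) F) (\<sigma> g h) \<in> carrier model" by (intro M.act_closed model_U_mem gh F)
  fix x v assume x: "x \<in> X" and v: "v \<in> carrier V"
  define z where "z = act (ginv h) (act (ginv g) x)"
  have m: "act (ginv g) x \<in> X" "U (ginv g) v \<in> carrier V" "z \<in> X"
    using x v g h by (auto simp: z_def intro!: act_mem U_mem)
  have inv: "ginv (g \<otimes>\<^bsub>G\<^esub> h) = ginv h \<otimes>\<^bsub>G\<^esub> ginv g" by (rule G.inv_mult_group[OF g h])
  have z: "act (ginv (g \<otimes>\<^bsub>G\<^esub> h)) x = z" by (simp add: inv z_def act_mult g h x)
  have hz: "act h z = act (ginv g) x" unfolding z_def by (rule act_ginv[OF h m(1)])
  define w where "w = U (ginv h) (U (ginv g) v)"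
  have w: "U (ginv (g \<otimes>\<^bsub>G\<^esub> h)) v = w" by (simp add: inv w_def U_mult g h v)
  define s where "s = \<sigma> g h"
  have s: "star s * s = 1" "\<And>b. s * b = b * s" using \<sigma>_facts[OF g h] by (auto simp: s_def center_def)
  define p where "p = star (\<alpha> g (act (ginv g) x))"
  define q where "q = star (\<alpha> h z)"
  have "star (\<alpha> (g \<otimes>\<^bsub>G\<^esub> h) z) = p * (q * star s)"
    by (simp add: \<alpha>_mult[OF g h m(3)] star_mult hz p_def q_def s_def mult.assoc)
  moreover have "model_U g (model_U h F) x v = p * (q * F z w)"
    using x v m by (simp add: model_U_def z_def w_def p_def q_def)
  moreover have "p * (q * star s) * F z w * s = p * (q * F z w)"
  proof -
    have "p * (q * star s) * F z w * s = p * q * (star s * (F z w * s))" by (simp add: mult.assoc)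
    also have "F z w * s = s * F z w" by (rule s(2)[symmetric])
    also have "star s * (s * F z w) = F z w" by (simp add: mult.assoc[symmetric] s(1))
    finally show ?thesis by (simp add: mult.assoc)
  qed
  moreover have "mact model (model_U (g \<otimes>\<^bsub>G\<^esub> h) F) (\<sigma> g h) x v = star (\<alpha> (g \<otimes>\<^bsub>G\<^esub> h) z) * F z w * s"
    using x v by (simp add: model_mact model_U_def z w s_def)
  ultimately show "model_U g (model_U h F) x v = mact model (model_U (g \<otimes>\<^bsub>G\<^esub> h) F) (\<sigma> g h) x v" by simp
qed

lemma model_U_unitary:
  assumes g: "g \<in> carrier G" shows "model_U g \<in> unitary_operators model"
proof -
  note gi = G.inv_closed[OF g]
  define s where "s = star (\<sigma> g (ginv g))"
  have s: "\<sigma> g (ginv g) * s = 1" "s * \<sigma> g (ginv g) = 1" "\<And>b. s * b = b * s"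
    using \<sigma>_facts(2,3)[OF g gi] central_star[OF \<sigma>_facts(1)[OF g gi]] unfolding s_def center_def by blast+
  \<comment> \<open>The inverse of \<open>model_U g\<close>; the scalar corrects for the cocycle.\<close>
  define T where "T F = mact model (model_U (ginv g) F) s" for F
  have T_mem: "T F \<in> carrier model" if "F \<in> carrier model" for F
    unfolding T_def by (intro M.act_closed model_U_mem gi that)
  have n1: "norm s \<le> 1"
  proof -
    have "star s * s = 1" using s(1) by (simp add: s_def star_star)
    then show ?thesis by (simp add: norm_unitary)
  qed
  show ?thesis
  proof (rule M.unitary_from_contractions[of _ T])
    show "T \<in> Lin model model"
      unfolding Lin_def
    proof (intro CollectI conjI ballI allI)
      show "T \<in> carrier model \<rightarrow> carrier model" using T_mem by blast
      fix F H c a assume F: "F \<in> carrier model"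
      note L = LinD[OF model_U_Lin[OF gi] F]
      show "T (F + H) = T F + T H" if "H \<in> carrier model"
        using L(2)[OF that] by (simp add: T_def M.act_add_left model_U_mem gi F that)
      show "T (mscale model c F) = mscale model c (T F)"
        using L(3) by (simp add: T_def M.act_scale_left model_U_mem gi F)
      show "T (mact model F a) = mact model (T F) a"
        using L(4) by (simp add: T_def M.act_act model_U_mem gi F s(3)[of a])
    qed
    fix F assume F: "F \<in> carrier model"
    show "norm (ip model (model_U g F) (model_U g F)) \<le> norm (ip model F F)" by (rule model_U_mem(2)[OF F g])
    have m: "model_U (ginv g) F \<in> carrier model" by (rule model_U_mem(1)[OF F gi])
    have "ip model (T F) (T F) = star s * ip model (model_U (ginv g) F) (model_U (ginv g) F) * s"
      using m by (simp add: T_def M.S.k_expand mult.assoc)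
    then have "norm (ip model (T F) (T F)) \<le> norm (star s * ip model (model_U (ginv g) F) (model_U (ginv g) F)) * norm s"
      by (simp add: norm_mult_ineq)
    also have "\<dots> \<le> (norm (star s) * norm (ip model (model_U (ginv g) F) (model_U (ginv g) F))) * norm s"
      by (intro mult_right_mono norm_mult_ineq) auto
    also have "\<dots> \<le> (1 * norm (ip model F F)) * 1"
      using n1 model_U_mem(2)[OF F gi] by (intro mult_mono) auto
    finally show "norm (ip model (T F) (T F)) \<le> norm (ip model F F)" by simp
    have "T (model_U g F) = mact model (mact model (model_U (ginv g \<otimes>\<^bsub>G\<^esub> g) F) (\<sigma> (ginv g) g)) s"
      by (simp only: T_def model_U_mult[OF gi g F])
    also have "\<dots> = F" using g F by (simp add: model_U_one M.act_act \<sigma>_inverse s(1,2) M.act_one)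
    finally show "T (model_U g F) = F" .
    have "model_U g (T F) = mact model (model_U g (model_U (ginv g) F)) s"
      unfolding T_def by (rule LinD(4)[OF model_U_Lin[OF g] m])
    also have "\<dots> = mact model (mact model (model_U (g \<otimes>\<^bsub>G\<^esub> ginv g) F) (\<sigma> g (ginv g))) s"
      by (simp only: model_U_mult[OF g gi F])
    also have "\<dots> = F" using g F by (simp add: model_U_one M.act_act s(1,2) M.act_one)
    finally show "model_U g (T F) = F" .
  qed (rule model_U_Lin[OF g])
qed

lemma model_R_covariant:
  assumes x: "x \<in> X" and g: "g \<in> carrier G" and v: "v \<in> carrier V"
  shows "model_R x (U g v) = mact model (model_U g (model_R (act (ginv g) x) v)) (\<alpha> g (act (ginv g) x))"
proof (rule model_ext)
  have m: "act (ginv g) x \<in> X" using x g by (auto intro: act_mem)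
  show "model_R x (U g v) \<in> carrier model" by (intro model_R_mem x U_mem g v)
  show "mact model (model_U g (model_R (act (ginv g) x) v)) (\<alpha> g (act (ginv g) x)) \<in> carrier model"
    by (intro M.act_closed model_U_mem model_R_mem m v g)
  fix y u assume y: "y \<in> X" and u: "u \<in> carrier V"
  have my: "act (ginv g) y \<in> X" "U (ginv g) u \<in> carrier V" using y u g by (auto intro: act_mem U_mem)
  have "K y x u (U g v) = K (act g (act (ginv g) y)) (act g (act (ginv g) x)) u (U g v)"
    by (simp add: act_ginv g x y)
  also have "\<dots> = star (\<alpha> g (act (ginv g) y)) * K (act (ginv g) y) (act (ginv g) x) (U (ginv g) u) (U (ginv g) (U g v))
      * \<alpha> g (act (ginv g) x)"
    by (rule covariance[OF g my(1) m u U_mem[OF g v]])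
  finally have "K y x u (U g v) = star (\<alpha> g (act (ginv g) y)) * K (act (ginv g) y) (act (ginv g) x) (U (ginv g) u) v
      * \<alpha> g (act (ginv g) x)" by (simp add: U_ginv g v)
  then show "model_R x (U g v) y u = mact model (model_U g (model_R (act (ginv g) x) v)) (\<alpha> g (act (ginv g) x)) y u"
    using x y u v g m my by (simp add: model_R_apply kernel0_def model_mact model_U_def U_mem)
qed

lemma model_is_dilation: "is_dilation P t G X act V U \<alpha> \<sigma> K model model_R model_U"
  unfolding is_dilation_def
proof (intro conjI ballI)
  show "self_dual_hilbert_module model" by (rule model_self_dual)
  show "model_R \<in> X \<rightarrow> Lin V model" using model_R_Lin by blast
  show "model_U \<in> carrier G \<rightarrow> unitary_operators model" using model_U_unitary by blast
  show "K x y v w = ip model (model_R x v) (model_R y w)"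
    if "x \<in> X" "y \<in> X" "v \<in> carrier V" "w \<in> carrier V" for x y v w
    using that by (simp add: model_R_ip model_R_mem model_R_apply kernel0_def)
  show "module_topology P t model closure_of module.span (mscale model) {model_R x v |x v. x \<in> X \<and> v \<in> carrier V} = carrier model"
    by (rule model_dense)
qed (simp_all add: model_U_one model_U_mult model_R_covariant)

end


section \<open>Every dilation is isomorphic to the model\<close>

locale dilation = covariant_kernel P V X K G act U \<alpha> \<sigma>
  for P :: "('a::cstar_algebra \<Rightarrow> complex) set" and V :: "('a, 'v::ab_group_add) amodule"
    and X :: "'x set" and K :: "'x \<Rightarrow> 'x \<Rightarrow> 'v \<Rightarrow> 'v \<Rightarrow> 'a"
    and G :: "'g monoid" and act :: "'g \<Rightarrow> 'x \<Rightarrow> 'x" and U :: "'g \<Rightarrow> 'v \<Rightarrow> 'v"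
    and \<alpha> :: "'g \<Rightarrow> 'x \<Rightarrow> 'a" and \<sigma> :: "'g \<Rightarrow> 'g \<Rightarrow> 'a" +
  fixes t :: tau and L :: "('a, 'l::ab_group_add) hmodule" and R :: "'x \<Rightarrow> 'v \<Rightarrow> 'l" and Ut :: "'g \<Rightarrow> 'l \<Rightarrow> 'l"
  assumes dil: "is_dilation P t G X act V U \<alpha> \<sigma> K L R Ut"
begin

sublocale L: self_dual_hilbert_module L
  using dil by (simp add: is_dilation_def)

sublocale LP: hilbert_module_predual P L ..

lemma R_Lin: "x \<in> X \<Longrightarrow> R x \<in> Lin V L"
  and Ut_unitary: "g \<in> carrier G \<Longrightarrow> Ut g \<in> unitary_operators L"
  using dil by (auto simp: is_dilation_def)

lemma R_mem: "x \<in> X \<Longrightarrow> v \<in> carrier V \<Longrightarrow> R x v \<in> carrier L"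
  by (rule LinD(1)[OF R_Lin])

lemma R_kernel: "x \<in> X \<Longrightarrow> y \<in> X \<Longrightarrow> v \<in> carrier V \<Longrightarrow> w \<in> carrier V \<Longrightarrow> ip L (R x v) (R y w) = K x y v w"
  using dil by (simp add: is_dilation_def)

lemma R_covariant: "x \<in> X \<Longrightarrow> g \<in> carrier G \<Longrightarrow> v \<in> carrier V \<Longrightarrow>
    R x (U g v) = mact L (Ut g (R (act (ginv g) x) v)) (\<alpha> g (act (ginv g) x))"
  using dil by (simp add: is_dilation_def)

lemma R_dense: "module_topology P t L closure_of module.span (mscale L) {R x v | x v. x \<in> X \<and> v \<in> carrier V} = carrier L"
  using dil by (simp add: is_dilation_def)

text \<open>
  The candidate for the isomorphism with the model, where \<open>F x v\<close> is the inner product of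
  \<open>model_R x v\<close> and \<open>F\<close>.
\<close>

definition J :: "'l \<Rightarrow> 'x \<Rightarrow> 'v \<Rightarrow> 'a" where
  "J l x v = (if x \<in> X \<and> v \<in> carrier V then ip L (R x v) l else 0)"

primrec R_sum :: "('x \<times> 'v) list \<Rightarrow> 'l" where
  "R_sum [] = 0"
| "R_sum (p # e) = R (fst p) (snd p) + R_sum e"

lemma R_sum_mem: "e \<in> formal_sums \<Longrightarrow> R_sum e \<in> carrier L"
  by (induction e) (auto simp: formal_sums_def L.carrier_closed R_mem)

lemma R_sum_ip:
  assumes "e \<in> formal_sums" "l \<in> carrier L" shows "ip L (R_sum e) l = extend (J l) e"
  using assms
proof (induction e)
  case Nil
  have "ip L 0 l = star (ip L l 0)" using L.ip_star[OF Nil(2) L.carrier_closed(3)] by simp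
  then show ?case by (simp add: L.ip_zero_right Nil(2))
next
  case (Cons p e)
  obtain x v where p: "p = (x, v)" by (cases p)
  have "x \<in> X" "v \<in> carrier V" "e \<in> formal_sums" using Cons.prems by (auto simp: formal_sums_def p)
  then show ?case using Cons.IH Cons.prems(2) by (simp add: p L.S.k_add_left R_mem R_sum_mem J_def)
qed

lemma R_sum_kform:
  assumes e: "e \<in> formal_sums" "f \<in> formal_sums" shows "ip L (R_sum e) (R_sum f) = kform e f"
proof -
  have mem: "x \<in> X \<and> v \<in> carrier V" if "(x, v) \<in> set e" for x v using that e(1) by (auto simp: formal_sums_def)
  have mem': "x \<in> X \<and> v \<in> carrier V" if "(x, v) \<in> set f" for x v using that e(2) by (auto simp: formal_sums_def)
  have "J (R_sum f) x v = extend (\<lambda>y w. kernel0 x y v w) f" if x: "x \<in> X" "v \<in> carrier V" for x v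
  proof -
    have "J (R_sum f) x v = star (ip L (R_sum f) (R x v))"
      using x by (simp add: J_def L.ip_star R_mem R_sum_mem e)
    also have "\<dots> = extend (\<lambda>y w. star (J (R x v) y w)) f"
      using x by (simp add: R_sum_ip e R_mem extend_star)
    also have "\<dots> = extend (\<lambda>y w. kernel0 x y v w) f"
    proof (rule extend_cong)
      fix y w assume "(y, w) \<in> set f"
      then have y: "y \<in> X" "w \<in> carrier V" using mem' by auto
      have "star (J (R x v) y w) = ip L (R x v) (R y w)" using x y by (simp add: J_def L.ip_star R_mem)
      also have "\<dots> = kernel0 x y v w" using x y by (simp add: R_kernel kernel0_def)
      finally show "star (J (R x v) y w) = kernel0 x y v w" .
    qed
    finally show ?thesis .
  qed
  then show ?thesis
    unfolding R_sum_ip[OF e(1) R_sum_mem[OF e(2)]] kform_def by (intro extend_cong) (auto dest: mem)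
qed

lemma J_mem:
  assumes l: "l \<in> carrier L"
  shows "J l \<in> carrier model" "norm (ip model (J l) (J l)) \<le> norm (ip L l l)"
proof -
  have scl: "J l x (mscale V c v) = cnj c *\<^sub>C J l x v" if "x \<in> X" "v \<in> carrier V" for x v c
    using that l by (simp add: J_def V.carrier_closed LinD(3)[OF R_Lin] L.S.k_expand R_mem)
  have act: "J l x (mact V v a) = star a * J l x v" if "x \<in> X" "v \<in> carrier V" for x v a
    using that l by (simp add: J_def V.act_closed LinD(4)[OF R_Lin] L.S.k_expand R_mem)
  have zero: "J l x v = 0" if "\<not> (x \<in> X \<and> v \<in> carrier V)" for x v using that by (auto simp: J_def)
  have b: "S.functional_bound (norm (ip L l l)) (extend (J l))"
    unfolding S.functional_bound_def
  proof (intro conjI ballI)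
    fix e assume e: "e \<in> formal_sums"
    show "(norm (extend (J l) e))\<^sup>2 \<le> norm (ip L l l) * norm (kform e e)"
      using L.S.Cauchy_Schwarz[OF R_sum_mem[OF e] l] by (simp add: R_sum_ip e l R_sum_kform mult.commute)
  qed simp
  show "J l \<in> carrier model" "norm (ip model (J l) (J l)) \<le> norm (ip L l l)"
    using model_memI[OF scl act zero b] by blast+
qed

lemma J_Lin: "J \<in> Lin L model"
  unfolding Lin_def
  by (auto simp: J_mem J_def fun_eq_iff L.S.k_expand R_mem model_mscale model_mact)

lemma J_R: "x \<in> X \<Longrightarrow> v \<in> carrier V \<Longrightarrow> J (R x v) = model_R x v"
  by (intro ext) (auto simp: J_def model_R_apply kernel0_def R_kernel)

text \<open>
  The kernel of \<open>J\<close> is orthogonal to the span of the \<open>R x v\<close>, which is dense.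
\<close>

lemma J_kernel:
  assumes l: "l \<in> carrier L" and 0: "J l = 0" shows "l = 0"
proof (rule LP.dense_orthogonal_zero[OF R_dense l])
  interpret vector_space "mscale L" by (rule L.vector_space)
  fix d assume d: "d \<in> module.span (mscale L) {R x v | x v. x \<in> X \<and> v \<in> carrier V}"
  have "d \<in> carrier L \<and> ip L l d = 0"
    using d
  proof (induction rule: span_induct_alt)
    case base
    then show ?case by (simp add: L.carrier_closed L.ip_zero_right l)
  next
    case (step c x y)
    then obtain z v where z: "z \<in> X" "v \<in> carrier V" "x = R z v" by blast
    have "ip L (R z v) l = 0" using fun_cong[OF fun_cong[OF 0], of z v] z by (simp add: J_def)
    then have "ip L l (R z v) = 0" using L.ip_star[OF R_mem[OF z(1,2)] l] by simp
    then show ?case using step z l by (simp add: L.S.k_expand R_mem L.carrier_closed)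
  qed
  then show "ip L l d = 0" by simp
qed

lemma J_inj: "inj_on J (carrier L)"
proof (rule inj_onI)
  fix l m assume l: "l \<in> carrier L" and m: "m \<in> carrier L" and eq: "J l = J m"
  have lm: "l - m \<in> carrier L" by (rule L.carrier_closed(4)[OF l m])
  have "J l = J (l - m) + J m" using LinD(2)[OF J_Lin lm m] by simp
  then have "J (l - m) = 0" using eq by simp
  then have "l - m = 0" by (rule J_kernel[OF lm])
  then show "l = m" by simp
qed

text \<open>Self-duality provides the adjoint of \<open>J\<close>, which is a right inverse.\<close>

lemma J_adjoint:
  assumes F: "F \<in> carrier model"
  obtains l where "l \<in> carrier L" "J l = F" "\<And>m. m \<in> carrier L \<Longrightarrow> ip model F (J m) = ip L l m"
proof -
  define f where "f m = ip model F (J m)" for m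
  note Jm = J_mem(1)
  have f: "f \<in> Lin L self_module"
    unfolding Lin_def f_def
    by (auto simp: self_module_def LinD[OF J_Lin] M.S.k_expand F Jm)
  have C: "(norm (f m))\<^sup>2 \<le> norm (ip model F F) * norm (ip L m m)" if m: "m \<in> carrier L" for m
  proof -
    have "(norm (f m))\<^sup>2 \<le> norm (ip model F F) * norm (ip model (J m) (J m))"
      unfolding f_def by (rule M.S.Cauchy_Schwarz[OF F Jm[OF m]])
    also have "\<dots> \<le> norm (ip model F F) * norm (ip L m m)"
      by (intro mult_left_mono J_mem m) simp
    finally show ?thesis .
  qed
  have "\<exists>l\<in>carrier L. \<forall>v\<in>carrier L. f v = ip L l v"
    by (rule L.self_dual[OF f]) (rule L.bounded_module_map_continuous[OF f C], simp_all)
  then obtain l where l: "l \<in> carrier L" "\<And>m. m \<in> carrier L \<Longrightarrow> f m = ip L l m" by blast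
  have "J l = F"
  proof (rule model_ext[OF Jm[OF l(1)] F])
    fix x v assume x: "x \<in> X" "v \<in> carrier V"
    have "J l x v = star (ip L l (R x v))" using x l(1) by (simp add: J_def L.ip_star R_mem)
    also have "\<dots> = star (ip model F (model_R x v))" using l(2)[OF R_mem[OF x]] x by (simp add: f_def J_R)
    also have "\<dots> = F x v" using x F by (simp add: M.ip_star model_R_mem model_R_ip)
    finally show "J l x v = F x v" .
  qed
  then show ?thesis using that l by (simp add: f_def)
qed

lemma J_bij: "bij_betw J (carrier L) (carrier model)"
  unfolding bij_betw_def
proof (intro conjI J_inj equalityI subsetI)
  show "F \<in> carrier model" if "F \<in> J ` carrier L" for F using that J_mem(1) by blast
  show "F \<in> J ` carrier L" if "F \<in> carrier model" for F by (rule J_adjoint[OF that]) blast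
qed

lemma J_ip:
  assumes l: "l \<in> carrier L" and m: "m \<in> carrier L" shows "ip model (J l) (J m) = ip L l m"
proof -
  obtain l' where l': "l' \<in> carrier L" "J l' = J l" "\<And>m. m \<in> carrier L \<Longrightarrow> ip model (J l) (J m) = ip L l' m"
    by (rule J_adjoint[OF J_mem(1)[OF l]]) blast
  have "l' = l" using inj_onD[OF J_inj l'(2) l'(1) l] .
  then show ?thesis using l'(3)[OF m] by simp
qed

lemma J_Ut:
  assumes g: "g \<in> carrier G" and l: "l \<in> carrier L"
  shows "Ut g l \<in> carrier L" "J (Ut g l) = model_U g (J l)"
proof -
  obtain S where S: "Ut g \<in> Lin L L" "S \<in> Lin L L"
    "\<And>v w. v \<in> carrier L \<Longrightarrow> w \<in> carrier L \<Longrightarrow> ip L (Ut g v) w = ip L v (S w)"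
    "\<And>v. v \<in> carrier L \<Longrightarrow> S (Ut g v) = v"
    using Ut_unitary[OF g] by (auto simp: unitary_operators_def)
  show m: "Ut g l \<in> carrier L" by (rule LinD(1)[OF S(1) l])
  show "J (Ut g l) = model_U g (J l)"
  proof (rule model_ext[OF J_mem(1)[OF m] model_U_mem(1)[OF J_mem(1)[OF l] g]])
    fix x v assume x: "x \<in> X" "v \<in> carrier V"
    have y: "act (ginv g) x \<in> X" "U (ginv g) v \<in> carrier V"
      using x g group.inv_closed[OF G] by (auto intro: act_mem U_mem)
    define r where "r = R (act (ginv g) x) (U (ginv g) v)"
    have r: "r \<in> carrier L" unfolding r_def by (rule R_mem[OF y])
    have "R x v = R x (U g (U (ginv g) v))" by (simp add: U_ginv g x)
    also have "\<dots> = mact L (Ut g r) (\<alpha> g (act (ginv g) x))" unfolding r_def by (rule R_covariant[OF x(1) g y(2)])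
    finally have "ip L (R x v) (Ut g l) = star (\<alpha> g (act (ginv g) x)) * ip L (Ut g r) (Ut g l)"
      using LinD(1)[OF S(1) r] m by (simp add: L.S.k_expand)
    also have "ip L (Ut g r) (Ut g l) = ip L r l" by (simp add: S(3)[OF r m] S(4)[OF l])
    finally show "J (Ut g l) x v = model_U g (J l) x v" using x y by (simp add: J_def model_U_def r_def)
  qed
qed

end

text \<open>
  The two isomorphisms with the model compose to \<open>W\<close>.
\<close>

lemma dilations_unitarily_equivalent:
  assumes "dilation P V X K G act U \<alpha> \<sigma> t L R Ut" "dilation P V X K G act U \<alpha> \<sigma> t L' R' Ut'"
  shows "\<exists>W\<in>unitary_maps L L'. (\<forall>x\<in>X. \<forall>v\<in>carrier V. W (R x v) = R' x v) \<and>
    (\<forall>g\<in>carrier G. \<forall>l\<in>carrier L. W (Ut g l) = Ut' g (W l))"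
proof -
  interpret A: dilation P V X K G act U \<alpha> \<sigma> t L R Ut by fact
  interpret B: dilation P V X K G act U \<alpha> \<sigma> t L' R' Ut' by fact
  define W where "W l = the_inv_into (carrier L') B.J (A.J l)" for l
  have W: "W l \<in> carrier L' \<and> B.J (W l) = A.J l" if l: "l \<in> carrier L" for l
  proof -
    have "A.J l \<in> B.J ` carrier L'" using B.J_bij A.J_mem(1)[OF l] by (simp add: bij_betw_def)
    then show ?thesis
      unfolding W_def using the_inv_into_into[OF B.J_inj _ order_refl] f_the_inv_into_f[OF B.J_inj] by blast
  qed
  have W_eq: "W l = m" if "l \<in> carrier L" "m \<in> carrier L'" "B.J m = A.J l" for l m
    using inj_onD[OF B.J_inj, of "W l" m] W[OF that(1)] that by simp
  have "W \<in> Lin L L'"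
    unfolding Lin_def
  proof (intro CollectI conjI ballI allI)
    show "W \<in> carrier L \<rightarrow> carrier L'" using W by blast
    fix l m c a assume l: "l \<in> carrier L"
    show "W (l + m) = W l + W m" if m: "m \<in> carrier L"
      using W[OF l] W[OF m] LinD(2)[OF B.J_Lin, of "W l" "W m"] LinD(2)[OF A.J_Lin l m]
      by (intro W_eq A.L.carrier_closed B.L.carrier_closed l m) simp_all
    show "W (mscale L c l) = mscale L' c (W l)"
      using W[OF l] LinD(3)[OF B.J_Lin, of "W l" c] LinD(3)[OF A.J_Lin l, of c]
      by (intro W_eq A.L.carrier_closed B.L.carrier_closed l) simp_all
    show "W (mact L l a) = mact L' (W l) a"
      using W[OF l] LinD(4)[OF B.J_Lin, of "W l" a] LinD(4)[OF A.J_Lin l, of a]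
      by (intro W_eq A.L.act_closed B.L.act_closed l) simp_all
  qed
  moreover have "W ` carrier L = carrier L'"
  proof (intro equalityI subsetI)
    show "m \<in> carrier L'" if "m \<in> W ` carrier L" for m using that W by blast
    fix m assume m: "m \<in> carrier L'"
    have "B.J m \<in> A.J ` carrier L" using A.J_bij B.J_mem(1)[OF m] by (simp add: bij_betw_def)
    then obtain l where l: "l \<in> carrier L" "B.J m = A.J l" by blast
    then show "m \<in> W ` carrier L" using W_eq[OF l(1) m l(2)] by blast
  qed
  moreover have "ip L' (W l) (W m) = ip L l m" if l: "l \<in> carrier L" and m: "m \<in> carrier L" for l m
    using B.J_ip[of "W l" "W m"] A.J_ip[OF l m] W[OF l] W[OF m] by simp
  ultimately have "W \<in> unitary_maps L L'" by (simp add: unitary_maps_def)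
  moreover have "W (R x v) = R' x v" if "x \<in> X" "v \<in> carrier V" for x v
    using that by (intro W_eq A.R_mem B.R_mem) (simp_all add: A.J_R B.J_R)
  moreover have "W (Ut g l) = Ut' g (W l)" if g: "g \<in> carrier G" and l: "l \<in> carrier L" for g l
    using W[OF l] A.J_Ut[OF g l] B.J_Ut[OF g, of "W l"] by (intro W_eq) simp_all
  ultimately show ?thesis by blast
qed

theorem corollary1:
  fixes P :: "('a::cstar_algebra \<Rightarrow> complex) set"
    and V :: "('a, 'v::ab_group_add) amodule"
    and G :: "'g monoid"
    and X :: "'x set"
    and act :: "'g \<Rightarrow> 'x \<Rightarrow> 'x"
    and U :: "'g \<Rightarrow> 'v \<Rightarrow> 'v"
    and \<alpha> :: "'g \<Rightarrow> 'x \<Rightarrow> 'a"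
    and \<sigma> :: "'g \<Rightarrow> 'g \<Rightarrow> 'a"
    and K :: "'x \<Rightarrow> 'x \<Rightarrow> 'v \<Rightarrow> 'v \<Rightarrow> 'a"
    and t :: tau
  assumes "is_predual P"
    and "A_module V"
    and "group G"
    and "group_action G X act" and "X \<noteq> {}"
    and "U \<in> hom G (GL V)"
    and "two_cocycle G \<sigma>"
    and "\<And>g x. \<lbrakk>g \<in> carrier G; x \<in> X\<rbrakk> \<Longrightarrow> \<alpha> g x \<in> invertibles \<inter> center"
    and "\<And>x. x \<in> X \<Longrightarrow> \<alpha> \<one>\<^bsub>G\<^esub> x = 1"
    and "\<And>g h x. \<lbrakk>g \<in> carrier G; h \<in> carrier G; x \<in> X\<rbrakk> \<Longrightarrow>
           \<alpha> (g \<otimes>\<^bsub>G\<^esub> h) x = \<sigma> g h * \<alpha> h x * \<alpha> g (act h x)"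
    and "positive_covariant_kernel G X act V \<alpha> U K"
  shows "(\<exists>(L :: ('a, 'x \<Rightarrow> 'v \<Rightarrow> 'a) hmodule) R Ut.
            is_dilation P t G X act V U \<alpha> \<sigma> K L R Ut) \<and>
         (\<forall>(L :: ('a, 'l::ab_group_add) hmodule) R Ut (L' :: ('a, 'm::ab_group_add) hmodule) R' Ut'.
            is_dilation P t G X act V U \<alpha> \<sigma> K L R Ut \<and>
            is_dilation P t G X act V U \<alpha> \<sigma> K L' R' Ut' \<longrightarrow>
            (\<exists>W\<in>unitary_maps L L'.
               (\<forall>x\<in>X. \<forall>v\<in>carrier V. W (R x v) = R' x v) \<and>
               (\<forall>g\<in>carrier G. \<forall>l\<in>carrier L. W (Ut g l) = Ut' g (W l))))"
proof -
  have "positive_kernel P V X K"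
  proof (intro positive_kernel.intro predual.intro positive_kernel_axioms.intro)
    show "is_predual P" "A_module V" by fact+
    show "K x y \<in> sesquilinear_forms V" if "x \<in> X" "y \<in> X" for x y
      using assms(11) that by (simp add: positive_covariant_kernel_def)
    show "positive (\<Sum>j<n. \<Sum>k<n. K (x j) (x k) (v j) (v k))"
      if "\<forall>j<n. x j \<in> X \<and> v j \<in> carrier V" for n :: nat and x v
      using assms(11) that by (simp add: positive_covariant_kernel_def)
  qed
  moreover have "covariant_kernel_axioms V X K G act U \<alpha> \<sigma>"
    by (rule covariant_kernel_axioms.intro)
      (use assms in \<open>auto simp: positive_covariant_kernel_def\<close>)
  ultimately have ck: "covariant_kernel P V X K G act U \<alpha> \<sigma>" by (rule covariant_kernel.intro)
  have dil: "dilation P V X K G act U \<alpha> \<sigma> t L R Ut" if "is_dilation P t G X act V U \<alpha> \<sigma> K L R Ut"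
    for L :: "('a, 'n::ab_group_add) hmodule" and R Ut
    by (rule dilation.intro[OF ck dilation_axioms.intro[OF that]])
  show ?thesis
    using covariant_kernel.model_is_dilation[OF ck] dilations_unitarily_equivalent[OF dil dil] by blast
qed


end
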